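(* Let $m\geq 2$, let $p(\xi)=\sum_{|\alpha|\leq m}c_\alpha\xi^\alpha$, $\xi\in\mathbf R^d$, be a polynomial of order $m$ with real coefficients, with principal part $p_m(\xi)=\sum_{|\alpha|=m}c_\alpha\xi^\alpha$ (there is $\alpha\in\mathbf N^d$ with $|\alpha|=m$ and $c_\alpha\neq 0$), and for $t\in\mathbf R$ let $$\chi_t(x,\xi)=(x+t\nabla p_m(\xi),\xi),\quad (x,\xi)\in T^*\mathbf R^d\setminus 0,$$ be the Hamiltonian flow of $p_m$. Let $r,s>0$ satisfy $r\geq s(m-1)>1$. For $t\in\mathbf R$ let $\mathscr K_t:\mathscr S(\mathbf R^d)\to\mathscr S'(\mathbf R^d)$ be the continuous linear operator with Schwartz kernel $K_t(x,y)=k_t(x-y)$, where $k_t=(2\pi)^{-d/2}\mathscr F^{-1}(e^{-itp})\in\mathscr S'(\mathbf R^d)$ (that is, $K_t=(1\otimes k_t)\circ\kappa^{-1}$ with $\kappa(x,y)=(x+\tfrac y2,x-\tfrac y2)$). Then, for every $t\in\mathbf R$, $\mathscr K_t:\Sigma_r^s(\mathbf R^d)\to\Sigma_r^s(\mathbf R^d)$ is continuous, extends uniquely to a continuous operator $\mathscr K_t:(\Sigma_r^s)'(\mathbf R^d)\to(\Sigma_r^s)'(\mathbf R^d)$, and is invertible with inverse $\mathscr K_t^{-1}=\mathscr K_{-t}$. Moreover, for $t\in\mathbf R$, $$\mathrm{WF}^{s(m-1),s}(\mathscr K_t u)=\chi_t\left(\mathrm{WF}^{s(m-1),s}(u)\right),\quad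 u\in(\Sigma_{s(m-1)}^s)'(\mathbf R^d),$$ $$\mathrm{WF}^{r,s}(\mathscr K_t u)=\mathrm{WF}^{r,s}(u),\quad u\in(\Sigma_r^s)'(\mathbf R^d),\quad r>s(m-1).$$
   Context: Fourier transform: $\mathscr F f(\xi)=(2\pi)^{-d/2}\int_{\mathbf R^d}f(x)e^{-i\langle x,\xi\rangle}\,dx$. The operator $\mathscr K_t$ is the solution operator $e^{-itp(D_x)}$ of $\partial_t u+ip(D_x)u=0$, $u(0,\cdot)=u_0$. Gelfand--Shilov spaces. For $s,t,h>0$ let $\mathcal S_{t,h}^s(\mathbf R^d)$ be the Banach space of $f\in C^\infty(\mathbf R^d)$ with $\|f\|_{\mathcal S_{t,h}^s}=\sup_{x\in\mathbf R^d,\ \alpha,\beta\in\mathbf N^d}\frac{|x^\alpha D^\beta f(x)|}{h^{|\alpha+\beta|}\alpha!^t\beta!^s}<\infty$. Then $\Sigma_t^s(\mathbf R^d)=\bigcap_{h>0}\mathcal S_{t,h}^s(\mathbf R^d)$ with the Fréchet topology given by the seminorms $\|\cdot\|_{\mathcal S_{t,h}^s}$, $h>0$ (nontrivial iff $t+s>1$), and $(\Sigma_t^s)'(\mathbf R^d)$ is its topological dual, equipped with the weak$^*$ topology; $\Sigma_t^s\subseteq\mathscr S$ and $\mathscr S'\subseteq(\Sigma_t^s)'$. The pairing $(u,f)$ is conjugate linear in $f$, consistent with the $L^2$ inner product (conjugate linear in the second argument). A kernel $K$ defines an operator $\mathscr K$ by $(\mathscr K f,g)=(K,g\otimes\overline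 f)$. Short-time Fourier transform. For $\psi\in\Sigma_t^s(\mathbf R^d)\setminus 0$ and $u\in(\Sigma_t^s)'(\mathbf R^d)$, $V_\psi u(x,\xi)=(2\pi)^{-d/2}(u,M_\xi T_x\psi)$, $x,\xi\in\mathbf R^d$, where $T_x f(y)=f(y-x)$ and $M_\xi f(y)=e^{i\langle y,\xi\rangle}f(y)$. Wave front set. $T^*\mathbf R^d\setminus 0$ means $\mathbf R^{2d}\setminus\{0\}$. For $t,s>0$ with $t+s>1$, $u\in(\Sigma_t^s)'(\mathbf R^d)$ and $\psi\in\Sigma_t^s(\mathbf R^d)\setminus 0$, the set $\mathrm{WF}^{t,s}(u)\subseteq T^*\mathbf R^d\setminus 0$ is defined by: $(x_0,\xi_0)\notin\mathrm{WF}^{t,s}(u)$ iff there is an open set $U\subseteq T^*\mathbf R^d\setminus 0$ containing $(x_0,\xi_0)$ such that $\sup_{\lambda>0,\,(x,\xi)\in U}e^{r\lambda}|V_\psi u(\lambda^t x,\lambda^s\xi)|<\infty$ for all $r>0$. It does not depend on $\psi$. (In these definitions $t$ and $r$ are generic parameters, unrelated to the time variable and the index $r$ of the claim.) *)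

theory Defs
  imports "HOL-Analysis.Analysis"
begin

text \<open>
  Throughout, \<open>\<real>\<^sup>d\<close> is \<open>real ^ 'd\<close> with \<open>d = CARD('d)\<close>, multi-indices in \<open>\<nat>\<^sup>d\<close> are
  functions \<open>'d \<Rightarrow> nat\<close>, and \<open>T\<^sup>*\<real>\<^sup>d\<close> is \<open>(real ^ 'd) \<times> (real ^ 'd)\<close>.
\<close>

section \<open>Multi-indices, derivatives and polynomials\<close>

definition mi_length :: "('d::finite \<Rightarrow> nat) \<Rightarrow> nat"
  where "mi_length \<alpha> = (\<Sum>i\<in>UNIV. \<alpha> i)"

definition mi_fact :: "('d::finite \<Rightarrow> nat) \<Rightarrow> real"
  where "mi_fact \<alpha> = (\<Prod>i\<in>UNIV. fact (\<alpha> i))"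

definition mi_power :: "real ^ 'd \<Rightarrow> ('d::finite \<Rightarrow> nat) \<Rightarrow> real"
  where "mi_power x \<alpha> = (\<Prod>i\<in>UNIV. (x $ i) ^ \<alpha> i)"

definition partial_deriv ::
    "'d::finite \<Rightarrow> (real ^ 'd \<Rightarrow> 'b::real_normed_vector) \<Rightarrow> real ^ 'd \<Rightarrow> 'b"
  where "partial_deriv i f x = frechet_derivative f (at x) (axis i 1)"

primrec Ck :: "nat \<Rightarrow> (real ^ 'd::finite \<Rightarrow> complex) \<Rightarrow> bool"
  where
    "Ck 0 f \<longleftrightarrow> continuous_on UNIV f"
  | "Ck (Suc n) f \<longleftrightarrow> (\<forall>x. f differentiable (at x)) \<and> (\<forall>i. Ck n (partial_deriv i f))"

definition smooth :: "(real ^ 'd::finite \<Rightarrow> complex) \<Rightarrow> bool"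
  where "smooth f \<longleftrightarrow> (\<forall>n. Ck n f)"

text \<open>
  \<open>D\<^sub>i = -\<i> \<partial>\<^sub>i\<close>. Since \<open>'d\<close> carries no order, \<open>D\<^sup>\<beta>\<close> applies the \<open>D\<^sub>i\<close> along some list that
  contains each \<open>i\<close> exactly \<open>\<beta> i\<close> times; on smooth functions the order is irrelevant.
\<close>

definition D_coord :: "'d::finite \<Rightarrow> (real ^ 'd \<Rightarrow> complex) \<Rightarrow> real ^ 'd \<Rightarrow> complex"
  where "D_coord i f = (\<lambda>x. - \<i> * partial_deriv i f x)"

definition D_multi :: "('d::finite \<Rightarrow> nat) \<Rightarrow> (real ^ 'd \<Rightarrow> complex) \<Rightarrow> real ^ 'd \<Rightarrow> complex"
  where "D_multi \<beta> f = foldr D_coord (SOME is. \<forall>i. count_list is i = \<beta> i) f"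

definition poly_fun :: "(('d::finite \<Rightarrow> nat) \<Rightarrow> real) \<Rightarrow> nat \<Rightarrow> real ^ 'd \<Rightarrow> real"
  where "poly_fun c m \<xi> = (\<Sum>\<alpha> | mi_length \<alpha> \<le> m. c \<alpha> * mi_power \<xi> \<alpha>)"

definition principal_part :: "(('d::finite \<Rightarrow> nat) \<Rightarrow> real) \<Rightarrow> nat \<Rightarrow> real ^ 'd \<Rightarrow> real"
  where "principal_part c m \<xi> = (\<Sum>\<alpha> | mi_length \<alpha> = m. c \<alpha> * mi_power \<xi> \<alpha>)"

definition grad :: "(real ^ 'd::finite \<Rightarrow> real) \<Rightarrow> real ^ 'd \<Rightarrow> real ^ 'd"
  where "grad q \<xi> = (\<chi> i. partial_deriv i q \<xi>)"

definition ham_flow ::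
    "(('d::finite \<Rightarrow> nat) \<Rightarrow> real) \<Rightarrow> nat \<Rightarrow> real \<Rightarrow> (real ^ 'd) \<times> (real ^ 'd) \<Rightarrow> (real ^ 'd) \<times> (real ^ 'd)"
  where "ham_flow c m t = (\<lambda>(x, \<xi>). (x + t *\<^sub>R grad (principal_part c m) \<xi>, \<xi>))"

section \<open>Schwartz and Gelfand--Shilov spaces\<close>

definition schwartz :: "(real ^ 'd::finite \<Rightarrow> complex) set"
  where "schwartz = {f. smooth f \<and>
    (\<forall>\<alpha> \<beta>. bdd_above (range (\<lambda>x. cmod (of_real (mi_power x \<alpha>) * D_multi \<beta> f x))))}"

definition gs_quotient ::
    "real \<Rightarrow> real \<Rightarrow> real \<Rightarrow> (real ^ 'd::finite \<Rightarrow> complex) \<Rightarrow>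
     (real ^ 'd) \<times> ('d \<Rightarrow> nat) \<times> ('d \<Rightarrow> nat) \<Rightarrow> real"
  where "gs_quotient t s h f = (\<lambda>(x, \<alpha>, \<beta>).
    cmod (of_real (mi_power x \<alpha>) * D_multi \<beta> f x) /
      (h ^ mi_length (\<lambda>i. \<alpha> i + \<beta> i) * mi_fact \<alpha> powr t * mi_fact \<beta> powr s))"

definition gs_norm :: "real \<Rightarrow> real \<Rightarrow> real \<Rightarrow> (real ^ 'd::finite \<Rightarrow> complex) \<Rightarrow> real"
  where "gs_norm t s h f = (SUP z. gs_quotient t s h f z)"

definition gs_banach :: "real \<Rightarrow> real \<Rightarrow> real \<Rightarrow> (real ^ 'd::finite \<Rightarrow> complex) set"
  where "gs_banach t s h = {f. smooth f \<and> bdd_above (range (gs_quotient t s h f))}"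

text \<open>In \<open>gs t s = \<Sigma>\<^sub>t\<^sup>s\<close> the first index governs decay, the second one regularity.\<close>

definition gs :: "real \<Rightarrow> real \<Rightarrow> (real ^ 'd::finite \<Rightarrow> complex) set"
  where "gs t s = (\<Inter>h\<in>{0<..}. gs_banach t s h)"

definition gs_topology :: "real \<Rightarrow> real \<Rightarrow> (real ^ 'd::finite \<Rightarrow> complex) topology"
  where "gs_topology t s = topology_generated_by
    {{g \<in> gs t s. gs_norm t s h (\<lambda>x. g x - f x) < \<epsilon>} | f h \<epsilon>. f \<in> gs t s \<and> h > 0 \<and> \<epsilon> > 0}"

text \<open>
  A distribution \<open>u\<close> is the functional \<open>f \<mapsto> (u, f)\<close>, which is conjugate linear. Functionals on
  a test function space are \<open>extensional\<close>, so that equality of functionals is equality on that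
  space; the weak* topology is then the one induced by the product topology.
\<close>

type_synonym 'd functional = "(real ^ 'd \<Rightarrow> complex) \<Rightarrow> complex"

definition gs_dual :: "real \<Rightarrow> real \<Rightarrow> ('d::finite) functional set"
  where "gs_dual t s = {u \<in> extensional (gs t s).
    (\<forall>f\<in>gs t s. \<forall>g\<in>gs t s. u (\<lambda>x. f x + g x) = u f + u g) \<and>
    (\<forall>a. \<forall>f\<in>gs t s. u (\<lambda>x. a * f x) = cnj a * u f) \<and>
    continuous_map (gs_topology t s) euclidean u}"

definition gs_weak_star :: "real \<Rightarrow> real \<Rightarrow> ('d::finite) functional topology"
  where "gs_weak_star t s = subtopology (product_topology (\<lambda>_. euclidean) (gs t s)) (gs_dual t s)"

definition regular_distr :: "(real ^ 'd::finite \<Rightarrow> complex) \<Rightarrow> 'd functional"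
  where "regular_distr f g = (LINT x|lborel. f x * cnj (g x))"

section \<open>The propagator\<close>

definition fourier :: "(real ^ 'd::finite \<Rightarrow> complex) \<Rightarrow> real ^ 'd \<Rightarrow> complex"
  where "fourier f \<xi> = of_real ((2 * pi) powr (- real CARD('d) / 2)) *
    (LINT x|lborel. f x * exp (- \<i> * of_real (x \<bullet> \<xi>)))"

text \<open>
  By Parseval's formula, \<open>(F\<inverse> u, \<phi>) = (u, F \<phi>)\<close> for the sesquilinear pairing.
\<close>

definition inv_fourier_distr :: "('d::finite) functional \<Rightarrow> 'd functional"
  where "inv_fourier_distr u \<phi> = u (fourier \<phi>)"

definition conv_kernel :: "(('d::finite \<Rightarrow> nat) \<Rightarrow> real) \<Rightarrow> nat \<Rightarrow> real \<Rightarrow> 'd functional"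
  where "conv_kernel c m t \<phi> = of_real ((2 * pi) powr (- real CARD('d) / 2)) *
    inv_fourier_distr (regular_distr (\<lambda>\<xi>. exp (- \<i> * of_real (t * poly_fun c m \<xi>)))) \<phi>"

text \<open>
  The inner conjugation makes \<open>(u \<otimes> v, \<phi> \<otimes> \<psi>) = (u, \<phi>) (v, \<psi>)\<close> for conjugate linear
  \<open>u\<close> and \<open>v\<close>.
\<close>

definition tensor_distr ::
    "('d::finite) functional \<Rightarrow> 'd functional \<Rightarrow> ((real ^ 'd) \<times> (real ^ 'd) \<Rightarrow> complex) \<Rightarrow> complex"
  where "tensor_distr u v \<Phi> = u (\<lambda>x. cnj (v (\<lambda>y. \<Phi> (x, y))))"

definition kappa :: "(real ^ 'd::finite) \<times> (real ^ 'd) \<Rightarrow> (real ^ 'd) \<times> (real ^ 'd)"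
  where "kappa = (\<lambda>(x, y). (x + (1/2) *\<^sub>R y, x - (1/2) *\<^sub>R y))"

text \<open>
  The kernel \<open>(1 \<otimes> k\<^sub>t) \<circ> \<kappa>\<inverse>\<close>; as \<open>\<bar>det \<kappa>\<bar> = 1\<close>, composing a distribution with \<open>\<kappa>\<inverse>\<close>
  means composing test functions with \<open>\<kappa>\<close>.
\<close>

definition schwartz_kernel ::
    "(('d::finite \<Rightarrow> nat) \<Rightarrow> real) \<Rightarrow> nat \<Rightarrow> real \<Rightarrow> ((real ^ 'd) \<times> (real ^ 'd) \<Rightarrow> complex) \<Rightarrow> complex"
  where "schwartz_kernel c m t \<Phi> =
    tensor_distr (regular_distr (\<lambda>_. 1)) (conv_kernel c m t) (\<Phi> \<circ> kappa)"

text \<open>The operator from \<open>schwartz\<close> to its dual: \<open>(K f, g) = (K, g \<otimes> cnj f)\<close>.\<close>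

definition kernel_op ::
    "(('d::finite \<Rightarrow> nat) \<Rightarrow> real) \<Rightarrow> nat \<Rightarrow> real \<Rightarrow> (real ^ 'd \<Rightarrow> complex) \<Rightarrow> 'd functional"
  where "kernel_op c m t f =
    (\<lambda>g\<in>schwartz. schwartz_kernel c m t (\<lambda>(x, y). g x * cnj (f y)))"

text \<open>The Schwartz function that represents the distribution \<open>kernel_op c m t f\<close>, if there is one.\<close>

definition propagator ::
    "(('d::finite \<Rightarrow> nat) \<Rightarrow> real) \<Rightarrow> nat \<Rightarrow> real \<Rightarrow> (real ^ 'd \<Rightarrow> complex) \<Rightarrow> real ^ 'd \<Rightarrow> complex"
  where "propagator c m t f =
    (THE g. g \<in> schwartz \<and> kernel_op c m t f = restrict (regular_distr g) schwartz)"

text \<open>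
  Continuous linear operators on the dual of \<open>gs r s\<close> that extend the operator \<open>A\<close> on \<open>gs r s\<close>,
  where functions are identified with functionals by the \<open>L\<^sup>2\<close> pairing.
\<close>

definition dual_extension ::
    "real \<Rightarrow> real \<Rightarrow> ((real ^ 'd \<Rightarrow> complex) \<Rightarrow> (real ^ 'd \<Rightarrow> complex)) \<Rightarrow>
     (('d::finite) functional \<Rightarrow> 'd functional) \<Rightarrow> bool"
  where "dual_extension r s A L \<longleftrightarrow>
    L \<in> extensional (gs_dual r s) \<and>
    (\<forall>u\<in>gs_dual r s. \<forall>v\<in>gs_dual r s. \<forall>a b.
       L (\<lambda>f\<in>gs r s. a * u f + b * v f) = (\<lambda>f\<in>gs r s. a * L u f + b * L v f)) \<and>
    continuous_map (gs_weak_star r s) (gs_weak_star r s) L \<and>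
    (\<forall>f\<in>gs r s. L (restrict (regular_distr f) (gs r s)) = restrict (regular_distr (A f)) (gs r s))"

definition dual_propagator ::
    "real \<Rightarrow> real \<Rightarrow> (('d::finite \<Rightarrow> nat) \<Rightarrow> real) \<Rightarrow> nat \<Rightarrow> real \<Rightarrow> 'd functional \<Rightarrow> 'd functional"
  where "dual_propagator r s c m t = (THE L. dual_extension r s (propagator c m t) L)"

section \<open>The wave front set\<close>

definition translate :: "real ^ 'd::finite \<Rightarrow> (real ^ 'd \<Rightarrow> complex) \<Rightarrow> real ^ 'd \<Rightarrow> complex"
  where "translate x f = (\<lambda>y. f (y - x))"

definition modulate :: "real ^ 'd::finite \<Rightarrow> (real ^ 'd \<Rightarrow> complex) \<Rightarrow> real ^ 'd \<Rightarrow> complex"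
  where "modulate \<xi> f = (\<lambda>y. exp (\<i> * of_real (y \<bullet> \<xi>)) * f y)"

definition stft ::
    "(real ^ 'd::finite \<Rightarrow> complex) \<Rightarrow> 'd functional \<Rightarrow> real ^ 'd \<Rightarrow> real ^ 'd \<Rightarrow> complex"
  where "stft \<psi> u x \<xi> =
    of_real ((2 * pi) powr (- real CARD('d) / 2)) * u (modulate \<xi> (translate x \<psi>))"

text \<open>The set does not depend on the window \<open>\<psi>\<close>, a nonzero element of \<open>gs t s\<close>, which is kept as a
  parameter here.\<close>

definition WF ::
    "real \<Rightarrow> real \<Rightarrow> (real ^ 'd::finite \<Rightarrow> complex) \<Rightarrow> 'd functional \<Rightarrow> ((real ^ 'd) \<times> (real ^ 'd)) set"
  where "WF t s \<psi> u = {z. z \<noteq> 0 \<and> \<not> (\<exists>U. open U \<and> U \<subseteq> - {0} \<and> z \<in> U \<and>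
    (\<forall>r>0. bdd_above {exp (r * l) * cmod (stft \<psi> u (l powr t *\<^sub>R x) (l powr s *\<^sub>R \<xi>)) | l x \<xi>.
              l > 0 \<and> (x, \<xi>) \<in> U}))}"

end

theory Submission
  imports Defs "HOL-Probability.Probability"
begin

text \<open>
  On Schwartz functions the operator with kernel \<open>k\<^sub>t(x - y)\<close> is the Fourier multiplier with
  symbol \<open>exp (- i t p)\<close> (\<open>kernel_op_eq\<close>). Reversing \<open>t\<close> inverts it and gives its adjoint, so
  that the statement is about the effect of this multiplier on decay and on phase space.

  The space \<open>gs r s\<close> consists of the functions with \<open>\<bar>f x\<bar> \<le> P exp (- H \<bar>x\<bar>\<^bsup>1/r\<^esup>)\<close> and
  \<open>\<bar>F f \<xi>\<bar> \<le> P exp (- H \<bar>\<xi>\<bar>\<^bsup>1/s\<^esup>)\<close> for every \<open>H > 0\<close> and some \<open>P\<close> (\<open>gs_iff\<close>). A multiplier of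
  modulus one preserves the second bound. For the first one, \<open>x\<^sub>j exp (- i t q(D)) f\<close> equals
  \<open>exp (- i t q(D)) (x\<^sub>j + t (d\<^sub>j q)(D)) f\<close> (\<open>component_pmul\<close>), so that moments of the result are
  norms of words in positions and momenta applied to \<open>f\<close>. In such a word of length \<open>N\<close> a position costs
  about \<open>N\<^bsup>r\<^esup>\<close> and a momentum about \<open>N\<^bsup>s\<^esup>\<close> (\<open>word_estimate\<close>); as \<open>d\<^sub>j q\<close> has degree
  \<open>m - 1\<close> and \<open>s (m - 1) \<le> r\<close>, its derivatives cost no more than the position (\<open>pmul_decay\<close>).

  Taylor's formula for \<open>p\<close> at \<open>\<xi>\<close> shows what happens in phase space (\<open>evo_tfs\<close>): a window shifted to
  \<open>(x, \<xi>)\<close> becomes a window shifted to \<open>(x + t \<nabla>p(\<xi>), \<xi>)\<close>, deformed by the phase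
  \<open>p(\<xi> + \<eta>) - p(\<xi>) - \<nabla>p(\<xi>)\<bullet>\<eta>\<close>. The coefficients of this phase grow with \<open>\<xi>\<close>, but the deformed
  window decays like the original one up to a factor \<open>exp (\<epsilon> \<bar>\<xi>\<bar>\<^bsup>1/s\<^esup>)\<close>. So the short-time Fourier
  transform of \<open>\<K>\<^sub>t u\<close> at \<open>(x, \<xi>)\<close> is governed by that of \<open>u\<close> near \<open>(x - t \<nabla>p(\<xi>), \<xi>)\<close>
  (\<open>kernel_estimate\<close>). Under the dilation \<open>(\<lambda>\<^bsup>r\<^esup> x, \<lambda>\<^bsup>s\<^esup> \<xi>)\<close> this displacement tends to that of the flow of
  \<open>p\<^sub>m\<close> if \<open>r = s (m - 1)\<close>, and to zero if \<open>r > s (m - 1)\<close> (\<open>scaled_gradient_limit\<close>). The extra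
  factor is exponential in \<open>\<lambda>\<close>, hence harmless as the decay in the definition of the wave front set has
  arbitrary rate. This gives one inclusion (\<open>WF_inclusion\<close>), and the inverse propagator gives the other.

  Functionals enter through two facts. A test function is a superposition of shifted windows that
  converges in \<open>gs r s\<close>, so a functional is recovered from its short-time Fourier transform
  (\<open>dual_stft_bound\<close>). And finitely many values of a functional are always values of a test function
  (\<open>dual_interpolation\<close>), so test functions are weak* dense and the extension to the dual is unique.
\<close>

type_synonym 'd fn = "real^'d => complex"

abbreviation osc :: "'a::real_inner => 'a => complex"
  where "osc x \<xi> \<equiv> exp (- \<i> * of_real (x \<bullet> \<xi>))"

abbreviation wt :: "real^'d::finite => real"
  where "wt x \<equiv> (1 + norm x) ^ (2 * CARD('d))"

section \<open>Integration over Euclidean space\<close>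

lemma euclidean_prod_integral:
  fixes f :: "'a::euclidean_space => real => 'b::{real_normed_field,banach,second_countable_topology}"
  assumes f: "\<And>b. b \<in> Basis ==> integrable lborel (f b)"
  shows "integrable lborel (\<lambda>x::'a. \<Prod>b\<in>Basis. f b (x \<bullet> b))" (is ?I)
    and "(LBINT x. (\<Prod>b\<in>Basis. f b ((x::'a) \<bullet> b))) = (\<Prod>b\<in>Basis. LBINT y. f b y)" (is ?E)
proof -
  interpret product_sigma_finite "\<lambda>_::'a. lborel :: real measure"
    by standard
  have m[measurable]: "\<And>b. b \<in> Basis ==> f b \<in> borel_measurable borel"
    using f by (metis borel_measurable_integrable measurable_lborel2)
  have mT[measurable]: "(\<lambda>g. \<Sum>b\<in>Basis. g b *\<^sub>R b) \<in> measurable (\<Pi>\<^sub>M b\<in>(Basis::'a set). (lborel::real measure)) borel"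
    by measurable
  have eq: "(\<Prod>b\<in>Basis. f b ((\<Sum>c\<in>Basis. g c *\<^sub>R c) \<bullet> b)) = (\<Prod>b\<in>Basis. f b (g b))" for g :: "'a => real"
    by (intro prod.cong) auto
  have mF: "(\<lambda>x::'a. \<Prod>b\<in>Basis. f b (x \<bullet> b)) \<in> borel_measurable borel"
    by measurable
  show ?I
    apply (subst lborel_eq)
    apply (subst integrable_distr_eq[OF mT mF])
    by (simp add: eq product_integrable_prod f)
  show ?E
    apply (subst lborel_eq)
    apply (subst integral_distr[OF mT mF])
    by (simp add: eq product_integral_prod f)
qed

lemma Basis_vec_real: "(Basis :: (real ^ 'd) set) = range (\<lambda>i. axis i 1)"
  by (auto simp: Basis_vec_def)

lemma inj_axis_one: "inj (\<lambda>i. axis i (1::real))"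
  by (auto simp: inj_on_def axis_eq_axis)

lemma vec_prod_integral:
  fixes f :: "'d::finite => real => 'b::{real_normed_field,banach,second_countable_topology}"
  assumes f: "\<And>i. integrable lborel (f i)"
  shows "integrable lborel (\<lambda>x::real^'d. \<Prod>i\<in>UNIV. f i (x $ i))"
    and "(LBINT x. (\<Prod>i\<in>UNIV. f i ((x::real^'d) $ i))) = (\<Prod>i\<in>UNIV. LBINT y. f i y)"
proof -
  define g where "g b = f (inv (\<lambda>i. axis i (1::real)) b)" for b :: "real^'d"
  have g: "g (axis i 1) = f i" for i
    by (simp add: g_def inv_f_f[OF inj_axis_one])
  have g': "\<And>b. b \<in> Basis ==> integrable lborel (g b)"
    unfolding g_def by (rule f)
  have e: "(\<Prod>b\<in>Basis. g b (x \<bullet> b)) = (\<Prod>i\<in>UNIV. f i (x $ i))" for x :: "real^'d"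
    unfolding Basis_vec_real by (simp add: prod.reindex[OF inj_axis_one] g inner_axis)
  have e2: "(\<Prod>b\<in>(Basis::(real^'d) set). LBINT y. g b y) = (\<Prod>i\<in>UNIV. LBINT y. f i y)"
    unfolding Basis_vec_real by (simp add: prod.reindex[OF inj_axis_one] g)
  show "integrable lborel (\<lambda>x::real^'d. \<Prod>i\<in>UNIV. f i (x $ i))"
    using euclidean_prod_integral(1)[of g, OF g'] by (simp add: e)
  show "(LBINT x. (\<Prod>i\<in>UNIV. f i ((x::real^'d) $ i))) = (\<Prod>i\<in>UNIV. LBINT y. f i y)"
    using euclidean_prod_integral(2)[of g, OF g'] by (simp add: e e2)
qed

lemma lborel_affine_int:
  fixes f :: "'a::euclidean_space => 'b::{banach, second_countable_topology}"
  assumes c: "c \<noteq> 0"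
  shows lborel_integrable_affine_iff: "integrable lborel (\<lambda>x. f (t + c *\<^sub>R x)) \<longleftrightarrow> integrable lborel f"
    and lborel_integral_affine: "(LBINT x. f x) = \<bar>c\<bar> ^ DIM('a) *\<^sub>R (LBINT x. f (t + c *\<^sub>R x))"
proof -
  have m: "(\<lambda>x. t + c *\<^sub>R x) \<in> borel \<rightarrow>\<^sub>M (borel::'a measure)" for t c
    by measurable
  have 1: "integrable lborel (\<lambda>x. f (t + c *\<^sub>R x))" if "integrable lborel f" "c \<noteq> 0"
    for f :: "'a => 'b" and c t
  proof -
    have [measurable]: "f \<in> borel_measurable borel"
      using that by (metis borel_measurable_integrable measurable_lborel2)
    have "integrable (density (distr lborel borel (\<lambda>x. t + c *\<^sub>R x)) (\<lambda>_. \<bar>c\<bar>^DIM('a))) f"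
      using that(1) lborel_affine[OF that(2), of t] by simp
    hence "integrable lborel (\<lambda>x. \<bar>c\<bar> ^ DIM('a) *\<^sub>R f (t + c *\<^sub>R x))"
      using that(2) by (subst (asm) integrable_density) (auto simp: integrable_distr_eq)
    from integrable_scaleR_right[of "inverse (\<bar>c\<bar> ^ DIM('a))", OF this] that(2)
    show ?thesis by simp
  qed
  have 2: "f (x) = f (t + c *\<^sub>R ((-(1/c)) *\<^sub>R t + (1/c) *\<^sub>R x))" for x
    using c by (simp add: algebra_simps)
  show I: "integrable lborel (\<lambda>x. f (t + c *\<^sub>R x)) \<longleftrightarrow> integrable lborel f"
    using 1[of f c t] 1[of "\<lambda>x. f (t + c *\<^sub>R x)" "1/c" "(-(1/c)) *\<^sub>R t"] c 2 by (auto simp: algebra_simps)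
  show "(LBINT x. f x) = \<bar>c\<bar> ^ DIM('a) *\<^sub>R (LBINT x. f (t + c *\<^sub>R x))"
  proof (cases "integrable lborel f")
    case True
    have [measurable]: "f \<in> borel_measurable borel"
      using True by (metis borel_measurable_integrable measurable_lborel2)
    show ?thesis
      using c by (subst lborel_affine[OF c, of t]) (simp add: integral_density integral_distr)
  next
    case False
    thus ?thesis using I by (simp add: not_integrable_integral_eq)
  qed
qed

lemma lborel_integrable_translate:
  fixes f :: "'a::euclidean_space => 'b::{banach, second_countable_topology}"
  shows "integrable lborel (\<lambda>x. f (x + t)) \<longleftrightarrow> integrable lborel f"
        "integrable lborel (\<lambda>x. f (x - t)) \<longleftrightarrow> integrable lborel f"
        "integrable lborel (\<lambda>x. f (t - x)) \<longleftrightarrow> integrable lborel f"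
        "integrable lborel (\<lambda>x. f (- x)) \<longleftrightarrow> integrable lborel f"
  using lborel_integrable_affine_iff[of 1 f t] lborel_integrable_affine_iff[of 1 f "-t"]
     lborel_integrable_affine_iff[of "-1" f t] lborel_integrable_affine_iff[of "-1" f 0]
  by (simp_all add: algebra_simps)

lemma lborel_integral_translate:
  fixes f :: "'a::euclidean_space => 'b::{banach, second_countable_topology}"
  shows "(LBINT x. f (x + t)) = (LBINT x. f x)"
        "(LBINT x. f (x - t)) = (LBINT x. f x)"
        "(LBINT x. f (t - x)) = (LBINT x. f x)"
        "(LBINT x. f (- x)) = (LBINT x. f x)"
  using lborel_integral_affine[of 1 f t] lborel_integral_affine[of 1 f "-t"]
     lborel_integral_affine[of "-1" f t] lborel_integral_affine[of "-1" f 0]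
  by (simp_all add: algebra_simps)

lemma integrable_inverse_one_plus_square: "integrable lborel (\<lambda>x::real. inverse (1 + x\<^sup>2))"
proof -
  have "set_integrable lborel UNIV (\<lambda>x::real. inverse (1 + x\<^sup>2))"
    using integrable_inverse_1_plus_square by simp
  thus ?thesis by (simp add: set_integrable_def)
qed


text \<open>
  The weight is dominated by a product: every factor \<open>1 + x\<^sub>i\<^sup>2\<close> is at most \<open>(1 + \<bar>x\<bar>)\<^sup>2\<close>.
\<close>

lemma integrable_weight:
  "integrable lborel (\<lambda>x::real^'d::finite. inverse (wt x))"
proof (rule Bochner_Integration.integrable_bound)
  show "integrable lborel (\<lambda>x::real^'d. \<Prod>i\<in>UNIV. inverse (1 + (x $ i)\<^sup>2))"
    by (rule vec_prod_integral(1)) (rule integrable_inverse_one_plus_square)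
  show "(\<lambda>x::real^'d::finite. inverse (wt x)) \<in> borel_measurable lborel"
    by measurable
  have "norm (inverse (wt x)) <= norm (\<Prod>i\<in>UNIV. inverse (1 + (x $ i)\<^sup>2))" for x :: "real^'d"
  proof -
    have "1 + (x $ i)\<^sup>2 <= (1 + norm x)\<^sup>2" for i
    proof -
      have "\<bar>x $ i\<bar> <= norm x" by (rule component_le_norm_cart)
      hence "(x $ i)\<^sup>2 <= (norm x)\<^sup>2" by (metis abs_le_square_iff abs_norm_cancel)
      moreover have "0 <= norm x" by simp
      moreover have "(1 + norm x)\<^sup>2 = 1 + (norm x)\<^sup>2 + 2 * norm x" by (simp add: power2_eq_square algebra_simps)
      ultimately show ?thesis by linarith
    qed
    hence "inverse ((1 + norm x)\<^sup>2) <= inverse (1 + (x $ i)\<^sup>2)" for i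
      by (intro le_imp_inverse_le) (auto simp: add_pos_nonneg)
    hence "(\<Prod>i\<in>(UNIV::'d set). inverse ((1 + norm x)\<^sup>2)) <= (\<Prod>i\<in>UNIV. inverse (1 + (x $ i)\<^sup>2))"
      by (intro prod_mono) auto
    thus ?thesis
      by (simp add: power_mult power_inverse prod_nonneg)
  qed
  thus "AE x::real^'d in lborel. norm (inverse (wt x)) <= norm (\<Prod>i\<in>UNIV. inverse (1 + (x $ i)\<^sup>2))"
    by simp
qed

lemma integrable_decay:
  fixes f :: "real^'d::finite => 'b::{banach, second_countable_topology}"
  assumes "f \<in> borel_measurable borel" and "\<And>x. wt x * norm (f x) <= C"
  shows "integrable lborel f"
    and "(LBINT x. norm (f x)) <= C * (LBINT x. inverse (wt (x::real^'d)))"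
proof -
  have p: "wt x > 0" for x :: "real^'d"
    by (simp add: add_pos_nonneg)
  have b: "norm (f x) <= C * inverse (wt x)" for x
    using assms(2)[of x] p[of x] by (simp add: field_simps)
  have C: "C >= 0" by (rule order_trans[OF _ assms(2)[of 0]]) simp
  show I: "integrable lborel f"
  proof (rule Bochner_Integration.integrable_bound)
    show "integrable lborel (\<lambda>x::real^'d. C * inverse (wt x))"
      by (intro integrable_mult_right integrable_weight)
    show "f \<in> borel_measurable lborel" using assms(1) by simp
    have "norm (f x) <= norm (C * inverse (wt x))" for x
      by (rule order_trans[OF b]) simp
    thus "AE x in lborel. norm (f x) <= norm (C * inverse (wt x))" by simp
  qed
  show "(LBINT x. norm (f x)) <= C * (LBINT x. inverse (wt (x::real^'d)))"
  proof (subst integral_mult_right_zero[symmetric], rule integral_mono)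
    show "integrable lborel (\<lambda>x. norm (f x))" using I by (rule integrable_norm)
    show "integrable lborel (\<lambda>x::real^'d. C * inverse (wt x))"
      by (intro integrable_mult_right integrable_weight)
  qed (rule b)
qed

text \<open>
  The characteristic function of the standard normal distribution, one coordinate at a time.
\<close>

lemma std_gauss_integral:
  fixes v :: "real^'d::finite"
  shows "integrable lborel (\<lambda>x::real^'d. exp (- (norm x)\<^sup>2 / 2))"
    and "(LBINT x. exp (\<i> * of_real (x \<bullet> v)) * of_real (exp (- (norm x)\<^sup>2 / 2))) =
      of_real (sqrt (2 * pi) ^ CARD('d) * exp (- (norm v)\<^sup>2 / 2))"
proof -
  have i1: "integrable lborel (\<lambda>x::real. exp (- x\<^sup>2 / 2))"
  proof -
    have "integrable lborel (\<lambda>x. sqrt (2*pi) * std_normal_density x)"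
      by (intro integrable_mult_right) (rule integrable_normal_density, simp)
    thus ?thesis by (simp add: std_normal_density_def)
  qed
  have n2: "(norm x)\<^sup>2 = (\<Sum>i\<in>UNIV. (x $ i)\<^sup>2)" for x :: "real^'d"
    by (simp only: power2_norm_eq_inner inner_vec_def) (simp add: power2_eq_square)
  have e1: "exp (- (norm x)\<^sup>2 / 2) = (\<Prod>i\<in>UNIV. exp (- (x $ i)\<^sup>2 / 2))" for x :: "real^'d"
    by (simp add: n2 exp_sum[symmetric] sum_divide_distrib sum_negf)
  show "integrable lborel (\<lambda>x::real^'d. exp (- (norm x)\<^sup>2 / 2))"
    unfolding e1 by (rule vec_prod_integral(1)[of "\<lambda>_ y. exp (- y\<^sup>2 / 2)", OF i1])
  define g where "g i y = exp (\<i> * of_real (y * v $ i)) * complex_of_real (exp (- y\<^sup>2 / 2))" for i y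
  have "g i \<in> borel_measurable borel" for i
    unfolding g_def by (intro borel_measurable_continuous_onI continuous_intros) auto
  hence gi: "integrable lborel (g i)" for i
    apply (intro Bochner_Integration.integrable_bound[OF i1])
    by (auto simp: g_def norm_mult)
  have gI: "(LBINT y. g i y) = of_real (sqrt (2 * pi) * exp (- (v $ i)\<^sup>2 / 2))" for i
  proof -
    have "of_real (exp (- (v $ i)\<^sup>2 / 2)) = char std_normal_distribution (v $ i)"
      by (simp add: char_std_normal_distribution)
    also have "... = (LBINT y. std_normal_density y *\<^sub>R exp (\<i> * of_real (v $ i * y)))"
      unfolding char_def by (subst integral_density) (auto simp: mult_ac)
    also have "... = (LBINT y. of_real (1 / sqrt (2*pi)) * g i y)"
      by (intro Bochner_Integration.integral_cong)
         (auto simp: std_normal_density_def g_def scaleR_conv_of_real mult_ac exp_of_real[symmetric])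
    also have "... = of_real (1 / sqrt (2*pi)) * (LBINT y. g i y)"
      by simp
    finally show ?thesis by (simp add: field_simps)
  qed
  have e2: "exp (\<i> * of_real (x \<bullet> v)) * of_real (exp (- (norm x)\<^sup>2 / 2)) = (\<Prod>i\<in>UNIV. g i (x $ i))" for x :: "real^'d"
    unfolding e1 g_def by (simp add: inner_vec_def prod.distrib exp_sum sum_distrib_left)
  show "(LBINT x. exp (\<i> * of_real (x \<bullet> v)) * of_real (exp (- (norm x)\<^sup>2 / 2))) =
      of_real (sqrt (2 * pi) ^ CARD('d) * exp (- (norm v)\<^sup>2 / 2))"
    unfolding e2 unfolding vec_prod_integral(2)[of g, OF gi] gI e1
    by (simp add: prod.distrib flip: of_real_prod)
qed

section \<open>The Fourier transform\<close>

lemma integrable_tensor: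
  fixes f :: "'a::euclidean_space => complex" and g :: "'b::euclidean_space => complex"
  assumes f: "integrable lborel f" and g: "integrable lborel g"
    and k: "k \<in> borel_measurable (borel \<Otimes>\<^sub>M borel)" "\<And>z. norm (k z) <= C"
  shows "integrable (lborel \<Otimes>\<^sub>M lborel) (\<lambda>(x, y). f x * g y * k (x, y))"
proof (rule Bochner_Integration.integrable_bound)
  have [measurable]: "f \<in> borel_measurable borel" "g \<in> borel_measurable borel"
    using f g by (metis borel_measurable_integrable measurable_lborel2)+
  show "integrable (lborel \<Otimes>\<^sub>M lborel) (\<lambda>(x, y). C * (norm (f x) * norm (g y)))"
  proof (rule lborel_pair.Fubini_integrable)
    show "AE x in lborel. integrable lborel (\<lambda>y. case (x, y) of (x, y) => C * (norm (f x) * norm (g y)))"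
      using g by (auto intro!: AE_I2 integrable_mult_right integrable_norm)
    show "integrable lborel (\<lambda>x. LBINT y. norm (case (x, y) of (x, y) => C * (norm (f x) * norm (g y))))"
      using f by (simp add: abs_mult integrable_norm)
  qed measurable
  show "(\<lambda>(x, y). f x * g y * k (x, y)) \<in> borel_measurable (lborel \<Otimes>\<^sub>M lborel)"
    using k(1) by measurable
  have "norm (f x * g y * k (x,y)) <= norm (C * (norm (f x) * norm (g y)))" for x y
  proof -
    have "norm (f x * g y * k (x,y)) = norm (f x) * norm (g y) * norm (k (x,y))"
      by (simp add: norm_mult)
    also have "... <= norm (f x) * norm (g y) * C"
      by (intro mult_left_mono k) auto
    finally show ?thesis by (simp add: abs_mult mult_ac) (smt (verit) mult_right_mono mult_nonneg_nonneg norm_ge_zero mult.commute mult.assoc)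
  qed
  thus "AE z in lborel \<Otimes>\<^sub>M lborel. norm (case z of (x, y) => f x * g y * k (x, y))
       <= norm (case z of (x, y) => C * (norm (f x) * norm (g y)))"
    by (auto intro!: AE_I2)
qed

definition fconst :: "'d itself => real"
  where "fconst _ = (2 * pi) powr (- real CARD('d) / 2)"

lemma fconst_pos: "fconst TYPE('d::finite) > 0"
  by (simp add: fconst_def)

lemma fconst_sqrt: "fconst TYPE('d::finite) * sqrt (2 * pi) ^ CARD('d) = 1"
proof -
  have "sqrt (2*pi) ^ CARD('d) = (2 * pi) powr (real CARD('d) / 2)"
    by (simp add: powr_half_sqrt[symmetric] powr_realpow[symmetric] powr_powr)
  thus ?thesis by (simp add: fconst_def powr_add[symmetric])
qed

lemma fourier_eq:
  "fourier f \<xi> = of_real (fconst TYPE('d)) * (LBINT x. f x * osc x \<xi>)"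
  for f :: "'d::finite fn"
  by (simp add: fourier_def fconst_def)

lemma borel_measurable_integrable_lborel:
  "integrable lborel f ==> f \<in> borel_measurable borel"
  by (metis borel_measurable_integrable measurable_lborel2)

lemma norm_exp_i_real [simp]: "norm (exp (\<i> * of_real x)) = 1" "norm (exp (- (\<i> * of_real x))) = 1"
  using norm_exp_i_times[of x] norm_exp_i_times[of "-x"] by simp_all

lemma integrable_fourier_kernel:
  fixes f :: "'d::finite fn"
  assumes "integrable lborel f"
  shows "integrable lborel (\<lambda>x. f x * osc x \<xi>)"
    "integrable lborel (\<lambda>x. f x * exp (\<i> * of_real (x \<bullet> \<xi>)))"
proof -
  have [measurable]: "f \<in> borel_measurable borel" using assms by (rule borel_measurable_integrable_lborel)
  show "integrable lborel (\<lambda>x. f x * osc x \<xi>)"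
    by (rule Bochner_Integration.integrable_bound[OF assms]) (auto simp: norm_mult)
  show "integrable lborel (\<lambda>x. f x * exp (\<i> * of_real (x \<bullet> \<xi>)))"
    by (rule Bochner_Integration.integrable_bound[OF assms]) (auto simp: norm_mult)
qed

lemma norm_fourier_le:
  fixes f :: "'d::finite fn"
  shows "norm (fourier f \<xi>) <= fconst TYPE('d) * (LBINT x. norm (f x))"
proof -
  have "norm (LBINT x. f x * osc x \<xi>) <= (LBINT x. norm (f x * osc x \<xi>))"
    by (rule integral_norm_bound)
  also have "... = (LBINT x. norm (f x))"
    by (simp add: norm_mult)
  finally show ?thesis using fconst_pos[where 'd='d]
    by (simp add: fourier_eq norm_mult)
qed

lemma continuous_on_integral_dominated:
  fixes F :: "'a::metric_space => 'b::euclidean_space => complex"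
  assumes m: "\<And>x. x \<in> S ==> F x \<in> borel_measurable borel"
    and c: "\<And>y. continuous_on S (\<lambda>x. F x y)"
    and w: "integrable lborel w" and b: "\<And>x y. x \<in> S ==> norm (F x y) <= w y"
  shows "continuous_on S (\<lambda>x. LBINT y. F x y)"
proof (subst continuous_on_sequentially, intro allI ballI impI)
  fix x a assume a: "a \<in> S" "(\<forall>n. x n \<in> S) \<and> x \<longlonglongrightarrow> a"
  show "((\<lambda>x. LBINT y. F x y) \<circ> x) \<longlonglongrightarrow> (LBINT y. F a y)"
    unfolding o_def
  proof (rule integral_dominated_convergence[where w=w])
    have "(\<lambda>n. F (x n) y) \<longlonglongrightarrow> F a y" for y
      using c[of y] a unfolding continuous_on_sequentially o_def by blast
    thus "AE y in lborel. (\<lambda>n. F (x n) y) \<longlonglongrightarrow> F a y" by simp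
  qed (use m a w b in auto)
qed

lemma continuous_on_fourier:
  fixes f :: "'d::finite fn"
  assumes "integrable lborel f"
  shows "continuous_on UNIV (fourier f)"
proof -
  have [measurable]: "f \<in> borel_measurable borel" using assms by (rule borel_measurable_integrable_lborel)
  have "continuous_on UNIV (\<lambda>\<xi>. LBINT x. f x * osc x \<xi>)"
    by (rule continuous_on_integral_dominated[where w="\<lambda>x. norm (f x)"])
       (auto intro!: continuous_intros assms integrable_norm simp: norm_mult)
  thus ?thesis
    unfolding fourier_eq[abs_def] by (intro continuous_intros)
qed

lemma fourier_exchange:
  fixes f g :: "'d::finite fn"
  assumes f: "integrable lborel f" and g: "integrable lborel g"
  shows "(LBINT x. fourier f x * g x) = (LBINT x. f x * fourier g x)"
proof -
  have I: "integrable (lborel \<Otimes>\<^sub>M lborel) (\<lambda>(x, y). f x * g y * (\<lambda>(x,y). osc x y) (x, y))"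
    by (rule integrable_tensor[OF f g, where C=1]) (measurable, auto)
  have "(LBINT y. fourier f y * g y) = of_real (fconst TYPE('d)) *
      (LBINT y. LBINT x. f x * g y * osc x y)"
    unfolding fourier_eq by (simp add: mult_ac flip: integral_mult_left_zero integral_mult_right_zero)
  also have "(LBINT y. LBINT x. f x * g y * osc x y)
     = (LBINT x. LBINT y. f x * g y * osc x y)"
    using lborel_pair.Fubini_integral[of "\<lambda>x y. f x * g y * osc x y"] I by simp
  also have "of_real (fconst TYPE('d)) * ... = (LBINT x. f x * fourier g x)"
    unfolding fourier_eq by (simp add: mult_ac inner_commute flip: integral_mult_left_zero integral_mult_right_zero)
  finally show ?thesis .
qed

text \<open>
  A wide Gaussian inserted into the inverse transform turns it, by \<open>fourier_exchange\<close>, into the mean of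
  \<open>f\<close> over a narrow Gaussian around \<open>x\<close>. Both sides converge by domination as the width tends to infinity.
\<close>

theorem fourier_inversion:
  fixes f :: "'d::finite fn"
  assumes cf: "continuous_on UNIV f" and bf: "\<And>x. norm (f x) <= B"
    and f: "integrable lborel f" and ff: "integrable lborel (fourier f)"
  shows "fourier (fourier f) (- x) = f x"
proof -
  define g where "g n \<xi> = exp (\<i> * of_real (\<xi> \<bullet> x)) * of_real (exp (- (norm (inverse (real (Suc n)) *\<^sub>R \<xi>))\<^sup>2 / 2))" for n and \<xi> :: "real^'d"
  define w where "w z = exp (- (norm z)\<^sup>2 / 2)" for z :: "real^'d"
  let ?c = "fconst TYPE('d)" and ?s = "sqrt (2 * pi) ^ CARD('d)"
  have [measurable]: "f \<in> borel_measurable borel" "fourier f \<in> borel_measurable borel"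
    using f ff by (auto intro: borel_measurable_integrable_lborel)
  have wI: "integrable lborel w"
    unfolding w_def by (rule std_gauss_integral)
  have gm[measurable]: "g n \<in> borel_measurable borel" for n
    unfolding g_def by measurable
  have gI: "integrable lborel (g n)" for n
  proof -
    have "integrable lborel (\<lambda>\<xi>. w (0 + inverse (real (Suc n)) *\<^sub>R \<xi>))"
      by (subst lborel_integrable_affine_iff) (auto intro: wI)
    thus ?thesis
      by (rule Bochner_Integration.integrable_bound) (auto simp: g_def w_def norm_mult)
  qed
  have fg: "fourier (g n) y = of_real (real (Suc n) ^ CARD('d) * w (real (Suc n) *\<^sub>R (x - y)))" for n y
  proof -
    let ?N = "real (Suc n)"
    have "(LBINT \<xi>. g n \<xi> * osc \<xi> y)
       = (LBINT \<xi>. exp (\<i> * of_real (\<xi> \<bullet> (x - y))) * of_real (w (inverse ?N *\<^sub>R \<xi>)))"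
      by (rule Bochner_Integration.integral_cong[OF refl])
         (simp add: g_def w_def inner_diff_right algebra_simps exp_add exp_diff exp_minus field_simps)
    also have "... = \<bar>?N\<bar> ^ DIM(real^'d) *\<^sub>R (LBINT \<xi>. exp (\<i> * of_real ((0 + ?N *\<^sub>R \<xi>) \<bullet> (x - y))) * of_real (w (inverse ?N *\<^sub>R (0 + ?N *\<^sub>R \<xi>))))"
      by (rule lborel_integral_affine) auto
    also have "... = ?N ^ CARD('d) *\<^sub>R (LBINT \<xi>. exp (\<i> * of_real (\<xi> \<bullet> (?N *\<^sub>R (x - y)))) * of_real (w \<xi>))"
      by simp
    also have "... = ?N ^ CARD('d) *\<^sub>R of_real (?s * w (?N *\<^sub>R (x - y)))"
      unfolding w_def std_gauss_integral(2) ..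
    finally have "fourier (g n) y = of_real ((?c * ?s) * (?N ^ CARD('d) * w (?N *\<^sub>R (x - y))))"
      unfolding fourier_eq by (simp add: scaleR_conv_of_real mult_ac)
    thus ?thesis unfolding fconst_sqrt by simp
  qed
  have A: "(LBINT \<xi>. fourier f \<xi> * g n \<xi>) = (LBINT z. f (x + inverse (real (Suc n)) *\<^sub>R z) * of_real (w z))" for n
  proof -
    let ?N = "real (Suc n)"
    have "(LBINT \<xi>. fourier f \<xi> * g n \<xi>) = (LBINT y. f y * of_real (?N ^ CARD('d) * w (?N *\<^sub>R (x - y))))"
      unfolding fourier_exchange[OF f gI] fg ..
    also have "... = \<bar>inverse ?N\<bar> ^ DIM(real^'d) *\<^sub>R
       (LBINT z. f (x + inverse ?N *\<^sub>R z) * of_real (?N ^ CARD('d) * w (?N *\<^sub>R (x - (x + inverse ?N *\<^sub>R z)))))"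
      by (rule lborel_integral_affine) auto
    also have "... = (LBINT z. inverse ?N ^ CARD('d) *\<^sub>R (f (x + inverse ?N *\<^sub>R z) * of_real (?N ^ CARD('d) * w z)))"
      by (simp add: w_def)
    also have "... = (LBINT z. f (x + inverse ?N *\<^sub>R z) * of_real (w z))"
    proof (rule Bochner_Integration.integral_cong[OF refl])
      fix z :: "real^'d"
      have "inverse ?N ^ CARD('d) * ?N ^ CARD('d) = 1"
        by (simp add: power_mult_distrib[symmetric])
      have "inverse ?N ^ CARD('d) *\<^sub>R (f (x + inverse ?N *\<^sub>R z) * of_real (?N ^ CARD('d) * w z))
          = f (x + inverse ?N *\<^sub>R z) * of_real ((inverse ?N ^ CARD('d) * ?N ^ CARD('d)) * w z)"
        by (simp only: scaleR_conv_of_real of_real_mult mult_ac)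
      thus "inverse ?N ^ CARD('d) *\<^sub>R (f (x + inverse ?N *\<^sub>R z) * of_real (?N ^ CARD('d) * w z))
          = f (x + inverse ?N *\<^sub>R z) * of_real (w z)"
        using \<open>inverse ?N ^ CARD('d) * ?N ^ CARD('d) = 1\<close> by (simp only: mult_1)
    qed
    finally show ?thesis .
  qed
  have L0: "(\<lambda>n. inverse (real (Suc n)) *\<^sub>R z) \<longlonglongrightarrow> 0" for z :: "real^'d"
    using tendsto_scaleR[OF LIMSEQ_inverse_real_of_nat tendsto_const[of z]] by simp
  have 1: "(\<lambda>n. LBINT \<xi>. fourier f \<xi> * g n \<xi>) \<longlonglongrightarrow> (LBINT \<xi>. fourier f \<xi> * exp (\<i> * of_real (\<xi> \<bullet> x)))"
  proof (rule integral_dominated_convergence[where w="\<lambda>\<xi>. norm (fourier f \<xi>)"])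
    have "(\<lambda>n. g n \<xi>) \<longlonglongrightarrow> exp (\<i> * of_real (\<xi> \<bullet> x)) * of_real (exp (- (norm (0::real^'d))\<^sup>2 / 2))" for \<xi>
      unfolding g_def by (intro tendsto_intros L0) auto
    thus "AE \<xi> in lborel. (\<lambda>n. fourier f \<xi> * g n \<xi>) \<longlonglongrightarrow> fourier f \<xi> * exp (\<i> * of_real (\<xi> \<bullet> x))"
      by (intro AE_I2 tendsto_intros) auto
    have "norm (g n \<xi>) <= 1" for n \<xi> by (simp add: g_def norm_mult)
    thus "AE \<xi> in lborel. norm (fourier f \<xi> * g n \<xi>) <= norm (fourier f \<xi>)" for n
      by (intro AE_I2) (simp add: norm_mult mult_left_le)
    show "integrable lborel (\<lambda>\<xi>. norm (fourier f \<xi>))" using ff by (rule integrable_norm)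
  qed measurable
  have 2: "(\<lambda>n. LBINT z. f (x + inverse (real (Suc n)) *\<^sub>R z) * of_real (w z)) \<longlonglongrightarrow> (LBINT z. f x * of_real (w z))"
  proof (rule integral_dominated_convergence[where w="\<lambda>z. B * w z"])
    have "(\<lambda>n. f (x + inverse (real (Suc n)) *\<^sub>R z)) \<longlonglongrightarrow> f x" for z
    proof (rule continuous_on_tendsto_compose[OF cf])
      show "(\<lambda>n. x + inverse (real (Suc n)) *\<^sub>R z) \<longlonglongrightarrow> x"
        using tendsto_add[OF tendsto_const[of x] L0[of z]] by simp
    qed auto
    thus "AE z in lborel. (\<lambda>n. f (x + inverse (real (Suc n)) *\<^sub>R z) * of_real (w z)) \<longlonglongrightarrow> f x * of_real (w z)"
      by (intro AE_I2 tendsto_intros) auto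
    show "AE z in lborel. norm (f (x + inverse (real (Suc n)) *\<^sub>R z) * of_real (w z)) <= B * w z" for n
      by (intro AE_I2) (simp add: norm_mult w_def mult_right_mono bf)
    show "integrable lborel (\<lambda>z. B * w z)" using wI by (rule integrable_mult_right)
  qed (measurable, simp_all add: w_def)
  have 3: "(LBINT \<xi>. fourier f \<xi> * exp (\<i> * of_real (\<xi> \<bullet> x))) = (LBINT z. f x * of_real (w z))"
    by (rule LIMSEQ_unique[OF 1[unfolded A] 2])
  have 4: "(LBINT z. complex_of_real (w z)) = of_real ?s"
    using std_gauss_integral(2)[of 0] by (simp add: w_def)
  have "fourier (fourier f) (- x) = of_real ?c * (f x * of_real ?s)"
    unfolding fourier_eq[of "fourier f"] using 3 4 by simp
  also have "... = f x * of_real (?c * ?s)" by (simp add: mult_ac)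
  finally show ?thesis unfolding fconst_sqrt by simp
qed

section \<open>Rapid decay and the Schwartz class\<close>

definition rapid :: "'d::finite fn => bool"
  where "rapid f \<longleftrightarrow> (\<forall>k. \<exists>C. \<forall>x. (1 + norm x) ^ k * norm (f x) <= C)"

lemma rapidD: assumes "rapid f" obtains C where "C >= 0" "\<And>x. (1 + norm x) ^ k * norm (f x) <= C"
proof -
  obtain C where C: "\<And>x. (1 + norm x) ^ k * norm (f x) <= C" using assms unfolding rapid_def by meson
  show ?thesis
  proof (rule that)
    show "C >= 0" by (rule order_trans[OF _ C[of 0]]) simp
  qed (rule C)
qed

lemma one_plus_norm_pos [simp]: "0 < 1 + norm x" "0 <= 1 + norm x" "1 + norm x \<noteq> 0"
  by (simp_all add: add_pos_nonneg) (metis add_pos_nonneg norm_ge_zero order_less_irrefl zero_less_one)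

lemma rapid_mult_poly:
  assumes f: "rapid f" and q: "\<And>x. norm (q x) <= C * (1 + norm x) ^ n"
  shows "rapid (\<lambda>x. q x * f x)"
  unfolding rapid_def
proof
  fix k
  obtain D where D: "D >= 0" "\<And>x. (1 + norm x) ^ (k + n) * norm (f x) <= D" using rapidD[OF f] by metis
  have C: "C >= 0" by (rule order_trans[OF _ q[of 0, simplified]]) simp
  have "(1 + norm x) ^ k * norm (q x * f x) <= C * D" for x
  proof -
    have "(1 + norm x) ^ k * norm (q x * f x) = norm (q x) * ((1 + norm x) ^ k * norm (f x))"
      by (simp add: norm_mult)
    also have "... <= (C * (1 + norm x) ^ n) * ((1 + norm x) ^ k * norm (f x))"
      by (intro mult_right_mono q) simp
    also have "... = C * ((1 + norm x) ^ (k + n) * norm (f x))" by (simp add: power_add)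
    also have "... <= C * D" using D C by (intro mult_left_mono) auto
    finally show ?thesis .
  qed
  thus "\<exists>C. \<forall>x. (1 + norm x) ^ k * norm (q x * f x) <= C" by blast
qed

lemma rapid_cmult: "rapid f ==> rapid (\<lambda>x. c * f x)"
  by (rule rapid_mult_poly[where C="norm c" and n=0]) auto

lemma rapid_component: "rapid f ==> rapid (\<lambda>x. of_real (x $ j) * f x)"
  by (rule rapid_mult_poly[where C=1 and n=1])
     (auto intro: order_trans[OF component_le_norm_cart])

lemma rapid_bound:
  assumes "rapid f" and "\<And>x. norm (g x) <= norm (f x)"
  shows "rapid g"
  unfolding rapid_def
proof
  fix k
  obtain D where D: "D >= 0" "\<And>x. (1 + norm x) ^ k * norm (f x) <= D" using rapidD[OF assms(1)] by metis
  have "(1 + norm x) ^ k * norm (g x) <= D" for x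
    by (rule order_trans[OF mult_left_mono[OF assms(2)] D(2)]) simp
  thus "\<exists>C. \<forall>x. (1 + norm x) ^ k * norm (g x) <= C" by blast
qed

lemma rapid_uminus: "rapid f ==> rapid (\<lambda>x. f (- x))"
  unfolding rapid_def by (metis norm_minus_cancel)

lemma rapid_minus: "rapid f ==> rapid (\<lambda>x. - f x)"
  by (erule rapid_bound) simp

lemma rapid_cnj: "rapid f ==> rapid (\<lambda>x. cnj (f x))"
  by (erule rapid_bound) simp

lemma rapid_add:
  assumes "rapid f" "rapid g" shows "rapid (\<lambda>x. f x + g x)"
  unfolding rapid_def
proof
  fix k
  obtain D where D: "\<And>x. (1 + norm x) ^ k * norm (f x) <= D" using rapidD[OF assms(1)] by metis
  obtain E where E: "\<And>x. (1 + norm x) ^ k * norm (g x) <= E" using rapidD[OF assms(2)] by metis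
  have "(1 + norm x) ^ k * norm (f x + g x) <= D + E" for x
  proof -
    have "(1 + norm x) ^ k * norm (f x + g x) <= (1 + norm x) ^ k * (norm (f x) + norm (g x))"
      by (intro mult_left_mono norm_triangle_ineq) simp
    thus ?thesis using D[of x] E[of x] by (simp add: distrib_left)
  qed
  thus "\<exists>C. \<forall>x. (1 + norm x) ^ k * norm (f x + g x) <= C" by blast
qed

lemma rapid_translate:
  assumes "rapid f" shows "rapid (\<lambda>x. f (x - a))"
  unfolding rapid_def
proof
  fix k
  obtain D where D: "D >= 0" "\<And>x. (1 + norm x) ^ k * norm (f x) <= D" using rapidD[OF assms(1)] by metis
  have "(1 + norm x) ^ k * norm (f (x - a)) <= (1 + norm a) ^ k * D" for x
  proof -
    have "norm x <= norm a + norm (x - a)" using norm_triangle_ineq[of a "x - a"] by simp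
    moreover have "0 <= norm a * norm (x - a)" by simp
    moreover have "(1 + norm a) * (1 + norm (x - a)) = 1 + norm a + norm (x - a) + norm a * norm (x - a)"
      by (simp add: algebra_simps)
    ultimately have "1 + norm x <= (1 + norm a) * (1 + norm (x - a))"
      by linarith
    hence "(1 + norm x) ^ k <= ((1 + norm a) * (1 + norm (x - a))) ^ k"
      by (intro power_mono) auto
    hence "(1 + norm x) ^ k * norm (f (x - a)) <= ((1 + norm a) * (1 + norm (x - a))) ^ k * norm (f (x - a))"
      by (intro mult_right_mono) auto
    also have "... = (1 + norm a) ^ k * ((1 + norm (x - a)) ^ k * norm (f (x - a)))"
      by (simp add: power_mult_distrib)
    also have "... <= (1 + norm a) ^ k * D" by (intro mult_left_mono D) auto
    finally show ?thesis .
  qed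
  thus "\<exists>C. \<forall>x. (1 + norm x) ^ k * norm (f (x - a)) <= C" by blast
qed

lemma rapid_integrable:
  assumes "continuous_on UNIV f" "rapid f"
  shows "integrable lborel f"
proof -
  obtain C where C: "\<And>x. (1 + norm x) ^ (2 * CARD('a)) * norm (f x) <= C" using rapidD[OF assms(2)] by metis
  show ?thesis
    by (rule integrable_decay(1)[OF _ C]) (intro borel_measurable_continuous_onI assms)
qed

lemma rapid_integrable_poly:
  fixes f :: "'d::finite fn"
  assumes "continuous_on UNIV f" "rapid f"
  shows "integrable lborel (\<lambda>x. norm x ^ k * norm (f x))"
proof -
  have "integrable lborel (\<lambda>x. of_real (norm x ^ k) * f x)"
  proof (rule rapid_integrable)
    show "continuous_on UNIV (\<lambda>x. complex_of_real (norm x ^ k) * f x)"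
      by (intro continuous_intros assms)
    show "rapid (\<lambda>x. complex_of_real (norm x ^ k) * f x)"
      by (rule rapid_mult_poly[OF assms(2), where C=1 and n=k]) (auto intro!: power_mono simp: norm_power)
  qed
  from integrable_norm[OF this] show ?thesis by (simp add: norm_mult norm_power)
qed

lemma rapid_bounded: assumes "rapid f" obtains B where "B >= 0" "\<And>x. norm (f x) <= B"
  using rapidD[OF assms, of 0] by auto

text \<open>
  The Schwartz space without derivatives: rapid decay of the transform stands for smoothness. The
  usual definition gives the same space (\<open>schwartz_eq_SS\<close>), but this one makes Fourier multipliers easy.
\<close>

definition SS :: "'d::finite fn set"
  where "SS = {f. continuous_on UNIV f \<and> rapid f \<and> rapid (fourier f)}"

lemma SS_I: "continuous_on UNIV f ==> rapid f ==> rapid (fourier f) ==> f \<in> SS"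
  by (simp add: SS_def)

lemma SS_cont: "f \<in> SS ==> continuous_on UNIV f" by (simp add: SS_def)
lemma SS_rapid: "f \<in> SS ==> rapid f" by (simp add: SS_def)
lemma SS_rapid_fourier: "f \<in> SS ==> rapid (fourier f)" by (simp add: SS_def)
lemma SS_integrable: "f \<in> SS ==> integrable lborel f"
  by (intro rapid_integrable SS_cont SS_rapid)
lemma SS_fourier_cont: "f \<in> SS ==> continuous_on UNIV (fourier f)"
  by (intro continuous_on_fourier SS_integrable)

lemma SS_inversion:
  assumes "f \<in> SS" shows "fourier (fourier f) x = f (- x)"
proof -
  obtain B where "\<And>x. norm (f x) <= B" using rapid_bounded[OF SS_rapid[OF assms]] by metis
  hence "fourier (fourier f) (- (- x)) = f (- x)"
    by (rule fourier_inversion[OF SS_cont[OF assms] _ SS_integrable[OF assms]])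
       (intro rapid_integrable SS_fourier_cont SS_rapid_fourier assms)
  thus ?thesis by simp
qed

lemma SS_fourier: assumes "f \<in> SS" shows "fourier f \<in> SS"
proof (rule SS_I)
  show "rapid (fourier (fourier f))"
  proof -
    have "fourier (fourier f) = (\<lambda>x. f (- x))" using SS_inversion[OF assms] by auto
    thus ?thesis using rapid_uminus[OF SS_rapid[OF assms]] by simp
  qed
qed (use assms in \<open>auto intro: SS_fourier_cont SS_rapid_fourier\<close>)

lemma fourier_uminus_arg: "fourier (\<lambda>x. f (- x)) \<xi> = fourier f (- \<xi>)"
  for f :: "'d::finite fn"
  unfolding fourier_eq
  using lborel_integral_translate(4)[of "\<lambda>x. f x * osc x (- \<xi>)"] by simp

lemma fourier_cmult: "fourier (\<lambda>x. c * f x) \<xi> = c * fourier f \<xi>"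
  for f :: "'d::finite fn"
  unfolding fourier_eq by (simp add: mult.assoc)

lemma fourier_uminus: "fourier (\<lambda>x. - f x) \<xi> = - fourier f \<xi>"
  using fourier_cmult[of "-1" f \<xi>] by simp

lemma fourier_add:
  fixes f :: "'d::finite fn"
  assumes "integrable lborel f" "integrable lborel g"
  shows "fourier (\<lambda>x. f x + g x) \<xi> = fourier f \<xi> + fourier g \<xi>"
  unfolding fourier_eq
  by (simp only: distrib_right Bochner_Integration.integral_add[OF integrable_fourier_kernel(1) integrable_fourier_kernel(1), OF assms] distrib_left)

lemma SS_uminus_arg: "f \<in> SS ==> (\<lambda>x. f (- x)) \<in> SS"
  unfolding SS_def
  by (auto simp: fourier_uminus_arg[abs_def] intro!: rapid_uminus continuous_intros
      intro: continuous_on_compose2[of UNIV f UNIV uminus])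

lemma SS_cmult: "f \<in> SS ==> (\<lambda>x. c * f x) \<in> SS"
  unfolding SS_def by (auto simp: fourier_cmult[abs_def] intro!: rapid_cmult continuous_intros)

lemma SS_uminus: "f \<in> SS ==> (\<lambda>x. - f x) \<in> SS"
  using SS_cmult[of f "-1"] by simp

lemma SS_add: "f \<in> SS ==> g \<in> SS ==> (\<lambda>x. f x + g x) \<in> SS"
proof -
  assume f: "f \<in> SS" and g: "g \<in> SS"
  have "fourier (\<lambda>x. f x + g x) = (\<lambda>\<xi>. fourier f \<xi> + fourier g \<xi>)"
    by (rule ext) (intro fourier_add SS_integrable f g)
  thus ?thesis using f g
    by (intro SS_I) (auto intro!: rapid_add continuous_intros intro: SS_cont SS_rapid SS_rapid_fourier)
qed

lemma SS_diff: "f \<in> SS ==> g \<in> SS ==> (\<lambda>x. f x - g x) \<in> SS"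
  using SS_add[OF _ SS_uminus, of f g] by simp

lemma SS_zero: "(\<lambda>x. 0) \<in> SS"
  unfolding SS_def by (auto simp: rapid_def fourier_def[abs_def])

definition ifourier :: "'d::finite fn => 'd fn"
  where "ifourier f x = fourier f (- x)"

lemma ifourier_alt: "ifourier f = fourier (\<lambda>x. f (- x))"
  by (simp add: fun_eq_iff ifourier_def fourier_uminus_arg)

lemma SS_ifourier: "f \<in> SS ==> ifourier f \<in> SS"
  unfolding ifourier_alt by (intro SS_fourier SS_uminus_arg)

lemma ifourier_fourier: "f \<in> SS ==> ifourier (fourier f) = f"
  by (simp add: fun_eq_iff ifourier_def SS_inversion)

lemma fourier_ifourier: "f \<in> SS ==> fourier (ifourier f) = f"
  by (simp add: ifourier_alt fun_eq_iff SS_inversion SS_uminus_arg)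

lemma iexp_second_order: "cmod (exp (- (\<i> * of_real y)) - 1 + \<i> * of_real y) <= y\<^sup>2"
proof -
  have "cmod (exp (\<i> * of_real (-y)) - (\<Sum>k\<le>1. (\<i> * of_real (-y)) ^ k / fact k)) <= \<bar>-y\<bar> ^ Suc 1 / fact (Suc 1)"
    by (rule iexp_approx1)
  also have "(\<Sum>k\<le>1. (\<i> * of_real (-y)) ^ k / fact k) = 1 - \<i> * of_real y" by simp
  finally have *: "cmod (exp (- (\<i> * of_real y)) - (1 - \<i> * of_real y)) <= y\<^sup>2 / 2"
    by (simp add: power2_eq_square)
  have "exp (- (\<i> * of_real y)) - 1 + \<i> * of_real y = exp (- (\<i> * of_real y)) - (1 - \<i> * of_real y)"
    by simp
  thus ?thesis using * by (smt (verit) field_sum_of_halves zero_le_power2)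
qed

lemma fourier_sum:
  fixes f :: "'i => 'd::finite fn"
  assumes "finite A" "\<And>i. i \<in> A ==> integrable lborel (f i)"
  shows "fourier (\<lambda>x. \<Sum>i\<in>A. f i x) \<xi> = (\<Sum>i\<in>A. fourier (f i) \<xi>)"
  using assms
proof (induction A rule: finite_induct)
  case empty thus ?case by (simp add: fourier_def)
next
  case (insert a A)
  thus ?case by (simp add: fourier_add)
qed

text \<open>
  The explicit remainder serves twice: for differentiability, and in \<open>SS_D_coord_rapid\<close> for trading
  step size against decay.
\<close>

lemma fourier_taylor:
  fixes g :: "'d::finite fn"
  assumes c: "continuous_on UNIV g" and r: "rapid g"
  shows "norm (fourier g (\<xi> + v) - fourier g \<xi> - (\<Sum>j\<in>UNIV. of_real (v $ j) * fourier (\<lambda>x. - \<i> * (of_real (x $ j) * g x)) \<xi>))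
     <= fconst TYPE('d) * (LBINT x. (norm x)^2 * norm (g x)) * (norm v)\<^sup>2"
proof -
  have I: "integrable lborel g" by (rule rapid_integrable[OF c r])
  have Ij: "integrable lborel (\<lambda>x. of_real (x $ j) * g x)" for j
    by (intro rapid_integrable rapid_component r continuous_intros c)
  have Ij': "integrable lborel (\<lambda>x. of_real (v $ j) * (- \<i> * (of_real (x $ j) * g x)))" for j
    by (intro integrable_mult_right Ij)
  let ?h = "\<lambda>x. g x * (osc x v)"
  have Ih: "integrable lborel ?h" by (rule integrable_fourier_kernel[OF I])
  have 1: "fourier g (\<xi> + v) = fourier ?h \<xi>"
    unfolding fourier_eq by (simp add: inner_add_right algebra_simps exp_add exp_diff exp_minus field_simps)
  have 2: "(\<Sum>j\<in>UNIV. of_real (v $ j) * fourier (\<lambda>x. - \<i> * (of_real (x $ j) * g x)) \<xi>)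
     = fourier (\<lambda>x. \<Sum>j\<in>UNIV. of_real (v $ j) * (- \<i> * (of_real (x $ j) * g x))) \<xi>"
    using fourier_sum[of UNIV "\<lambda>j x. of_real (v $ j) * (- \<i> * (of_real (x $ j) * g x))", OF _ Ij']
    by (simp only: fourier_cmult finite_class.finite_UNIV)
  let ?s = "\<lambda>x. \<Sum>j\<in>UNIV. of_real (v $ j) * (- \<i> * (of_real (x $ j) * g x))"
  have 3: "?s x = - \<i> * of_real (x \<bullet> v) * g x" for x
    by (simp add: inner_vec_def sum_distrib_left sum_distrib_right mult_ac sum_negf)
  have Is: "integrable lborel ?s" by (intro Bochner_Integration.integrable_sum Ij')
  have "fourier g (\<xi> + v) - fourier g \<xi> - fourier ?s \<xi> = fourier (\<lambda>x. ?h x + (- 1) * g x + (- 1) * ?s x) \<xi>"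
    unfolding 1
    using fourier_add[OF Bochner_Integration.integrable_add[OF Ih integrable_mult_right[OF I, of "- 1"]] integrable_mult_right[OF Is, of "- 1"], of \<xi>]
      fourier_add[OF Ih integrable_mult_right[OF I, of "- 1"], of \<xi>]
      fourier_cmult[of "- 1" g \<xi>] fourier_cmult[of "- 1" ?s \<xi>]
    by (simp only: mult_minus1 add_uminus_conv_diff)
  hence "norm (fourier g (\<xi> + v) - fourier g \<xi> - fourier ?s \<xi>) <=
      fconst TYPE('d) * (LBINT x. norm (?h x + (- 1) * g x + (- 1) * ?s x))"
    by (simp only: norm_fourier_le)
  also have "... <= fconst TYPE('d) * (LBINT x. (norm x)^2 * norm (g x) * (norm v)\<^sup>2)"
  proof (intro mult_left_mono integral_mono)
    show "integrable lborel (\<lambda>x. norm (?h x + (- 1) * g x + (- 1) * ?s x))"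
      by (intro integrable_norm Bochner_Integration.integrable_add integrable_mult_right Ih I Is)
    show "integrable lborel (\<lambda>x. (norm x)^2 * norm (g x) * (norm v)\<^sup>2)"
      by (intro integrable_mult_left rapid_integrable_poly c r)
    fix x :: "real^'d"
    have "?h x + (- 1) * g x + (- 1) * ?s x = (exp (- (\<i> * of_real (x \<bullet> v))) - 1 + \<i> * of_real (x \<bullet> v)) * g x"
      unfolding 3 by (simp add: algebra_simps)
    hence "norm (?h x + (- 1) * g x + (- 1) * ?s x) <= (x \<bullet> v)\<^sup>2 * norm (g x)"
      by (simp only: norm_mult) (intro mult_right_mono iexp_second_order norm_ge_zero)
    also have "... <= (norm x * norm v)\<^sup>2 * norm (g x)"
      using Cauchy_Schwarz_ineq2[of x v]
      by (intro mult_right_mono) (auto simp: abs_le_square_iff[symmetric] abs_mult)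
    finally show "norm (?h x + (- 1) * g x + (- 1) * ?s x) <= (norm x)^2 * norm (g x) * (norm v)\<^sup>2"
      by (simp add: power_mult_distrib mult_ac)
  qed (use fconst_pos[where 'd='d] in simp)
  finally show ?thesis unfolding 2 integral_mult_left_zero by (simp only: mult.assoc[symmetric])
qed

lemma fourier_has_derivative:
  fixes g :: "'d::finite fn"
  assumes c: "continuous_on UNIV g" and r: "rapid g"
  shows "(fourier g has_derivative (\<lambda>v. \<Sum>j\<in>UNIV. of_real (v $ j) * fourier (\<lambda>x. - \<i> * (of_real (x $ j) * g x)) \<xi>)) (at \<xi>)"
proof (rule has_derivativeI_sandwich[of 1])
  let ?M = "fconst TYPE('d) * (LBINT x. (norm x)^2 * norm (g x))"
  show "bounded_linear (\<lambda>v. \<Sum>j\<in>UNIV. of_real (v $ j) * fourier (\<lambda>x. - \<i> * (of_real (x $ j) * g x)) \<xi>)"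
    unfolding linear_conv_bounded_linear[symmetric]
    by (rule linearI)
       (simp_all only: vector_add_component of_real_add distrib_right sum.distrib vector_scaleR_component
          real_scaleR_def of_real_mult scaleR_conv_of_real[where 'a=complex] sum_distrib_left mult.assoc)
  show "norm (fourier g y - fourier g \<xi> - (\<Sum>j\<in>UNIV. of_real ((y - \<xi>) $ j) * fourier (\<lambda>x. - \<i> * (of_real (x $ j) * g x)) \<xi>))
      / norm (y - \<xi>) <= ?M * norm (y - \<xi>)" if "y \<noteq> \<xi>" for y
    using fourier_taylor[OF c r, of \<xi> "y - \<xi>"] that
    by (simp add: divide_le_eq power2_eq_square mult_ac)
  have "((\<lambda>y. ?M * norm (y - \<xi>)) \<longlongrightarrow> ?M * norm (\<xi> - \<xi>)) (at \<xi>)"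
    by (intro tendsto_intros)
  thus "((\<lambda>y. ?M * norm (y - \<xi>)) \<longlongrightarrow> 0) (at \<xi>)" by simp
qed auto

lemma partial_derivI: "(f has_derivative f') (at x) ==> partial_deriv j f x = f' (axis j 1)"
  unfolding partial_deriv_def by (simp flip: frechet_derivative_at)

lemma fourier_D_coord:
  fixes g :: "'d::finite fn"
  assumes c: "continuous_on UNIV g" and r: "rapid g"
  shows "fourier g differentiable at \<xi>"
    and "D_coord j (fourier g) \<xi> = fourier (\<lambda>x. - of_real (x $ j) * g x) \<xi>"
proof -
  note d = fourier_has_derivative[OF c r, of \<xi>]
  show "fourier g differentiable at \<xi>" using d by (rule differentiableI)
  have s: "(\<Sum>i\<in>UNIV. of_real (axis j 1 $ i) * F i) = F j" for F :: "'d => complex"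
  proof -
    have "(\<Sum>i\<in>UNIV. of_real (axis j 1 $ i) * F i) = (\<Sum>i\<in>UNIV. if i = j then F i else 0)"
      by (rule sum.cong) (auto simp: axis_def)
    thus ?thesis by simp
  qed
  have "partial_deriv j (fourier g) \<xi> = fourier (\<lambda>x. - \<i> * (of_real (x $ j) * g x)) \<xi>"
    using partial_derivI[OF d, of j] unfolding s .
  thus "D_coord j (fourier g) \<xi> = fourier (\<lambda>x. - of_real (x $ j) * g x) \<xi>"
    using fourier_cmult[of "- \<i>" "\<lambda>x. of_real (x $ j) * g x" \<xi>] fourier_cmult[of "- 1" "\<lambda>x. of_real (x $ j) * g x" \<xi>]
    by (simp add: D_coord_def)
qed

lemma SS_as_fourier:
  assumes "f \<in> SS" obtains g where "g \<in> SS" "f = fourier g" "\<And>\<xi>. fourier f \<xi> = g (- \<xi>)"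
proof (rule that[of "ifourier f"])
  show "ifourier f \<in> SS" using assms by (rule SS_ifourier)
  show "f = fourier (ifourier f)" using assms by (simp add: fourier_ifourier)
  show "fourier f \<xi> = ifourier f (- \<xi>)" for \<xi> by (simp add: ifourier_def)
qed

text \<open>
  The difference quotient with step \<open>(1 + \<bar>x\<bar>)\<^sup>-\<^sup>k\<close> differs from the derivative by a constant times
  the step, and it is itself small because \<open>f\<close> decays faster than any power.
\<close>

lemma SS_D_coord_rapid:
  fixes f :: "'d::finite fn"
  assumes "f \<in> SS" shows "rapid (D_coord j f)"
proof -
  obtain g where g: "g \<in> SS" "f = fourier g" using SS_as_fourier[OF assms] by metis
  define M where "M = fconst TYPE('d) * (LBINT x. (norm x)^2 * norm (g x))"
  have M: "M >= 0" unfolding M_def using fconst_pos[where 'd='d] by simp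
  have D: "D_coord j f x = fourier (\<lambda>x. - of_real (x $ j) * g x) x" for x
    unfolding g(2) by (rule fourier_D_coord(2)[OF SS_cont SS_rapid]) (rule g)+
  have T: "norm (f (x + \<tau> *\<^sub>R axis j 1) - f x - of_real \<tau> * (\<i> * D_coord j f x)) <= M * \<tau>\<^sup>2" for x \<tau>
  proof -
    have s: "(\<Sum>i\<in>UNIV. of_real ((\<tau> *\<^sub>R axis j 1) $ i) * F i) = of_real \<tau> * F j" for F :: "'d => complex"
    proof -
      have "(\<Sum>i\<in>UNIV. of_real ((\<tau> *\<^sub>R axis j 1) $ i) * F i) = (\<Sum>i\<in>UNIV. if i = j then of_real \<tau> * F i else 0)"
        by (rule sum.cong) (auto simp: axis_def)
      thus ?thesis by simp
    qed
    have n: "(norm (\<tau> *\<^sub>R axis j (1::real)))\<^sup>2 = \<tau>\<^sup>2" by (simp add: norm_axis_1)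
    have e: "fourier (\<lambda>x. - \<i> * (of_real (x $ j) * g x)) x = \<i> * D_coord j f x"
      unfolding D fourier_cmult[symmetric] by (simp add: mult_ac)
    show ?thesis
      using fourier_taylor[OF SS_cont[OF g(1)] SS_rapid[OF g(1)], of x "\<tau> *\<^sub>R axis j 1"]
      unfolding s n e g(2)[symmetric] M_def by simp
  qed
  show ?thesis unfolding rapid_def
  proof
    fix k
    obtain C where C: "C >= 0" "\<And>x. (1 + norm x) ^ (2 * k) * norm (f x) <= C" using rapidD[OF SS_rapid[OF assms]] by metis
    have "(1 + norm x) ^ k * norm (D_coord j f x) <= C * 2 ^ (2 * k) + C + M" for x
    proof -
      define X where "X = (1 + norm x) ^ k"
      have X: "X >= 1" unfolding X_def by (simp add: one_le_power)
      define y where "y = x + (1 / X) *\<^sub>R axis j 1"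
      have "norm x <= norm y + norm ((1 / X) *\<^sub>R axis j (1::real) :: real^'d)"
        unfolding y_def using norm_triangle_ineq4[of "x + (1 / X) *\<^sub>R axis j 1" "(1 / X) *\<^sub>R axis j 1"] by simp
      moreover have "norm ((1 / X) *\<^sub>R axis j (1::real) :: real^'d) <= 1"
        using X by (simp add: norm_axis_1)
      ultimately have "1 + norm x <= 2 * (1 + norm y)" by (smt (verit) norm_ge_zero)
      hence "(1 + norm x) ^ (2 * k) <= (2 * (1 + norm y)) ^ (2 * k)"
        by (intro power_mono) auto
      moreover have XX: "X * X = (1 + norm x) ^ (2 * k)"
        unfolding X_def by (simp add: power_add[symmetric] mult_2[symmetric])
      ultimately have "X * X * norm (f y) <= (2 * (1 + norm y)) ^ (2 * k) * norm (f y)"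
        by (intro mult_right_mono) auto
      also have "... = 2 ^ (2 * k) * ((1 + norm y) ^ (2 * k) * norm (f y))"
        by (simp only: power_mult_distrib mult.assoc)
      also have "... <= 2 ^ (2 * k) * C" by (intro mult_left_mono C) auto
      finally have fy: "X * X * norm (f y) <= 2 ^ (2 * k) * C" .
      have fx: "X * X * norm (f x) <= C"
        using C(2)[of x] unfolding X_def by (simp add: power_add[symmetric] mult_2[symmetric])
      have "of_real (1 / X) * (\<i> * D_coord j f x) =
          (f y - f x) - (f y - f x - of_real (1 / X) * (\<i> * D_coord j f x))" by simp
      hence "norm (of_real (1 / X) * (\<i> * D_coord j f x)) <= norm (f y - f x) + M * (1 / X)\<^sup>2"
        using T[of x "1 / X"] unfolding y_def by (smt (verit) norm_triangle_ineq4)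
      also have "... <= norm (f y) + norm (f x) + M * (1 / X)\<^sup>2"
        using norm_triangle_ineq4[of "f y" "f x"] by simp
      finally have "norm (D_coord j f x) / X <= norm (f y) + norm (f x) + M * (1 / X)\<^sup>2"
        using X by (simp add: norm_mult norm_divide)
      hence "X * X * (norm (D_coord j f x) / X) <= X * X * (norm (f y) + norm (f x) + M * (1 / X)\<^sup>2)"
        using X by (intro mult_left_mono) auto
      also have "... = X * X * norm (f y) + X * X * norm (f x) + M"
        using X by (simp add: field_simps power2_eq_square)
      also have "... <= 2 ^ (2 * k) * C + C + M" using fx fy by simp
      finally show ?thesis using X by (simp add: X_def[symmetric] mult_ac)
    qed
    thus "\<exists>C. \<forall>x. (1 + norm x) ^ k * norm (D_coord j f x) <= C" by blast
  qed
qed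

lemma SS_D_coord:
  assumes "f \<in> SS"
  shows SS_differentiable: "f differentiable at x"
    and SS_D_coord_closed: "D_coord j f \<in> SS"
    and fourier_SS_D_coord: "fourier (D_coord j f) \<xi> = of_real (\<xi> $ j) * fourier f \<xi>"
proof -
  obtain g where g: "g \<in> SS" "f = fourier g" "\<And>\<xi>. fourier f \<xi> = g (- \<xi>)" using SS_as_fourier[OF assms] by metis
  show "f differentiable at x"
    unfolding g(2) by (rule fourier_D_coord(1)[OF SS_cont SS_rapid]) (rule g)+
  let ?h = "\<lambda>x. - (of_real (x $ j) * g x)"
  have D: "D_coord j f = fourier ?h"
    unfolding g(2) fun_eq_iff using fourier_D_coord(2)[OF SS_cont[OF g(1)] SS_rapid[OF g(1)], of j] by simp
  have h: "?h \<in> SS"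
  proof (rule SS_I)
    show "rapid (fourier ?h)" unfolding D[symmetric] by (rule SS_D_coord_rapid[OF assms])
    show "rapid ?h" by (intro rapid_minus rapid_component SS_rapid g)
    show "continuous_on UNIV ?h" by (intro continuous_intros SS_cont g)
  qed
  show "D_coord j f \<in> SS" unfolding D by (rule SS_fourier[OF h])
  show "fourier (D_coord j f) \<xi> = of_real (\<xi> $ j) * fourier f \<xi>"
    unfolding D SS_inversion[OF h] g(3) by simp
qed

lemma SS_component:
  fixes f :: "'d::finite fn"
  assumes "f \<in> SS"
  shows SS_component_closed: "(\<lambda>x. of_real (x $ j) * f x) \<in> SS"
    and fourier_SS_component: "fourier (\<lambda>x. of_real (x $ j) * f x) = (\<lambda>\<xi>. - D_coord j (fourier f) \<xi>)"
proof -
  have e: "D_coord j (fourier f) \<xi> = - fourier (\<lambda>x. of_real (x $ j) * f x) \<xi>" for \<xi>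
    using fourier_D_coord(2)[OF SS_cont[OF assms] SS_rapid[OF assms], of j \<xi>]
    by (simp add: fourier_uminus)
  thus 1: "fourier (\<lambda>x. of_real (x $ j) * f x) = (\<lambda>\<xi>. - D_coord j (fourier f) \<xi>)" by auto
  show "(\<lambda>x. of_real (x $ j) * f x) \<in> SS"
    by (rule SS_I)
       (auto simp: 1 intro!: continuous_intros rapid_component rapid_minus SS_D_coord_rapid SS_fourier
         intro: SS_cont SS_rapid assms)
qed

lemma SS_parseval:
  fixes f g :: "'d::finite fn"
  assumes "f \<in> SS" "g \<in> SS"
  shows "(LBINT x. f x * cnj (g x)) = (LBINT \<xi>. fourier f \<xi> * cnj (fourier g \<xi>))"
proof -
  have c: "fourier (\<lambda>\<xi>. cnj (fourier g \<xi>)) x = cnj (g x)" for x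
  proof -
    have "fourier (\<lambda>\<xi>. cnj (fourier g \<xi>)) x = cnj (fourier (fourier g) (- x))"
    proof -
      have "(LBINT \<xi>. cnj (fourier g \<xi>) * osc \<xi> x)
          = (LBINT \<xi>. cnj (fourier g \<xi> * osc \<xi> (- x)))"
        by (rule Bochner_Integration.integral_cong) (auto simp: exp_cnj)
      also have "... = cnj (LBINT \<xi>. fourier g \<xi> * osc \<xi> (- x))"
        by (rule Bochner_Integration.integral_cnj)
      finally show ?thesis unfolding fourier_eq[of _ x] fourier_eq[of _ "- x"]
        by (simp only: complex_cnj_mult complex_cnj_complex_of_real)
    qed
    thus ?thesis by (simp add: SS_inversion assms)
  qed
  have "(LBINT x. f x * cnj (g x)) = (LBINT x. f x * fourier (\<lambda>\<xi>. cnj (fourier g \<xi>)) x)"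
    by (simp add: c)
  also have "... = (LBINT \<xi>. fourier f \<xi> * cnj (fourier g \<xi>))"
    using SS_integrable[OF SS_fourier[OF assms(2)]] by (subst fourier_exchange) (auto intro: SS_integrable assms)
  finally show ?thesis .
qed

section \<open>Stretched exponential weights\<close>

definition ew :: "real => real => real^'d::finite => real"
  where "ew q h x = exp (- (h * norm x powr (1 / q)))"

lemma ew_pos [simp]: "ew q h x > 0" "ew q h x >= 0" "ew q h x \<noteq> 0"
  by (simp_all add: ew_def)

lemma ew_le_1: "h >= 0 ==> ew q h x <= 1"
  by (simp add: ew_def)

lemma ew_mono: "h <= h' ==> ew q h' x <= ew q h x"
  by (simp add: ew_def mult_right_mono)

lemma ew_add: "ew q (h + k) x = ew q h x * ew q k x"
  by (simp add: ew_def exp_add[symmetric] distrib_right)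

lemma ew_uminus [simp]: "ew q h (- x) = ew q h x"
  by (simp add: ew_def)

lemma continuous_on_ew: "q > 0 ==> continuous_on UNIV (ew q h)"
  unfolding ew_def[abs_def]
  by (intro continuous_intros continuous_on_powr') auto

text \<open>
  The power \<open>q n\<close> of the inequality \<open>z \<le> c exp (z / c)\<close>, with \<open>z = y\<^bsup>1/q\<^esup>\<close> and \<open>c = q n / k\<close>.
\<close>

lemma power_exp_root_bound:
  fixes y q k :: real
  assumes y: "y >= 0" and q: "q > 0" and k: "k > 0"
  shows "y ^ n * exp (- (k * y powr (1 / q))) <= ((q * real n / k) powr q) ^ n"
proof (cases "n = 0 \<or> y = 0")
  case True
  thus ?thesis using k by (auto simp: power_0_left)
next
  case False
  hence n: "n > 0" and y0: "y > 0" using y by auto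
  define z where "z = y powr (1 / q)"
  have z: "z > 0" using y0 by (simp add: z_def)
  have yz: "y = z powr q" using y0 q by (simp add: z_def powr_powr)
  have u: "k * z / (q * real n) <= exp (k * z / (q * real n))"
    using exp_ge_add_one_self[of "k * z / (q * real n)"] by linarith
  hence "z <= (q * real n / k) * exp (k * z / (q * real n))"
    using k q n by (simp add: field_simps)
  hence "z powr (q * real n) <= ((q * real n / k) * exp (k * z / (q * real n))) powr (q * real n)"
    using z q by (intro powr_mono2) auto
  also have "... = (q * real n / k) powr (q * real n) * exp (k * z / (q * real n)) powr (q * real n)"
    using k q by (intro powr_mult; auto)
  also have "exp (k * z / (q * real n)) powr (q * real n) = exp (k * z)"
    using q n by (simp add: powr_def)
  also have "z powr (q * real n) = y ^ n"
    using z by (simp add: yz powr_powr[symmetric] powr_realpow)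
  also have "(q * real n / k) powr (q * real n) = ((q * real n / k) powr q) ^ n"
    using k q n by (simp add: powr_powr[symmetric] powr_realpow)
  finally have "y ^ n <= ((q * real n / k) powr q) ^ n * exp (k * z)" .
  thus ?thesis by (simp add: z_def exp_minus field_simps)
qed

lemma power_exp_root_le:
  fixes y q k R :: real
  assumes "y >= 0" "q > 0" "k > 0" "real n <= R"
  shows "y ^ n * exp (- (k * y powr (1 / q))) <= ((q / k) powr q * R powr q) ^ n"
proof (rule order_trans[OF power_exp_root_bound[OF assms(1-3)]], rule power_mono)
  have "(q * real n / k) powr q <= (q * R / k) powr q"
    using assms by (intro powr_mono2) (auto simp: divide_right_mono)
  also have "q * R / k = (q / k) * R" by simp
  also have "((q / k) * R) powr q = (q / k) powr q * R powr q"
    using assms by (intro powr_mult; auto)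
  finally show "(q * real n / k) powr q <= (q / k) powr q * R powr q" .
qed simp

lemma power_ew_le:
  assumes "q > 0" "k > 0" "real n <= R"
  shows "norm x ^ n * ew q k x <= ((q / k) powr q * R powr q) ^ n"
  unfolding ew_def using power_exp_root_le[of "norm x", OF _ assms] by simp

lemma rapid_ew:
  assumes q: "q > 0" and h: "h > 0"
  shows "rapid (\<lambda>x. of_real (ew q h x))"
  unfolding rapid_def
proof
  fix k
  let ?C = "2 ^ k * (1 + ((q / h) powr q * real k powr q) ^ k)"
  have "(1 + norm x) ^ k * norm (complex_of_real (ew q h x)) <= ?C" for x
  proof -
    have "(1 + norm x) ^ k <= (2 * max 1 (norm x)) ^ k"
      by (intro power_mono) auto
    also have "... <= 2 ^ k * (1 + norm x ^ k)"
      by (auto simp: power_mult_distrib max_def)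
    finally have "(1 + norm x) ^ k * ew q h x <= 2 ^ k * (1 + norm x ^ k) * ew q h x"
      by (intro mult_right_mono) auto
    also have "... = 2 ^ k * (ew q h x + norm x ^ k * ew q h x)" by (simp add: algebra_simps)
    also have "... <= ?C"
      by (intro mult_left_mono add_mono power_ew_le q h ew_le_1) (use h in auto)
    finally show ?thesis by (simp add: norm_mult)
  qed
  thus "\<exists>C. \<forall>x. (1 + norm x) ^ k * norm (complex_of_real (ew q h x)) <= C" by blast
qed

lemma integrable_ew:
  assumes q: "q > 0" and h: "h > 0"
  shows "integrable lborel (ew q h)"
proof -
  have "integrable lborel (\<lambda>x. complex_of_real (ew q h x))"
    by (intro rapid_integrable rapid_ew continuous_intros continuous_on_ew q h)
  from integrable_norm[OF this] show ?thesis by (simp add: norm_mult)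
qed

lemma ew_quasi_triangle:
  fixes x y :: "'a::real_normed_vector"
  assumes q: "q > 0"
  shows "norm (x + y) powr (1 / q) <= 2 powr (1 / q) * (norm x powr (1 / q) + norm y powr (1 / q))"
proof -
  have "norm (x + y) <= 2 * max (norm x) (norm y)"
    using norm_triangle_ineq[of x y] by linarith
  hence "norm (x + y) powr (1 / q) <= (2 * max (norm x) (norm y)) powr (1 / q)"
    using q by (intro powr_mono2) auto
  also have "... = 2 powr (1 / q) * max (norm x) (norm y) powr (1 / q)"
    by (intro powr_mult; auto)
  also have "... <= 2 powr (1 / q) * (norm x powr (1 / q) + norm y powr (1 / q))"
    by (intro mult_left_mono) (auto simp: max_def)
  finally show ?thesis .
qed

text \<open>
  The moment of order \<open>N\<close> gives the factor \<open>exp (- N)\<close> as long as \<open>N \<le> (y / (e h))\<^bsup>1/q\<^esup>\<close>. The largest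
  such integer is taken; rounding costs the factor \<open>exp 1\<close>.
\<close>

lemma decay_from_moments:
  fixes y v A h q :: real
  assumes y: "y >= 0" and h: "h > 0" and q: "q > 0" and A: "A >= 0"
    and m: "\<And>N. y ^ N * v <= A * (h ^ N * fact N powr q)"
  shows "v <= exp 1 * A * exp (- ((y / (exp 1 * h)) powr (1 / q)))"
proof -
  define z where "z = (y / (exp 1 * h)) powr (1 / q)"
  define N where "N = nat \<lfloor>z\<rfloor>"
  have z: "z >= 0" by (simp add: z_def)
  have N: "real N <= z" "z <= real N + 1" using z unfolding N_def by linarith+
  show ?thesis
  proof (cases "N = 0")
    case True
    have "v <= A * 1" using m[of 0] by simp
    also have "... <= A * (exp 1 * exp (- z))"
      using N True A by (intro mult_left_mono) (auto simp: exp_add[symmetric])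
    finally show ?thesis by (simp add: z_def mult_ac)
  next
    case False
    hence N1: "real N >= 1" by linarith
    have zp: "z > 0" using N N1 by linarith
    hence yp: "y > 0" using y z_def by (cases "y = 0") auto
    have "real N powr q <= z powr q" using N q by (intro powr_mono2) auto
    also have "... = y / (exp 1 * h)" unfolding z_def using q yp h by (simp add: powr_powr)
    finally have 1: "exp 1 * (h * real N powr q) <= y" using h by (simp add: field_simps)
    have "fact N <= real N ^ N" using fact_le_power[of N, where 'a=real] by simp
    hence "fact N powr q <= (real N ^ N) powr q"
      using q by (intro powr_mono2) auto
    also have "... = (real N powr q) ^ N"
      using N1 by (simp add: powr_realpow[symmetric] powr_powr mult.commute)
    finally have 2: "y ^ N * v <= A * (h * real N powr q) ^ N"
      using m[of N] A h by (smt (verit) mult_left_mono power_mult_distrib zero_le_power)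
    let ?w = "h * real N powr q"
    have w: "?w > 0" using h N1 by simp
    have "v * ?w ^ N * exp 1 ^ N <= A * ?w ^ N"
    proof (cases "v >= 0")
      case True
      have "(exp 1 * ?w) ^ N * v <= y ^ N * v"
        using 1 w True by (intro mult_right_mono power_mono) auto
      thus ?thesis using 2 by (simp add: power_mult_distrib mult_ac)
    next
      case False
      hence "v * ?w ^ N * exp 1 ^ N <= 0" using w by (simp add: mult_nonpos_nonneg)
      also have "... <= A * ?w ^ N" using A w by simp
      finally show ?thesis .
    qed
    hence "?w ^ N * (v * exp 1 ^ N) <= ?w ^ N * A" by (simp add: mult_ac)
    hence "v * exp 1 ^ N <= A" using w by (simp add: mult_le_cancel_left_pos)
    hence "v * exp (real N) <= A" by (simp add: exp_of_nat_mult[symmetric])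
    hence "v <= A * exp (- real N)" by (simp add: exp_minus field_simps)
    also have "... <= A * (exp 1 * exp (- z))"
      using N A by (intro mult_left_mono) (auto simp: exp_add[symmetric])
    finally show ?thesis by (simp add: z_def mult_ac)
  qed
qed

text \<open>
  The same rate \<open>H\<close> and the same constant on both sides: \<open>P\<close> then behaves like a norm, and the family over
  all \<open>H\<close> is equivalent to the norms of \<open>gs r s\<close> (\<open>gs_norm_le_bnd\<close>, \<open>gs_imp_bnd\<close>).
\<close>

definition bnd :: "real => real => real => real => 'd::finite fn => bool"
  where "bnd r s H P f \<longleftrightarrow>
    (\<forall>x. norm (f x) <= P * ew r H x) \<and> (\<forall>\<xi>. norm (fourier f \<xi>) <= P * ew s H \<xi>)"

lemma bnd_nonneg:
  fixes f :: "'d::finite fn"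
  shows "bnd r s H P f ==> P >= 0"
proof -
  assume "bnd r s H P f"
  hence "norm (f 0) <= P * ew r H (0 :: real^'d)" by (simp add: bnd_def)
  hence "0 <= P * ew r H (0 :: real^'d)" using norm_ge_zero order_trans by blast
  thus ?thesis using ew_pos(1)[of r H "0 :: real^'d"] by (simp add: zero_le_mult_iff)
qed

lemma bnd_weaken: assumes "bnd r s H P f" "H' <= H" "P <= P'" shows "bnd r s H' P' f"
proof -
  have P: "P >= 0" "P' >= 0" using bnd_nonneg[OF assms(1)] assms(3) by auto
  have "P * ew r H x <= P' * ew r H' x" "P * ew s H x <= P' * ew s H' x" for x :: "real^'d"
    using P assms(2,3) by (auto intro!: mult_mono ew_mono)
  thus ?thesis using assms(1) unfolding bnd_def by (meson order_trans)
qed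

section \<open>Words in position and momentum operators\<close>

text \<open>
  Letters \<open>Inl j\<close> stand for multiplication by \<open>x\<^sub>j\<close>, letters \<open>Inr j\<close> for \<open>D\<^sub>j\<close>. Words are not brought into
  normal order, since the powers of \<open>x\<^sub>j + t (d\<^sub>j q)(D)\<close> that have to be estimated mix the letters.
\<close>

fun lop :: "'d::finite + 'd => 'd fn => 'd fn" where
  "lop (Inl j) f = (\<lambda>x. of_real (x $ j) * f x)"
| "lop (Inr j) f = D_coord j f"

abbreviation wop :: "('d::finite + 'd) list => 'd fn => 'd fn"
  where "wop w f \<equiv> foldr lop w f"

definition nX :: "('d + 'd) list => nat" where "nX w = length (filter isl w)"
definition nD :: "('d + 'd) list => nat" where "nD w = length (filter (\<lambda>l. \<not> isl l) w)"

lemma nX_simps [simp]: "nX [] = 0" "nX (Inl j # w) = Suc (nX w)" "nX (Inr j # w) = nX w" "nX (v @ w) = nX v + nX w" "nX (rev w) = nX w"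
  by (auto simp: nX_def rev_filter[symmetric])
lemma nD_simps [simp]: "nD [] = 0" "nD (Inl j # w) = nD w" "nD (Inr j # w) = Suc (nD w)" "nD (v @ w) = nD v + nD w" "nD (rev w) = nD w"
  by (auto simp: nD_def rev_filter[symmetric])
lemma nX_map [simp]: "nX (map Inl l) = length l" "nX (map Inr l) = 0" "nX (replicate n (Inr j)) = 0" "nX (replicate n (Inl j)) = n"
  by (auto simp: nX_def o_def filter_map)
lemma nD_map [simp]: "nD (map Inl l) = 0" "nD (map Inr l) = length l" "nD (replicate n (Inr j)) = n" "nD (replicate n (Inl j)) = 0"
  by (auto simp: nD_def o_def filter_map)
lemma lop_SS: "f \<in> SS ==> lop l f \<in> SS"
  by (cases l) (auto intro: SS_component_closed SS_D_coord_closed)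

lemma wop_SS: "f \<in> SS ==> wop w f \<in> SS"
  by (induction w) (auto intro: lop_SS)

lemma partial_deriv_add:
  "f differentiable at x ==> g differentiable at x ==>
    partial_deriv j (\<lambda>x. f x + g x) x = partial_deriv j f x + partial_deriv j g x"
  by (subst partial_derivI[OF has_derivative_add[OF frechet_derivative_works[THEN iffD1] frechet_derivative_works[THEN iffD1]]]) (auto simp: partial_deriv_def)

lemma partial_deriv_cmult:
  fixes f :: "'d::finite fn"
  assumes "f differentiable at x" shows "partial_deriv j (\<lambda>x. c * f x) x = c * partial_deriv j f x"
proof -
  have "((\<lambda>x. c * f x) has_derivative (\<lambda>h. c * frechet_derivative f (at x) h)) (at x)"
    using assms by (auto intro!: derivative_eq_intros simp: frechet_derivative_works)
  from partial_derivI[OF this, of j] show ?thesis by (simp add: partial_deriv_def)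
qed

lemma D_coord_add:
  "f differentiable at x ==> g differentiable at x ==>
    D_coord j (\<lambda>x. f x + g x) x = D_coord j f x + D_coord j g x"
  unfolding D_coord_def by (simp add: partial_deriv_add algebra_simps)

lemma D_coord_cmult:
  "f differentiable at x ==> D_coord j (\<lambda>x. c * f x) x = c * D_coord j f x"
  unfolding D_coord_def by (simp add: partial_deriv_cmult algebra_simps)

lemma lop_linear:
  assumes "f \<in> SS" "g \<in> SS"
  shows "lop l (\<lambda>x. a * f x + b * g x) = (\<lambda>x. a * lop l f x + b * lop l g x)"
proof (cases l)
  case (Inl j) thus ?thesis by (auto simp: algebra_simps)
next
  case (Inr j)
  have "D_coord j (\<lambda>x. a * f x + b * g x) x = a * D_coord j f x + b * D_coord j g x" for x
    using assms by (simp add: D_coord_add D_coord_cmult SS_differentiable SS_cmult)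
  thus ?thesis using Inr by auto
qed

lemma wop_linear:
  assumes "f \<in> SS" "g \<in> SS"
  shows "wop w (\<lambda>x. a * f x + b * g x) = (\<lambda>x. a * wop w f x + b * wop w g x)"
  by (induction w) (auto simp: lop_linear wop_SS assms)

text \<open>
  Letters are symmetric for this pairing (\<open>ip_lop\<close>), so a word passes to the other side reversed.
\<close>

definition ip :: "'d::finite fn => 'd fn => complex"
  where "ip f g = (LBINT x. f x * cnj (g x))"

lemma ip_lop:
  assumes "f \<in> SS" "g \<in> SS" shows "ip (lop l f) g = ip f (lop l g)"
proof (cases l)
  case (Inl j)
  thus ?thesis by (simp add: ip_def mult_ac)
next
  case (Inr j)
  show ?thesis
    unfolding Inr ip_def lop.simps
      SS_parseval[OF SS_D_coord_closed[OF assms(1)] assms(2)] SS_parseval[OF assms(1) SS_D_coord_closed[OF assms(2)]]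
      fourier_SS_D_coord[OF assms(1)] fourier_SS_D_coord[OF assms(2)]
    by (simp add: mult_ac)
qed

lemma ip_wop:
  assumes "f \<in> SS" "g \<in> SS" shows "ip (wop w f) g = ip f (wop (rev w) g)"
  using assms by (induction w arbitrary: f g) (auto simp: ip_lop wop_SS lop_SS)

lemma SS_ip_integrable:
  assumes "f \<in> SS" "g \<in> SS" shows "integrable lborel (\<lambda>x. f x * cnj (g x))"
proof (rule rapid_integrable)
  show "continuous_on UNIV (\<lambda>x. f x * cnj (g x))" by (intro continuous_intros SS_cont assms)
  obtain B where B: "\<And>x. norm (g x) <= B" using rapid_bounded[OF SS_rapid[OF assms(2)]] by metis
  have "rapid (\<lambda>x. cnj (g x) * f x)"
    by (rule rapid_mult_poly[OF SS_rapid[OF assms(1)], where C=B and n=0]) (use B in simp)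
  thus "rapid (\<lambda>x. f x * cnj (g x))" by (simp add: mult.commute)
qed

lemma ip_linear:
  assumes "f \<in> SS" "g \<in> SS" "h \<in> SS"
  shows "ip (\<lambda>x. a * f x + b * g x) h = a * ip f h + b * ip g h"
  unfolding ip_def distrib_right mult.assoc
  by (subst Bochner_Integration.integral_add) (auto intro!: integrable_mult_right SS_ip_integrable assms)

lemma D_coord_component_mult:
  fixes w :: "'d::finite fn"
  assumes "w differentiable at x"
  shows "D_coord j (\<lambda>x. of_real (x $ k) * w x) x = of_real (x $ k) * D_coord j w x - (if j = k then \<i> * w x else 0)"
proof -
  have d1: "((\<lambda>x. complex_of_real (x $ k)) has_derivative (\<lambda>h. of_real (h $ k))) (at x)"
    by (intro has_derivative_of_real bounded_linear_imp_has_derivative bounded_linear_vec_nth)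
  have "((\<lambda>x. of_real (x $ k) * w x) has_derivative (\<lambda>h. of_real (x $ k) * frechet_derivative w (at x) h + of_real (h $ k) * w x)) (at x)"
    by (rule has_derivative_mult[OF d1]) (use assms in \<open>simp add: frechet_derivative_works\<close>)
  from partial_derivI[OF this, of j]
  have "partial_deriv j (\<lambda>x. of_real (x $ k) * w x) x = of_real (x $ k) * partial_deriv j w x + of_real (axis j 1 $ k) * w x"
    by (simp add: partial_deriv_def)
  thus ?thesis by (auto simp: D_coord_def axis_def algebra_simps)
qed

lemma D_coord_monomial:
  assumes f: "f \<in> SS"
  shows "D_coord j (wop (map Inl \<gamma>) f) x =
    wop (map Inl \<gamma>) (D_coord j f) x - \<i> * of_nat (count_list \<gamma> j) * wop (map Inl (remove1 j \<gamma>)) f x"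
proof (induction \<gamma> arbitrary: x)
  case Nil thus ?case by simp
next
  case (Cons k \<gamma>)
  have 1: "D_coord j (wop (map Inl (k # \<gamma>)) f) x
     = of_real (x $ k) * D_coord j (wop (map Inl \<gamma>) f) x - (if j = k then \<i> * wop (map Inl \<gamma>) f x else 0)"
    using D_coord_component_mult[OF SS_differentiable[OF wop_SS[OF f]]] by simp
  have 2: "count_list \<gamma> j > 0 ==> of_real (x $ j) * wop (map Inl (remove1 j \<gamma>)) f x = wop (map Inl \<gamma>) f x" for \<gamma>
    by (induction \<gamma>) (auto split: if_splits simp: mult.left_commute)
  show ?case
  proof (cases "j = k")
    case True
    have "\<i> * of_nat (count_list \<gamma> j) * (of_real (x $ j) * wop (map Inl (remove1 j \<gamma>)) f x)
       = \<i> * of_nat (count_list \<gamma> j) * wop (map Inl \<gamma>) f x"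
      using 2[of \<gamma>] by (cases "count_list \<gamma> j = 0") auto
    thus ?thesis unfolding 1 Cons.IH using True by (auto simp: algebra_simps)
  next
    case False
    thus ?thesis unfolding 1 Cons.IH by (simp add: algebra_simps)
  qed
qed

lemma wop_map_Inl: "wop (map Inl \<gamma>) f x = of_real (prod_list (map (\<lambda>i. x $ i) \<gamma>)) * f x"
  by (induction \<gamma>) auto

lemma fourier_wop_Inr:
  assumes "f \<in> SS"
  shows "fourier (wop (map Inr \<epsilon>) f) \<xi> = of_real (prod_list (map (\<lambda>i. \<xi> $ i) \<epsilon>)) * fourier f \<xi>"
  by (induction \<epsilon>) (auto simp: fourier_SS_D_coord wop_SS assms)

lemma abs_prod_list_component_le: "\<bar>prod_list (map (\<lambda>i. (x::real^'d::finite) $ i) \<gamma>)\<bar> <= norm x ^ length \<gamma>"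
  by (induction \<gamma>) (auto simp: abs_mult intro!: mult_mono component_le_norm_cart)

text \<open>
  The letters of \<open>W\<close> are absorbed one by one: a position joins the monomial \<open>\<gamma>\<close>, a momentum passes to the
  right-hand factor. The latter leaves a commutator with at most \<open>N \<le> a b / 2\<close> terms, each lacking one
  position and one momentum. One half of \<open>b\<close> pays for the momentum that passed, the other half for the
  commutator; this is why the hypothesis has \<open>b / 2\<close> and the conclusion \<open>b\<close>.
\<close>

lemma word_pairing:
  assumes f: "f \<in> SS" and a: "a > 0" and b: "b > 0" and Q: "Q >= 0" and N: "real N <= a * b / 2"
    and base: "\<And>\<gamma> \<epsilon>. length \<gamma> <= N ==> length \<epsilon> <= N ==>
      norm (ip (wop (map Inl \<gamma>) f) (wop (map Inr \<epsilon>) f)) <= Q * a ^ length \<gamma> * (b / 2) ^ length \<epsilon>"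
  shows "length \<gamma> + length W <= N ==> length \<epsilon> + length W <= N ==>
    norm (ip (wop (map Inl \<gamma> @ W) f) (wop (map Inr \<epsilon>) f)) <= Q * a ^ (length \<gamma> + nX W) * b ^ nD W * (b / 2) ^ length \<epsilon>"
proof (induction W arbitrary: \<gamma> \<epsilon>)
  case Nil
  thus ?case using base by simp
next
  case (Cons l W)
  let ?w = "wop W f" and ?v = "wop (map Inr \<epsilon>) f"
  have w: "?w \<in> SS" and v: "?v \<in> SS" by (intro wop_SS f)+
  show ?case
  proof (cases l)
    case (Inl j)
    have "wop (map Inl \<gamma> @ l # W) f = wop (map Inl (\<gamma> @ [j]) @ W) f" by (simp add: Inl)
    thus ?thesis using Cons.IH[of "\<gamma> @ [j]" \<epsilon>] Cons.prems by (simp add: Inl)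
  next
    case (Inr j)
    let ?g = "length \<gamma>" and ?e = "length \<epsilon>"
    let ?c = "real (count_list \<gamma> j)"
    have e1: "wop (map Inl \<gamma> @ l # W) f = (\<lambda>x. 1 * D_coord j (wop (map Inl \<gamma>) ?w) x + (\<i> * ?c) * wop (map Inl (remove1 j \<gamma>)) ?w x)"
      using D_coord_monomial[OF w, of j \<gamma>] by (auto simp: Inr)
    have "ip (wop (map Inl \<gamma> @ l # W) f) ?v = 1 * ip (D_coord j (wop (map Inl \<gamma>) ?w)) ?v
        + (\<i> * ?c) * ip (wop (map Inl (remove1 j \<gamma>)) ?w) ?v"
      unfolding e1 by (intro ip_linear SS_D_coord_closed wop_SS w f)
    also have "ip (D_coord j (wop (map Inl \<gamma>) ?w)) ?v = ip (wop (map Inl \<gamma> @ W) f) (wop (map Inr (j # \<epsilon>)) f)"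
      using ip_lop[of "wop (map Inl \<gamma>) ?w" ?v "Inr j"] by (simp add: wop_SS w v f)
    finally have e2: "ip (wop (map Inl \<gamma> @ l # W) f) ?v = ip (wop (map Inl \<gamma> @ W) f) (wop (map Inr (j # \<epsilon>)) f)
        + (\<i> * ?c) * ip (wop (map Inl (remove1 j \<gamma>) @ W) f) ?v" by simp
    have b1: "norm (ip (wop (map Inl \<gamma> @ W) f) (wop (map Inr (j # \<epsilon>)) f)) <= Q * a ^ (?g + nX W) * b ^ nD W * (b / 2) ^ Suc ?e"
      using Cons.IH[of \<gamma> "j # \<epsilon>"] Cons.prems by simp
    have b2: "norm ((\<i> * ?c) * ip (wop (map Inl (remove1 j \<gamma>) @ W) f) ?v) <= Q * a ^ (?g + nX W) * b ^ nD W * (b / 2) ^ ?e * (b / 2)"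
    proof (cases "j \<in> set \<gamma>")
      case False
      hence "?c = 0" by simp
      thus ?thesis using Q a b by simp
    next
      case True
      hence g: "?g > 0" by (cases \<gamma>) auto
      have le: "length (remove1 j \<gamma>) = ?g - 1" using True by (simp add: length_remove1)
      have "?c <= ?g" by (simp add: count_le_length)
      also have "... <= N" using Cons.prems by simp
      also have "... <= a * (b / 2)" using N by simp
      finally have c: "?c <= a * (b / 2)" .
      have "norm ((\<i> * ?c) * ip (wop (map Inl (remove1 j \<gamma>) @ W) f) ?v)
          = ?c * norm (ip (wop (map Inl (remove1 j \<gamma>) @ W) f) ?v)"
        by (simp add: norm_mult)
      also have "... <= (a * (b / 2)) * (Q * a ^ (?g - 1 + nX W) * b ^ nD W * (b / 2) ^ ?e)"
        using Cons.IH[of "remove1 j \<gamma>" \<epsilon>] Cons.prems c le a b by (intro mult_mono) auto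
      also have "... = Q * (a * a ^ (?g - 1 + nX W)) * b ^ nD W * (b / 2) ^ ?e * (b / 2)" by simp
      also have "a * a ^ (?g - 1 + nX W) = a ^ (?g + nX W)"
        using g by (cases \<gamma>) auto
      finally show ?thesis .
    qed
    have "norm (ip (wop (map Inl \<gamma> @ l # W) f) ?v) <=
       Q * a ^ (?g + nX W) * b ^ nD W * (b / 2) ^ Suc ?e + Q * a ^ (?g + nX W) * b ^ nD W * (b / 2) ^ ?e * (b / 2)"
      unfolding e2 using norm_triangle_ineq b1 b2 by (meson add_mono order_trans)
    also have "... = Q * a ^ (?g + nX W) * b ^ Suc (nD W) * (b / 2) ^ ?e" by (simp add: field_simps)
    finally show ?thesis by (simp add: Inr)
  qed
qed

lemma one_plus_norm_power_le:
  "(1 + norm (x::real^'d::finite)) ^ k <= (2 * real CARD('d)) ^ k * (1 + (\<Sum>j\<in>UNIV. \<bar>x $ j\<bar> ^ k))"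
proof -
  define m where "m = Max (range (\<lambda>j. \<bar>x $ j\<bar>))"
  have m: "\<bar>x $ j\<bar> <= m" for j unfolding m_def by (intro Max_ge) auto
  have "m \<in> range (\<lambda>j. \<bar>x $ j\<bar>)" unfolding m_def by (intro Max_in) auto
  then obtain j0 where j0: "m = \<bar>x $ j0\<bar>" by auto
  have m0: "m >= 0" using j0 by simp
  have d: "real CARD('d) >= 1" by (simp add: Suc_leI)
  have "norm x <= (\<Sum>j\<in>UNIV. \<bar>x $ j\<bar>)" by (rule norm_le_l1_cart)
  also have "... <= (\<Sum>j\<in>(UNIV::'d set). m)" by (intro sum_mono m)
  finally have "norm x <= real CARD('d) * m" by simp
  also have "... <= real CARD('d) * max 1 m" by (intro mult_left_mono) auto
  finally have n: "norm x <= real CARD('d) * max 1 m" .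
  have "1 * 1 <= real CARD('d) * max 1 m" using d by (intro mult_mono) auto
  hence "1 + norm x <= 2 * (real CARD('d) * max 1 m)" using n by linarith
  hence "1 + norm x <= 2 * real CARD('d) * max 1 m" by (simp only: mult.assoc)
  hence "(1 + norm x) ^ k <= (2 * real CARD('d) * max 1 m) ^ k"
    by (intro power_mono) auto
  also have "... = (2 * real CARD('d)) ^ k * (max 1 m) ^ k" by (simp add: power_mult_distrib)
  also have "... <= (2 * real CARD('d)) ^ k * (1 + (\<Sum>j\<in>UNIV. \<bar>x $ j\<bar> ^ k))"
  proof (intro mult_left_mono)
    have "(max 1 m) ^ k <= 1 + m ^ k" using m0 by (auto simp: max_def)
    also have "m ^ k <= (\<Sum>j\<in>UNIV. \<bar>x $ j\<bar> ^ k)" unfolding j0 by (intro member_le_sum) auto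
    finally show "(max 1 m) ^ k <= 1 + (\<Sum>j\<in>UNIV. \<bar>x $ j\<bar> ^ k)" by simp
  qed simp
  finally show ?thesis .
qed

lemma ip_self: "ip f f = of_real (LBINT x. (norm (f x))\<^sup>2)"
  unfolding ip_def by (simp add: complex_norm_square[symmetric] del: of_real_power) 

lemma SS_square_integrable: "f \<in> SS ==> integrable lborel (\<lambda>x. (norm (f x))\<^sup>2)"
  using integrable_norm[OF SS_ip_integrable[of f f]] by (simp add: norm_mult power2_eq_square)

definition sob_const :: "'d::finite itself => real" where
  "sob_const _ = (2 * real CARD('d)) ^ (2 * CARD('d)) * (LBINT x. inverse (wt (x::real^'d)))"

text \<open>
  A Sobolev inequality: the weight \<open>1 + \<Sum>\<^sub>j \<bar>\<xi>\<^sub>j\<bar>\<^bsup>2d\<^esup>\<close>, whose inverse is integrable, splits the \<open>L\<^sup>1\<close> norm, and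
  Plancherel's formula returns to \<open>g\<close> and its derivatives of order \<open>d\<close>.
\<close>

lemma fourier_L1_le_L2:
  fixes g :: "'d::finite fn"
  assumes g: "g \<in> SS" and M: "M > 0"
    and L2: "(LBINT x. (norm (g x))\<^sup>2) <= M\<^sup>2"
    and L2D: "\<And>j. (LBINT x. (norm (wop (replicate CARD('d) (Inr j)) g x))\<^sup>2) <= M\<^sup>2 * K"
  shows "(LBINT \<xi>. norm (fourier g \<xi>)) <= M * (sob_const TYPE('d) + 1 + real CARD('d) * K)"
proof -
  let ?n = "CARD('d)"
  define \<rho> where "\<rho> \<xi> = 1 + (\<Sum>j\<in>UNIV. \<bar>\<xi> $ j\<bar> ^ (2 * ?n))" for \<xi> :: "real^'d"
  have \<rho>1: "\<rho> \<xi> >= 1" for \<xi> unfolding \<rho>_def by (simp add: sum_nonneg)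
  define w where "w \<xi> = (2 * real ?n) ^ (2 * ?n) * inverse ((1 + norm \<xi>) ^ (2 * ?n))" for \<xi> :: "real^'d"
  have w: "inverse (\<rho> \<xi>) <= w \<xi>" for \<xi>
  proof -
    have "(1 + norm \<xi>) ^ (2 * ?n) <= (2 * real ?n) ^ (2 * ?n) * \<rho> \<xi>"
      unfolding \<rho>_def by (rule one_plus_norm_power_le)
    thus ?thesis unfolding w_def using \<rho>1[of \<xi>] by (simp add: field_simps)
  qed
  have gh: "fourier g \<in> SS" by (rule SS_fourier[OF g])
  let ?r = "\<lambda>j. wop (replicate ?n (Inr j)) g"
  have rS: "?r j \<in> SS" for j by (rule wop_SS[OF g])
  have fr: "fourier (?r j) \<xi> = of_real (\<xi> $ j) ^ ?n * fourier g \<xi>" for j \<xi>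
    using fourier_wop_Inr[OF g, of "replicate ?n j" \<xi>] by (simp add: prod_list_replicate)
  have planch: "(LBINT \<xi>. (norm (fourier u \<xi>))\<^sup>2) = (LBINT x. (norm (u x))\<^sup>2)" if "u \<in> SS" for u :: "'d fn"
  proof -
    have "ip u u = ip (fourier u) (fourier u)" unfolding ip_def by (rule SS_parseval) (rule that)+
    thus ?thesis unfolding ip_self by simp
  qed
  have sq: "\<rho> \<xi> * (norm (fourier g \<xi>))\<^sup>2 = (norm (fourier g \<xi>))\<^sup>2 + (\<Sum>j\<in>UNIV. (norm (fourier (?r j) \<xi>))\<^sup>2)" for \<xi>
    unfolding \<rho>_def fr
    by (simp add: norm_mult norm_power power_mult_distrib power_mult[symmetric] mult.commute)
       (simp add: distrib_left sum_distrib_left)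
  have I: "integrable lborel (\<lambda>\<xi>. \<rho> \<xi> * (norm (fourier g \<xi>))\<^sup>2)"
    unfolding sq by (intro Bochner_Integration.integrable_add Bochner_Integration.integrable_sum SS_square_integrable gh SS_fourier rS)
  have "(LBINT \<xi>. \<rho> \<xi> * (norm (fourier g \<xi>))\<^sup>2)
      = (LBINT \<xi>. (norm (fourier g \<xi>))\<^sup>2) + (\<Sum>j\<in>UNIV. (LBINT \<xi>. (norm (fourier (?r j) \<xi>))\<^sup>2))"
    unfolding sq by (subst Bochner_Integration.integral_add, intro SS_square_integrable gh,
       intro Bochner_Integration.integrable_sum SS_square_integrable SS_fourier rS,
       subst Bochner_Integration.integral_sum, intro SS_square_integrable SS_fourier rS, rule refl)
  also have "... <= M\<^sup>2 + (\<Sum>j\<in>(UNIV::'d set). M\<^sup>2 * K)"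
    unfolding planch[OF g] planch[OF rS] by (intro add_mono sum_mono L2 L2D)
  finally have B: "(LBINT \<xi>. \<rho> \<xi> * (norm (fourier g \<xi>))\<^sup>2) <= M\<^sup>2 * (1 + real ?n * K)"
    by (simp add: algebra_simps)
  have Iw: "integrable lborel w" unfolding w_def[abs_def] by (intro integrable_mult_right integrable_weight)
  have "(LBINT \<xi>. norm (fourier g \<xi>)) <= (LBINT \<xi>. M * w \<xi> + (1 / M) * (\<rho> \<xi> * (norm (fourier g \<xi>))\<^sup>2))"
  proof (rule integral_mono)
    show "integrable lborel (\<lambda>\<xi>. norm (fourier g \<xi>))" by (intro integrable_norm SS_integrable gh)
    show "integrable lborel (\<lambda>\<xi>. M * w \<xi> + (1 / M) * (\<rho> \<xi> * (norm (fourier g \<xi>))\<^sup>2))"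
      by (intro Bochner_Integration.integrable_add integrable_mult_right Iw I)
    fix \<xi> :: "real^'d"
    let ?y = "norm (fourier g \<xi>)"
    define A where "A = M * inverse (\<rho> \<xi>)"
    have A: "A > 0" unfolding A_def using \<rho>1[of \<xi>] M by simp
    have "0 <= (A - ?y)\<^sup>2 + A\<^sup>2 + ?y\<^sup>2" by simp
    hence "?y * A <= A\<^sup>2 + ?y\<^sup>2" by (simp add: power2_diff mult_ac)
    hence "?y <= (A\<^sup>2 + ?y\<^sup>2) / A" using A by (simp add: pos_le_divide_eq)
    also have "... = A + ?y\<^sup>2 / A" using A by (simp add: add_divide_distrib power2_eq_square)
    also have "?y\<^sup>2 / A = (1 / M) * (\<rho> \<xi> * ?y\<^sup>2)" by (simp add: A_def divide_simps)
    finally have "?y <= M * inverse (\<rho> \<xi>) + (1 / M) * (\<rho> \<xi> * ?y\<^sup>2)" by (simp only: A_def)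
    also have "... <= M * w \<xi> + (1 / M) * (\<rho> \<xi> * ?y\<^sup>2)"
      using M by (intro add_right_mono mult_left_mono w) auto
    finally show "?y <= M * w \<xi> + (1 / M) * (\<rho> \<xi> * ?y\<^sup>2)" .
  qed
  also have "... = M * (LBINT \<xi>. w \<xi>) + (1 / M) * (LBINT \<xi>. \<rho> \<xi> * (norm (fourier g \<xi>))\<^sup>2)"
    by (subst Bochner_Integration.integral_add) (auto intro!: integrable_mult_right Iw I)
  also have "... <= M * (LBINT \<xi>. w \<xi>) + (1 / M) * (M\<^sup>2 * (1 + real ?n * K))"
    using M B by (intro add_left_mono mult_left_mono) auto
  also have "... = M * (sob_const TYPE('d) + 1 + real ?n * K)"
    using M by (simp add: sob_const_def w_def power2_eq_square algebra_simps)
  finally show ?thesis .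
qed

text \<open>
  The \<open>L\<^sup>2\<close> norm of a word applied to \<open>f\<close> is a pairing of \<open>f\<close> with a word of twice the length; together with
  the \<open>d\<close> derivatives of the Sobolev inequality this accounts for \<open>2 * (length V + CARD('d)) \<le> N\<close>.
\<close>

lemma word_L1:
  fixes f :: "'d::finite fn"
  assumes f: "f \<in> SS" and a: "a > 0" and b: "b > 0" and q: "q > 0" and N: "real N <= a * b / 2"
    and base: "\<And>\<gamma> \<epsilon>. length \<gamma> <= N ==> length \<epsilon> <= N ==>
      norm (ip (wop (map Inl \<gamma>) f) (wop (map Inr \<epsilon>) f)) <= q\<^sup>2 * a ^ length \<gamma> * (b / 2) ^ length \<epsilon>"
    and V: "2 * (length V + CARD('d)) <= N"
  shows "(LBINT \<xi>. norm (fourier (wop V f) \<xi>)) <=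
     (q * a ^ nX V * b ^ nD V) * (sob_const TYPE('d) + 1 + real CARD('d) * (b ^ CARD('d))\<^sup>2)"
proof -
  have L2: "(LBINT x. (norm (wop U f x))\<^sup>2) <= (q * a ^ nX U * b ^ nD U)\<^sup>2" if "2 * length U <= N" for U
  proof -
    have "ip (wop U f) (wop U f) = ip (wop (rev U @ U) f) f"
      using ip_wop[OF wop_SS[OF f] f, of "rev U" U] by simp
    hence "(LBINT x. (norm (wop U f x))\<^sup>2) = norm (ip (wop (map Inl [] @ (rev U @ U)) f) (wop (map Inr []) f))"
    proof -
      assume "ip (wop U f) (wop U f) = ip (wop (rev U @ U) f) f"
      moreover have "(LBINT x. (norm (wop U f x))\<^sup>2) = norm (ip (wop U f) (wop U f))"
        unfolding ip_self by (simp add: integral_nonneg)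
      ultimately show ?thesis by simp
    qed
    also have "... <= q\<^sup>2 * a ^ (length ([]::'d list) + nX (rev U @ U)) * b ^ nD (rev U @ U) * (b / 2) ^ length ([]::'d list)"
      by (rule word_pairing[OF f a b _ N base]) (use that in auto)
    also have "... = (q * a ^ nX U * b ^ nD U)\<^sup>2" by (simp add: power2_eq_square power_add mult_ac)
    finally show ?thesis .
  qed
  show ?thesis
  proof (rule fourier_L1_le_L2[OF wop_SS[OF f]])
    show "0 < q * a ^ nX V * b ^ nD V" using a b q by simp
    show "(LBINT x. (norm (wop V f x))\<^sup>2) <= (q * a ^ nX V * b ^ nD V)\<^sup>2" using V by (intro L2) simp
    fix j
    have "(LBINT x. (norm (wop (replicate CARD('d) (Inr j) @ V) f x))\<^sup>2) <=
        (q * a ^ nX (replicate CARD('d) (Inr j) @ V) * b ^ nD (replicate CARD('d) (Inr j) @ V))\<^sup>2"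
      using V by (intro L2) simp
    thus "(LBINT x. (norm (wop (replicate CARD('d) (Inr j)) (wop V f) x))\<^sup>2)
        <= (q * a ^ nX V * b ^ nD V)\<^sup>2 * (b ^ CARD('d))\<^sup>2"
      by (simp add: power_add power_mult_distrib mult_ac)
  qed
qed

text \<open>
  Pairings without mixed words: monomials use the decay of \<open>f\<close>, derivatives that of its transform. One unit of
  the rate \<open>k + 1\<close> is kept to make both factors integrable.
\<close>

lemma bnd_pairing_base:
  fixes f :: "'d::finite fn"
  assumes f: "f \<in> SS" and r: "r > 0" and s: "s > 0" and k: "k > 0" and bd: "bnd r s (k + 1) P f"
    and kr: "(r / k) powr r <= h" and ks: "(s / k) powr s <= h"
    and g: "real (length \<gamma>) <= R" and e: "real (length \<epsilon>) <= R"
  shows "norm (ip (wop (map Inl \<gamma>) f) (wop (map Inr \<epsilon>) f)) <=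
     (P\<^sup>2 * (fconst TYPE('d) * (LBINT x. ew r 1 (x::real^'d)) * (LBINT x. ew s 1 (x::real^'d))))
      * (h * R powr r) ^ length \<gamma> * (h * R powr s) ^ length \<epsilon>"
proof -
  have P: "P >= 0" by (rule bnd_nonneg[OF bd])
  have h: "h >= 0" using kr by (meson order_trans powr_ge_zero)
  have core: "norm (of_real (prod_list (map (\<lambda>i. x $ i) \<gamma>)) * u) <= P * (h * R powr q) ^ length \<gamma> * ew q 1 x"
    if u: "norm u <= P * ew q (k + 1) x" and q: "q > 0" "(q / k) powr q <= h" and l: "real (length \<gamma>) <= R"
    for q \<gamma> and x :: "real^'d" and u :: complex
  proof -
    have "norm (of_real (prod_list (map (\<lambda>i. x $ i) \<gamma>)) * u) <= norm x ^ length \<gamma> * (P * ew q (k + 1) x)"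
      using u abs_prod_list_component_le[of x \<gamma>] by (simp only: norm_mult norm_of_real) (intro mult_mono, auto)
    also have "... = P * (norm x ^ length \<gamma> * ew q k x) * ew q 1 x" by (simp add: ew_add)
    also have "... <= P * (h * R powr q) ^ length \<gamma> * ew q 1 x"
    proof (intro mult_right_mono mult_left_mono P)
      have "norm x ^ length \<gamma> * ew q k x <= ((q / k) powr q * R powr q) ^ length \<gamma>"
        by (rule power_ew_le[OF q(1) k l])
      also have "... <= (h * R powr q) ^ length \<gamma>"
        using q(2) by (intro power_mono mult_right_mono) auto
      finally show "norm x ^ length \<gamma> * ew q k x <= (h * R powr q) ^ length \<gamma>" .
    qed simp
    finally show ?thesis .
  qed
  let ?Ir = "LBINT x. ew r 1 (x::real^'d)" and ?Is = "LBINT x. ew s 1 (x::real^'d)"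
  let ?v = "wop (map Inr \<epsilon>) f" and ?u = "wop (map Inl \<gamma>) f"
  have vS: "?v \<in> SS" and uS: "?u \<in> SS" by (intro wop_SS f)+
  have v: "norm (?v x) <= fconst TYPE('d) * (P * (h * R powr s) ^ length \<epsilon> * ?Is)" for x
  proof -
    have "?v x = fourier (fourier ?v) (- x)" by (simp add: SS_inversion[OF vS])
    hence "norm (?v x) <= fconst TYPE('d) * (LBINT \<xi>. norm (fourier ?v \<xi>))"
      by (simp only: norm_fourier_le)
    also have "(LBINT \<xi>. norm (fourier ?v \<xi>)) <= (LBINT \<xi>. P * (h * R powr s) ^ length \<epsilon> * ew s 1 (\<xi>::real^'d))"
    proof (rule integral_mono)
      show "integrable lborel (\<lambda>\<xi>. norm (fourier ?v \<xi>))" by (intro integrable_norm SS_integrable SS_fourier vS)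
      show "integrable lborel (\<lambda>\<xi>::real^'d. P * (h * R powr s) ^ length \<epsilon> * ew s 1 \<xi>)"
        by (intro integrable_mult_right integrable_ew s) simp
      show "norm (fourier ?v \<xi>) <= P * (h * R powr s) ^ length \<epsilon> * ew s 1 \<xi>" for \<xi>
        unfolding fourier_wop_Inr[OF f] using bd e by (intro core s ks) (auto simp: bnd_def)
    qed
    also have "... = P * (h * R powr s) ^ length \<epsilon> * ?Is" by simp
    finally show ?thesis using fconst_pos[where 'd='d] by (simp add: mult_left_mono)
  qed
  have "norm (ip ?u ?v) <= (LBINT x. norm (?u x * cnj (?v x)))"
    unfolding ip_def by (rule integral_norm_bound)
  also have "... <= (LBINT x. (P * (h * R powr r) ^ length \<gamma> * ew r 1 (x::real^'d)) * (fconst TYPE('d) * (P * (h * R powr s) ^ length \<epsilon> * ?Is)))"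
  proof (rule integral_mono)
    show "integrable lborel (\<lambda>x. norm (?u x * cnj (?v x)))" by (intro integrable_norm SS_ip_integrable uS vS)
    show "integrable lborel (\<lambda>x::real^'d. (P * (h * R powr r) ^ length \<gamma> * ew r 1 x) * (fconst TYPE('d) * (P * (h * R powr s) ^ length \<epsilon> * ?Is)))"
      by (intro integrable_mult_left integrable_mult_right integrable_ew r) simp
    fix x
    have "norm (?u x) <= P * (h * R powr r) ^ length \<gamma> * ew r 1 x"
      unfolding wop_map_Inl using bd g by (intro core r kr) (auto simp: bnd_def)
    thus "norm (?u x * cnj (?v x)) <= (P * (h * R powr r) ^ length \<gamma> * ew r 1 x) * (fconst TYPE('d) * (P * (h * R powr s) ^ length \<epsilon> * ?Is))"
      unfolding norm_mult complex_mod_cnj by (intro mult_mono v) (use P h in auto)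
  qed
  also have "... = (P\<^sup>2 * (fconst TYPE('d) * ?Ir * ?Is)) * (h * R powr r) ^ length \<gamma> * (h * R powr s) ^ length \<epsilon>"
    by (simp add: power2_eq_square mult_ac)
  finally show ?thesis .
qed

lemma integral_ew_pos: assumes "q > 0" shows "(LBINT x. ew q 1 (x::real^'d::finite)) > 0"
proof -
  have "(LBINT x. ew q 1 (x::real^'d)) \<noteq> 0"
  proof
    assume "(LBINT x. ew q 1 (x::real^'d)) = 0"
    hence "AE x::real^'d in lborel. ew q 1 x = 0"
      using integral_nonneg_eq_0_iff_AE[OF integrable_ew[OF assms, of 1, where 'a='d]] by simp
    hence "AE x::real^'d in lborel. False" by simp
    thus False by (simp add: AE_iff_null null_sets_def emeasure_lborel_UNIV)
  qed
  moreover have "(LBINT x. ew q 1 (x::real^'d)) >= 0" by (intro Bochner_Integration.integral_nonneg) simp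
  ultimately show ?thesis by linarith
qed

text \<open>
  \<open>word_L1\<close> with \<open>a = h R\<^sup>r\<close> and \<open>b = 2 h R\<^sup>s\<close>, where \<open>h\<close> is as small as desired if the rate is large. Its
  hypothesis becomes \<open>R \<le> h\<^sup>2 R\<^bsup>r + s\<^esup>\<close>: this holds for large \<open>R\<close> because \<open>r + s > 1\<close>, and it determines \<open>R0\<close>.
\<close>

lemma word_estimate:
  assumes r: "r > 0" and s: "s > 0" and rs: "r + s > 1" and h: "h > 0" 
  obtains H C R0 where "H > 0" "C > 0" "R0 >= 1"
    "\<And>f P V R. f \<in> (SS :: 'd::finite fn set) ==> bnd r s H P f ==> R >= R0 ==>
       2 * (real (length V) + real CARD('d)) <= R ==>
       (LBINT \<xi>. norm (fourier (wop V f) \<xi>)) <=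
         C * P * (h * R powr r) ^ nX V * (2 * h * R powr s) ^ nD V * (1 + (2 * h * R powr s) ^ (2 * CARD('d)))"
proof -
  define k where "k = max (r / h powr (1 / r)) (s / h powr (1 / s))"
  have k0: "k > 0" unfolding k_def using r h by (simp add: less_max_iff_disj)
  have kq: "(q / k) powr q <= h" if q: "q > 0" and le: "q / h powr (1 / q) <= k" for q
  proof -
    have "q / k <= h powr (1 / q)" using le k0 h by (simp add: field_simps)
    hence "(q / k) powr q <= (h powr (1 / q)) powr q" using q k0 by (intro powr_mono2) auto
    thus ?thesis using q h by (simp add: powr_powr)
  qed
  have kr: "(r / k) powr r <= h" and ks: "(s / k) powr s <= h"
    using kq[OF r] kq[OF s] by (simp_all add: k_def)
  let ?\<kappa> = "fconst TYPE('d) * (LBINT x. ew r 1 (x::real^'d)) * (LBINT x. ew s 1 (x::real^'d))"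
  have kap: "?\<kappa> > 0" using integral_ew_pos[OF r, where 'd='d] integral_ew_pos[OF s, where 'd='d] fconst_pos[where 'd='d] by simp
  have sc: "sob_const TYPE('d) >= 0" unfolding sob_const_def by (intro mult_nonneg_nonneg integral_nonneg) auto
  define C where "C = sqrt ?\<kappa> * (sob_const TYPE('d) + 1 + real CARD('d))"
  define R0 where "R0 = max 1 ((h powr (-2)) powr (1 / (r + s - 1)))"
  have C: "C > 0" unfolding C_def using kap sc by (simp add: add_nonneg_pos add_pos_nonneg)
  have main: "(LBINT \<xi>. norm (fourier (wop V f) \<xi>)) <=
         C * P * (h * R powr r) ^ nX V * (2 * h * R powr s) ^ nD V * (1 + (2 * h * R powr s) ^ (2 * CARD('d)))"
    if f: "f \<in> SS" and bd: "bnd r s (k + 1) P f" and R: "R >= R0" and V: "2 * (real (length V) + real CARD('d)) <= R" and P: "P > 0"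
    for f :: "'d fn" and P R :: real and V :: "('d + 'd) list"
  proof -
    let ?a = "h * R powr r" and ?b = "2 * h * R powr s" and ?q = "P * sqrt ?\<kappa>"
    have R1: "R >= 1" using R unfolding R0_def by simp
    have ab: "?a > 0" "?b > 0" using h R1 by auto
    define N where "N = nat \<lfloor>R\<rfloor>"
    have NR: "real N <= R" unfolding N_def using R1 by linarith
    have "((h powr (-2)) powr (1 / (r + s - 1))) powr (r + s - 1) <= R powr (r + s - 1)"
      using R rs unfolding R0_def by (intro powr_mono2) auto
    moreover have "(x powr (1 / a)) powr a = x" if "x > 0" "a \<noteq> 0" for x a :: real
      using that by (simp add: powr_powr)
    ultimately have "h powr (-2) <= R powr (r + s - 1)" using rs h by simp
    hence "R * (h\<^sup>2 * h powr (-2)) <= R * (h\<^sup>2 * R powr (r + s - 1))"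
      using R1 by (intro mult_left_mono) auto
    also have "h\<^sup>2 * h powr (-2) = 1" using h by (simp add: powr_minus powr_numeral)
    also have "R * (h\<^sup>2 * R powr (r + s - 1)) = ?a * ?b / 2"
      using R1 by (simp add: powr_add powr_diff power2_eq_square)
    finally have Nab: "real N <= ?a * ?b / 2" using NR by simp
    have base: "norm (ip (wop (map Inl \<gamma>) f) (wop (map Inr \<epsilon>) f)) <= ?q\<^sup>2 * ?a ^ length \<gamma> * (?b / 2) ^ length \<epsilon>"
      if "length \<gamma> <= N" "length \<epsilon> <= N" for \<gamma> \<epsilon>
    proof -
      have g: "real (length \<gamma>) <= R" "real (length \<epsilon>) <= R" using that NR by linarith+
      have "?q\<^sup>2 = P\<^sup>2 * ?\<kappa>" using kap by (simp add: power_mult_distrib)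
      thus ?thesis using bnd_pairing_base[OF f r s k0 bd kr ks g] by simp
    qed
    have "2 * (length V + CARD('d)) <= N" unfolding N_def using V by (simp add: le_nat_floor)
    from word_L1[OF f ab _ Nab base this] P kap
    have "(LBINT \<xi>. norm (fourier (wop V f) \<xi>)) <=
       (?q * ?a ^ nX V * ?b ^ nD V) * (sob_const TYPE('d) + 1 + real CARD('d) * (?b ^ CARD('d))\<^sup>2)" by simp
    also have "... <= (?q * ?a ^ nX V * ?b ^ nD V) * ((sob_const TYPE('d) + 1 + real CARD('d)) * (1 + ?b ^ (2 * CARD('d))))"
    proof (intro mult_left_mono)
      have e: "(?b ^ CARD('d))\<^sup>2 = ?b ^ (2 * CARD('d))" by (simp add: power_mult[symmetric] mult.commute)
      have "0 <= (sob_const TYPE('d) + 1) * ?b ^ (2 * CARD('d))" using sc ab by (intro mult_nonneg_nonneg) auto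
      thus "sob_const TYPE('d) + 1 + real CARD('d) * (?b ^ CARD('d))\<^sup>2 <=
          (sob_const TYPE('d) + 1 + real CARD('d)) * (1 + ?b ^ (2 * CARD('d)))"
        unfolding e distrib_left distrib_right by simp
    qed (use P kap ab in auto)
    finally show ?thesis by (simp add: C_def mult_ac)
  qed
  show ?thesis
  proof (rule that[of "k + 1" C R0])
    show "R0 >= 1" by (simp add: R0_def)
    fix f :: "'d fn" and P R :: real and V :: "('d + 'd) list"
    assume f: "f \<in> SS" and bd: "bnd r s (k + 1) P f" and R: "R >= R0" and V: "2 * (real (length V) + real CARD('d)) <= R"
    let ?D = "C * (h * R powr r) ^ nX V * (2 * h * R powr s) ^ nD V * (1 + (2 * h * R powr s) ^ (2 * CARD('d)))"
    have R1: "R >= 1" using R unfolding R0_def by simp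
    have D: "?D > 0" using C h R1 by (intro mult_pos_pos zero_less_power add_pos_nonneg) auto
    have "(LBINT \<xi>. norm (fourier (wop V f) \<xi>)) / ?D <= P"
    proof (rule dense_ge)
      fix P' assume P': "P < P'"
      hence "P' > 0" using bnd_nonneg[OF bd] by simp
      hence "(LBINT \<xi>. norm (fourier (wop V f) \<xi>)) <= ?D * P'"
        using main[OF f bnd_weaken[OF bd order_refl] R V, of P'] P' by (simp add: mult_ac)
      thus "(LBINT \<xi>. norm (fourier (wop V f) \<xi>)) / ?D <= P'" using D by (simp add: pos_divide_le_eq mult.commute)
    qed
    thus "(LBINT \<xi>. norm (fourier (wop V f) \<xi>)) <= C * P * (h * R powr r) ^ nX V * (2 * h * R powr s) ^ nD V * (1 + (2 * h * R powr s) ^ (2 * CARD('d)))"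
      using D by (simp add: pos_divide_le_eq mult_ac)
  qed (use k0 C in auto)
qed

section \<open>The Gelfand--Shilov space as a space of functions with two-sided decay\<close>

lemma SS_smooth:
  assumes "f \<in> SS" shows "smooth f"
proof -
  have "Ck n f" if "f \<in> SS" for n and f :: "'a fn"
    using that
  proof (induction n arbitrary: f)
    case 0 thus ?case by (simp add: SS_cont)
  next
    case (Suc n)
    have "partial_deriv i f = (\<lambda>x. \<i> * D_coord i f x)" for i
      by (simp add: D_coord_def fun_eq_iff mult.assoc[symmetric])
    thus ?case using Suc by (simp add: SS_differentiable SS_cmult SS_D_coord_closed)
  qed
  thus ?thesis using assms by (simp add: smooth_def)
qed

lemma D_multi_wop: "D_multi \<beta> f = wop (map Inr (SOME is. \<forall>i. count_list is i = \<beta> i)) f"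
proof -
  have "foldr D_coord l f = wop (map Inr l) f" for l by (induction l) auto
  thus ?thesis by (simp add: D_multi_def)
qed

lemma ex_list_counts: "\<exists>is. \<forall>i. count_list is i = (\<beta> :: 'd::finite => nat) i"
proof -
  have "\<exists>is. \<forall>i. count_list is i = (if i \<in> A then \<beta> i else 0)" if "finite A" for A :: "'d set"
    using that
  proof (induction A rule: finite_induct)
    case empty show ?case by (rule exI[of _ "[]"]) simp
  next
    case (insert a A)
    then obtain l where l: "\<forall>i. count_list l i = (if i \<in> A then \<beta> i else 0)" by blast
    have r: "count_list (replicate n a) i = (if i = a then n else 0)" for n i by (induction n) auto
    show ?case
      by (rule exI[of _ "replicate (\<beta> a) a @ l"]) (use insert l in \<open>auto simp: r\<close>)
  qed
  from this[of UNIV] show ?thesis by simp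
qed

text \<open>
  The very list that \<open>D_multi\<close> chooses, so that \<open>D_multi \<beta>\<close> is a word.
\<close>

definition mi_list :: "('d::finite => nat) => 'd list"
  where "mi_list \<beta> = (SOME is. \<forall>i. count_list is i = \<beta> i)"

lemma count_mi_list: "count_list (mi_list \<beta>) i = \<beta> i"
  unfolding mi_list_def using someI_ex[OF ex_list_counts[of \<beta>]] by blast

lemma D_multi_mi_list: "D_multi \<beta> f = wop (map Inr (mi_list \<beta>)) f"
  by (simp add: D_multi_wop mi_list_def)

lemma prod_list_count: 
  fixes g :: "'d::finite => 'b::comm_monoid_mult"
  shows "prod_list (map g l) = (\<Prod>i\<in>UNIV. g i ^ count_list l i)"
proof (induction l)
  case Nil thus ?case by simp
next
  case (Cons a l)
  have "(\<Prod>i\<in>UNIV. g i ^ count_list (a # l) i) = (\<Prod>i\<in>UNIV. (if i = a then g i else 1) * g i ^ count_list l i)"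
    by (rule prod.cong) auto
  also have "... = g a * (\<Prod>i\<in>UNIV. g i ^ count_list l i)" by (simp add: prod.distrib)
  finally show ?case using Cons by simp
qed

lemma length_count: "length l = (\<Sum>i\<in>(UNIV::'d::finite set). count_list l i)"
proof (induction l)
  case Nil thus ?case by simp
next
  case (Cons a l)
  have "(\<Sum>i\<in>UNIV. count_list (a # l) i) = (\<Sum>i\<in>UNIV. (if i = a then 1 else 0) + count_list l i)"
    by (rule sum.cong) auto
  also have "... = 1 + (\<Sum>i\<in>UNIV. count_list l i)" by (simp add: sum.distrib)
  finally show ?case using Cons by simp
qed

lemma mi_power_mi_list: "mi_power x \<alpha> = prod_list (map (\<lambda>i. x $ i) (mi_list \<alpha>))"
  by (simp add: mi_power_def prod_list_count count_mi_list)

lemma length_mi_list: "length (mi_list \<alpha>) = mi_length \<alpha>"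
  by (simp add: mi_length_def length_count count_mi_list)

lemma monomial_derivative_wop:
  "of_real (mi_power x \<alpha>) * D_multi \<beta> f x = wop (map Inl (mi_list \<alpha>) @ map Inr (mi_list \<beta>)) f x"
  by (simp add: D_multi_mi_list mi_power_mi_list wop_map_Inl)

lemma mi_fact_pos: "mi_fact \<alpha> > 0"
  by (simp add: mi_fact_def prod_pos)

lemma fact_add_le: "fact (a + b) <= (2 ^ (a + b) * fact a * fact b :: real)"
proof -
  have "fact (a + b) = (fact a * fact b * real ((a + b) choose a))"
    using binomial_fact_lemma[of a "a + b"] by (metis add_diff_cancel_left' le_add1 of_nat_fact of_nat_mult)
  also have "... <= fact a * fact b * 2 ^ (a + b)"
  proof (intro mult_left_mono)
    have "real ((a + b) choose a) <= real (2 ^ (a + b))" by (simp only: of_nat_le_iff binomial_le_pow2)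
    thus "real ((a + b) choose a) <= 2 ^ (a + b)" by simp
  qed simp
  finally show ?thesis by (simp add: mult_ac)
qed

lemma fact_length_le: "fact (mi_length \<alpha>) <= (2 ^ CARD('d)) ^ mi_length \<alpha> * mi_fact (\<alpha> :: 'd::finite => nat)"
proof -
  have "fact (sum \<alpha> A) <= (2 ^ card A) ^ sum \<alpha> A * (\<Prod>i\<in>A. fact (\<alpha> i) :: real)" if "finite A" for A :: "'d set"
    using that
  proof (induction A rule: finite_induct)
    case empty thus ?case by simp
  next
    case (insert a A)
    let ?S = "sum \<alpha> A"
    have "fact (sum \<alpha> (insert a A)) = (fact (\<alpha> a + ?S) :: real)" using insert by simp
    also have "... <= 2 ^ (\<alpha> a + ?S) * fact (\<alpha> a) * fact ?S" by (rule fact_add_le)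
    also have "... <= 2 ^ (\<alpha> a + ?S) * fact (\<alpha> a) * ((2 ^ card A) ^ (\<alpha> a + ?S) * (\<Prod>i\<in>A. fact (\<alpha> i)))"
    proof (intro mult_left_mono)
      have "(2 ^ card A) ^ ?S <= ((2::real) ^ card A) ^ (\<alpha> a + ?S)" by (intro power_increasing) auto
      thus "fact ?S <= (2 ^ card A) ^ (\<alpha> a + ?S) * (\<Prod>i\<in>A. fact (\<alpha> i) :: real)"
        by (intro order_trans[OF insert.IH] mult_right_mono) (auto intro!: prod_nonneg)
    qed auto
    also have "... = (2 ^ card (insert a A)) ^ sum \<alpha> (insert a A) * (\<Prod>i\<in>insert a A. fact (\<alpha> i))"
      using insert by (simp add: power_mult_distrib mult_ac)
    finally show ?case .
  qed
  from this[of UNIV] show ?thesis by (simp add: mi_length_def mi_fact_def)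
qed

lemma power_le_fact_exp: "R >= 0 ==> R ^ n <= fact n * exp (R::real)"
proof -
  assume R: "R >= 0"
  have "(\<Sum>i<Suc n. R ^ i /\<^sub>R fact i) <= (\<Sum>i. R ^ i /\<^sub>R fact i)"
    by (rule sum_le_suminf[OF summable_exp_generic]) (use R in auto)
  hence "(\<Sum>i<Suc n. R ^ i / fact i) <= exp R" by (simp add: exp_def divide_inverse_commute)
  moreover have "R ^ n / fact n <= (\<Sum>i<Suc n. R ^ i / fact i)"
    by (rule member_le_sum) (use R in auto)
  ultimately have "R ^ n / fact n <= exp R" by linarith
  thus ?thesis by (simp add: divide_le_eq mult.commute)
qed

lemma powr_power_le_fact_exp:
  fixes R q :: real
  assumes "R >= 1" "q > 0" shows "(R powr q) ^ n <= fact n powr q * exp (q * R)"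
proof -
  have "(R powr q) ^ n = (R ^ n) powr q"
    using assms by (simp add: powr_realpow[symmetric] powr_powr mult.commute)
  also have "... <= (fact n * exp R) powr q"
    using assms by (intro powr_mono2 power_le_fact_exp) auto
  also have "... = fact n powr q * exp (q * R)"
    by (subst powr_mult) (auto simp: exp_powr_real mult.commute)
  finally show ?thesis .
qed

lemma norm_le_fourier_L1:
  assumes "f \<in> (SS :: 'd::finite fn set)"
  shows "norm (f x) <= fconst TYPE('d) * (LBINT \<xi>. norm (fourier f \<xi>))"
proof -
  have "f x = fourier (fourier f) (- x)" using assms by (simp add: SS_inversion)
  thus ?thesis by (simp only: norm_fourier_le)
qed

text \<open>
  \<open>word_estimate\<close> with \<open>R\<close> proportional to the number of letters: the powers \<open>R\<^bsup>r n\<^esup>\<close> are at most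
  \<open>n!\<^sup>r exp (r R)\<close>, and the exponential is absorbed by the small constant \<open>h\<close>.
\<close>

lemma gs_quotient_le_bnd:
  assumes r: "r > 0" and s: "s > 0" and rs: "r + s > 1" and h: "h > 0"
  obtains H C where "H > 0" "C > 0"
    "\<And>f P z. f \<in> (SS :: 'd::finite fn set) ==> bnd r s H P f ==> gs_quotient r s h f z <= C * P"
proof -
  let ?d = "CARD('d)"
  define L where "L = exp (2 * (r + 2 * s)) * (2 ^ ?d) powr (r + s)"
  have L: "L >= 1"
  proof -
    have "1 <= ((2::real) ^ ?d) powr (r + s)" using r s by (intro ge_one_powr_ge_zero) auto
    moreover have "1 <= exp (2 * (r + 2 * s))" using r s by simp
    ultimately show ?thesis unfolding L_def by (metis mult_mono' mult_1 zero_le_one)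
  qed
  define k where "k = min (1/2) (h / (2 * L))"
  have k: "k > 0" "2 * k <= 1" "2 * k * L <= h" "k * L <= h"
    using h L by (auto simp: k_def min_def field_simps split: if_splits)
  obtain H C R0 where H: "H > 0" and C: "C > 0" and R0: "R0 >= 1" and
    W: "\<And>f P V R. f \<in> (SS :: 'd fn set) ==> bnd r s H P f ==> R >= R0 ==>
       2 * (real (length V) + real ?d) <= R ==>
       (LBINT \<xi>. norm (fourier (wop V f) \<xi>)) <=
         C * P * (k * R powr r) ^ nX V * (2 * k * R powr s) ^ nD V * (1 + (2 * k * R powr s) ^ (2 * ?d))"
    using word_estimate[OF r s rs k(1)] by metis
  define E where "E = exp ((r + 2 * s) * (2 * real ?d + R0))"
  define D where "D = fconst TYPE('d) * C * (1 + fact (2 * ?d) powr s) * E"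
  show ?thesis
  proof (rule that[OF H])
    show "D > 0" unfolding D_def E_def using C fconst_pos[where 'd='d] by (simp add: add_pos_nonneg)
    fix f :: "'d fn" and P :: real and z :: "(real^'d) \<times> ('d => nat) \<times> ('d => nat)"
    assume f: "f \<in> SS" and bd: "bnd r s H P f"
    have P: "P >= 0" by (rule bnd_nonneg[OF bd])
    obtain x \<alpha> \<beta> where z: "z = (x, \<alpha>, \<beta>)" by (cases z) auto
    let ?g = "mi_length \<alpha>" and ?n = "mi_length \<beta>"
    let ?V = "map Inl (mi_list \<alpha>) @ map Inr (mi_list \<beta>) :: ('d + 'd) list"
    define R where "R = 2 * (real ?g + real ?n + real ?d) + R0"
    have R: "R >= R0" "R >= 1" using R0 by (auto simp: R_def)
    have l: "2 * (real (length ?V) + real ?d) <= R" using R0 by (simp add: R_def length_mi_list)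
    have nV: "nX ?V = ?g" "nD ?V = ?n" by (simp_all add: length_mi_list)
    have "cmod (of_real (mi_power x \<alpha>) * D_multi \<beta> f x) <= fconst TYPE('d) * (LBINT \<xi>. norm (fourier (wop ?V f) \<xi>))"
      unfolding monomial_derivative_wop by (rule norm_le_fourier_L1[OF wop_SS[OF f]])
    also have "... <= fconst TYPE('d) * (C * P * (k * R powr r) ^ ?g * (2 * k * R powr s) ^ ?n * (1 + (2 * k * R powr s) ^ (2 * ?d)))"
      using W[OF f bd R(1) l] fconst_pos[where 'd='d] unfolding nV by simp
    also have "... <= fconst TYPE('d) * (C * P * (k ^ ?g * (fact ?g powr r * exp (r * R))) * ((2 * k) ^ ?n * (fact ?n powr s * exp (s * R))) * ((1 + fact (2 * ?d) powr s) * exp (s * R)))"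
    proof (intro mult_left_mono mult_mono)
      show "(k * R powr r) ^ ?g <= k ^ ?g * (fact ?g powr r * exp (r * R))"
        unfolding power_mult_distrib using k by (intro mult_left_mono powr_power_le_fact_exp R r) auto
      show "(2 * k * R powr s) ^ ?n <= (2 * k) ^ ?n * (fact ?n powr s * exp (s * R))"
        unfolding power_mult_distrib[of "2 * k"] using k by (intro mult_left_mono powr_power_le_fact_exp R s) auto
      have "(2 * k * R powr s) ^ (2 * ?d) <= (1 * R powr s) ^ (2 * ?d)"
        using k R by (intro power_mono mult_right_mono) auto
      also have "... <= fact (2 * ?d) powr s * exp (s * R)" using powr_power_le_fact_exp[OF R(2) s] by simp
      finally have "(2 * k * R powr s) ^ (2 * ?d) <= fact (2 * ?d) powr s * exp (s * R)" .
      moreover have "1 <= exp (s * R)" using s R by simp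
      ultimately show "1 + (2 * k * R powr s) ^ (2 * ?d) <= (1 + fact (2 * ?d) powr s) * exp (s * R)"
        unfolding distrib_right mult_1 by (rule add_mono[rotated])
    qed (use k C P fconst_pos[where 'd='d] in \<open>auto intro!: mult_nonneg_nonneg\<close>)
    also have "... = fconst TYPE('d) * C * (1 + fact (2 * ?d) powr s) * P * (exp (r * R) * exp (s * R) * exp (s * R)) * k ^ ?g * (2 * k) ^ ?n * fact ?g powr r * fact ?n powr s"
      by (simp only: mult_ac)
    also have "exp (r * R) * exp (s * R) * exp (s * R) = E * exp (2 * (r + 2 * s)) ^ ?g * exp (2 * (r + 2 * s)) ^ ?n"
      unfolding E_def R_def exp_of_nat_mult[symmetric] exp_add[symmetric] by (simp add: algebra_simps)
    also have "fconst TYPE('d) * C * (1 + fact (2 * ?d) powr s) * P * (E * exp (2 * (r + 2 * s)) ^ ?g * exp (2 * (r + 2 * s)) ^ ?n) * k ^ ?g * (2 * k) ^ ?n * fact ?g powr r * fact ?n powr s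
       <= fconst TYPE('d) * C * (1 + fact (2 * ?d) powr s) * P * (E * exp (2 * (r + 2 * s)) ^ ?g * exp (2 * (r + 2 * s)) ^ ?n) * k ^ ?g * (2 * k) ^ ?n *
         (((2 ^ ?d) powr (r + s)) ^ ?g * mi_fact \<alpha> powr r) * (((2 ^ ?d) powr (r + s)) ^ ?n * mi_fact \<beta> powr s)"
    proof (intro mult_mono mult_left_mono)
      have F: "fact (mi_length \<gamma>) powr q <= ((2 ^ ?d) powr (r + s)) ^ mi_length \<gamma> * mi_fact \<gamma> powr q"
        if "0 < q" "q <= r + s" for q and \<gamma> :: "'d => nat"
      proof -
        have "fact (mi_length \<gamma>) powr q <= ((2 ^ ?d) ^ mi_length \<gamma> * mi_fact \<gamma>) powr q"
          using that by (intro powr_mono2 fact_length_le) auto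
        also have "... = ((2 ^ ?d) powr q) ^ mi_length \<gamma> * mi_fact \<gamma> powr q"
          using mi_fact_pos[of \<gamma>] by (subst powr_mult) (simp_all add: powr_realpow[symmetric] powr_powr mult_ac)
        also have "... <= ((2 ^ ?d) powr (r + s)) ^ mi_length \<gamma> * mi_fact \<gamma> powr q"
          using that by (intro mult_right_mono power_mono powr_mono) auto
        finally show ?thesis .
      qed
      show "fact ?g powr r <= ((2 ^ ?d) powr (r + s)) ^ ?g * mi_fact \<alpha> powr r" using r s by (intro F) auto
      show "fact ?n powr s <= ((2 ^ ?d) powr (r + s)) ^ ?n * mi_fact \<beta> powr s" using r s by (intro F) auto
    qed (use k C P fconst_pos[where 'd='d] in \<open>auto intro!: mult_nonneg_nonneg simp: E_def\<close>)
    also have "... = D * P * ((k * L) ^ ?g * (2 * k * L) ^ ?n) * mi_fact \<alpha> powr r * mi_fact \<beta> powr s"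
      unfolding D_def L_def power_mult_distrib by (simp only: mult_ac)
    also have "... <= D * P * (h ^ ?g * h ^ ?n) * mi_fact \<alpha> powr r * mi_fact \<beta> powr s"
    proof (intro mult_right_mono mult_left_mono mult_mono)
      show "(k * L) ^ ?g <= h ^ ?g" using k L by (intro power_mono) auto
      show "(2 * k * L) ^ ?n <= h ^ ?n" using k L by (intro power_mono) auto
    qed (use k L h P \<open>D > 0\<close> in auto)
    finally have "cmod (of_real (mi_power x \<alpha>) * D_multi \<beta> f x) <= D * P * (h ^ mi_length (\<lambda>i. \<alpha> i + \<beta> i) * mi_fact \<alpha> powr r * mi_fact \<beta> powr s)"
      by (simp add: mi_length_def sum.distrib power_add mult_ac)
    thus "gs_quotient r s h f z <= D * P"
      unfolding z gs_quotient_def using h mi_fact_pos[of \<alpha>] mi_fact_pos[of \<beta>] by (simp add: pos_divide_le_eq)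
  qed
qed

lemma bnd_imp_gs:
  assumes "r > 0" "s > 0" "r + s > 1" "f \<in> SS" and b: "\<And>H. H > 0 ==> \<exists>P. bnd r s H P f"
  shows "f \<in> gs r s"
  unfolding gs_def gs_banach_def
proof (clarsimp simp: SS_smooth[OF assms(4)])
  fix h :: real assume h: "h > 0"
  from gs_quotient_le_bnd[OF assms(1-3) h, where 'd='a]
  obtain H C where HC: "H > 0" "\<And>P z. bnd r s H P f ==> gs_quotient r s h f z <= C * P" using assms(4) by metis
  obtain P where "bnd r s H P f" using b HC(1) by blast
  thus "bdd_above (range (gs_quotient r s h f))" using HC(2) by (intro bdd_aboveI2) blast
qed

lemma gs_norm_le_bnd:
  assumes "r > 0" "s > 0" "r + s > 1" "h > 0"
  obtains H C where "H > 0" "C > 0"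
    "\<And>f P. f \<in> (SS :: 'd::finite fn set) ==> bnd r s H P f ==> gs_norm r s h f <= C * P"
proof -
  obtain H C where HC: "H > 0" "C > 0" "\<And>f P z. f \<in> (SS :: 'd fn set) ==> bnd r s H P f ==> gs_quotient r s h f z <= C * P"
    using gs_quotient_le_bnd[OF assms] by metis
  show ?thesis
    by (rule that[OF HC(1,2)]) (auto simp: gs_norm_def intro!: cSUP_least HC(3))
qed

section \<open>Schwartz functions\<close>

lemma component_decay:
  fixes x :: "real^'d::finite"
  assumes "v <= B" "\<And>j. \<bar>x $ j\<bar> ^ k * v <= B" "v >= 0"
  shows "(1 + norm x) ^ k * v <= (2 * real CARD('d)) ^ k * ((1 + real CARD('d)) * B)"
proof -
  have "(1 + norm x) ^ k * v <= (2 * real CARD('d)) ^ k * (1 + (\<Sum>j\<in>UNIV. \<bar>x $ j\<bar> ^ k)) * v"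
    using one_plus_norm_power_le[of x k] assms(3) by (rule mult_right_mono)
  also have "... = (2 * real CARD('d)) ^ k * (v + (\<Sum>j\<in>UNIV. \<bar>x $ j\<bar> ^ k * v))"
    by (simp add: algebra_simps sum_distrib_left sum_distrib_right)
  also have "... <= (2 * real CARD('d)) ^ k * (B + (\<Sum>j\<in>(UNIV::'d set). B))"
    by (intro mult_left_mono add_mono sum_mono assms) auto
  finally show ?thesis by (simp add: algebra_simps)
qed

lemma fourier_translate:
  fixes g :: "'d::finite fn"
  shows "fourier (\<lambda>x. g (x - a)) \<xi> = osc a \<xi> * fourier g \<xi>"
proof -
  let ?F = "\<lambda>x. g x * osc (x + a) \<xi>"
  have "(LBINT x. g (x - a) * osc x \<xi>) = (LBINT x. ?F (x - a))" by simp
  also have "... = (LBINT x. ?F x)" by (rule lborel_integral_translate(2))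
  also have "... = (LBINT x. osc a \<xi> * (g x * osc x \<xi>))"
    by (rule Bochner_Integration.integral_cong) (auto simp: inner_add_left distrib_left exp_add mult_ac exp_diff exp_minus field_simps)
  also have "... = osc a \<xi> * (LBINT x. g x * osc x \<xi>)" by simp
  finally show ?thesis unfolding fourier_eq by (simp only: mult_ac)
qed

text \<open>
  Here \<open>g\<close> is not yet known to have a rapidly decaying transform. Difference quotients have explicit
  transforms and converge to the derivative under a common integrable bound.
\<close>

lemma fourier_D_coord_general:
  fixes g :: "'d::finite fn"
  assumes d: "\<And>x. g differentiable at x" and c: "continuous_on UNIV (D_coord j g)"
    and rg: "rapid g" and rd: "rapid (D_coord j g)"
  shows "fourier (D_coord j g) \<xi> = of_real (\<xi> $ j) * fourier g \<xi>"
proof -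
  let ?n = "2 * CARD('d)"
  define e :: "real^'d" where "e = axis j 1"
  define \<tau> where "\<tau> n = inverse (real (Suc n))" for n
  have \<tau>: "0 < \<tau> n" "\<tau> n <= 1" for n by (auto simp: \<tau>_def field_simps)
  have \<tau>0: "\<tau> \<longlonglongrightarrow> 0" unfolding \<tau>_def by (rule LIMSEQ_inverse_real_of_nat)
  have cg: "continuous_on UNIV g"
    by (simp add: continuous_on_eq_continuous_at d differentiable_imp_continuous_within)
  have I: "integrable lborel g" by (rule rapid_integrable[OF cg rg])
  obtain C where C: "C >= 0" "\<And>x. (1 + norm x) ^ ?n * norm (D_coord j g x) <= C" using rapidD[OF rd] by metis
  have pd: "partial_deriv j g x = \<i> * D_coord j g x" for x
    by (simp add: D_coord_def mult.assoc[symmetric])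
  have vd: "((\<lambda>\<sigma>. g (x + \<sigma> *\<^sub>R e)) has_vector_derivative (\<i> * D_coord j g (x + \<sigma> *\<^sub>R e))) (at \<sigma> within S)" for x \<sigma> S
  proof -
    have "(g has_derivative frechet_derivative g (at (x + \<sigma> *\<^sub>R e))) (at (x + \<sigma> *\<^sub>R e))"
      using d by (simp add: frechet_derivative_works)
    moreover have "((\<lambda>\<sigma>. x + \<sigma> *\<^sub>R e) has_derivative (\<lambda>h. h *\<^sub>R e)) (at \<sigma>)"
      by (auto intro!: derivative_eq_intros)
    ultimately have "((\<lambda>\<sigma>. g (x + \<sigma> *\<^sub>R e)) has_derivative (\<lambda>h. frechet_derivative g (at (x + \<sigma> *\<^sub>R e)) (h *\<^sub>R e))) (at \<sigma>)"
      by (rule has_derivative_compose[rotated])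
    moreover have "frechet_derivative g (at (x + \<sigma> *\<^sub>R e)) (h *\<^sub>R e) = h *\<^sub>R (\<i> * D_coord j g (x + \<sigma> *\<^sub>R e))" for h
      using linear_frechet_derivative[OF d, of "x + \<sigma> *\<^sub>R e"]
      by (simp add: linear_cmul pd[symmetric] partial_deriv_def e_def)
    ultimately have "((\<lambda>\<sigma>. g (x + \<sigma> *\<^sub>R e)) has_vector_derivative (\<i> * D_coord j g (x + \<sigma> *\<^sub>R e))) (at \<sigma>)"
      by (simp add: has_vector_derivative_def)
    thus ?thesis by (rule has_vector_derivative_at_within)
  qed
  define q where "q n x = (g (x + \<tau> n *\<^sub>R e) - g x) / of_real (\<tau> n)" for n x
  have qb: "norm (q n x) <= 2 ^ ?n * C * inverse ((1 + norm x) ^ ?n)" for n x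
  proof -
    have B: "norm (\<i> * D_coord j g (x + \<sigma> *\<^sub>R e)) <= 2 ^ ?n * C * inverse ((1 + norm x) ^ ?n)" if "\<sigma> \<in> {0..1}" for \<sigma>
    proof -
      let ?y = "x + \<sigma> *\<^sub>R e"
      have "norm x <= norm ?y + norm (\<sigma> *\<^sub>R e)" using norm_triangle_ineq4[of ?y "\<sigma> *\<^sub>R e"] by simp
      moreover have "norm (\<sigma> *\<^sub>R e) <= 1" using that by (simp add: e_def)
      ultimately have "1 + norm x <= 2 * (1 + norm ?y)" by (smt (verit) norm_ge_zero)
      hence "(1 + norm x) ^ ?n <= (2 * (1 + norm ?y)) ^ ?n" by (intro power_mono) auto
      hence "(1 + norm x) ^ ?n * norm (D_coord j g ?y) <= (2 * (1 + norm ?y)) ^ ?n * norm (D_coord j g ?y)"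
        by (intro mult_right_mono) auto
      also have "... = 2 ^ ?n * ((1 + norm ?y) ^ ?n * norm (D_coord j g ?y))" by (simp only: power_mult_distrib mult.assoc)
      also have "... <= 2 ^ ?n * C" by (intro mult_left_mono C) auto
      finally have "norm (D_coord j g ?y) <= 2 ^ ?n * C / (1 + norm x) ^ ?n"
        by (simp add: pos_le_divide_eq mult.commute)
      thus ?thesis by (simp add: norm_mult divide_inverse)
    qed
    have "norm ((\<lambda>\<sigma>. g (x + \<sigma> *\<^sub>R e)) (\<tau> n) - (\<lambda>\<sigma>. g (x + \<sigma> *\<^sub>R e)) 0) <= 2 ^ ?n * C * inverse ((1 + norm x) ^ ?n) * norm (\<tau> n - 0)"
    proof (rule differentiable_bound[of "{0..1}"])
      show "((\<lambda>\<sigma>. g (x + \<sigma> *\<^sub>R e)) has_derivative (\<lambda>h. h *\<^sub>R (\<i> * D_coord j g (x + \<sigma> *\<^sub>R e)))) (at \<sigma> within {0..1})" for \<sigma>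
        using vd[of x \<sigma> "{0..1}"] by (simp add: has_vector_derivative_def)
      show "onorm (\<lambda>h::real. h *\<^sub>R (\<i> * D_coord j g (x + \<sigma> *\<^sub>R e))) <= 2 ^ ?n * C * inverse ((1 + norm x) ^ ?n)" if "\<sigma> \<in> {0..1}" for \<sigma>
        by (rule onorm_bound) (use B[OF that] C in \<open>auto intro!: mult_left_mono simp: mult.commute[of _ "\<bar>_\<bar>"]\<close>)
    qed (use \<tau>[of n] in auto)
    thus ?thesis using \<tau>[of n] by (simp add: q_def norm_divide pos_divide_le_eq)
  qed
  have ql: "(\<lambda>n. q n x) \<longlonglongrightarrow> \<i> * D_coord j g x" for x
  proof -
    let ?\<phi> = "\<lambda>\<sigma>. g (x + \<sigma> *\<^sub>R e)" and ?D = "\<i> * D_coord j g x"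
    have "(?\<phi> has_vector_derivative ?D) (at 0)" using vd[of x 0 UNIV] by simp
    hence l: "((\<lambda>h. norm (?\<phi> (0 + h) - ?\<phi> 0 - h *\<^sub>R ?D) / norm h) \<longlongrightarrow> 0) (at 0)"
      unfolding has_vector_derivative_def has_derivative_at by blast
    have f0: "filterlim \<tau> (at 0) sequentially"
      unfolding filterlim_at using \<tau>0 \<tau>(1) by (auto simp: less_imp_neq[symmetric] intro!: always_eventually)
    have "(\<lambda>n. norm (?\<phi> (0 + \<tau> n) - ?\<phi> 0 - \<tau> n *\<^sub>R ?D) / norm (\<tau> n)) \<longlonglongrightarrow> 0"
      by (rule filterlim_compose[OF l f0])
    moreover have "norm (?\<phi> (0 + \<tau> n) - ?\<phi> 0 - \<tau> n *\<^sub>R ?D) / norm (\<tau> n) = norm (q n x - ?D)" for n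
    proof -
      have "q n x - ?D = (?\<phi> (0 + \<tau> n) - ?\<phi> 0 - \<tau> n *\<^sub>R ?D) / of_real (\<tau> n)"
        using \<tau>(1)[of n] by (simp add: q_def scaleR_conv_of_real diff_divide_distrib)
      thus ?thesis by (simp add: norm_divide)
    qed
    ultimately have "(\<lambda>n. norm (q n x - ?D)) \<longlonglongrightarrow> 0" by simp
    thus ?thesis by (simp add: LIM_zero_cancel tendsto_norm_zero_iff)
  qed
  have fq: "fourier (q n) \<xi> = ((exp (\<i> * of_real (\<tau> n * \<xi> $ j)) - 1) / of_real (\<tau> n)) * fourier g \<xi>" for n
  proof -
    let ?t = "complex_of_real (inverse (\<tau> n))"
    have It: "integrable lborel (\<lambda>x. g (x + \<tau> n *\<^sub>R e))" using I by (simp add: lborel_integrable_translate)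
    have "q n = (\<lambda>x. ?t * (g (x + \<tau> n *\<^sub>R e) + (-1) * g x))"
      by (simp add: q_def fun_eq_iff divide_inverse mult.commute)
    hence "fourier (q n) \<xi> = ?t * (fourier (\<lambda>x. g (x + \<tau> n *\<^sub>R e)) \<xi> + (-1) * fourier g \<xi>)"
      using fourier_add[OF It integrable_mult_right[OF I, of "-1"], of \<xi>] by (simp only: fourier_cmult)
    also have "fourier (\<lambda>x. g (x + \<tau> n *\<^sub>R e)) \<xi> = exp (\<i> * of_real (\<tau> n * \<xi> $ j)) * fourier g \<xi>"
    proof -
      have "fourier (\<lambda>x. g (x - (- (\<tau> n *\<^sub>R e)))) \<xi> = exp (- \<i> * of_real ((- (\<tau> n *\<^sub>R e)) \<bullet> \<xi>)) * fourier g \<xi>"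
        by (rule fourier_translate)
      thus ?thesis by (simp add: e_def inner_axis')
    qed
    finally show ?thesis by (simp add: divide_inverse algebra_simps)
  qed
  have L1: "(\<lambda>n. fourier (q n) \<xi>) \<longlonglongrightarrow> fourier (\<lambda>x. \<i> * D_coord j g x) \<xi>"
    unfolding fourier_eq
  proof (intro tendsto_intros integral_dominated_convergence[where w="\<lambda>x. 2 ^ ?n * C * inverse ((1 + norm x) ^ ?n)"])
    have [measurable]: "g \<in> borel_measurable borel" "D_coord j g \<in> borel_measurable borel"
      by (intro borel_measurable_continuous_onI cg c)+
    show "(\<lambda>x. q n x * osc x \<xi>) \<in> borel_measurable lborel" for n
      unfolding q_def by measurable
    show "(\<lambda>x. \<i> * D_coord j g x * osc x \<xi>) \<in> borel_measurable lborel"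
      by measurable
    show "integrable lborel (\<lambda>x::real^'d. 2 ^ ?n * C * inverse ((1 + norm x) ^ ?n))"
      by (intro integrable_mult_right integrable_weight)
    show "AE x in lborel. (\<lambda>n. q n x * osc x \<xi>) \<longlonglongrightarrow> \<i> * D_coord j g x * osc x \<xi>"
      by (intro AE_I2 tendsto_intros ql)
    show "AE x in lborel. norm (q n x * osc x \<xi>) <= 2 ^ ?n * C * inverse ((1 + norm x) ^ ?n)" for n
      using qb[of n] by (intro AE_I2) (simp add: norm_mult)
  qed
  have L2: "(\<lambda>n. ((exp (\<i> * of_real (\<tau> n * \<xi> $ j)) - 1) / of_real (\<tau> n)) * fourier g \<xi>) \<longlonglongrightarrow> (\<i> * of_real (\<xi> $ j)) * fourier g \<xi>"
  proof (rule tendsto_mult[OF LIM_zero_cancel[OF tendsto_norm_zero_cancel] tendsto_const])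
    show "(\<lambda>n. norm ((exp (\<i> * of_real (\<tau> n * \<xi> $ j)) - 1) / of_real (\<tau> n) - \<i> * of_real (\<xi> $ j))) \<longlonglongrightarrow> 0"
    proof (rule Lim_null_comparison)
      have "norm ((exp (\<i> * of_real (\<tau> n * \<xi> $ j)) - 1) / of_real (\<tau> n) - \<i> * of_real (\<xi> $ j)) <= \<tau> n * (\<xi> $ j)\<^sup>2" for n
      proof -
        let ?y = "\<tau> n * \<xi> $ j"
        have "(exp (\<i> * of_real ?y) - 1) / of_real (\<tau> n) - \<i> * of_real (\<xi> $ j) = (exp (\<i> * of_real ?y) - 1 - \<i> * of_real ?y) / of_real (\<tau> n)"
          using \<tau>(1)[of n] by (simp add: diff_divide_distrib)
        moreover have "norm (exp (\<i> * of_real ?y) - 1 - \<i> * of_real ?y) <= ?y\<^sup>2"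
          using iexp_second_order[of "- ?y"] by simp
        ultimately have "norm ((exp (\<i> * of_real ?y) - 1) / of_real (\<tau> n) - \<i> * of_real (\<xi> $ j)) <= ?y\<^sup>2 / \<tau> n"
          using \<tau>(1)[of n] by (simp only: norm_divide norm_of_real) (simp add: divide_right_mono)
        also have "... = \<tau> n * (\<xi> $ j)\<^sup>2" using \<tau>(1)[of n] by (simp add: power2_eq_square)
        finally show ?thesis .
      qed
      thus "\<forall>\<^sub>F n in sequentially. norm (norm ((exp (\<i> * of_real (\<tau> n * \<xi> $ j)) - 1) / of_real (\<tau> n) - \<i> * of_real (\<xi> $ j))) <= \<tau> n * (\<xi> $ j)\<^sup>2"
        by simp
      show "(\<lambda>n. \<tau> n * (\<xi> $ j)\<^sup>2) \<longlonglongrightarrow> 0" using tendsto_mult_right[OF \<tau>0, of "(\<xi> $ j)\<^sup>2"] by simp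
    qed
  qed
  have "fourier (\<lambda>x. \<i> * D_coord j g x) \<xi> = (\<i> * of_real (\<xi> $ j)) * fourier g \<xi>"
    by (rule LIMSEQ_unique[OF L1 L2[folded fq]])
  thus ?thesis by (simp add: fourier_cmult)
qed

definition mi_single :: "'d::finite => nat => 'd => nat"
  where "mi_single j n = (\<lambda>i. if i = j then n else 0)"

lemma mi_list_single: "mi_list (mi_single j n) = replicate n j"
proof -
  let ?l = "mi_list (mi_single j n)"
  have "\<forall>y\<in>set ?l. y = j"
    using count_mi_list[of "mi_single j n"] by (metis count_list_0_iff mi_single_def)
  moreover have "length ?l = n" by (simp add: length_mi_list mi_length_def mi_single_def)
  ultimately show ?thesis by (metis replicate_length_same)
qed

lemma mi_single_simps:
  "mi_power x (mi_single j n) = (x $ j) ^ n" "mi_fact (mi_single j n) = fact n" "mi_length (mi_single j n) = n"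
  "D_multi (mi_single j n) f = wop (replicate n (Inr j)) f"
proof -
  show "mi_power x (mi_single j n) = (x $ j) ^ n" by (simp add: mi_power_mi_list mi_list_single prod_list_replicate)
  have "mi_fact (mi_single j n) = (\<Prod>i\<in>UNIV. if i = j then fact n else 1)"
    unfolding mi_fact_def mi_single_def by (rule prod.cong) auto
  thus "mi_fact (mi_single j n) = fact n" by simp
  show "mi_length (mi_single j n) = n" by (simp add: mi_length_def mi_single_def)
  show "D_multi (mi_single j n) f = wop (replicate n (Inr j)) f" by (simp add: D_multi_mi_list mi_list_single)
qed

text \<open>
  Repeated derivatives in one direction only: they already bound \<open>\<bar>\<xi>\<^sub>j\<bar>\<^sup>n\<close> times the transform, for each \<open>j\<close>.
\<close>

lemma schwartz_derivatives:
  fixes f :: "'d::finite fn"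
  assumes f: "f \<in> schwartz"
  shows "wop (replicate n (Inr j)) f differentiable at x"
    and "continuous_on UNIV (wop (replicate n (Inr j)) f)"
    and "rapid (wop (replicate n (Inr j)) f)"
    and "fourier (wop (replicate n (Inr j)) f) \<xi> = of_real (\<xi> $ j) ^ n * fourier f \<xi>"
proof -
  have sm: "smooth (wop (replicate n (Inr j)) f)" for n
  proof (induction n)
    case 0 thus ?case using f by (simp add: schwartz_def)
  next
    case (Suc n)
    have "Ck k (D_coord j g)" if "smooth g" for k and g :: "'d fn"
    proof -
      have cm: "Ck k (\<lambda>x. a * u x)" if "Ck k u" for k and a :: complex and u :: "'d fn"
        using that
      proof (induction k arbitrary: u)
        case 0 thus ?case by (simp add: continuous_on_mult_left)
      next
        case (Suc k)
        have "partial_deriv i (\<lambda>x. a * u x) = (\<lambda>x. a * partial_deriv i u x)" for i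
          using Suc.prems by (simp add: fun_eq_iff partial_deriv_cmult)
        thus ?case using Suc by simp
      qed
      have "Ck (Suc k) g" using that by (simp only: smooth_def)
      thus ?thesis unfolding D_coord_def by (intro cm) simp
    qed
    thus ?case using Suc by (simp add: smooth_def)
  qed
  have d: "wop (replicate n (Inr j)) f differentiable at x" for n x
    using sm[of n] unfolding smooth_def by (metis Ck.simps(2))
  have c: "continuous_on UNIV (wop (replicate n (Inr j)) f)" for n
    using sm[of n] unfolding smooth_def by (metis Ck.simps(1))
  have ra: "rapid (wop (replicate n (Inr j)) f)" for n
    unfolding rapid_def
  proof
    fix k
    have "\<exists>B. \<forall>x. \<bar>x $ i\<bar> ^ k' * norm (wop (replicate n (Inr j)) f x) <= B" for i k'
    proof -
      have "bdd_above (range (\<lambda>x. cmod (of_real (mi_power x (mi_single i k')) * D_multi (mi_single j n) f x)))"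
        by (rule f[unfolded schwartz_def, THEN CollectD, THEN conjunct2, rule_format])
      then obtain M where M: "\<And>x. cmod (of_real (mi_power x (mi_single i k')) * D_multi (mi_single j n) f x) <= M"
        unfolding bdd_above_def by blast
      have "\<bar>x $ i\<bar> ^ k' * norm (wop (replicate n (Inr j)) f x) <= M" for x
        using M[of x] unfolding mi_single_simps norm_mult norm_of_real power_abs .
      thus ?thesis by blast
    qed
    note exB = this
    define B where "B i k' = (SOME B. \<forall>x. \<bar>x $ i\<bar> ^ k' * norm (wop (replicate n (Inr j)) f x) <= B)" for i k'
    have B: "\<bar>x $ i\<bar> ^ k' * norm (wop (replicate n (Inr j)) f x) <= B i k'" for i k' x
      using someI_ex[OF exB[of i k']] unfolding B_def by blast
    define M where "M = (\<Sum>i\<in>UNIV. \<bar>B i k\<bar>) + (\<Sum>i\<in>UNIV. \<bar>B i 0\<bar>)"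
    have m1: "\<bar>B i k'\<bar> <= (\<Sum>i\<in>UNIV. \<bar>B i k'\<bar>)" for i k' by (rule member_le_sum) auto
    have m2: "(\<Sum>i\<in>UNIV. \<bar>B i k'\<bar>) >= 0" for k' by (rule sum_nonneg) simp
    have "(1 + norm x) ^ k * norm (wop (replicate n (Inr j)) f x) <= (2 * real CARD('d)) ^ k * ((1 + real CARD('d)) * M)" for x
    proof (rule component_decay)
      have "norm (wop (replicate n (Inr j)) f x) <= B j 0" using B[of x j 0] by simp
      also have "... <= \<bar>B j 0\<bar>" by simp
      also have "... <= M" unfolding M_def using m1[of j 0] m2[of k] by linarith
      finally show "norm (wop (replicate n (Inr j)) f x) <= M" .
      show "\<bar>x $ i\<bar> ^ k * norm (wop (replicate n (Inr j)) f x) <= M" for i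
      proof -
        have "\<bar>x $ i\<bar> ^ k * norm (wop (replicate n (Inr j)) f x) <= \<bar>B i k\<bar>" using B[of x i k] by simp
        also have "... <= M" unfolding M_def using m1[of i k] m2[of 0] by linarith
        finally show ?thesis .
      qed
    qed simp
    thus "\<exists>C. \<forall>x. (1 + norm x) ^ k * norm (wop (replicate n (Inr j)) f x) <= C" by blast
  qed
  show "wop (replicate n (Inr j)) f differentiable at x" by (rule d)
  show "continuous_on UNIV (wop (replicate n (Inr j)) f)" by (rule c)
  show "rapid (wop (replicate n (Inr j)) f)" by (rule ra)
  show "fourier (wop (replicate n (Inr j)) f) \<xi> = of_real (\<xi> $ j) ^ n * fourier f \<xi>"
  proof (induction n)
    case (Suc n)
    have "fourier (D_coord j (wop (replicate n (Inr j)) f)) \<xi> = of_real (\<xi> $ j) * fourier (wop (replicate n (Inr j)) f) \<xi>"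
      by (rule fourier_D_coord_general[OF d _ ra]) (use c[of "Suc n"] ra[of "Suc n"] in simp_all)
    thus ?case using Suc by simp
  qed simp
qed

lemma schwartz_imp_SS:
  fixes f :: "'d::finite fn"
  assumes f: "f \<in> schwartz"
  shows "f \<in> SS"
proof (rule SS_I)
  show "continuous_on UNIV f" using schwartz_derivatives(2)[OF f, of 0] by simp
  show "rapid f" using schwartz_derivatives(3)[OF f, of 0] by simp
  show "rapid (fourier f)"
    unfolding rapid_def
  proof
    fix k
    let ?B = "\<lambda>j n. fconst TYPE('d) * (LBINT x. norm (wop (replicate n (Inr j)) f x))"
    have B0: "?B j n >= 0" for j n
      using fconst_pos[where 'd='d] by (intro mult_nonneg_nonneg Bochner_Integration.integral_nonneg) auto
    have B: "\<bar>\<xi> $ j\<bar> ^ n * norm (fourier f \<xi>) <= ?B j n" for \<xi> j n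
      using norm_fourier_le[of "wop (replicate n (Inr j)) f" \<xi>]
      unfolding schwartz_derivatives(4)[OF f] norm_mult norm_power norm_of_real .
    define M where "M = (\<Sum>j\<in>UNIV. ?B j k) + (\<Sum>j\<in>UNIV. ?B j 0)"
    have m1: "?B i k' <= (\<Sum>i\<in>UNIV. ?B i k')" for i k' by (rule member_le_sum) (use B0 in auto)
    have m2: "(\<Sum>i\<in>UNIV. ?B i k') >= 0" for k' by (rule sum_nonneg) (rule B0)
    have "(1 + norm \<xi>) ^ k * norm (fourier f \<xi>) <= (2 * real CARD('d)) ^ k * ((1 + real CARD('d)) * M)" for \<xi>
    proof (rule component_decay)
      show "norm (fourier f \<xi>) <= M"
        using B[of \<xi> undefined 0] m1[where i=undefined and k'=0] m2[of k] unfolding M_def power_0 mult_1 by linarith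
      show "\<bar>\<xi> $ i\<bar> ^ k * norm (fourier f \<xi>) <= M" for i
        using B[of \<xi> i k] m1[where i=i and k'=k] m2[of 0] unfolding M_def by linarith
    qed simp
    thus "\<exists>C. \<forall>\<xi>. (1 + norm \<xi>) ^ k * norm (fourier f \<xi>) <= C" by blast
  qed
qed

lemma SS_imp_schwartz:
  assumes f: "f \<in> SS" shows "f \<in> schwartz"
  unfolding schwartz_def
proof (intro CollectI conjI allI)
  show "smooth f" by (rule SS_smooth[OF f])
  fix \<alpha> \<beta>
  obtain B where "\<And>x. norm (wop (map Inl (mi_list \<alpha>) @ map Inr (mi_list \<beta>)) f x) <= B"
    using rapid_bounded[OF SS_rapid[OF wop_SS[OF f]]] by metis
  hence "cmod (of_real (mi_power x \<alpha>) * D_multi \<beta> f x) <= B" for x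
    by (simp only: monomial_derivative_wop)
  thus "bdd_above (range (\<lambda>x. cmod (of_real (mi_power x \<alpha>) * D_multi \<beta> f x)))"
    by (intro bdd_aboveI2)
qed

theorem schwartz_eq_SS: "schwartz = SS"
  using schwartz_imp_SS SS_imp_schwartz by blast

lemma gs_quotient_le_norm:
  assumes "f \<in> gs r s" "h > 0" shows "gs_quotient r s h f z <= gs_norm r s h f"
  unfolding gs_norm_def by (rule cSUP_upper) (use assms in \<open>auto simp: gs_def gs_banach_def\<close>)

lemma gs_moment_le:
  assumes "f \<in> gs r s" "h > 0"
  shows "cmod (of_real (mi_power x \<alpha>) * D_multi \<beta> f x) <=
     gs_norm r s h f * (h ^ (mi_length \<alpha> + mi_length \<beta>) * mi_fact \<alpha> powr r * mi_fact \<beta> powr s)"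
proof -
  have "mi_length (\<lambda>i. \<alpha> i + \<beta> i) = mi_length \<alpha> + mi_length \<beta>" by (simp add: mi_length_def sum.distrib)
  thus ?thesis
    using gs_quotient_le_norm[OF assms, of "(x, \<alpha>, \<beta>)"] assms(2) mi_fact_pos[of \<alpha>] mi_fact_pos[of \<beta>]
    by (simp add: gs_quotient_def pos_divide_le_eq)
qed

lemma gs_imp_SS:
  fixes f :: "'d::finite fn"
  assumes f: "f \<in> gs r s" shows "f \<in> SS"
proof (rule schwartz_imp_SS)
  show "f \<in> schwartz" unfolding schwartz_def
  proof (intro CollectI conjI allI)
    have "f \<in> gs_banach r s 1" using f unfolding gs_def by (rule INT_D) simp
    thus "smooth f" by (simp add: gs_banach_def)
    show "bdd_above (range (\<lambda>x. cmod (of_real (mi_power x \<alpha>) * D_multi \<beta> f x)))" for \<alpha> \<beta>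
      by (rule bdd_aboveI2, rule gs_moment_le[OF f zero_less_one])
  qed
qed

lemma gs_norm_nonneg: "f \<in> gs r s ==> h > 0 ==> gs_norm r s h f >= 0"
proof -
  assume f: "f \<in> gs r s" "h > 0"
  have "0 <= gs_quotient r s h f (0, \<lambda>_. 0, \<lambda>_. 0)" using f(2) by (simp add: gs_quotient_def)
  thus ?thesis using gs_quotient_le_norm[OF f] by (rule order_trans)
qed

text \<open>
  Some coordinate of \<open>x\<close> is at least \<open>\<bar>x\<bar> / d\<close> in modulus; its moments determine the decay.
\<close>

lemma ew_from_component:
  fixes x :: "real^'d::finite"
  assumes q: "q > 0" and H: "H > 0" and A: "A >= 0" 
    and m: "\<And>j N. \<bar>x $ j\<bar> ^ N * v <= A * ((H powr (- q) / (exp 1 * real CARD('d))) ^ N * fact N powr q)"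
  shows "v <= exp 1 * A * ew q H x"
proof -
  let ?d = "real CARD('d)"
  let ?h = "H powr (- q) / (exp 1 * ?d)"
  have h: "?h > 0" using H by simp
  obtain j where j: "norm x <= ?d * \<bar>x $ j\<bar>"
  proof -
    define m where "m = Max (range (\<lambda>j. \<bar>x $ j\<bar>))"
    have m: "\<bar>x $ j\<bar> <= m" for j unfolding m_def by (intro Max_ge) auto
    have "m \<in> range (\<lambda>j. \<bar>x $ j\<bar>)" unfolding m_def by (intro Max_in) auto
    then obtain j0 where j0: "m = \<bar>x $ j0\<bar>" by auto
    have "norm x <= (\<Sum>j\<in>UNIV. \<bar>x $ j\<bar>)" by (rule norm_le_l1_cart)
    also have "... <= (\<Sum>j\<in>(UNIV::'d set). m)" by (intro sum_mono m)
    finally show ?thesis using that[of j0] j0 by simp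
  qed
  have "v <= exp 1 * A * exp (- ((\<bar>x $ j\<bar> / (exp 1 * ?h)) powr (1 / q)))"
    by (rule decay_from_moments[OF _ h q A m]) simp
  also have "... <= exp 1 * A * ew q H x"
  proof -
    have e: "\<bar>x $ j\<bar> / (exp 1 * ?h) = ?d * \<bar>x $ j\<bar> * H powr q"
      by (simp add: powr_minus field_simps)
    have "H * norm x powr (1 / q) = (norm x * H powr q) powr (1 / q)"
      using H q by (subst powr_mult) (auto simp: powr_powr)
    also have "... <= (?d * \<bar>x $ j\<bar> * H powr q) powr (1 / q)"
      using j q by (intro powr_mono2 mult_right_mono) auto
    finally show ?thesis unfolding e ew_def using A by (intro mult_left_mono) auto
  qed
  finally show ?thesis .
qed

lemma gs_imp_bnd:
  assumes r: "r > 0" and s: "s > 0" and H: "H > 0"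
  obtains h C where "h > 0" "C > 0"
    "\<And>f. f \<in> (gs r s :: 'd::finite fn set) ==> bnd r s H (C * gs_norm r s h f) f"
proof -
  let ?d = "CARD('d)"
  let ?hr = "H powr (- r) / (exp 1 * real ?d)" and ?hs = "H powr (- s) / (exp 1 * real ?d)"
  define h where "h = min ?hr ?hs"
  have h: "h > 0" "h <= ?hr" "h <= ?hs" using H by (auto simp: h_def)
  let ?I = "LBINT x. inverse ((1 + norm (x::real^'d)) ^ (2 * ?d))"
  have I0: "?I >= 0" by (intro Bochner_Integration.integral_nonneg) simp
  define K where "K = (2 * real ?d) ^ (2 * ?d) * ((1 + real ?d) * (1 + h ^ (2 * ?d) * fact (2 * ?d) powr r))"
  have K0: "K >= 0" unfolding K_def using h by simp
  define D where "D = fconst TYPE('d) * K * ?I"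
  have D0: "D >= 0" unfolding D_def using K0 I0 fconst_pos[where 'd='d] by simp
  show ?thesis
  proof (rule that[OF h(1)])
    show "exp 1 * (1 + D) > 0" using D0 by (simp add: add_pos_nonneg)
    fix f :: "'d fn" assume f: "f \<in> gs r s"
    have sf: "f \<in> schwartz" using SS_imp_schwartz[OF gs_imp_SS[OF f]] .
    let ?n = "gs_norm r s h f"
    have n0: "?n >= 0" by (rule gs_norm_nonneg[OF f h(1)])
    have mom: "\<bar>x $ i\<bar> ^ k * norm (wop (replicate n (Inr j)) f x) <= ?n * (h ^ (k + n) * fact k powr r * fact n powr s)" for x i j k n
      using gs_moment_le[OF f h(1), of x "mi_single i k" "mi_single j n"]
      unfolding mi_single_simps norm_mult norm_of_real power_abs by (simp add: mult.assoc)
    show "bnd r s H (exp 1 * (1 + D) * ?n) f"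
      unfolding bnd_def
    proof (intro conjI allI)
      fix x :: "real^'d"
      have "norm (f x) <= exp 1 * ?n * ew r H x"
      proof (rule ew_from_component[OF r H n0])
        fix j N
        have "\<bar>x $ j\<bar> ^ N * norm (f x) <= ?n * (h ^ N * fact N powr r)" using mom[of x j N 0 j] by simp
        also have "... <= ?n * (?hr ^ N * fact N powr r)"
          using h n0 by (intro mult_left_mono mult_right_mono power_mono) auto
        finally show "\<bar>x $ j\<bar> ^ N * norm (f x) <= ?n * (?hr ^ N * fact N powr r)" .
      qed
      also have "... <= exp 1 * (1 + D) * ?n * ew r H x"
        using D0 n0 by (intro mult_right_mono) auto
      finally show "norm (f x) <= exp 1 * (1 + D) * ?n * ew r H x" .
    next
      fix \<xi> :: "real^'d"
      have "norm (fourier f \<xi>) <= exp 1 * (D * ?n) * ew s H \<xi>"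
      proof (rule ew_from_component[OF s H])
        show "0 <= D * ?n" using D0 n0 by simp
        fix j N
        let ?g = "wop (replicate N (Inr j)) f"
        let ?B = "K * ?n * (h ^ N * fact N powr s)"
        have dec: "(1 + norm x) ^ (2 * ?d) * norm (?g x) <= ?B" for x
        proof -
          have "(1 + norm x) ^ (2 * ?d) * norm (?g x) <= (2 * real ?d) ^ (2 * ?d) *
             ((1 + real ?d) * ((1 + h ^ (2 * ?d) * fact (2 * ?d) powr r) * (?n * (h ^ N * fact N powr s))))"
          proof (rule component_decay)
            have p: "0 <= h ^ (2 * ?d) * fact (2 * ?d) powr r * (?n * (h ^ N * fact N powr s))"
              "0 <= ?n * (h ^ N * fact N powr s)" using h n0 by simp_all
            show "norm (?g x) <= (1 + h ^ (2 * ?d) * fact (2 * ?d) powr r) * (?n * (h ^ N * fact N powr s))"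
            proof -
              have "norm (?g x) <= ?n * (h ^ N * fact N powr s)" using mom[of x j 0 N j] by simp
              thus ?thesis using p unfolding distrib_right mult_1 by linarith
            qed
            show "\<bar>x $ i\<bar> ^ (2 * ?d) * norm (?g x) <= (1 + h ^ (2 * ?d) * fact (2 * ?d) powr r) * (?n * (h ^ N * fact N powr s))" for i
            proof -
              have "\<bar>x $ i\<bar> ^ (2 * ?d) * norm (?g x) <= h ^ (2 * ?d) * fact (2 * ?d) powr r * (?n * (h ^ N * fact N powr s))"
                using mom[of x i "2 * ?d" N j] by (simp add: power_add mult_ac)
              thus ?thesis using p unfolding distrib_right mult_1 by linarith
            qed
          qed simp
          thus ?thesis by (simp add: K_def mult_ac)
        qed
        have mg: "?g \<in> borel_measurable borel"
          by (intro borel_measurable_continuous_onI schwartz_derivatives(2)[OF sf])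
        have "\<bar>\<xi> $ j\<bar> ^ N * norm (fourier f \<xi>) = norm (fourier ?g \<xi>)"
          unfolding schwartz_derivatives(4)[OF sf] norm_mult norm_power norm_of_real ..
        also have "... <= fconst TYPE('d) * (?B * ?I)"
          by (rule order_trans[OF norm_fourier_le], rule mult_left_mono[OF integrable_decay(2)[OF mg dec]])
             (use fconst_pos[where 'd='d] in simp)
        also have "... = D * ?n * (h ^ N * fact N powr s)" by (simp add: D_def mult_ac)
        also have "... <= D * ?n * (?hs ^ N * fact N powr s)"
          using h D0 n0 by (intro mult_left_mono mult_right_mono power_mono) auto
        finally show "\<bar>\<xi> $ j\<bar> ^ N * norm (fourier f \<xi>) <= D * ?n * (?hs ^ N * fact N powr s)" .
      qed
      also have "... <= exp 1 * (1 + D) * ?n * ew s H \<xi>"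
        using D0 n0 by (intro mult_right_mono) (auto simp: algebra_simps)
      finally show "norm (fourier f \<xi>) <= exp 1 * (1 + D) * ?n * ew s H \<xi>" .
    qed
  qed
qed

section \<open>Decay of the propagated function\<close>

definition mon :: "'d::finite list => real^'d => real"
  where "mon l \<eta> = prod_list (map (\<lambda>i. \<eta> $ i) l)"

lemma mon_simps [simp]: "mon [] \<eta> = 1" "mon (i # l) \<eta> = \<eta> $ i * mon l \<eta>"
  by (simp_all add: mon_def)

text \<open>
  Polynomials as lists of coefficients and words of indices, so that substituting \<open>D\<close> for the variables
  gives words in the sense of \<open>wop\<close>. The value \<open>maj ps \<rho>\<close> bounds the polynomial for \<open>\<bar>\<eta>\<bar> \<le> \<rho>\<close> together with every
  such substitution.
\<close>

definition pl :: "(real \<times> 'd::finite list) list => real^'d => real"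
  where "pl ps \<eta> = (\<Sum>(b, l)\<leftarrow>ps. b * mon l \<eta>)"

definition maj :: "(real \<times> 'd list) list => real => real"
  where "maj ps \<rho> = (\<Sum>(b, l)\<leftarrow>ps. \<bar>b\<bar> * \<rho> ^ length l)"

lemma pl_simps [simp]: "pl [] \<eta> = 0" "pl ((b, l) # ps) \<eta> = b * mon l \<eta> + pl ps \<eta>" "pl (ps @ qs) \<eta> = pl ps \<eta> + pl qs \<eta>"
  by (simp_all add: pl_def)

lemma maj_simps [simp]: "maj [] \<rho> = 0" "maj ((b, l) # ps) \<rho> = \<bar>b\<bar> * \<rho> ^ length l + maj ps \<rho>" "maj (ps @ qs) \<rho> = maj ps \<rho> + maj qs \<rho>"
  by (simp_all add: maj_def)

lemma maj_nonneg: "\<rho> >= 0 ==> maj ps \<rho> >= 0"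
  by (induction ps) auto

lemma pl_scale: "pl (map (\<lambda>(b, l). (a * b, l)) ps) \<eta> = a * pl ps \<eta>"
  by (induction ps) (auto simp: algebra_simps)
lemma maj_scale: "maj (map (\<lambda>(b, l). (a * b, l)) ps) \<rho> = \<bar>a\<bar> * maj ps \<rho>"
  by (induction ps) (auto simp: algebra_simps abs_mult)
lemma pl_cons_map: "pl (map (\<lambda>(b, l). (b, i # l)) ps) \<eta> = \<eta> $ i * pl ps \<eta>"
  by (induction ps) (auto simp: algebra_simps)
lemma maj_cons_map: "maj (map (\<lambda>(b, l). (b, i # l)) ps) \<rho> = \<rho> * maj ps \<rho>"
  by (induction ps) (auto simp: algebra_simps)

text \<open>
  Without a constant term, shrinking the radius by \<open>\<theta>\<close> gains a factor \<open>\<theta>\<close>.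
\<close>

lemma maj_contract:
  assumes "0 <= \<theta>" "\<theta> <= 1" "\<rho> >= 0" "\<And>b l. (b, l) \<in> set ps ==> length l >= 1"
  shows "maj ps (\<theta> * \<rho>) <= \<theta> * maj ps \<rho>"
  using assms(4)
proof (induction ps)
  case (Cons a ps)
  obtain b l where a: "a = (b, l)" by (cases a)
  have l: "length l >= 1" using Cons.prems a by auto
  have "\<theta> ^ length l <= \<theta> ^ 1" using l assms by (intro power_decreasing) auto
  hence "\<bar>b\<bar> * (\<theta> * \<rho>) ^ length l <= \<theta> * (\<bar>b\<bar> * \<rho> ^ length l)"
    using assms by (simp add: power_mult_distrib mult_left_mono mult_right_mono mult.left_commute[of \<theta>])
  moreover have "maj ps (\<theta> * \<rho>) <= \<theta> * maj ps \<rho>" using Cons by auto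
  ultimately show ?case by (simp add: a distrib_left add_mono)
qed simp

text \<open>
  The expansion of \<open>mon l (\<xi> + \<eta>) - mon l \<xi>\<close> in powers of \<open>\<eta>\<close>; it has no constant term.
\<close>

fun shift_mon :: "real^'d::finite => 'd list => (real \<times> 'd list) list" where
  "shift_mon \<xi> [] = []"
| "shift_mon \<xi> (i # l) = map (\<lambda>(b, k). (\<xi> $ i * b, k)) (shift_mon \<xi> l) @ map (\<lambda>(b, k). (b, i # k)) (shift_mon \<xi> l) @ [(mon l \<xi>, [i])]"

lemma pl_shift_mon: "pl (shift_mon \<xi> l) \<eta> = mon l (\<xi> + \<eta>) - mon l \<xi>"
  by (induction l) (simp_all add: pl_scale pl_cons_map, simp add: algebra_simps)

lemma shift_mon_length: "(b, k) \<in> set (shift_mon \<xi> l) ==> 1 <= length k \<and> length k <= length l"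
  by (induction l arbitrary: b k) fastforce+

lemma abs_mon_le: "\<bar>mon l \<xi>\<bar> <= norm \<xi> ^ length l"
  using abs_prod_list_component_le[of \<xi> l] by (simp add: mon_def)

lemma maj_shift_mon:
  assumes "\<rho> >= norm \<xi>" shows "maj (shift_mon \<xi> l) \<rho> <= (2 ^ length l - 1) * \<rho> ^ length l"
proof (induction l)
  case Nil thus ?case by simp
next
  case (Cons i l)
  have \<rho>: "\<rho> >= 0" using assms norm_ge_zero order_trans by blast
  have "maj (shift_mon \<xi> (i # l)) \<rho> = (\<bar>\<xi> $ i\<bar> + \<rho>) * maj (shift_mon \<xi> l) \<rho> + \<bar>mon l \<xi>\<bar> * \<rho>"
    by (simp add: maj_scale maj_cons_map) (simp add: algebra_simps)
  also have "... <= (\<rho> + \<rho>) * ((2 ^ length l - 1) * \<rho> ^ length l) + \<rho> ^ length l * \<rho>"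
    using assms component_le_norm_cart[of \<xi> i] \<rho> abs_mon_le[of l \<xi>]
    by (intro add_mono mult_mono Cons) (auto intro: order_trans[OF _ power_mono] maj_nonneg)
  also have "... = (2 ^ length (i # l) - 1) * \<rho> ^ length (i # l)" by (simp add: algebra_simps)
  finally show ?case .
qed

lemma mon_has_derivative:
  "(mon l has_derivative (\<lambda>v. \<Sum>j\<in>UNIV. v $ j * (real (count_list l j) * mon (remove1 j l) \<eta>))) (at \<eta>)"
proof (induction l)
  case Nil thus ?case by (simp add: mon_def[abs_def])
next
  case (Cons i l)
  have "((\<lambda>\<eta>. \<eta> $ i * mon l \<eta>) has_derivative
      (\<lambda>v. \<eta> $ i * (\<Sum>j\<in>UNIV. v $ j * (real (count_list l j) * mon (remove1 j l) \<eta>)) + v $ i * mon l \<eta>)) (at \<eta>)"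
    by (rule has_derivative_mult[OF bounded_linear_imp_has_derivative[OF bounded_linear_vec_nth] Cons])
  moreover have "\<eta> $ i * (\<Sum>j\<in>UNIV. v $ j * (real (count_list l j) * mon (remove1 j l) \<eta>)) + v $ i * mon l \<eta>
     = (\<Sum>j\<in>UNIV. v $ j * (real (count_list (i # l) j) * mon (remove1 j (i # l)) \<eta>))" for v
  proof -
    have 2: "count_list l j > 0 ==> \<eta> $ j * mon (remove1 j l) \<eta> = mon l \<eta>" for l j
      by (induction l) (auto split: if_splits simp: mult.left_commute)
    have 3: "\<eta> $ i * (real (count_list l i) * mon (remove1 i l) \<eta>) = real (count_list l i) * mon l \<eta>"
      using 2[of l i] by (cases "count_list l i = 0") auto
    have "v $ j * (real (count_list (i # l) j) * mon (remove1 j (i # l)) \<eta>) =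
        \<eta> $ i * (v $ j * (real (count_list l j) * mon (remove1 j l) \<eta>)) + (if j = i then v $ i * mon l \<eta> else 0)" for j
      using 3 by (auto simp: algebra_simps)
    hence "(\<Sum>j\<in>UNIV. v $ j * (real (count_list (i # l) j) * mon (remove1 j (i # l)) \<eta>)) =
       (\<Sum>j\<in>UNIV. \<eta> $ i * (v $ j * (real (count_list l j) * mon (remove1 j l) \<eta>))) + (\<Sum>j\<in>UNIV. if j = i then v $ i * mon l \<eta> else 0)"
      by (simp only: sum.distrib)
    thus ?thesis by (simp add: sum_distrib_left)
  qed
  ultimately show ?case by (simp add: mon_def[abs_def] del: remove1.simps count_list.simps)
qed

lemma finite_mi_le: "finite {\<alpha> :: 'd::finite => nat. mi_length \<alpha> <= m}"
proof (rule finite_subset)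
  show "{\<alpha> :: 'd => nat. mi_length \<alpha> <= m} \<subseteq> (\<Pi>\<^sub>E i\<in>UNIV. {..m})"
  proof (auto simp: PiE_def)
    fix \<alpha> :: "'d => nat" and i
    assume "mi_length \<alpha> <= m"
    moreover have "\<alpha> i <= mi_length \<alpha>" unfolding mi_length_def by (rule member_le_sum) auto
    ultimately show "\<alpha> i <= m" by simp
  qed
  show "finite (\<Pi>\<^sub>E i\<in>(UNIV::'d set). {..m})" by (intro finite_PiE) auto
qed

definition psum :: "(('d::finite => nat) => real) => ('d => nat) set => real^'d => real"
  where "psum c A \<xi> = (\<Sum>\<alpha>\<in>A. c \<alpha> * mon (mi_list \<alpha>) \<xi>)"

definition dpsum :: "(('d::finite => nat) => real) => ('d => nat) set => 'd => real^'d => real"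
  where "dpsum c A j \<xi> = (\<Sum>\<alpha>\<in>A. (c \<alpha> * real (\<alpha> j)) * mon (remove1 j (mi_list \<alpha>)) \<xi>)"

lemma poly_fun_psum: "poly_fun c m = psum c {\<alpha>. mi_length \<alpha> <= m}"
  by (simp add: fun_eq_iff poly_fun_def psum_def mon_def mi_power_mi_list)

lemma principal_part_psum: "principal_part c m = psum c {\<alpha>. mi_length \<alpha> = m}"
  by (simp add: fun_eq_iff principal_part_def psum_def mon_def mi_power_mi_list)

lemma psum_has_derivative:
  "(psum c A has_derivative (\<lambda>v. \<Sum>j\<in>UNIV. v $ j * dpsum c A j \<xi>)) (at \<xi>)"
proof -
  have "((\<lambda>\<xi>. \<Sum>\<alpha>\<in>A. c \<alpha> * mon (mi_list \<alpha>) \<xi>) has_derivative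
    (\<lambda>v. \<Sum>\<alpha>\<in>A. c \<alpha> * (\<Sum>j\<in>UNIV. v $ j * (real (count_list (mi_list \<alpha>) j) * mon (remove1 j (mi_list \<alpha>)) \<xi>)))) (at \<xi>)"
    by (intro has_derivative_sum has_derivative_mult_right mon_has_derivative)
  moreover have "(\<Sum>\<alpha>\<in>A. c \<alpha> * (\<Sum>j\<in>UNIV. v $ j * (real (count_list (mi_list \<alpha>) j) * mon (remove1 j (mi_list \<alpha>)) \<xi>)))
      = (\<Sum>j\<in>UNIV. v $ j * dpsum c A j \<xi>)" for v
    unfolding dpsum_def sum_distrib_left count_mi_list
    by (subst sum.swap) (simp add: mult_ac)
  ultimately show ?thesis by (simp add: psum_def[abs_def])
qed

lemma grad_psum: "grad (psum c A) \<xi> $ j = dpsum c A j \<xi>"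
proof -
  have "partial_deriv j (psum c A) \<xi> = (\<Sum>i\<in>UNIV. axis j 1 $ i * dpsum c A i \<xi>)"
    by (rule partial_derivI[OF psum_has_derivative])
  also have "... = (\<Sum>i\<in>UNIV. if i = j then dpsum c A i \<xi> else 0)"
    by (rule sum.cong) (auto simp: axis_def)
  finally show ?thesis by (simp add: grad_def)
qed

text \<open>
  The part of the phase beyond the linear Taylor polynomial at \<open>\<xi>\<close>.
\<close>

definition remainder :: "(('d::finite => nat) => real) => nat => real^'d => real^'d => real"
  where "remainder c m \<xi> \<eta> = poly_fun c m (\<xi> + \<eta>) - poly_fun c m \<xi> - grad (poly_fun c m) \<xi> \<bullet> \<eta>"

text \<open>
  The gradient of \<open>q\<close> is given by the polynomials \<open>pl (qs j)\<close> without constant term and of degree at most \<open>m\<close>.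
  Beyond the radius \<open>\<rho>0\<close> their majorants are controlled by \<open>B\<close> alone, however large the coefficients are.
\<close>

definition good_phase :: "nat => real => real => (real^'d::finite => real) => ('d => (real \<times> 'd list) list) => bool"
  where "good_phase m B \<rho>0 q qs \<longleftrightarrow>
    (\<forall>j. \<forall>(b, l)\<in>set (qs j). 1 <= length l \<and> length l <= m) \<and>
    (\<forall>j. \<forall>\<rho>\<ge>\<rho>0. maj (qs j) \<rho> <= B * \<rho> ^ m) \<and>
    (\<forall>\<eta>. (q has_derivative (\<lambda>v. \<Sum>j\<in>UNIV. v $ j * pl (qs j) \<eta>)) (at \<eta>))"

text \<open>
  The gradient of the remainder is \<open>\<nabla>p(\<xi> + \<eta>) - \<nabla>p(\<xi>)\<close>. Its coefficients are bounded by powers of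
  \<open>\<bar>\<xi>\<bar>\<close>, which radii above \<open>1 + \<bar>\<xi>\<bar>\<close> dominate.
\<close>

lemma remainder_good_phase:
  fixes c :: "('d::finite => nat) => real"
  obtains B where "B >= 0" "\<And>\<xi>. \<exists>qs. good_phase (m - 1) B (1 + norm \<xi>) (remainder c m \<xi>) qs"
proof -
  let ?A = "{\<alpha> :: 'd => nat. mi_length \<alpha> <= m}"
  obtain as where as: "set as = ?A" "distinct as" using finite_distinct_list[OF finite_mi_le] by blast
  define qa where "qa \<xi> j \<alpha> = (if \<alpha> j = 0 then [] else
     map (\<lambda>(b, l). ((c \<alpha> * real (\<alpha> j)) * b, l)) (shift_mon \<xi> (remove1 j (mi_list \<alpha>))))" for \<xi> j \<alpha>
  define qs where "qs \<xi> j = concat (map (qa \<xi> j) as)" for \<xi> j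
  define B where "B = (\<Sum>\<alpha>\<leftarrow>as. \<Sum>j\<in>UNIV. \<bar>c \<alpha> * real (\<alpha> j)\<bar> * 2 ^ m)"
  have mem: "\<alpha> j \<noteq> 0 ==> j \<in> set (mi_list \<alpha>)" for \<alpha> :: "'d => nat" and j
    using count_mi_list[of \<alpha> j] by (metis count_list_0_iff)
  have len: "length (remove1 j (mi_list \<alpha>)) <= m - 1" if "\<alpha> \<in> ?A" "\<alpha> j \<noteq> 0" for \<alpha> j
    using that mem[of \<alpha> j] by (auto simp: length_remove1 length_mi_list)
  have plc: "pl (concat (map f xs)) \<eta> = (\<Sum>\<alpha>\<leftarrow>xs. pl (f \<alpha>) \<eta>)" for f :: "('d => nat) => _" and xs \<eta>
    by (induction xs) auto
  have majc: "maj (concat (map f xs)) \<eta> = (\<Sum>\<alpha>\<leftarrow>xs. maj (f \<alpha>) \<eta>)" for f :: "('d => nat) => (real \<times> 'd list) list" and xs \<eta>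
    by (induction xs) auto
  have plq: "pl (qs \<xi> j) \<eta> = dpsum c ?A j (\<xi> + \<eta>) - dpsum c ?A j \<xi>" for \<xi> j \<eta>
  proof -
    have "pl (qa \<xi> j \<alpha>) \<eta> = (c \<alpha> * real (\<alpha> j)) * (mon (remove1 j (mi_list \<alpha>)) (\<xi> + \<eta>) - mon (remove1 j (mi_list \<alpha>)) \<xi>)" for \<alpha>
      unfolding qa_def by (simp add: pl_scale pl_shift_mon)
    hence "pl (qs \<xi> j) \<eta> = (\<Sum>\<alpha>\<in>?A. (c \<alpha> * real (\<alpha> j)) * (mon (remove1 j (mi_list \<alpha>)) (\<xi> + \<eta>) - mon (remove1 j (mi_list \<alpha>)) \<xi>))"
      unfolding qs_def plc using as by (simp add: sum_list_distinct_conv_sum_set)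
    thus ?thesis by (simp add: dpsum_def sum_subtractf right_diff_distrib)
  qed
  have len_qs: "1 <= length l \<and> length l <= m - 1" if bl: "(b, l) \<in> set (qs \<xi> j)" for b l \<xi> j
  proof -
    from bl obtain \<alpha> where \<alpha>: "\<alpha> \<in> ?A" "(b, l) \<in> set (qa \<xi> j \<alpha>)" unfolding qs_def using as(1) by auto
    hence nz: "\<alpha> j \<noteq> 0" by (auto simp: qa_def split: if_splits)
    from \<alpha>(2) nz obtain b' where "(b', l) \<in> set (shift_mon \<xi> (remove1 j (mi_list \<alpha>)))" by (auto simp: qa_def)
    from shift_mon_length[OF this] len[of \<alpha> j] \<alpha>(1) nz show ?thesis by linarith
  qed
  have m1: "maj (qs \<xi> j) \<rho> <= B * \<rho> ^ (m - 1)" if \<rho>: "\<rho> >= 1 + norm \<xi>" for \<xi> j \<rho>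
  proof -
    have \<rho>': "\<rho> >= 1" "\<rho> >= norm \<xi>" using \<rho> norm_ge_zero[of \<xi>] by linarith+
    have "maj (qa \<xi> j \<alpha>) \<rho> <= (\<Sum>j\<in>UNIV. \<bar>c \<alpha> * real (\<alpha> j)\<bar> * 2 ^ m) * \<rho> ^ (m - 1)" if \<alpha>: "\<alpha> \<in> set as" for \<alpha>
    proof (cases "\<alpha> j = 0")
      case True
      thus ?thesis using \<rho>' by (simp add: qa_def sum_nonneg)
    next
      case False
      let ?l = "remove1 j (mi_list \<alpha>)"
      have l: "length ?l <= m - 1" using len[of \<alpha> j] False \<alpha> as by blast
      have "maj (shift_mon \<xi> ?l) \<rho> <= (2 ^ length ?l - 1) * \<rho> ^ length ?l" by (rule maj_shift_mon[OF \<rho>'(2)])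
      also have "... <= 2 ^ m * \<rho> ^ (m - 1)"
      proof (intro mult_mono)
        have "(2::real) ^ length ?l <= 2 ^ m" using l by (intro power_increasing) auto
        thus "(2::real) ^ length ?l - 1 <= 2 ^ m" by linarith
        show "\<rho> ^ length ?l <= \<rho> ^ (m - 1)" using l \<rho>' by (intro power_increasing) auto
      qed (use \<rho>' in auto)
      finally have "maj (qa \<xi> j \<alpha>) \<rho> <= \<bar>c \<alpha> * real (\<alpha> j)\<bar> * (2 ^ m * \<rho> ^ (m - 1))"
        unfolding qa_def using False by (simp add: maj_scale mult_left_mono)
      also have "... = \<bar>c \<alpha> * real (\<alpha> j)\<bar> * 2 ^ m * \<rho> ^ (m - 1)" by simp
      also have "... <= (\<Sum>j\<in>UNIV. \<bar>c \<alpha> * real (\<alpha> j)\<bar> * 2 ^ m) * \<rho> ^ (m - 1)"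
        using \<rho>' by (intro mult_right_mono member_le_sum) auto
      finally show ?thesis .
    qed
    hence "(\<Sum>\<alpha>\<leftarrow>as. maj (qa \<xi> j \<alpha>) \<rho>) <= (\<Sum>\<alpha>\<leftarrow>as. (\<Sum>j\<in>UNIV. \<bar>c \<alpha> * real (\<alpha> j)\<bar> * 2 ^ m) * \<rho> ^ (m - 1))"
      by (intro sum_list_mono) auto
    thus ?thesis unfolding qs_def majc B_def by (simp add: sum_list_mult_const)
  qed
  have der: "(remainder c m \<xi> has_derivative (\<lambda>v. \<Sum>j\<in>UNIV. v $ j * pl (qs \<xi> j) \<eta>)) (at \<eta>)" for \<xi> \<eta>
  proof -
    have 1: "((\<lambda>\<eta>. psum c ?A (\<xi> + \<eta>)) has_derivative (\<lambda>v. \<Sum>j\<in>UNIV. v $ j * dpsum c ?A j (\<xi> + \<eta>))) (at \<eta>)"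
      by (rule has_derivative_compose[of "\<lambda>\<eta>. \<xi> + \<eta>" "\<lambda>v. v", OF _ psum_has_derivative]) (auto intro!: derivative_eq_intros)
    have 2: "((\<lambda>\<eta>. grad (psum c ?A) \<xi> \<bullet> \<eta>) has_derivative (\<lambda>v. grad (psum c ?A) \<xi> \<bullet> v)) (at \<eta>)"
      by (intro bounded_linear_imp_has_derivative bounded_linear_inner_right)
    have 3: "grad (psum c ?A) \<xi> \<bullet> v = (\<Sum>j\<in>UNIV. v $ j * dpsum c ?A j \<xi>)" for v
      by (simp add: inner_vec_def grad_psum mult.commute)
    have "((\<lambda>\<eta>. psum c ?A (\<xi> + \<eta>) - psum c ?A \<xi> - grad (psum c ?A) \<xi> \<bullet> \<eta>) has_derivative
       (\<lambda>v. (\<Sum>j\<in>UNIV. v $ j * dpsum c ?A j (\<xi> + \<eta>)) - 0 - grad (psum c ?A) \<xi> \<bullet> v)) (at \<eta>)"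
      by (intro has_derivative_diff 1 2 has_derivative_const)
    moreover have "(\<Sum>j\<in>UNIV. v $ j * dpsum c ?A j (\<xi> + \<eta>)) - 0 - grad (psum c ?A) \<xi> \<bullet> v = (\<Sum>j\<in>UNIV. v $ j * pl (qs \<xi> j) \<eta>)" for v
      unfolding 3 plq by (simp add: sum_subtractf right_diff_distrib)
    ultimately show ?thesis by (simp add: remainder_def[abs_def] poly_fun_psum)
  qed
  show ?thesis
  proof (rule that[of B])
    show "B >= 0" unfolding B_def by (intro sum_list_nonneg) (auto intro!: sum_nonneg)
    show "\<exists>qs. good_phase (m - 1) B (1 + norm \<xi>) (remainder c m \<xi>) qs" for \<xi>
    proof (intro exI[of _ "qs \<xi>"], unfold good_phase_def, intro conjI allI impI)
      show "\<forall>(b, l)\<in>set (qs \<xi> j). 1 <= length l \<and> length l <= m - 1" for j using len_qs by auto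
    qed (use m1 der in simp_all)
  qed
qed

subsection \<open>Multiplication by a unimodular phase on the Fourier side\<close>

definition phase :: "real => (real^'d::finite => real) => 'd fn"
  where "phase t q \<eta> = exp (- \<i> * of_real (t * q \<eta>))"

lemma norm_phase [simp]: "norm (phase t q \<eta>) = 1"
  unfolding phase_def using norm_exp_i_real(2)[of "t * q \<eta>"] by simp

text \<open>
  The Fourier multiplier with symbol \<open>exp (- i t q)\<close>.
\<close>

definition pmul :: "real => (real^'d::finite => real) => 'd fn => 'd fn"
  where "pmul t q f = ifourier (\<lambda>\<eta>. phase t q \<eta> * fourier f \<eta>)"

definition pdop :: "(real \<times> 'd::finite list) list => 'd fn => 'd fn"
  where "pdop ps g x = (\<Sum>(b, l)\<leftarrow>ps. of_real b * wop (map Inr l) g x)"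

text \<open>
  The operator \<open>x\<^sub>j + t ps(D)\<close>, the conjugate of multiplication by \<open>x\<^sub>j\<close> if \<open>ps\<close> represents \<open>d\<^sub>j q\<close>.
\<close>

definition Aop :: "real => (real \<times> 'd::finite list) list => 'd => 'd fn => 'd fn"
  where "Aop t ps j g = (\<lambda>x. of_real (x $ j) * g x + of_real t * pdop ps g x)"

lemma pdop_SS: "g \<in> SS ==> pdop ps g \<in> SS"
proof (induction ps)
  case Nil thus ?case by (simp add: pdop_def[abs_def] SS_zero)
next
  case (Cons a ps)
  obtain b l where a: "a = (b, l)" by (cases a)
  have "pdop (a # ps) g = (\<lambda>x. of_real b * wop (map Inr l) g x + pdop ps g x)"
    by (simp add: pdop_def a fun_eq_iff)
  thus ?case using Cons by (simp add: SS_add SS_cmult wop_SS)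
qed

lemma fourier_pdop: "g \<in> SS ==> fourier (pdop ps g) \<eta> = of_real (pl ps \<eta>) * fourier g \<eta>"
proof (induction ps)
  case Nil thus ?case by (simp add: pdop_def[abs_def] fourier_def)
next
  case (Cons a ps)
  obtain b l where a: "a = (b, l)" by (cases a)
  have "pdop (a # ps) g = (\<lambda>x. of_real b * wop (map Inr l) g x + pdop ps g x)"
    by (simp add: pdop_def a fun_eq_iff)
  hence "fourier (pdop (a # ps) g) \<eta> = of_real b * fourier (wop (map Inr l) g) \<eta> + fourier (pdop ps g) \<eta>"
    using fourier_add[OF SS_integrable[OF SS_cmult[OF wop_SS[OF Cons.prems]]] SS_integrable[OF pdop_SS[OF Cons.prems]]]
    by (simp add: fourier_cmult)
  thus ?case using Cons by (simp add: a fourier_wop_Inr mon_def algebra_simps)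
qed

lemma Aop_SS: "g \<in> SS ==> Aop t ps j g \<in> SS"
  unfolding Aop_def by (intro SS_add SS_component_closed SS_cmult pdop_SS)

lemma phase_continuous:
  assumes "\<And>\<eta>. q differentiable (at \<eta>)"
  shows "continuous_on UNIV (phase t q)"
proof -
  have "continuous_on UNIV q"
    by (simp add: continuous_on_eq_continuous_at assms differentiable_imp_continuous_within)
  thus ?thesis unfolding phase_def[abs_def] by (intro continuous_intros)
qed

lemma phase_D_coord:
  fixes \<phi> :: "'d::finite fn"
  assumes q: "(q has_derivative (\<lambda>v. \<Sum>j\<in>UNIV. v $ j * dq j)) (at \<eta>)" and \<phi>: "\<phi> differentiable (at \<eta>)"
  shows "(\<lambda>\<eta>. phase t q \<eta> * \<phi> \<eta>) differentiable (at \<eta>)"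
    and "D_coord j (\<lambda>\<eta>. phase t q \<eta> * \<phi> \<eta>) \<eta> = phase t q \<eta> * (D_coord j \<phi> \<eta> - of_real (t * dq j) * \<phi> \<eta>)"
proof -
  let ?dq = "\<lambda>v. \<Sum>j\<in>UNIV. v $ j * dq j"
  have 1: "((\<lambda>\<eta>. - \<i> * of_real (t * q \<eta>)) has_derivative (\<lambda>v. - \<i> * of_real (t * ?dq v))) (at \<eta>)"
    by (intro has_derivative_mult_right has_derivative_of_real q)
  have 2: "(phase t q has_derivative (\<lambda>v. phase t q \<eta> * (- \<i> * of_real (t * ?dq v)))) (at \<eta>)"
    unfolding phase_def[abs_def]
    by (rule has_derivative_compose[OF 1 DERIV_exp[unfolded has_field_derivative_def]])
  have 3: "((\<lambda>\<eta>. phase t q \<eta> * \<phi> \<eta>) has_derivative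
     (\<lambda>v. phase t q \<eta> * frechet_derivative \<phi> (at \<eta>) v + (phase t q \<eta> * (- \<i> * of_real (t * ?dq v))) * \<phi> \<eta>)) (at \<eta>)"
    by (rule has_derivative_mult[OF 2]) (use \<phi> in \<open>simp add: frechet_derivative_works\<close>)
  thus "(\<lambda>\<eta>. phase t q \<eta> * \<phi> \<eta>) differentiable (at \<eta>)" by (rule differentiableI)
  have "?dq (axis j 1) = dq j"
  proof -
    have "?dq (axis j 1) = (\<Sum>i\<in>UNIV. if i = j then dq i else 0)"
      by (rule sum.cong) (auto simp: axis_def)
    thus ?thesis by simp
  qed
  hence "partial_deriv j (\<lambda>\<eta>. phase t q \<eta> * \<phi> \<eta>) \<eta> = phase t q \<eta> * partial_deriv j \<phi> \<eta> + (phase t q \<eta> * (- \<i> * of_real (t * dq j))) * \<phi> \<eta>"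
    using partial_derivI[OF 3, of j] by (simp only: partial_deriv_def)
  hence "D_coord j (\<lambda>\<eta>. phase t q \<eta> * \<phi> \<eta>) \<eta> = - \<i> * (phase t q \<eta> * partial_deriv j \<phi> \<eta> + (phase t q \<eta> * (- \<i> * of_real (t * dq j))) * \<phi> \<eta>)"
    by (simp only: D_coord_def)
  also have "... = phase t q \<eta> * (D_coord j \<phi> \<eta> + (\<i> * \<i>) * of_real (t * dq j) * \<phi> \<eta>)"
    by (simp add: D_coord_def algebra_simps)
  finally show "D_coord j (\<lambda>\<eta>. phase t q \<eta> * \<phi> \<eta>) \<eta> = phase t q \<eta> * (D_coord j \<phi> \<eta> - of_real (t * dq j) * \<phi> \<eta>)"
    by simp
qed

lemma good_phase_differentiable: "good_phase m B \<rho>0 q qs ==> q differentiable (at \<eta>)"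
  unfolding good_phase_def by (blast intro: differentiableI)

text \<open>
  On the Fourier side \<open>x\<^sub>j\<close> is a derivative, and the product rule lets it pass the phase at the cost of
  \<open>t (d\<^sub>j q)\<close>.
\<close>

lemma component_pmul:
  fixes g :: "'d::finite fn"
  assumes q: "good_phase m B \<rho>0 q qs" and g: "g \<in> SS"
  shows "of_real (x $ j) * pmul t q g x = pmul t q (Aop t (qs j) j g) x"
proof -
  have dq: "(q has_derivative (\<lambda>v. \<Sum>j\<in>UNIV. v $ j * pl (qs j) \<eta>)) (at \<eta>)" for \<eta>
    using q unfolding good_phase_def by blast
  let ?G = "\<lambda>\<eta>. phase t q \<eta> * fourier g \<eta>"
  have fg: "fourier g \<in> SS" by (rule SS_fourier[OF g])
  have fA: "fourier (Aop t (qs j) j g) \<eta> = - D_coord j (fourier g) \<eta> + of_real (t * pl (qs j) \<eta>) * fourier g \<eta>" for \<eta>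
  proof -
    have "fourier (Aop t (qs j) j g) \<eta> = fourier (\<lambda>x. of_real (x $ j) * g x) \<eta> + of_real t * fourier (pdop (qs j) g) \<eta>"
      unfolding Aop_def
      by (subst fourier_add) (auto intro!: SS_integrable SS_component_closed SS_cmult pdop_SS g simp: fourier_cmult)
    thus ?thesis by (simp add: fourier_SS_component[OF g] fourier_pdop[OF g])
  qed
  have d: "?G differentiable (at \<eta>)" for \<eta>
    by (rule phase_D_coord(1)[OF dq SS_differentiable[OF fg]])
  have D: "D_coord j ?G \<eta> = - (phase t q \<eta> * fourier (Aop t (qs j) j g) \<eta>)" for \<eta>
    unfolding phase_D_coord(2)[OF dq SS_differentiable[OF fg]] fA by (simp add: algebra_simps)
  have D': "D_coord j ?G = (\<lambda>\<eta>. - (phase t q \<eta> * fourier (Aop t (qs j) j g) \<eta>))" using D by auto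
  have cp: "continuous_on UNIV (phase t q)" by (intro phase_continuous good_phase_differentiable[OF q])
  have rG: "rapid (\<lambda>\<eta>. phase t q \<eta> * fourier u \<eta>)" if "u \<in> SS" for u
    by (rule rapid_bound[OF SS_rapid_fourier[OF that]]) (simp add: norm_mult)
  have "fourier (D_coord j ?G) (- x) = of_real ((- x) $ j) * fourier ?G (- x)"
  proof (rule fourier_D_coord_general[OF d])
    show "continuous_on UNIV (D_coord j ?G)"
      unfolding D' by (intro continuous_intros cp SS_fourier_cont Aop_SS g)
    show "rapid ?G" by (rule rG[OF g])
    show "rapid (D_coord j ?G)" unfolding D' by (intro rapid_minus rG Aop_SS g)
  qed
  thus ?thesis unfolding D' by (simp add: pmul_def ifourier_def fourier_uminus)
qed

text \<open>
  This bounds the supremum of \<open>f\<close> and does not see a unimodular factor on the Fourier side.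
\<close>

definition N1 :: "'d::finite fn => real"
  where "N1 f = (LBINT \<xi>. norm (fourier f \<xi>))"

lemma N1_add: assumes "f \<in> SS" "g \<in> SS" shows "N1 (\<lambda>x. f x + g x) <= N1 f + N1 g"
proof -
  have "N1 (\<lambda>x. f x + g x) = (LBINT \<xi>. norm (fourier f \<xi> + fourier g \<xi>))"
    unfolding N1_def by (simp add: fourier_add SS_integrable assms)
  also have "... <= (LBINT \<xi>. norm (fourier f \<xi>) + norm (fourier g \<xi>))"
    by (intro integral_mono norm_triangle_ineq Bochner_Integration.integrable_add integrable_norm SS_integrable SS_fourier assms)
  also have "... = N1 f + N1 g"
    unfolding N1_def by (intro Bochner_Integration.integral_add integrable_norm SS_integrable SS_fourier assms)
  finally show ?thesis .
qed

lemma N1_cmult: "N1 (\<lambda>x. a * f x) = norm a * N1 f"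
  unfolding N1_def by (simp add: fourier_cmult norm_mult)

text \<open>
  Expansion of the power into words: the majorants of the terms sum up to the power of the majorant.
\<close>

lemma N1_word_Aop:
  fixes f :: "'d::finite fn"
  assumes f: "f \<in> SS" and ab: "a >= 0" "b >= 0" "Q >= 0"
    and W: "\<And>U. length U <= L ==> N1 (wop U f) <= Q * a ^ nX U * b ^ nD U"
    and k: "k >= 1" "\<And>c l. (c, l) \<in> set ps ==> length l <= k"
  shows "length V + k * N <= L ==>
    N1 (wop V ((Aop t ps j ^^ N) f)) <= Q * a ^ nX V * b ^ nD V * (a + \<bar>t\<bar> * maj ps b) ^ N"
proof (induction N arbitrary: V)
  case 0 thus ?case using W by simp
next
  case (Suc N)
  let ?g = "(Aop t ps j ^^ N) f" and ?Y = "a + \<bar>t\<bar> * maj ps b"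
  have g: "?g \<in> SS" by (induction N) (auto intro: f Aop_SS)
  have Y: "?Y >= 0" using ab maj_nonneg[of b ps] by simp
  let ?R = "Q * a ^ nX V * b ^ nD V * ?Y ^ N"
  have R: "?R >= 0" using ab Y by simp
  have P: "N1 (wop V (pdop qs ?g)) <= ?R * maj qs b" if "\<And>c l. (c, l) \<in> set qs ==> length l <= k" for qs
    using that
  proof (induction qs)
    case Nil
    have "wop V (pdop [] ?g) = (\<lambda>x. 0)"
      using wop_linear[OF SS_zero SS_zero, of V 0 0] by (simp add: pdop_def[abs_def])
    thus ?case by (simp add: N1_def fourier_def)
  next
    case (Cons p qs)
    obtain c l where p: "p = (c, l)" by (cases p)
    have "pdop (p # qs) ?g = (\<lambda>x. of_real c * wop (map Inr l) ?g x + 1 * pdop qs ?g x)"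
      by (simp add: pdop_def p fun_eq_iff)
    hence e: "wop V (pdop (p # qs) ?g) = (\<lambda>x. of_real c * wop (V @ map Inr l) ?g x + 1 * wop V (pdop qs ?g) x)"
      using wop_linear[OF wop_SS[OF g, of "map Inr l"] pdop_SS[OF g, of qs], of V "of_real c" 1] by simp
    have "N1 (wop V (pdop (p # qs) ?g)) <= N1 (\<lambda>x. of_real c * wop (V @ map Inr l) ?g x) + N1 (\<lambda>x. 1 * wop V (pdop qs ?g) x)"
      unfolding e by (intro N1_add SS_cmult wop_SS pdop_SS g)
    also have "... = \<bar>c\<bar> * N1 (wop (V @ map Inr l) ?g) + N1 (wop V (pdop qs ?g))"
      by (simp only: N1_cmult norm_of_real) simp
    also have "N1 (wop (V @ map Inr l) ?g) <= Q * a ^ nX (V @ map Inr l) * b ^ nD (V @ map Inr l) * ?Y ^ N"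
    proof (rule Suc.IH)
      have "length l <= k" using Cons.prems p by auto
      thus "length (V @ map Inr l) + k * N <= L" using Suc.prems by simp
    qed
    also have "... = ?R * b ^ length l" by (simp add: power_add mult_ac)
    finally have "N1 (wop V (pdop (p # qs) ?g)) <= \<bar>c\<bar> * (?R * b ^ length l) + N1 (wop V (pdop qs ?g))"
      by (simp add: mult_left_mono)
    also have "... <= \<bar>c\<bar> * (?R * b ^ length l) + ?R * maj qs b" using Cons by (intro add_left_mono) auto
    finally show ?case by (simp add: p algebra_simps)
  qed
  have "wop V (Aop t ps j ?g) = (\<lambda>x. 1 * wop V (lop (Inl j) ?g) x + of_real t * wop V (pdop ps ?g) x)"
    using wop_linear[OF lop_SS[OF g, of "Inl j"] pdop_SS[OF g, of ps], of V 1 "of_real t"] by (simp add: Aop_def)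
  hence "N1 (wop V (Aop t ps j ?g)) <= N1 (\<lambda>x. 1 * wop V (lop (Inl j) ?g) x) + N1 (\<lambda>x. of_real t * wop V (pdop ps ?g) x)"
    by (simp only:) (intro N1_add SS_cmult wop_SS pdop_SS lop_SS g)
  also have "... = N1 (wop (V @ [Inl j]) ?g) + \<bar>t\<bar> * N1 (wop V (pdop ps ?g))"
    by (simp only: N1_cmult norm_of_real) simp
  also have "... <= (Q * a ^ nX (V @ [Inl j]) * b ^ nD (V @ [Inl j]) * ?Y ^ N) + \<bar>t\<bar> * (?R * maj ps b)"
    using Suc.prems k by (intro add_mono mult_left_mono Suc.IH P) auto
  also have "... = Q * a ^ nX V * b ^ nD V * ?Y ^ Suc N" by (simp add: algebra_simps)
  finally show ?case by simp
qed

lemma moment_pmul: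
  fixes f :: "'d::finite fn"
  assumes q: "good_phase m B \<rho>0 q qs" and f: "f \<in> SS"
  shows "\<bar>x $ j\<bar> ^ N * norm (pmul t q f x) <= fconst TYPE('d) * N1 ((Aop t (qs j) j ^^ N) f)"
proof -
  have "of_real (x $ j) ^ N * pmul t q f x = pmul t q ((Aop t (qs j) j ^^ N) f) x" if "f \<in> SS" for f
    using that
  proof (induction N arbitrary: f)
    case (Suc N)
    have "of_real (x $ j) ^ Suc N * pmul t q f x = of_real (x $ j) ^ N * (of_real (x $ j) * pmul t q f x)"
      by (simp add: mult_ac)
    also have "... = pmul t q ((Aop t (qs j) j ^^ N) (Aop t (qs j) j f)) x"
      unfolding component_pmul[OF q Suc.prems] by (rule Suc.IH[OF Aop_SS[OF Suc.prems]])
    finally show ?case by (simp add: funpow_swap1)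
  qed simp
  from this[OF f] have "\<bar>x $ j\<bar> ^ N * norm (pmul t q f x) = norm (pmul t q ((Aop t (qs j) j ^^ N) f) x)"
    by (metis norm_mult norm_power norm_of_real)
  also have "... <= fconst TYPE('d) * (LBINT \<eta>. norm (phase t q \<eta> * fourier ((Aop t (qs j) j ^^ N) f) \<eta>))"
    unfolding pmul_def ifourier_def by (rule norm_fourier_le)
  also have "... = fconst TYPE('d) * N1 ((Aop t (qs j) j ^^ N) f)" by (simp add: N1_def norm_mult)
  finally show ?thesis .
qed

lemma pmul_SS:
  fixes f :: "'d::finite fn"
  assumes q: "good_phase m B \<rho>0 q qs" and f: "f \<in> SS"
  shows "pmul t q f \<in> SS" and "fourier (pmul t q f) = (\<lambda>\<eta>. phase t q \<eta> * fourier f \<eta>)"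
proof -
  let ?G = "\<lambda>\<eta>. phase t q \<eta> * fourier f \<eta>"
  have rp: "rapid (pmul t q f)" unfolding rapid_def
  proof
    fix k
    let ?B = "\<lambda>j n. fconst TYPE('d) * N1 ((Aop t (qs j) j ^^ n) f)"
    have B0: "?B j n >= 0" for j n
      using fconst_pos[where 'd='d] unfolding N1_def by (intro mult_nonneg_nonneg Bochner_Integration.integral_nonneg) auto
    define M where "M = (\<Sum>j\<in>UNIV. ?B j k) + (\<Sum>j\<in>UNIV. ?B j 0)"
    have m1: "?B i k' <= (\<Sum>i\<in>UNIV. ?B i k')" for i k' by (rule member_le_sum) (use B0 in auto)
    have m2: "(\<Sum>i\<in>UNIV. ?B i k') >= 0" for k' by (rule sum_nonneg) (rule B0)
    have "(1 + norm x) ^ k * norm (pmul t q f x) <= (2 * real CARD('d)) ^ k * ((1 + real CARD('d)) * M)" for x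
    proof (rule component_decay)
      show "norm (pmul t q f x) <= M"
        using moment_pmul[OF q f, of x undefined 0 t] m1[where i=undefined and k'=0] m2[of k] unfolding M_def power_0 mult_1 by linarith
      show "\<bar>x $ i\<bar> ^ k * norm (pmul t q f x) <= M" for i
        using moment_pmul[OF q f, of x i k t] m1[where i=i and k'=k] m2[of 0] unfolding M_def by linarith
    qed simp
    thus "\<exists>C. \<forall>x. (1 + norm x) ^ k * norm (pmul t q f x) <= C" by blast
  qed
  have G: "?G \<in> SS"
  proof (rule SS_I)
    show "continuous_on UNIV ?G"
      by (intro continuous_intros phase_continuous good_phase_differentiable[OF q] SS_fourier_cont f)
    show "rapid ?G" by (rule rapid_bound[OF SS_rapid_fourier[OF f]]) (simp add: norm_mult)
    have "fourier ?G = (\<lambda>x. pmul t q f (- x))" by (simp add: pmul_def ifourier_def fun_eq_iff)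
    thus "rapid (fourier ?G)" using rapid_uminus[OF rp] by simp
  qed
  show "pmul t q f \<in> SS" unfolding pmul_def by (rule SS_ifourier[OF G])
  show "fourier (pmul t q f) = ?G" unfolding pmul_def by (rule fourier_ifourier[OF G])
qed

text \<open>
  Arithmetic for the number of letters in \<open>pmul_decay\<close>: of \<open>R / 2 - d\<close> available letters, every
  application of \<open>Aop\<close> uses up to \<open>k\<close>, which leaves about \<open>R / (2k)\<close> applications.
\<close>

lemma word_count_arith:
  fixes x R d L M N A B C u :: real
  shows "x >= 0 ==> real (nat \<lfloor>x\<rfloor>) <= x \<and> real (nat \<lfloor>x\<rfloor>) >= x - 1"
    and "L >= (R - 2 * d) / 2 - 1 ==> L < M ==> R / 2 - d - 1 < M"
    and "A < N + 1 ==> A = B - C ==> C <= (d + 1) / 1 ==> B - d - 2 <= N"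
    and "u <= L ==> L <= (R - 2 * d) / 2 ==> 2 * (u + d) <= R"
  by (linarith, argo+)

text \<open>
  At a point with \<open>\<bar>x\<bar> = g R\<^sup>r\<close> the moment of order \<open>N \<approx> R / (2k)\<close> is used. If \<open>R\<^sup>s \<ge> \<rho>0\<close>, then a derivative
  of degree \<open>k\<close> in \<open>Aop\<close> costs \<open>B R\<^bsup>s k\<^esup> \<le> B R\<^sup>r\<close>, as much as a position, and the moment yields
  \<open>exp (- N)\<close>. For smaller \<open>R\<close> the weight at \<open>x\<close> is not smaller than \<open>exp (- \<epsilon> \<rho>0\<^bsup>1/s\<^esup>)\<close> up to a constant,
  and a bound for the supremum suffices.
\<close>

lemma pmul_decay:
  fixes t :: real and k :: nat
  assumes r: "r > 0" and s: "s > 0" and k: "k >= 1" and rk: "r >= s * real k" and sk: "s * real k > 1"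
    and H: "H > 0" and \<epsilon>: "\<epsilon> > 0" and B: "B >= 0"
  obtains H' C where "H' > 0" "C > 0"
    "\<And>f P q qs \<rho>0 x. f \<in> (SS :: 'd::finite fn set) ==> bnd r s H' P f ==> \<rho>0 >= 1 ==>
       good_phase k B \<rho>0 q qs ==> norm (pmul t q f x) <= C * P * ew r H x * exp (\<epsilon> * \<rho>0 powr (1 / s))"
proof -
  let ?d = "CARD('d)"
  have d1: "real ?d >= 1" by (simp add: Suc_leI)
  define K0 where "K0 = 1 + 2 * \<bar>t\<bar> * B"
  have K0: "K0 >= 1" using B by (simp add: K0_def)
  \<comment> \<open>The first bound lets \<open>exp (- R / (4 k))\<close> absorb the weight for large \<open>R\<close>, the second lets the exponential of \<open>\<rho>0\<close> do so for small \<open>R\<close>.\<close>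
  define \<theta>0 where "\<theta>0 = min (1 / (4 * real k * H)) (\<epsilon> / H)"
  have \<theta>0: "\<theta>0 > 0" "4 * real k * H * \<theta>0 <= 1" "H * \<theta>0 <= \<epsilon>"
  proof -
    show "\<theta>0 > 0" using H \<epsilon> k by (simp add: \<theta>0_def)
    have "\<theta>0 <= 1 / (4 * real k * H)" "\<theta>0 <= \<epsilon> / H" by (simp_all add: \<theta>0_def)
    thus "4 * real k * H * \<theta>0 <= 1" "H * \<theta>0 <= \<epsilon>"
      using H k by (simp_all add: pos_le_divide_eq mult.commute mult.left_commute)
  qed
  \<comment> \<open>The factor \<open>d\<close> accounts for passing to the largest coordinate, \<open>e\<close> for the gain \<open>exp (- N)\<close>, \<open>K0\<close> for the sum in \<open>Aop\<close>.\<close>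
  define u where "u = real ?d * exp 1 * K0"
  have u: "u > 0" using d1 K0 by (simp add: u_def)
  define h where "h = min (1/2) (\<theta>0 powr r / u)"
  have h: "h > 0" "2 * h <= 1" "u * h <= \<theta>0 powr r"
  proof -
    show "h > 0" "2 * h <= 1" using \<theta>0 u by (simp_all add: h_def)
    have "h <= \<theta>0 powr r / u" by (simp add: h_def)
    thus "u * h <= \<theta>0 powr r" using u by (simp add: pos_le_divide_eq mult.commute)
  qed
  define g where "g = u * h"
  have g: "g > 0" "g <= \<theta>0 powr r" using u h by (simp_all add: g_def)
  define \<theta> where "\<theta> = g powr (1 / r)"
  have "\<theta> <= (\<theta>0 powr r) powr (1 / r)" unfolding \<theta>_def using g r by (intro powr_mono2) auto
  hence \<theta>: "\<theta> > 0" "\<theta> <= \<theta>0" using g r \<theta>0 by (simp_all add: powr_powr \<theta>_def)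
  have rs: "r + s > 1" using rk sk s by linarith
  obtain H' C R0 where H': "H' > 0" and C: "C > 0" and R0: "R0 >= 1" and
    W: "\<And>f P V R. f \<in> (SS :: 'd fn set) ==> bnd r s H' P f ==> R >= R0 ==>
       2 * (real (length V) + real ?d) <= R ==>
       (LBINT \<xi>. norm (fourier (wop V f) \<xi>)) <=
         C * P * (h * R powr r) ^ nX V * (2 * h * R powr s) ^ nD V * (1 + (2 * h * R powr s) ^ (2 * ?d))"
    using word_estimate[OF r s rs h(1)] by metis
  define R2 where "R2 = max R0 (2 * real ?d)"
  have R2: "R2 >= R0" "R2 >= 2 * real ?d" "R2 >= 1" using R0 by (auto simp: R2_def)
  define D where "D = ((s * real (2 * ?d) / (1 / (4 * real k))) powr s) ^ (2 * ?d)"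
  have D: "D >= 0" by (simp add: D_def)
  let ?f = "fconst TYPE('d)"
  have f0: "?f > 0" by (rule fconst_pos)
  define Ca where "Ca = ?f * C * (1 + D) * exp (real ?d + 2)"
  define Cb where "Cb = ?f * C * (1 + (2 * h * R2 powr s) ^ (2 * ?d)) * exp (H * \<theta>0 * R2)"
  have Cab: "Ca > 0" "Cb > 0" unfolding Ca_def Cb_def using f0 C D h by (auto intro!: mult_pos_pos add_pos_nonneg)
  show ?thesis
  proof (rule that[OF H', of "Ca + Cb"])
    show "Ca + Cb > 0" using Cab by simp
    fix f :: "'d fn" and P \<rho>0 :: real and q :: "real^'d => real"
      and qs :: "'d => (real \<times> 'd list) list" and x :: "real^'d"
    assume f: "f \<in> SS" and bd: "bnd r s H' P f" and \<rho>0: "\<rho>0 >= 1" and q: "good_phase k B \<rho>0 q qs"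
    have P: "P >= 0" by (rule bnd_nonneg[OF bd])
    define X where "X = norm x"
    define R where "R = (X / g) powr (1 / r)"
    have Rn: "R >= 0" by (simp add: R_def)
    have XR: "X powr (1 / r) = \<theta> * R"
    proof -
      have "X powr (1 / r) = (g * (X / g)) powr (1 / r)" using g by simp
      also have "... = \<theta> * R" unfolding \<theta>_def R_def by (subst powr_mult) (use g in \<open>auto simp: X_def\<close>)
      finally show ?thesis .
    qed
    have ewx: "ew r H x = exp (- (H * (\<theta> * R)))" unfolding ew_def X_def[symmetric] XR ..
    have e1: "exp (\<epsilon> * \<rho>0 powr (1 / s)) >= 1" using \<epsilon> by simp
    show "norm (pmul t q f x) <= (Ca + Cb) * P * ew r H x * exp (\<epsilon> * \<rho>0 powr (1 / s))"
    proof (cases "R >= max R2 (\<rho>0 powr (1 / s))")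
      case True
      hence RR: "R >= R0" "R >= 2 * real ?d" "R >= 1" "R >= \<rho>0 powr (1 / s)" using R2 by auto
      have "\<rho>0 = (\<rho>0 powr (1 / s)) powr s" using s \<rho>0 by (simp add: powr_powr)
      also have "... <= R powr s" using RR s by (intro powr_mono2) auto
      finally have R\<rho>: "R powr s >= \<rho>0" .
      let ?a = "h * R powr r" and ?b = "2 * h * R powr s"
      define L where "L = nat \<lfloor>(R - 2 * real ?d) / 2\<rfloor>"
      define N where "N = L div k"
      have L: "real L <= (R - 2 * real ?d) / 2" "real L >= (R - 2 * real ?d) / 2 - 1"
        unfolding L_def using word_count_arith(1)[of "(R - 2 * real ?d) / 2"] RR by simp_all
      have NL: "k * N <= L" unfolding N_def by simp
      have Nlow: "real N >= R / (2 * real k) - real ?d - 2"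
      proof -
        have "real L < real k * (real N + 1)"
        proof -
          have "L < k * (N + 1)" unfolding N_def using k
            by (metis Suc_eq_plus1 dividend_less_times_div mult.commute mult_Suc_right add.commute less_eq_Suc_le One_nat_def)
          hence "real L < real (k * (N + 1))" by (simp only: of_nat_less_iff)
          thus ?thesis by (simp only: of_nat_mult of_nat_add of_nat_1)
        qed
        hence "R / 2 - real ?d - 1 < real k * (real N + 1)" by (rule word_count_arith(2)[OF L(2)])
        hence "(R / 2 - real ?d - 1) / real k < real N + 1" using k by (simp add: pos_divide_less_eq mult.commute)
        moreover have "(R / 2 - real ?d - 1) / real k = R / (2 * real k) - (real ?d + 1) / real k"
          by (simp add: diff_divide_distrib add_divide_distrib)
        moreover have "(real ?d + 1) / real k <= (real ?d + 1) / 1" using k by (intro divide_left_mono) auto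
        ultimately show ?thesis by (rule word_count_arith(3))
      qed
      let ?Q = "C * P * (1 + ?b ^ (2 * ?d))"
      obtain j where j: "X <= real ?d * \<bar>x $ j\<bar>"
      proof -
        define M where "M = Max (range (\<lambda>j. \<bar>x $ j\<bar>))"
        have M: "\<bar>x $ j\<bar> <= M" for j unfolding M_def by (intro Max_ge) auto
        have "M \<in> range (\<lambda>j. \<bar>x $ j\<bar>)" unfolding M_def by (intro Max_in) auto
        then obtain j0 where j0: "M = \<bar>x $ j0\<bar>" by auto
        have "norm x <= (\<Sum>j\<in>UNIV. \<bar>x $ j\<bar>)" by (rule norm_le_l1_cart)
        also have "... <= (\<Sum>j\<in>(UNIV::'d set). M)" by (intro sum_mono M)
        finally show ?thesis using that[of j0] j0 by (simp add: X_def)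
      qed
      have W': "N1 (wop U f) <= ?Q * ?a ^ nX U * ?b ^ nD U" if "length U <= L" for U
      proof -
        have "real (length U) <= real L" using that by simp
        hence "2 * (real (length U) + real ?d) <= R" by (rule word_count_arith(4)[OF _ L(1)])
        from W[OF f bd RR(1) this] show ?thesis by (simp add: N1_def mult_ac)
      qed
      have ql: "length l <= k" if "(c, l) \<in> set (qs j)" for c l
        using q that unfolding good_phase_def by blast
      have "N1 (wop [] ((Aop t (qs j) j ^^ N) f)) <= ?Q * ?a ^ nX ([]::('d+'d) list) * ?b ^ nD ([]::('d+'d) list) * (?a + \<bar>t\<bar> * maj (qs j) ?b) ^ N"
        by (rule N1_word_Aop[OF f _ _ _ W' k ql]) (use h C P NL in auto)
      hence n1: "N1 ((Aop t (qs j) j ^^ N) f) <= ?Q * (?a + \<bar>t\<bar> * maj (qs j) ?b) ^ N" by simp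
      let ?w = "h * K0 * R powr r"
      have w: "?w > 0" using h K0 RR by simp
      have "maj (qs j) ?b <= 2 * h * maj (qs j) (R powr s)"
        using q h unfolding good_phase_def by (intro maj_contract) auto
      also have "maj (qs j) (R powr s) <= B * (R powr s) ^ k"
        using q R\<rho> unfolding good_phase_def by blast
      also have "(R powr s) ^ k = R powr (s * real k)"
        using RR by (simp add: powr_realpow[symmetric] powr_powr)
      also have "R powr (s * real k) <= R powr r" using rk RR by (intro powr_mono) auto
      finally have "maj (qs j) ?b <= 2 * h * (B * R powr r)" using h B by (simp add: mult_left_mono)
      hence "?a + \<bar>t\<bar> * maj (qs j) ?b <= ?a + \<bar>t\<bar> * (2 * h * (B * R powr r))"
        by (intro add_left_mono mult_left_mono) auto
      also have "... = ?w" by (simp add: K0_def algebra_simps)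
      finally have Y: "?a + \<bar>t\<bar> * maj (qs j) ?b <= ?w" .
      have Y0: "0 <= ?a + \<bar>t\<bar> * maj (qs j) ?b" using h maj_nonneg[of ?b "qs j"] by simp
      have Q0: "?Q >= 0" using C P h by simp
      have "\<bar>x $ j\<bar> ^ N * norm (pmul t q f x) <= ?f * N1 ((Aop t (qs j) j ^^ N) f)"
        by (rule moment_pmul[OF q f])
      also have "... <= ?f * (?Q * ?w ^ N)"
        using f0 n1 power_mono[OF Y Y0, of N] Q0 by (intro mult_left_mono) (auto intro: order_trans mult_left_mono)
      finally have mo: "\<bar>x $ j\<bar> ^ N * norm (pmul t q f x) <= ?f * (?Q * ?w ^ N)" .
      have "X > 0" using RR(3) by (cases "X = 0") (auto simp: R_def X_def)
      hence "R powr r = X / g" unfolding R_def using r g by (simp add: powr_powr)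
      hence "g * R powr r = X" using g by simp
      hence "X = u * h * R powr r" by (simp add: g_def)
      hence "real ?d * (exp 1 * ?w) <= real ?d * \<bar>x $ j\<bar>" using j by (simp add: u_def mult_ac)
      hence "exp 1 * ?w <= \<bar>x $ j\<bar>" using d1 by simp
      hence "(exp 1 * ?w) ^ N * norm (pmul t q f x) <= \<bar>x $ j\<bar> ^ N * norm (pmul t q f x)"
        using w by (intro mult_right_mono power_mono) auto
      hence "?w ^ N * (exp 1 ^ N * norm (pmul t q f x)) <= ?w ^ N * (?f * ?Q)"
        using mo by (simp add: power_mult_distrib mult_ac)
      hence "exp 1 ^ N * norm (pmul t q f x) <= ?f * ?Q" using w by (simp add: mult_le_cancel_left_pos)
      hence "exp (real N) * norm (pmul t q f x) <= ?f * ?Q" by (simp add: exp_of_nat_mult[symmetric])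
      hence "norm (pmul t q f x) <= ?f * ?Q * exp (- real N)" by (simp add: exp_minus field_simps)
      also have "... <= ?f * ?Q * (exp (real ?d + 2) * exp (- (R / (2 * real k))))"
        unfolding exp_add[symmetric] using Nlow f0 Q0 by (intro mult_left_mono) auto
      also have "... = ?f * C * P * exp (real ?d + 2) * ((1 + ?b ^ (2 * ?d)) * exp (- (R / (2 * real k))))"
        by (simp only: mult_ac)
      also have "... <= ?f * C * P * exp (real ?d + 2) * ((1 + D) * exp (- (R / (4 * real k))))"
      proof (intro mult_left_mono)
        let ?E = "exp (- (R / (4 * real k)))"
        have EE: "exp (- (R / (2 * real k))) = ?E * ?E" unfolding exp_add[symmetric] using k by (simp add: field_simps)
        have E1: "?E <= 1" using RR by simp
        have "?b ^ (2 * ?d) <= (1 * R powr s) ^ (2 * ?d)" using h by (intro power_mono mult_right_mono) auto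
        hence "?b ^ (2 * ?d) * ?E <= (R powr s) ^ (2 * ?d) * ?E" by (intro mult_right_mono) auto
        also have "... = (R powr s) ^ (2 * ?d) * exp (- (1 / (4 * real k) * (R powr s) powr (1 / s)))"
          using s RR by (simp add: powr_powr)
        also have "... <= D" unfolding D_def using s k by (intro power_exp_root_bound) auto
        finally have "(1 + ?b ^ (2 * ?d)) * ?E <= 1 + D" unfolding distrib_right mult_1 by (rule add_mono[OF E1])
        hence "((1 + ?b ^ (2 * ?d)) * ?E) * ?E <= (1 + D) * ?E" by (intro mult_right_mono) auto
        thus "(1 + ?b ^ (2 * ?d)) * exp (- (R / (2 * real k))) <= (1 + D) * ?E" unfolding EE by (simp only: mult.assoc)
      qed (use f0 C P in auto)
      also have "... = Ca * P * exp (- (R / (4 * real k)))" by (simp add: Ca_def mult_ac)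
      also have "... <= Ca * P * ew r H x"
      proof (intro mult_left_mono)
        have "4 * real k * H * \<theta> <= 4 * real k * H * \<theta>0" using \<theta> k H by (intro mult_left_mono) auto
        hence "4 * real k * H * \<theta> <= 1" using \<theta>0 by linarith
        hence "R * (4 * real k * H * \<theta>) <= R * 1" using Rn by (intro mult_left_mono)
        hence "H * (\<theta> * R) <= R / (4 * real k)" using k by (simp add: pos_le_divide_eq mult_ac)
        thus "exp (- (R / (4 * real k))) <= ew r H x" unfolding ewx by simp
      qed (use Cab P in auto)
      also have "... <= (Ca + Cb) * P * ew r H x * 1"
        using Cab P by (simp add: mult_right_mono)
      also have "... <= (Ca + Cb) * P * ew r H x * exp (\<epsilon> * \<rho>0 powr (1 / s))"
        using Cab P e1 by (intro mult_left_mono) auto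
      finally show ?thesis .
    next
      case False
      hence "R <= R2 + \<rho>0 powr (1 / s)" using R2 by (auto simp: max_def not_le less_imp_le split: if_splits intro: add_increasing2 add_increasing)
      hence "H * (\<theta> * R) <= H * (\<theta>0 * (R2 + \<rho>0 powr (1 / s)))"
        using H \<theta> Rn R2 by (intro mult_left_mono mult_mono) auto
      also have "... = H * \<theta>0 * R2 + (H * \<theta>0) * \<rho>0 powr (1 / s)" by (simp add: algebra_simps)
      also have "... <= H * \<theta>0 * R2 + \<epsilon> * \<rho>0 powr (1 / s)" using \<theta>0 by (intro add_left_mono mult_right_mono) auto
      finally have "1 <= exp (H * \<theta>0 * R2) * ew r H x * exp (\<epsilon> * \<rho>0 powr (1 / s))"
        unfolding ewx exp_add[symmetric] by simp
      moreover have "norm (pmul t q f x) <= ?f * C * P * (1 + (2 * h * R2 powr s) ^ (2 * ?d))"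
      proof -
        have "norm (pmul t q f x) <= ?f * N1 f" using moment_pmul[OF q f, of x undefined 0 t] by simp
        also have "... <= ?f * (C * P * (1 + (2 * h * R2 powr s) ^ (2 * ?d)))"
          using W[OF f bd R2(1), of "[]"] R2 f0 by (simp add: N1_def)
        finally show ?thesis by (simp add: mult_ac)
      qed
      ultimately have "norm (pmul t q f x) * 1 <= (?f * C * P * (1 + (2 * h * R2 powr s) ^ (2 * ?d))) * (exp (H * \<theta>0 * R2) * ew r H x * exp (\<epsilon> * \<rho>0 powr (1 / s)))"
        by (intro mult_mono) (use f0 C P h in auto)
      hence "norm (pmul t q f x) <= Cb * P * ew r H x * exp (\<epsilon> * \<rho>0 powr (1 / s))" by (simp add: Cb_def mult_ac)
      also have "... <= (Ca + Cb) * P * ew r H x * exp (\<epsilon> * \<rho>0 powr (1 / s))"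
        using Cab P by (intro mult_right_mono) auto
      finally show ?thesis .
    qed
  qed
qed

section \<open>Time-frequency shifts and the propagator\<close>

definition tfs :: "real^'d::finite => real^'d => 'd fn => 'd fn"
  where "tfs x \<xi> f = modulate \<xi> (translate x f)"

lemma tfs_apply: "tfs x \<xi> f y = exp (\<i> * of_real (y \<bullet> \<xi>)) * f (y - x)"
  by (simp add: tfs_def modulate_def translate_def)

lemma norm_tfs [simp]: "norm (tfs x \<xi> f y) = norm (f (y - x))"
  by (simp add: tfs_apply norm_mult)

lemma fourier_tfs:
  fixes f :: "'d::finite fn"
  shows "fourier (tfs x \<xi> f) \<zeta> = osc x (\<zeta> - \<xi>) * fourier f (\<zeta> - \<xi>)"
proof -
  have "fourier (tfs x \<xi> f) \<zeta> = fourier (\<lambda>y. f (y - x)) (\<zeta> - \<xi>)"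
    unfolding fourier_eq tfs_apply
    by (simp add: inner_diff_right algebra_simps exp_add exp_diff exp_minus field_simps)
  thus ?thesis by (simp only: fourier_translate)
qed

lemma norm_fourier_tfs [simp]: "norm (fourier (tfs x \<xi> f) \<zeta>) = norm (fourier f (\<zeta> - \<xi>))"
  using norm_exp_i_real(2)[of "x \<bullet> (\<zeta> - \<xi>)"] by (simp add: fourier_tfs norm_mult)

lemma tfs_SS: assumes "f \<in> SS" shows "tfs x \<xi> f \<in> SS"
proof (rule SS_I)
  show "continuous_on UNIV (tfs x \<xi> f)"
    unfolding tfs_apply[abs_def] by (intro continuous_intros continuous_on_compose2[OF SS_cont[OF assms]]) auto
  show "rapid (tfs x \<xi> f)"
    by (rule rapid_bound[OF rapid_translate[OF SS_rapid[OF assms], of x]]) simp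
  show "rapid (fourier (tfs x \<xi> f))"
    by (rule rapid_bound[OF rapid_translate[OF SS_rapid_fourier[OF assms], of \<xi>]]) simp
qed

lemma tfs_0 [simp]: "tfs 0 0 f = f"
  by (simp add: tfs_apply fun_eq_iff)

definition evo :: "(('d::finite => nat) => real) => nat => real => 'd fn => 'd fn"
  where "evo c m t f = pmul t (poly_fun c m) f"

text \<open>
  In Taylor's formula at \<open>\<xi>\<close> the constant term gives the unimodular factor and the linear term the translation.
\<close>

lemma evo_tfs:
  fixes f :: "'d::finite fn"
  shows "evo c m t (tfs x \<xi> f) = (\<lambda>y. exp (- \<i> * of_real (t * poly_fun c m \<xi>)) *
     tfs (x + t *\<^sub>R grad (poly_fun c m) \<xi>) \<xi> (pmul t (remainder c m \<xi>) f) y)"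
proof
  fix y
  let ?p = "poly_fun c m" and ?g = "grad (poly_fun c m) \<xi>" and ?q = "remainder c m \<xi>"
  let ?F = "\<lambda>\<zeta>. phase t ?p \<zeta> * fourier (tfs x \<xi> f) \<zeta> * osc \<zeta> (- y)"
  have "evo c m t (tfs x \<xi> f) y = of_real (fconst TYPE('d)) * (LBINT \<zeta>. ?F \<zeta>)"
    unfolding evo_def pmul_def ifourier_def fourier_eq[of _ "- y"] ..
  also have "(LBINT \<zeta>. ?F \<zeta>) = (LBINT \<eta>. ?F (\<eta> + \<xi>))"
    by (rule lborel_integral_translate(1)[symmetric])
  also have "... = (LBINT \<eta>. exp (- \<i> * of_real (t * ?p \<xi>)) * exp (\<i> * of_real (y \<bullet> \<xi>)) *
      (phase t ?q \<eta> * fourier f \<eta> * exp (- \<i> * of_real (\<eta> \<bullet> - (y - (x + t *\<^sub>R ?g))))))"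
  proof (rule Bochner_Integration.integral_cong[OF refl])
    fix \<eta> :: "real^'d"
    have e: "?p (\<eta> + \<xi>) = ?p \<xi> + ?g \<bullet> \<eta> + ?q \<eta>" by (simp add: remainder_def add.commute)
    show "?F (\<eta> + \<xi>) = exp (- \<i> * of_real (t * ?p \<xi>)) * exp (\<i> * of_real (y \<bullet> \<xi>)) *
      (phase t ?q \<eta> * fourier f \<eta> * exp (- \<i> * of_real (\<eta> \<bullet> - (y - (x + t *\<^sub>R ?g)))))"
      unfolding fourier_tfs phase_def e
      by (simp add: inner_add_left inner_add_right inner_diff_right inner_diff_left inner_commute algebra_simps exp_add exp_diff exp_minus field_simps)
  qed
  also have "... = exp (- \<i> * of_real (t * ?p \<xi>)) * exp (\<i> * of_real (y \<bullet> \<xi>)) *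
      (LBINT \<eta>. phase t ?q \<eta> * fourier f \<eta> * exp (- \<i> * of_real (\<eta> \<bullet> - (y - (x + t *\<^sub>R ?g)))))"
    by (rule integral_mult_right_zero)
  also have "of_real (fconst TYPE('d)) * ... = exp (- \<i> * of_real (t * ?p \<xi>)) * tfs (x + t *\<^sub>R ?g) \<xi> (pmul t ?q f) y"
    unfolding tfs_apply pmul_def ifourier_def fourier_eq[of _ "- (y - (x + t *\<^sub>R ?g))"] by (simp only: mult_ac)
  finally show "evo c m t (tfs x \<xi> f) y = exp (- \<i> * of_real (t * ?p \<xi>)) * tfs (x + t *\<^sub>R ?g) \<xi> (pmul t ?q f) y" .
qed

text \<open>
  The phase \<open>p\<close> itself need not satisfy \<open>good_phase\<close>, as its gradient can have a constant term; after
  splitting off the linear part at the origin it does.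
\<close>

lemma evo_at_0:
  "evo c m t f = (\<lambda>y. exp (- \<i> * of_real (t * poly_fun c m 0)) *
     tfs (t *\<^sub>R grad (poly_fun c m) 0) 0 (pmul t (remainder c m 0) f) y)"
  using evo_tfs[of c m t 0 0 f] by simp

lemma evo_SS:
  fixes f :: "'d::finite fn"
  assumes "f \<in> SS"
  shows "evo c m t f \<in> SS"
    and fourier_evo: "fourier (evo c m t f) = (\<lambda>\<eta>. phase t (poly_fun c m) \<eta> * fourier f \<eta>)"
proof -
  obtain B qs where "good_phase (m - 1) B (1 + norm (0::real^'d)) (remainder c m 0) qs"
    using remainder_good_phase[of m c] by metis
  thus 1: "evo c m t f \<in> SS"
    unfolding evo_at_0 by (intro SS_cmult tfs_SS pmul_SS(1)[OF _ assms])
  let ?G = "\<lambda>\<eta>. phase t (poly_fun c m) \<eta> * fourier f \<eta>"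
  have "poly_fun c m differentiable (at \<eta>)" for \<eta>
    unfolding poly_fun_psum using psum_has_derivative by (rule differentiableI)
  hence "continuous_on UNIV ?G" by (intro continuous_intros phase_continuous SS_fourier_cont assms)
  moreover have "rapid ?G" by (rule rapid_bound[OF SS_rapid_fourier[OF assms]]) (simp add: norm_mult)
  moreover have "fourier ?G = (\<lambda>x. evo c m t f (- x))" by (simp add: evo_def pmul_def ifourier_def fun_eq_iff)
  ultimately have "?G \<in> SS" using rapid_uminus[OF SS_rapid[OF 1]] by (intro SS_I) auto
  thus "fourier (evo c m t f) = ?G" unfolding evo_def pmul_def by (rule fourier_ifourier)
qed

lemma evo_inverse: assumes "f \<in> SS" shows "evo c m (- t) (evo c m t f) = f"
proof -
  have "phase (- t) q \<eta> * (phase t q \<eta> * z) = z" for q :: "real^'a => real" and \<eta> z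
    by (simp add: phase_def exp_minus field_simps)
  hence "evo c m (- t) (evo c m t f) = ifourier (fourier f)"
    unfolding evo_def[of c m "- t"] pmul_def fourier_evo[OF assms] by (simp only:)
  thus ?thesis using ifourier_fourier[OF assms] by simp
qed

lemma ip_evo: assumes "f \<in> SS" "g \<in> SS" shows "ip (evo c m t f) g = ip f (evo c m (- t) g)"
  unfolding ip_def SS_parseval[OF evo_SS(1)[OF assms(1)] assms(2)] SS_parseval[OF assms(1) evo_SS(1)[OF assms(2)]]
    fourier_evo[OF assms(1)] fourier_evo[OF assms(2)]
  by (simp add: phase_def exp_cnj mult_ac)

lemma ew_translate_le:
  fixes x a :: "real^'d::finite"
  assumes q: "q > 0" and H: "H >= 0"
  shows "ew q (2 powr (1 / q) * H) (x - a) <= exp (2 powr (1 / q) * H * norm a powr (1 / q)) * ew q H x"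
proof -
  have "norm x powr (1 / q) <= 2 powr (1 / q) * (norm (x - a) powr (1 / q) + norm a powr (1 / q))"
    using ew_quasi_triangle[OF q, of "x - a" a] by simp
  hence "H * norm x powr (1 / q) <= H * (2 powr (1 / q) * (norm (x - a) powr (1 / q) + norm a powr (1 / q)))"
    using H by (rule mult_left_mono)
  thus ?thesis unfolding ew_def exp_add[symmetric] by (simp add: algebra_simps)
qed

lemma bnd_evo:
  fixes c :: "('d::finite => nat) => real"
  assumes m: "m >= 2" and r: "r > 0" and s: "s > 0" and rk: "r >= s * (real m - 1)" and sk: "s * (real m - 1) > 1"
    and H: "H > 0"
  obtains H' C where "H' > 0" "C > 0"
    "\<And>f P. f \<in> SS ==> bnd r s H' P f ==> bnd r s H (C * P) (evo c m t f)"
proof -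
  obtain B where B: "B >= 0" "\<And>\<xi>. \<exists>qs. good_phase (m - 1) B (1 + norm \<xi>) (remainder c m \<xi>) qs"
    using remainder_good_phase[of m c] by metis
  have mm: "real (m - 1) = real m - 1" using m by simp
  have H2: "2 powr (1 / r) * H > 0" using H by simp
  obtain H' C where H': "H' > 0" and C: "C > 0" and dec:
    "\<And>f P q qs \<rho>0 x. f \<in> (SS :: 'd::finite fn set) ==> bnd r s H' P f ==> \<rho>0 >= 1 ==>
       good_phase (m - 1) B \<rho>0 q qs ==> norm (pmul t q f x) <= C * P * ew r (2 powr (1 / r) * H) x * exp (1 * \<rho>0 powr (1 / s))"
    using pmul_decay[of r s "m - 1" "2 powr (1 / r) * H" 1 B t, where 'd='d, unfolded mm, OF r s _ rk sk H2 zero_less_one B(1)] m by (metis Suc_1 diff_le_mono diff_Suc_1)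
  let ?a = "t *\<^sub>R grad (poly_fun c m) 0"
  let ?E = "exp (2 powr (1 / r) * H * norm ?a powr (1 / r))"
  let ?D = "C * exp 1 * ?E + 1"
  show ?thesis
  proof (rule that[of "max H' H" ?D])
    show "max H' H > 0" using H by simp
    show "?D > 0" using C by (simp add: add_pos_pos)
    fix f :: "'d fn" and P assume f: "f \<in> SS" and bd: "bnd r s (max H' H) P f"
    have P: "P >= 0" by (rule bnd_nonneg[OF bd])
    obtain qs where qs: "good_phase (m - 1) B (1 + norm (0::real^'d)) (remainder c m 0) qs" using B(2) by blast
    show "bnd r s H (?D * P) (evo c m t f)"
      unfolding bnd_def
    proof (intro conjI allI)
      fix x :: "real^'d"
      have n: "norm (evo c m t f x) = norm (pmul t (remainder c m 0) f (x - ?a))"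
        unfolding evo_at_0 using norm_exp_i_real(2)[of "t * poly_fun c m 0"] by (simp add: norm_mult)
      have "norm (evo c m t f x) <= C * P * ew r (2 powr (1 / r) * H) (x - ?a) * exp (1 * (1 + norm (0::real^'d)) powr (1 / s))"
        unfolding n by (rule dec[OF f bnd_weaken[OF bd] _ qs]) auto
      also have "... <= C * P * (?E * ew r H x) * exp 1"
      proof -
        have "exp (1 * (1 + norm (0::real^'d)) powr (1 / s)) = exp 1" by simp
        thus ?thesis using C P H r by (simp only:) (intro mult_right_mono mult_left_mono ew_translate_le; simp)
      qed
      also have "... <= ?D * P * ew r H x" using P by (simp add: algebra_simps)
      finally show "norm (evo c m t f x) <= ?D * P * ew r H x" .
    next
      fix \<xi> :: "real^'d"
      have "norm (fourier (evo c m t f) \<xi>) = norm (fourier f \<xi>)" by (simp add: fourier_evo[OF f] norm_mult)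
      also have "... <= P * ew s (max H' H) \<xi>" using bd by (simp add: bnd_def)
      also have "... <= P * ew s H \<xi>" using P by (intro mult_left_mono ew_mono) auto
      also have "... <= ?D * P * ew s H \<xi>"
        using C P by (intro mult_right_mono) (auto simp: algebra_simps)
      finally show "norm (fourier (evo c m t f) \<xi>) <= ?D * P * ew s H \<xi>" .
    qed
  qed
qed

lemma gs_bnd_ex:
  assumes "r > 0" "s > 0" "f \<in> gs r s" "H > 0" shows "\<exists>P. bnd r s H P f"
  using gs_imp_bnd[OF assms(1,2,4)] assms(3) by metis

lemma evo_gs:
  fixes c :: "('d::finite => nat) => real"
  assumes m: "m >= 2" and r: "r > 0" and s: "s > 0" and rk: "r >= s * (real m - 1)" and sk: "s * (real m - 1) > 1"
    and f: "f \<in> gs r s"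
  shows "evo c m t f \<in> gs r s"
proof (rule bnd_imp_gs[OF r s])
  show "r + s > 1" using rk sk s by linarith
  show "evo c m t f \<in> SS" by (rule evo_SS[OF gs_imp_SS[OF f]])
  fix H :: real assume H: "H > 0"
  obtain H' C where "H' > 0" "\<And>f P. f \<in> SS ==> bnd r s H' P f ==> bnd r s H (C * P) (evo c m t f)"
    using bnd_evo[OF m r s rk sk H, of c t] by metis
  thus "\<exists>P. bnd r s H P (evo c m t f)"
    using gs_bnd_ex[OF r s f] gs_imp_SS[OF f] by blast
qed

lemma gs_norm_evo_le:
  fixes c :: "('d::finite => nat) => real"
  assumes m: "m >= 2" and r: "r > 0" and s: "s > 0" and rk: "r >= s * (real m - 1)" and sk: "s * (real m - 1) > 1"
    and h: "h > 0"
  obtains h' C where "h' > 0" "C > 0" "\<And>f. f \<in> gs r s ==> gs_norm r s h (evo c m t f) <= C * gs_norm r s h' f"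
proof -
  have rs: "r + s > 1" using rk sk s by linarith
  obtain H1 C1 where 1: "H1 > 0" "C1 > 0"
    "\<And>f P. f \<in> (SS :: 'd::finite fn set) ==> bnd r s H1 P f ==> gs_norm r s h f <= C1 * P"
    using gs_norm_le_bnd[OF r s rs h] by metis
  obtain H2 C2 where 2: "H2 > 0" "C2 > 0" "\<And>f P. f \<in> SS ==> bnd r s H2 P f ==> bnd r s H1 (C2 * P) (evo c m t f)"
    using bnd_evo[OF m r s rk sk 1(1), of c t] by metis
  obtain h' C3 where 3: "h' > 0" "C3 > 0"
    "\<And>f. f \<in> (gs r s :: 'd::finite fn set) ==> bnd r s H2 (C3 * gs_norm r s h' f) f"
    using gs_imp_bnd[OF r s 2(1)] by metis
  show ?thesis
  proof (rule that[OF 3(1), of "C1 * (C2 * C3)"])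
    show "C1 * (C2 * C3) > 0" using 1 2 3 by simp
    fix f :: "'d fn" assume f: "f \<in> gs r s"
    show "gs_norm r s h (evo c m t f) <= C1 * (C2 * C3) * gs_norm r s h' f"
      using 1(3)[OF evo_SS(1)[OF gs_imp_SS[OF f]] 2(3)[OF gs_imp_SS[OF f] 3(3)[OF f]]] by (simp add: mult_ac)
  qed
qed

section \<open>The kernel operator\<close>

lemma borel_measurable_pair_continuous:
  fixes F :: "'a::euclidean_space => 'b::euclidean_space => complex"
  assumes "continuous_on UNIV (\<lambda>(x, y). F x y)"
  shows "(\<lambda>(x, y). F x y) \<in> borel_measurable (borel \<Otimes>\<^sub>M borel)"
  unfolding borel_prod using assms by (rule borel_measurable_continuous_onI)

lemma integrable_pair_decay:
  fixes F :: "real^'d::finite => 'e::finite fn"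
  assumes m: "(\<lambda>(x, y). F x y) \<in> borel_measurable (borel \<Otimes>\<^sub>M borel)"
    and b: "\<And>x y. wt x * (1 + norm y) ^ (2 * CARD('e)) * norm (F x y) <= C"
  shows "integrable (lborel \<Otimes>\<^sub>M lborel) (\<lambda>(x, y). F x y)"
proof (rule Bochner_Integration.integrable_bound)
  let ?u = "\<lambda>x::real^'d. complex_of_real (inverse (wt x))"
  let ?v = "\<lambda>y::real^'e. complex_of_real (inverse ((1 + norm y) ^ (2 * CARD('e))))"
  have "integrable (lborel \<Otimes>\<^sub>M lborel) (\<lambda>(x, y). ?u x * ?v y * (\<lambda>z. of_real C) (x, y))"
    by (rule integrable_tensor[where C="\<bar>C\<bar>"]) (auto intro!: integrable_of_real integrable_weight simp del: of_real_inverse)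
  thus "integrable (lborel \<Otimes>\<^sub>M lborel) (\<lambda>(x, y). ?u x * ?v y * of_real C)" by simp
  show "(\<lambda>(x, y). F x y) \<in> borel_measurable (lborel \<Otimes>\<^sub>M lborel)" using m by (simp cong: measurable_cong_sets sets_pair_measure_cong)
  have "norm (F x y) <= norm (?u x * ?v y * of_real C)" for x y
  proof -
    let ?X = "wt x" and ?Y = "(1 + norm y) ^ (2 * CARD('e))"
    have XY: "?X > 0" "?Y > 0" by simp_all
    have "?X * ?Y * norm (F x y) <= \<bar>C\<bar>" using b[of x y] by linarith
    hence "norm (F x y) <= inverse ?X * inverse ?Y * \<bar>C\<bar>" using XY by (simp add: field_simps)
    moreover have "norm (?u x * ?v y * of_real C) = inverse ?X * inverse ?Y * \<bar>C\<bar>"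
      unfolding norm_mult norm_of_real using XY by simp
    ultimately show ?thesis by simp
  qed
  thus "AE z in lborel \<Otimes>\<^sub>M lborel. norm (case z of (x, y) => F x y) <= norm (case z of (x, y) => ?u x * ?v y * of_real C)"
    by (intro AE_I2) (simp add: case_prod_beta)
qed

lemma fourier_mult:
  fixes u v :: "'d::finite fn"
  assumes u: "integrable lborel u" and v: "v \<in> SS"
  shows "fourier (\<lambda>y. u y * v y) \<xi> = of_real (fconst TYPE('d)) * (LBINT \<eta>. fourier v \<eta> * fourier u (\<xi> - \<eta>))"
proof -
  let ?c = "of_real (fconst TYPE('d)) :: complex"
  have vy: "v y = ?c * (LBINT \<eta>. fourier v \<eta> * osc \<eta> (- y))" for y
    using SS_inversion[OF v, of "- y"] unfolding fourier_eq[of "fourier v"] by simp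
  have I: "integrable (lborel \<Otimes>\<^sub>M lborel) (\<lambda>(y, \<eta>). u y * fourier v \<eta> * (\<lambda>(y, \<eta>). osc \<eta> (- y) * osc y \<xi>) (y, \<eta>))"
  proof (rule integrable_tensor[OF u SS_integrable[OF SS_fourier[OF v]], where C=1])
    show "(\<lambda>(y, \<eta>). osc \<eta> (- y) * osc y \<xi>) \<in> borel_measurable (borel \<Otimes>\<^sub>M borel)"
      by (rule borel_measurable_pair_continuous) (auto simp: case_prod_beta intro!: continuous_intros)
  qed (auto simp: norm_mult case_prod_beta)
  let ?G = "\<lambda>y \<eta>. u y * fourier v \<eta> * (osc \<eta> (- y) * osc y \<xi>)"
  have "fourier (\<lambda>y. u y * v y) \<xi> = ?c * (LBINT y. ?c * (LBINT \<eta>. ?G y \<eta>))"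
  proof -
    have "u y * v y * osc y \<xi> = ?c * (LBINT \<eta>. ?G y \<eta>)" for y
    proof -
      let ?X = "\<lambda>\<eta>. fourier v \<eta> * osc \<eta> (- y)" and ?e = "osc y \<xi>"
      have "u y * v y * ?e = ?c * ((u y * ?e) * (LBINT \<eta>. ?X \<eta>))" unfolding vy[of y] by (simp only: mult_ac)
      also have "(u y * ?e) * (LBINT \<eta>. ?X \<eta>) = (LBINT \<eta>. (u y * ?e) * ?X \<eta>)"
        by (rule integral_mult_right_zero[symmetric])
      also have "... = (LBINT \<eta>. ?G y \<eta>)" by (simp only: mult_ac)
      finally show ?thesis .
    qed
    thus ?thesis unfolding fourier_eq[of "\<lambda>y. u y * v y"] by simp
  qed
  also have "... = ?c * (?c * (LBINT y. LBINT \<eta>. ?G y \<eta>))" by simp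
  also have "(LBINT y. LBINT \<eta>. ?G y \<eta>) = (LBINT \<eta>. LBINT y. ?G y \<eta>)"
    using lborel_pair.Fubini_integral[of ?G] I by simp
  also have "... = (LBINT \<eta>. fourier v \<eta> * (LBINT y. u y * osc y (\<xi> - \<eta>)))"
  proof (rule Bochner_Integration.integral_cong[OF refl])
    fix \<eta> :: "real^'d"
    have "(LBINT y. ?G y \<eta>) = (LBINT y. fourier v \<eta> * (u y * osc y (\<xi> - \<eta>)))"
      by (rule Bochner_Integration.integral_cong[OF refl])
         (simp add: inner_diff_right inner_commute algebra_simps exp_add exp_diff exp_minus field_simps)
    thus "(LBINT y. ?G y \<eta>) = fourier v \<eta> * (LBINT y. u y * osc y (\<xi> - \<eta>))" by simp
  qed
  also have "?c * ... = (LBINT \<eta>. ?c * (fourier v \<eta> * (LBINT y. u y * osc y (\<xi> - \<eta>))))"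
    by (rule integral_mult_right_zero[symmetric])
  also have "... = (LBINT \<eta>. fourier v \<eta> * fourier u (\<xi> - \<eta>))"
    unfolding fourier_eq[of u] by (simp only: mult.left_commute)
  finally show ?thesis .
qed

lemma fourier_affine:
  fixes f :: "'d::finite fn"
  assumes c: "c \<noteq> 0"
  shows "fourier (\<lambda>y. f (a + c *\<^sub>R y)) \<xi> = of_real (inverse (\<bar>c\<bar> ^ CARD('d))) * exp (\<i> * of_real (a \<bullet> (inverse c *\<^sub>R \<xi>))) * fourier f (inverse c *\<^sub>R \<xi>)"
proof -
  let ?F = "\<lambda>z. f z * exp (- \<i> * of_real ((inverse c *\<^sub>R (z - a)) \<bullet> \<xi>))"
  have "(LBINT z. ?F z) = \<bar>c\<bar> ^ DIM(real^'d) *\<^sub>R (LBINT y. ?F (a + c *\<^sub>R y))"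
    by (rule lborel_integral_affine[OF c])
  also have "(LBINT y. ?F (a + c *\<^sub>R y)) = (LBINT y. f (a + c *\<^sub>R y) * osc y \<xi>)"
    using c by simp
  finally have 1: "(LBINT y. f (a + c *\<^sub>R y) * osc y \<xi>) = of_real (inverse (\<bar>c\<bar> ^ CARD('d))) * (LBINT z. ?F z)"
    using c by (simp add: scaleR_conv_of_real power_inverse field_simps)
  have "(LBINT z. ?F z) = (LBINT z. exp (\<i> * of_real (a \<bullet> (inverse c *\<^sub>R \<xi>))) * (f z * osc z (inverse c *\<^sub>R \<xi>)))"
    by (rule Bochner_Integration.integral_cong[OF refl])
       (simp add: inner_diff_left algebra_simps exp_add exp_diff exp_minus field_simps)
  also have "... = exp (\<i> * of_real (a \<bullet> (inverse c *\<^sub>R \<xi>))) * (LBINT z. f z * osc z (inverse c *\<^sub>R \<xi>))"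
    by (rule integral_mult_right_zero)
  finally show ?thesis unfolding fourier_eq 1 by (simp only: mult_ac)
qed

lemma fourier_cnj:
  fixes f :: "'d::finite fn"
  shows "fourier (\<lambda>y. cnj (f y)) \<xi> = cnj (fourier f (- \<xi>))"
proof -
  have "(LBINT y. cnj (f y) * osc y \<xi>) = (LBINT y. cnj (f y * osc y (- \<xi>)))"
    by (rule Bochner_Integration.integral_cong) (auto simp: exp_cnj)
  also have "... = cnj (LBINT y. f y * osc y (- \<xi>))"
    by (rule Bochner_Integration.integral_cnj)
  finally show ?thesis unfolding fourier_eq by (simp only: complex_cnj_mult complex_cnj_complex_of_real)
qed

lemma SS_cnj: assumes "f \<in> SS" shows "(\<lambda>y. cnj (f y)) \<in> SS"
proof (rule SS_I)
  show "continuous_on UNIV (\<lambda>y. cnj (f y))" by (intro continuous_intros SS_cont assms)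
  show "rapid (\<lambda>y. cnj (f y))" by (intro rapid_cnj SS_rapid assms)
  have "fourier (\<lambda>y. cnj (f y)) = (\<lambda>\<xi>. cnj (fourier f (- \<xi>)))" using fourier_cnj by auto
  thus "rapid (fourier (\<lambda>y. cnj (f y)))"
    using rapid_cnj[OF rapid_uminus[OF SS_rapid_fourier[OF assms]]] by simp
qed

lemma rapid_affine:
  fixes f :: "'d::finite fn"
  assumes f: "rapid f" and c: "c \<noteq> 0"
  shows "rapid (\<lambda>y. f (a + c *\<^sub>R y))"
proof -
  have sc: "rapid (\<lambda>y. g (c *\<^sub>R y))" if g: "rapid g" for g :: "'d fn"
    unfolding rapid_def
  proof
    fix k
    obtain D where D: "D >= 0" "\<And>x. (1 + norm x) ^ k * norm (g x) <= D" using rapidD[OF g] by metis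
    let ?m = "1 + inverse \<bar>c\<bar>"
    have "(1 + norm y) ^ k * norm (g (c *\<^sub>R y)) <= ?m ^ k * D" for y
    proof -
      have "norm y = inverse \<bar>c\<bar> * norm (c *\<^sub>R y)" using c by simp
      hence "1 + norm y <= ?m * (1 + norm (c *\<^sub>R y))"
      proof -
        assume n: "norm y = inverse \<bar>c\<bar> * norm (c *\<^sub>R y)"
        have "0 <= inverse \<bar>c\<bar>" by simp
        moreover have "?m * (1 + norm (c *\<^sub>R y)) = 1 + inverse \<bar>c\<bar> + norm (c *\<^sub>R y) + norm y"
          unfolding n by (simp only: distrib_left distrib_right mult_1 mult_1_right add_ac)
        ultimately show ?thesis using norm_ge_zero[of "c *\<^sub>R y"] by linarith
      qed
      hence "(1 + norm y) ^ k <= (?m * (1 + norm (c *\<^sub>R y))) ^ k" by (intro power_mono) auto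
      hence "(1 + norm y) ^ k * norm (g (c *\<^sub>R y)) <= (?m * (1 + norm (c *\<^sub>R y))) ^ k * norm (g (c *\<^sub>R y))"
        by (intro mult_right_mono) auto
      also have "... = ?m ^ k * ((1 + norm (c *\<^sub>R y)) ^ k * norm (g (c *\<^sub>R y)))" by (simp only: power_mult_distrib mult.assoc)
      also have "... <= ?m ^ k * D" by (intro mult_left_mono D) auto
      finally show ?thesis .
    qed
    thus "\<exists>C. \<forall>y. (1 + norm y) ^ k * norm (g (c *\<^sub>R y)) <= C" by blast
  qed
  have "rapid (\<lambda>y. f (y - (- a)))" by (rule rapid_translate[OF f])
  from sc[OF this] show ?thesis by (simp add: add.commute)
qed

lemma SS_affine:
  fixes f :: "'d::finite fn"
  assumes f: "f \<in> SS" and c: "c \<noteq> 0"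
  shows "(\<lambda>y. f (a + c *\<^sub>R y)) \<in> SS"
proof (rule SS_I)
  show "continuous_on UNIV (\<lambda>y. f (a + c *\<^sub>R y))"
    by (intro continuous_on_compose2[OF SS_cont[OF f]] continuous_intros) auto
  show "rapid (\<lambda>y. f (a + c *\<^sub>R y))" by (rule rapid_affine[OF SS_rapid[OF f] c])
  have "rapid (\<lambda>\<xi>. fourier f (0 + inverse c *\<^sub>R \<xi>))" by (rule rapid_affine[OF SS_rapid_fourier[OF f]]) (use c in simp)
  from rapid_cmult[OF this, of "of_real (inverse (\<bar>c\<bar> ^ CARD('d)))"]
  show "rapid (fourier (\<lambda>y. f (a + c *\<^sub>R y)))"
    by (rule rapid_bound) (simp add: fourier_affine[OF c] norm_mult norm_inverse norm_power)
qed

lemma SS_decay: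
  assumes "f \<in> SS" obtains C where "C >= 0" "\<And>x. (1 + norm x) ^ k * norm (f x) <= C" "\<And>\<xi>. (1 + norm \<xi>) ^ k * norm (fourier f \<xi>) <= C"
proof -
  obtain A where A: "\<And>x. (1 + norm x) ^ k * norm (f x) <= A" using rapidD[OF SS_rapid[OF assms]] by metis
  obtain B where B: "\<And>x. (1 + norm x) ^ k * norm (fourier f x) <= B" using rapidD[OF SS_rapid_fourier[OF assms]] by metis
  show ?thesis
    by (rule that[of "max 0 (max A B)"]) (use A B in \<open>auto intro: order_trans simp: le_max_iff_disj\<close>)
qed

lemma one_plus_norm_sum_le: "1 + norm (x + y) <= (1 + norm x) * (1 + norm y)"
proof -
  have "(1 + norm x) * (1 + norm y) = 1 + norm x + norm y + norm x * norm y" by (simp add: algebra_simps)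
  moreover have "0 <= norm x * norm y" by simp
  ultimately show ?thesis using norm_triangle_ineq[of x y] by linarith
qed

lemma half_sum_le:
  fixes x y :: "'a::real_normed_vector"
  shows "1 + norm x <= (1 + norm (x + (1/2) *\<^sub>R y)) * (1 + norm (x - (1/2) *\<^sub>R y))"
    and "1 + norm y <= (1 + norm (x + (1/2) *\<^sub>R y)) * (1 + norm (x - (1/2) *\<^sub>R y))"
proof -
  let ?u = "x + (1/2) *\<^sub>R y" and ?v = "x - (1/2) *\<^sub>R y"
  have "x = (1/2) *\<^sub>R ?u + (1/2) *\<^sub>R ?v" by (simp add: algebra_simps flip: scaleR_add_left)
  hence "norm x <= norm ((1/2) *\<^sub>R ?u) + norm ((1/2) *\<^sub>R ?v)" by (metis norm_triangle_ineq)
  hence "norm x <= norm ?u / 2 + norm ?v / 2" by simp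
  moreover have "0 <= norm ?u * norm ?v" by simp
  moreover have e: "(1 + norm ?u) * (1 + norm ?v) = 1 + norm ?u + norm ?v + norm ?u * norm ?v" by (simp add: algebra_simps)
  ultimately show "1 + norm x <= (1 + norm ?u) * (1 + norm ?v)" using norm_ge_zero[of ?u] norm_ge_zero[of ?v] unfolding e by linarith
  have "y = ?u - ?v" by (simp flip: scaleR_add_left)
  hence "norm y <= norm ?u + norm ?v" by (metis norm_triangle_ineq4)
  thus "1 + norm y <= (1 + norm ?u) * (1 + norm ?v)" using \<open>0 <= norm ?u * norm ?v\<close> unfolding e by linarith
qed

text \<open>
  The integrand that the coordinates \<open>kappa\<close> produce; its transform in \<open>y\<close> is a cross-Wigner distribution.
\<close>

definition wig :: "'d::finite fn => 'd fn => real^'d => 'd fn"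
  where "wig g f x y = g (x + (1/2) *\<^sub>R y) * cnj (f (x - (1/2) *\<^sub>R y))"

lemma wig_decay:
  fixes f g :: "'d::finite fn"
  assumes f: "f \<in> SS" and g: "g \<in> SS"
  obtains C where "C >= 0" "\<And>x y. (1 + norm x) ^ k * (1 + norm y) ^ n * norm (wig g f x y) <= C"
proof -
  obtain Cf where Cf: "Cf >= 0" "\<And>x. (1 + norm x) ^ (k + n) * norm (f x) <= Cf" using SS_decay[OF f] by metis
  obtain Cg where Cg: "Cg >= 0" "\<And>x. (1 + norm x) ^ (k + n) * norm (g x) <= Cg" using SS_decay[OF g] by metis
  show ?thesis
  proof (rule that[of "Cg * Cf"])
    fix x y :: "real^'d"
    let ?u = "x + (1/2) *\<^sub>R y" and ?v = "x - (1/2) *\<^sub>R y"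
    have "(1 + norm x) ^ k * (1 + norm y) ^ n <= ((1 + norm ?u) * (1 + norm ?v)) ^ k * ((1 + norm ?u) * (1 + norm ?v)) ^ n"
      by (intro mult_mono power_mono half_sum_le) auto
    also have "... = (1 + norm ?u) ^ (k + n) * (1 + norm ?v) ^ (k + n)"
      by (simp only: power_add power_mult_distrib mult_ac)
    finally have "(1 + norm x) ^ k * (1 + norm y) ^ n * norm (wig g f x y) <= (1 + norm ?u) ^ (k + n) * (1 + norm ?v) ^ (k + n) * (norm (g ?u) * norm (f ?v))"
      unfolding wig_def by (simp only: norm_mult complex_mod_cnj) (intro mult_right_mono, auto)
    also have "... = ((1 + norm ?u) ^ (k + n) * norm (g ?u)) * ((1 + norm ?v) ^ (k + n) * norm (f ?v))" by (simp only: mult_ac)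
    also have "... <= Cg * Cf" by (intro mult_mono Cg Cf) auto
    finally show "(1 + norm x) ^ k * (1 + norm y) ^ n * norm (wig g f x y) <= Cg * Cf" .
  qed (use Cf Cg in simp)
qed

lemma continuous_on_wig:
  assumes "f \<in> SS" "g \<in> SS" shows "continuous_on UNIV (\<lambda>(x, y). wig g f x y)"
  unfolding wig_def case_prod_beta
  by (intro continuous_intros continuous_on_compose2[OF SS_cont[OF assms(1)]] continuous_on_compose2[OF SS_cont[OF assms(2)]]) auto

text \<open>
  Decay in \<open>x\<close> uniformly in \<open>\<xi>\<close> and decay in \<open>\<xi>\<close> uniformly in \<open>x\<close> give joint decay by taking geometric means.
\<close>

lemma fourier_wig_decay:
  fixes f g :: "'d::finite fn"
  assumes f: "f \<in> SS" and g: "g \<in> SS"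
  obtains C where "C >= 0" "\<And>x \<xi>. wt x * wt \<xi> * norm (fourier (wig g f x) \<xi>) <= C"
proof -
  let ?n = "2 * CARD('d)" and ?c = "fconst TYPE('d)"
  let ?I = "LBINT y. inverse ((1 + norm (y::real^'d)) ^ ?n)"
  have I0: "?I >= 0" by (intro Bochner_Integration.integral_nonneg) simp
  have c0: "?c > 0" by (rule fconst_pos)
  obtain C1 where C1: "C1 >= 0" "\<And>x y. (1 + norm x) ^ (2 * ?n) * (1 + norm y) ^ ?n * norm (wig g f x y) <= C1"
    using wig_decay[OF f g] by metis
  have wm: "wig g f x \<in> borel_measurable borel" for x
  proof -
    have "continuous_on UNIV (wig g f x)"
    proof -
      have e: "wig g f x = (\<lambda>y. g (x + (1/2) *\<^sub>R y) * cnj (f (x - (1/2) *\<^sub>R y)))" by (simp add: fun_eq_iff wig_def)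
      show ?thesis unfolding e
        by (intro continuous_intros continuous_on_compose2[OF SS_cont[OF f]] continuous_on_compose2[OF SS_cont[OF g]]) auto
    qed
    thus ?thesis by (rule borel_measurable_continuous_onI)
  qed
  have D1: "(1 + norm x) ^ (2 * ?n) * norm (fourier (wig g f x) \<xi>) <= ?c * (C1 * ?I)" for x \<xi>
  proof -
    let ?X = "(1 + norm x) ^ (2 * ?n)"
    have X: "?X > 0" by simp
    have "(1 + norm y) ^ ?n * norm (wig g f x y) <= C1 / ?X" for y
      using C1(2)[of x y] X by (simp add: pos_le_divide_eq mult_ac)
    from integrable_decay(2)[OF wm this] have "norm (fourier (wig g f x) \<xi>) <= ?c * (C1 / ?X * ?I)"
      using norm_fourier_le[of "wig g f x" \<xi>] c0 by (meson mult_left_mono less_imp_le order_trans)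
    hence "?X * norm (fourier (wig g f x) \<xi>) <= ?X * (?c * (C1 / ?X * ?I))" using X by (intro mult_left_mono) auto
    also have "... = ?c * (C1 * ?I)" using X by (simp add: field_simps)
    finally show ?thesis .
  qed
  obtain Cf where Cf: "Cf >= 0" "\<And>\<xi>. (1 + norm \<xi>) ^ (3 * ?n) * norm (fourier f \<xi>) <= Cf" using SS_decay[OF f] by metis
  obtain Cg where Cg: "Cg >= 0" "\<And>\<xi>. (1 + norm \<xi>) ^ (3 * ?n) * norm (fourier g \<xi>) <= Cg" using SS_decay[OF g] by metis
  let ?K = "inverse (\<bar>1/2\<bar> ^ CARD('d)) :: real"
  have D2: "(1 + norm \<xi>) ^ (2 * ?n) * norm (fourier (wig g f x) \<xi>) <= ?c * (?K * ?K * Cg * Cf * ?I)" for x \<xi>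
  proof -
    let ?u = "\<lambda>y. g (x + (1/2) *\<^sub>R y)" and ?v = "\<lambda>y. cnj (f (x + (-1/2) *\<^sub>R y))"
    have u: "?u \<in> SS" by (rule SS_affine[OF g]) simp
    have v: "?v \<in> SS" by (rule SS_cnj[OF SS_affine[OF f]]) simp
    have uv: "wig g f x = (\<lambda>y. ?u y * ?v y)" by (simp add: wig_def fun_eq_iff)
    have nu: "norm (fourier ?u \<eta>) = ?K * norm (fourier g (2 *\<^sub>R \<eta>))" for \<eta>
      by (subst fourier_affine) (auto simp: norm_mult norm_inverse norm_power norm_divide)
    have nv: "norm (fourier ?v \<eta>) = ?K * norm (fourier f (2 *\<^sub>R \<eta>))" for \<eta>
      by (subst fourier_cnj, subst complex_mod_cnj, subst fourier_affine) (auto simp: norm_mult norm_inverse norm_power norm_divide)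
    let ?P = "(1 + norm \<xi>) ^ (2 * ?n)"
    have "norm (fourier (wig g f x) \<xi>) <= ?c * (LBINT \<eta>. norm (fourier ?v \<eta> * fourier ?u (\<xi> - \<eta>)))"
    proof -
      let ?F = "\<lambda>\<eta>. fourier ?v \<eta> * fourier ?u (\<xi> - \<eta>)"
      have "norm (fourier (wig g f x) \<xi>) = ?c * norm (LBINT \<eta>. ?F \<eta>)"
        unfolding uv fourier_mult[OF SS_integrable[OF u] v] using c0 by (simp only: norm_mult norm_of_real abs_of_pos)
      thus ?thesis using integral_norm_bound[of lborel ?F] c0 by (simp only:) (intro mult_left_mono; simp)
    qed
    moreover have "(LBINT \<eta>. norm (fourier ?v \<eta> * fourier ?u (\<xi> - \<eta>))) <= (?K * ?K * Cg * Cf / ?P) * ?I"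
    proof (rule integrable_decay(2))
      show "(\<lambda>\<eta>. fourier ?v \<eta> * fourier ?u (\<xi> - \<eta>)) \<in> borel_measurable borel"
        by (intro borel_measurable_continuous_onI continuous_intros SS_fourier_cont v
            continuous_on_compose2[OF SS_fourier_cont[OF u]]) auto
      fix \<eta> :: "real^'d"
      let ?A = "1 + norm (2 *\<^sub>R (\<xi> - \<eta>))" and ?B = "1 + norm (2 *\<^sub>R \<eta>)"
      have "1 + norm \<xi> <= 1 + norm (2 *\<^sub>R (\<xi> - \<eta>) + 2 *\<^sub>R \<eta>)" by (simp add: algebra_simps)
      also have "... <= ?A * ?B" by (rule one_plus_norm_sum_le)
      finally have "?P <= (?A * ?B) ^ (2 * ?n)" by (intro power_mono) auto
      moreover have "(1 + norm \<eta>) ^ ?n <= (?A * ?B) ^ ?n"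
      proof (intro power_mono)
        have "1 * (1 + norm \<eta>) <= ?A * ?B" by (intro mult_mono) auto
        thus "1 + norm \<eta> <= ?A * ?B" by simp
      qed auto
      ultimately have "?P * (1 + norm \<eta>) ^ ?n <= (?A * ?B) ^ (2 * ?n) * (?A * ?B) ^ ?n" by (intro mult_mono) auto
      also have "... = ?A ^ (3 * ?n) * ?B ^ (3 * ?n)"
      proof -
        have e: "3 * ?n = 2 * ?n + ?n" by simp
        show ?thesis unfolding e by (simp only: power_add power_mult_distrib mult_ac)
      qed
      finally have "?P * (1 + norm \<eta>) ^ ?n * (norm (fourier g (2 *\<^sub>R (\<xi> - \<eta>))) * norm (fourier f (2 *\<^sub>R \<eta>))) <=
          ?A ^ (3 * ?n) * ?B ^ (3 * ?n) * (norm (fourier g (2 *\<^sub>R (\<xi> - \<eta>))) * norm (fourier f (2 *\<^sub>R \<eta>)))"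
        by (intro mult_right_mono) auto
      also have "... = (?A ^ (3 * ?n) * norm (fourier g (2 *\<^sub>R (\<xi> - \<eta>)))) * (?B ^ (3 * ?n) * norm (fourier f (2 *\<^sub>R \<eta>)))"
        by (simp only: mult_ac)
      also have "... <= Cg * Cf" by (intro mult_mono Cg Cf) auto
      finally have "(?K * ?K) * (?P * (1 + norm \<eta>) ^ ?n * (norm (fourier g (2 *\<^sub>R (\<xi> - \<eta>))) * norm (fourier f (2 *\<^sub>R \<eta>)))) <= (?K * ?K) * (Cg * Cf)"
        by (intro mult_left_mono) auto
      thus "(1 + norm \<eta>) ^ ?n * norm (fourier ?v \<eta> * fourier ?u (\<xi> - \<eta>)) <= ?K * ?K * Cg * Cf / ?P"
        unfolding norm_mult nu nv by (simp add: pos_le_divide_eq mult_ac)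
    qed
    ultimately have "norm (fourier (wig g f x) \<xi>) <= ?c * ((?K * ?K * Cg * Cf / ?P) * ?I)"
      using c0 by (meson mult_left_mono less_imp_le order_trans)
    hence "?P * norm (fourier (wig g f x) \<xi>) <= ?P * (?c * ((?K * ?K * Cg * Cf / ?P) * ?I))" by (intro mult_left_mono) auto
    also have "... = ?c * (?K * ?K * Cg * Cf * ?I)" by (simp add: field_simps)
    finally show ?thesis .
  qed
  define M where "M = ?c * (C1 * ?I) + ?c * (?K * ?K * Cg * Cf * ?I)"
  have M: "?c * (C1 * ?I) <= M" "?c * (?K * ?K * Cg * Cf * ?I) <= M" "M >= 0"
    unfolding M_def using c0 C1 I0 Cf Cg by simp_all
  show ?thesis
  proof (rule that[OF M(3)])
    fix x \<xi> :: "real^'d"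
    let ?X = "(1 + norm x) ^ ?n" and ?Y = "(1 + norm \<xi>) ^ ?n" and ?w = "norm (fourier (wig g f x) \<xi>)"
    have "(?X\<^sup>2 * ?w) * (?Y\<^sup>2 * ?w) <= M * M"
      using order_trans[OF D1[of x \<xi>] M(1)] order_trans[OF D2[of \<xi> x] M(2)] M(3)
      by (intro mult_mono) (auto simp: power_mult[symmetric] mult.commute)
    hence "(?X * ?Y * ?w)\<^sup>2 <= M\<^sup>2" by (simp add: power2_eq_square mult_ac)
    thus "?X * ?Y * ?w <= M" using M(3) by (rule power2_le_imp_le)
  qed
qed

text \<open>
  The Wigner distribution integrates over \<open>x\<close> to the product of the transforms, so that only the symbol
  and Parseval's formula are left. The joint decay of the Wigner distribution justifies the interchange of integrals.
\<close>

lemma kernel_op_evo: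
  fixes f g :: "'d::finite fn"
  assumes f: "f \<in> SS" and g: "g \<in> SS"
  shows "schwartz_kernel c m t (\<lambda>(x, y). g x * cnj (f y)) = ip (evo c m t f) g"
proof -
  let ?c = "complex_of_real (fconst TYPE('d))" and ?p = "phase t (poly_fun c m)"
  have pc: "continuous_on UNIV ?p"
  proof -
    have "poly_fun c m differentiable (at \<eta>)" for \<eta>
      unfolding poly_fun_psum using psum_has_derivative by (rule differentiableI)
    thus ?thesis by (rule phase_continuous)
  qed
  have ck: "conv_kernel c m t \<phi> = ?c * (LBINT \<xi>. ?p \<xi> * cnj (fourier \<phi> \<xi>))" for \<phi>
    by (simp add: conv_kernel_def inv_fourier_distr_def regular_distr_def phase_def fconst_def)
  have "schwartz_kernel c m t (\<lambda>(x, y). g x * cnj (f y)) = (LBINT x. conv_kernel c m t (wig g f x))"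
  proof -
    have wl: "(\<lambda>y. g (x + (1/2) *\<^sub>R y) * cnj (f (x - (1/2) *\<^sub>R y))) = wig g f x" for x
      by (simp add: fun_eq_iff wig_def)
    show ?thesis
      by (simp add: schwartz_kernel_def tensor_distr_def regular_distr_def kappa_def o_def wl)
  qed
  also have "... = ?c * (LBINT x. LBINT \<xi>. ?p \<xi> * cnj (fourier (wig g f x) \<xi>))"
    unfolding ck by simp
  also have "(LBINT x. LBINT \<xi>. ?p \<xi> * cnj (fourier (wig g f x) \<xi>)) = (LBINT \<xi>. LBINT x. ?p \<xi> * cnj (fourier (wig g f x) \<xi>))"
  proof (rule lborel_pair.Fubini_integral[symmetric])
    obtain C where C: "\<And>x \<xi>. wt x * wt \<xi> * norm (fourier (wig g f x) \<xi>) <= C"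
      using fourier_wig_decay[OF f g] by metis
    have wm: "(\<lambda>(z, y). wig g f (fst z) y * osc y (snd z)) \<in> borel_measurable ((borel \<Otimes>\<^sub>M borel) \<Otimes>\<^sub>M lborel)"
    proof -
      have "continuous_on UNIV (\<lambda>p. wig g f (fst (fst p)) (snd p) * osc (snd p) (snd (fst p)))"
        unfolding wig_def
        by (intro continuous_intros continuous_on_compose2[OF SS_cont[OF f]] continuous_on_compose2[OF SS_cont[OF g]]) auto
      hence "(\<lambda>(z, y). wig g f (fst z) y * osc y (snd z)) \<in> borel_measurable ((borel \<Otimes>\<^sub>M borel) \<Otimes>\<^sub>M borel)"
        unfolding borel_prod case_prod_beta by (rule borel_measurable_continuous_onI)
      moreover have "borel_measurable ((borel \<Otimes>\<^sub>M borel) \<Otimes>\<^sub>M lborel) = borel_measurable (((borel :: (real^'d) measure) \<Otimes>\<^sub>M (borel :: (real^'d) measure)) \<Otimes>\<^sub>M (borel :: (real^'d) measure))"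
        by (intro measurable_cong_sets sets_pair_measure_cong refl sets_lborel)
      ultimately show ?thesis by simp
    qed
    have fm: "(\<lambda>z. fourier (wig g f (fst z)) (snd z)) \<in> borel_measurable (borel \<Otimes>\<^sub>M borel)"
      unfolding fourier_eq
      by (intro borel_measurable_times borel_measurable_const lborel.borel_measurable_lebesgue_integral wm)
    have pm: "?p \<in> borel_measurable borel" by (rule borel_measurable_continuous_onI[OF pc])
    show "integrable (lborel \<Otimes>\<^sub>M lborel) (\<lambda>(x, \<xi>). ?p \<xi> * cnj (fourier (wig g f x) \<xi>))"
    proof (rule integrable_pair_decay)
      show "(\<lambda>(x, \<xi>). ?p \<xi> * cnj (fourier (wig g f x) \<xi>)) \<in> borel_measurable (borel \<Otimes>\<^sub>M borel)"
      proof -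
        have cm: "cnj \<in> borel_measurable borel" by (intro borel_measurable_continuous_onI continuous_intros)
        show ?thesis unfolding case_prod_beta
          by (intro borel_measurable_times measurable_compose[OF measurable_snd pm] measurable_compose[OF fm cm])
      qed
      show "wt x * wt \<xi> * norm (?p \<xi> * cnj (fourier (wig g f x) \<xi>)) <= C" for x \<xi>
        using C[of x \<xi>] by (simp add: norm_mult)
    qed
  qed
  also have "... = (LBINT \<xi>. ?p \<xi> * cnj (LBINT x. fourier (wig g f x) \<xi>))"
    by simp
  also have "... = (LBINT \<xi>. ?p \<xi> * (inverse ?c * (fourier f \<xi> * cnj (fourier g \<xi>))))"
  proof (rule Bochner_Integration.integral_cong[OF refl])
    fix \<xi> :: "real^'d"
    let ?e = "\<lambda>y. osc y \<xi>"
    let ?Ig = "LBINT y. g y * ?e y" and ?If = "LBINT y. f y * ?e y"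
    have em: "?e \<in> borel_measurable borel" by measurable
    obtain C where C: "\<And>x y. wt x * wt y * norm (wig g f x y) <= C"
      using wig_decay[OF f g] by metis
    have "(LBINT x. fourier (wig g f x) \<xi>) = ?c * (LBINT x. LBINT y. wig g f x y * ?e y)"
      unfolding fourier_eq by simp
    also have "(LBINT x. LBINT y. wig g f x y * ?e y) = (LBINT y. LBINT x. wig g f x y * ?e y)"
    proof (rule lborel_pair.Fubini_integral[symmetric])
      show "integrable (lborel \<Otimes>\<^sub>M lborel) (\<lambda>(x, y). wig g f x y * ?e y)"
      proof (rule integrable_pair_decay)
        show "(\<lambda>(x, y). wig g f x y * ?e y) \<in> borel_measurable (borel \<Otimes>\<^sub>M borel)"
          using borel_measurable_pair_continuous[OF continuous_on_wig[OF f g]] em by (simp add: case_prod_beta) measurable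
        show "wt x * wt y * norm (wig g f x y * ?e y) <= C" for x y
          using C[of x y] by (simp add: norm_mult)
      qed
    qed
    also have "... = (LBINT y. LBINT x. g (x + y) * cnj (f x) * ?e y)"
    proof (rule Bochner_Integration.integral_cong[OF refl])
      fix y :: "real^'d"
      let ?H = "\<lambda>x. wig g f x y * ?e y"
      have "(LBINT x. ?H x) = (LBINT x. ?H (x + (1/2) *\<^sub>R y))" by (rule lborel_integral_translate(1)[symmetric])
      also have "... = (LBINT x. g (x + y) * cnj (f x) * ?e y)"
        by (simp add: wig_def add.assoc flip: scaleR_add_left)
      finally show "(LBINT x. ?H x) = (LBINT x. g (x + y) * cnj (f x) * ?e y)" .
    qed
    also have "... = (LBINT x. LBINT y. g (x + y) * cnj (f x) * ?e y)"
    proof (rule lborel_pair.Fubini_integral)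
      obtain Cf where Cf: "Cf >= 0" "\<And>\<xi>. (1 + norm \<xi>) ^ (2 * CARD('d) + 2 * CARD('d)) * norm (f \<xi>) <= Cf" using SS_decay[OF f] by metis
      obtain Cg where Cg: "Cg >= 0" "\<And>\<xi>. wt \<xi> * norm (g \<xi>) <= Cg" using SS_decay[OF g] by metis
      show "integrable (lborel \<Otimes>\<^sub>M lborel) (\<lambda>(x, y). g (x + y) * cnj (f x) * ?e y)"
      proof (rule integrable_pair_decay[where C="Cf * Cg"])
        have "continuous_on UNIV (\<lambda>(x, y). g (x + y) * cnj (f x) * ?e y)"
          unfolding case_prod_beta
          by (intro continuous_intros continuous_on_compose2[OF SS_cont[OF f]] continuous_on_compose2[OF SS_cont[OF g]]) auto
        thus "(\<lambda>(x, y). g (x + y) * cnj (f x) * ?e y) \<in> borel_measurable (borel \<Otimes>\<^sub>M borel)"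
          by (rule borel_measurable_pair_continuous)
        fix x y :: "real^'d"
        have "1 + norm y <= (1 + norm (x + y)) * (1 + norm x)"
          using one_plus_norm_sum_le[of "x + y" "- x"] by simp
        hence "wt y <= ((1 + norm (x + y)) * (1 + norm x)) ^ (2 * CARD('d))"
          by (intro power_mono) auto
        hence "wt x * wt y * (norm (g (x + y)) * norm (f x)) <=
          wt x * ((1 + norm (x + y)) * (1 + norm x)) ^ (2 * CARD('d)) * (norm (g (x + y)) * norm (f x))"
          by (intro mult_right_mono mult_left_mono) auto
        also have "... = ((1 + norm x) ^ (2 * CARD('d) + 2 * CARD('d)) * norm (f x)) * ((1 + norm (x + y)) ^ (2 * CARD('d)) * norm (g (x + y)))"
          by (simp only: power_add power_mult_distrib mult_ac)
        also have "... <= Cf * Cg" by (intro mult_mono Cf Cg) auto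
        finally show "wt x * wt y * norm (g (x + y) * cnj (f x) * ?e y) <= Cf * Cg"
          by (simp add: norm_mult)
      qed
    qed
    also have "... = (LBINT x. cnj (f x * ?e x) * ?Ig)"
    proof (rule Bochner_Integration.integral_cong[OF refl])
      fix x :: "real^'d"
      let ?H = "\<lambda>z. g z * cnj (f x) * ?e (z - x)"
      have "(LBINT y. g (x + y) * cnj (f x) * ?e y) = (LBINT y. ?H (y + x))" by (simp add: add.commute)
      also have "... = (LBINT z. ?H z)" by (rule lborel_integral_translate(1))
      also have "... = (LBINT z. cnj (f x * ?e x) * (g z * ?e z))"
        by (rule Bochner_Integration.integral_cong[OF refl])
           (simp add: exp_cnj inner_diff_left algebra_simps exp_add exp_diff exp_minus field_simps)
      also have "... = cnj (f x * ?e x) * ?Ig" by (rule integral_mult_right_zero)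
      finally show "(LBINT y. g (x + y) * cnj (f x) * ?e y) = cnj (f x * ?e x) * ?Ig" .
    qed
    also have "... = (LBINT x. cnj (f x * ?e x)) * ?Ig" by (rule integral_mult_left_zero)
    also have "(LBINT x. cnj (f x * ?e x)) = cnj ?If" by (rule Bochner_Integration.integral_cnj)
    finally have 1: "(LBINT x. fourier (wig g f x) \<xi>) = ?c * (cnj ?If * ?Ig)" .
    have cn: "?c \<noteq> 0" using fconst_pos[where 'd='d] by simp
    have "cnj (?c * (cnj ?If * ?Ig)) = inverse ?c * ((?c * ?If) * cnj (?c * ?Ig))"
      using cn by (simp only: complex_cnj_mult complex_cnj_cnj complex_cnj_complex_of_real) (simp add: field_simps)
    hence "cnj (LBINT x. fourier (wig g f x) \<xi>) = inverse ?c * (fourier f \<xi> * cnj (fourier g \<xi>))"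
      unfolding 1 fourier_eq[of f] fourier_eq[of g] by (simp only:)
    thus "?p \<xi> * cnj (LBINT x. fourier (wig g f x) \<xi>) = ?p \<xi> * (inverse ?c * (fourier f \<xi> * cnj (fourier g \<xi>)))"
      by (simp only:)
  qed
  also have "... = (LBINT \<xi>. inverse ?c * (?p \<xi> * fourier f \<xi> * cnj (fourier g \<xi>)))"
    by (simp only: mult_ac)
  also have "... = inverse ?c * (LBINT \<xi>. fourier (evo c m t f) \<xi> * cnj (fourier g \<xi>))"
    unfolding fourier_evo[OF f] by (rule integral_mult_right_zero)
  also have "?c * ... = (LBINT \<xi>. fourier (evo c m t f) \<xi> * cnj (fourier g \<xi>))"
    using fconst_pos[where 'd='d] by simp
  also have "... = ip (evo c m t f) g"
    unfolding ip_def by (rule SS_parseval[symmetric, OF evo_SS(1)[OF f] g])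
  finally show ?thesis .
qed

lemma SS_eq_0:
  fixes f :: "'d::finite fn"
  assumes f: "f \<in> SS" and z: "ip f f = 0"
  shows "f x = 0"
proof (rule ccontr)
  assume nz: "f x \<noteq> 0"
  have "(LBINT x. (norm (f x))\<^sup>2) = 0" using z unfolding ip_self by simp
  hence "AE x in lborel. (norm (f x))\<^sup>2 = 0"
    using integral_nonneg_eq_0_iff_AE[OF SS_square_integrable[OF f]] by simp
  hence "{x. f x \<noteq> 0} \<in> null_sets lborel" by (simp add: AE_iff_null SS_cont[OF f] open_Collect_neq borel_open null_sets_def)
  hence "negligible {x. f x \<noteq> 0}" by (auto simp: negligible_iff_null_sets intro: null_sets_completionI)
  moreover have "open {x. f x \<noteq> 0}" by (intro open_Collect_neq SS_cont f continuous_intros)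
  ultimately show False using nz open_not_negligible by blast
qed

lemma kernel_op_eq:
  fixes f :: "'d::finite fn"
  assumes f: "f \<in> SS"
  shows "kernel_op c m t f = restrict (regular_distr (evo c m t f)) schwartz"
  unfolding kernel_op_def
proof (rule restrict_ext)
  fix g :: "'d fn" assume "g \<in> schwartz"
  hence "g \<in> SS" by (simp add: schwartz_eq_SS)
  from kernel_op_evo[OF f this, of c m t]
  show "schwartz_kernel c m t (\<lambda>(x, y). g x * cnj (f y)) = regular_distr (evo c m t f) g"
    by (simp add: regular_distr_def ip_def)
qed

text \<open>
  Uniqueness of the representing function: the difference of two of them is itself a test function.
\<close>

lemma propagator_eq_evo:
  fixes f :: "'d::finite fn"
  assumes f: "f \<in> SS"
  shows "propagator c m t f = evo c m t f"
  unfolding propagator_def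
proof (rule the_equality)
  show "evo c m t f \<in> schwartz \<and> kernel_op c m t f = restrict (regular_distr (evo c m t f)) schwartz"
    using evo_SS(1)[OF f] kernel_op_eq[OF f] by (simp add: schwartz_eq_SS)
  fix g assume g: "g \<in> schwartz \<and> kernel_op c m t f = restrict (regular_distr g) schwartz"
  let ?h = "\<lambda>x. g x - evo c m t f x"
  have gS: "g \<in> SS" using g by (simp add: schwartz_eq_SS)
  have h: "?h \<in> SS" by (intro SS_diff gS evo_SS(1) f)
  have "ip g ?h = ip (evo c m t f) ?h"
  proof -
    have hs: "?h \<in> schwartz" using h by (simp add: schwartz_eq_SS)
    have "restrict (regular_distr g) schwartz ?h = restrict (regular_distr (evo c m t f)) schwartz ?h"
      using g kernel_op_eq[OF f, of c m t] by (simp only:)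
    thus ?thesis using hs by (simp add: regular_distr_def ip_def)
  qed
  hence z: "ip g ?h - ip (evo c m t f) ?h = 0" by (rule iffD2[OF right_minus_eq])
  have "ip ?h ?h = ip g ?h - ip (evo c m t f) ?h"
  proof -
    have e: "?h = (\<lambda>x. 1 * g x + (-1) * evo c m t f x)" by (intro ext) simp
    have "ip ?h ?h = ip (\<lambda>x. 1 * g x + (-1) * evo c m t f x) ?h" by (rule arg_cong[OF e, of "\<lambda>k. ip k ?h"])
    also have "... = 1 * ip g ?h + (-1) * ip (evo c m t f) ?h"
      by (rule ip_linear[OF gS evo_SS(1)[OF f] h])
    finally show ?thesis by (simp only: mult_1 mult_minus1 add_uminus_conv_diff)
  qed
  hence z0: "ip ?h ?h = 0" using z by (rule trans)
  show "g = evo c m t f"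
  proof (rule ext)
    fix x show "g x = evo c m t f x" using SS_eq_0[OF h z0, of x] by (rule iffD1[OF right_minus_eq])
  qed
qed

section \<open>The topology of the Gelfand--Shilov space and its dual\<close>

lemma bnd_add:
  assumes "f \<in> SS" "g \<in> SS" "bnd r s H P f" "bnd r s H Q g"
  shows "bnd r s H (P + Q) (\<lambda>x. f x + g x)"
  unfolding bnd_def
proof (intro conjI allI)
  show "norm (f x + g x) <= (P + Q) * ew r H x" for x
    using assms(3,4) norm_triangle_ineq[of "f x" "g x"] unfolding bnd_def distrib_right
    by (meson add_mono order_trans)
  show "norm (fourier (\<lambda>x. f x + g x) \<xi>) <= (P + Q) * ew s H \<xi>" for \<xi>
    using assms(3,4) norm_triangle_ineq[of "fourier f \<xi>" "fourier g \<xi>"]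
    unfolding bnd_def distrib_right fourier_add[OF SS_integrable[OF assms(1)] SS_integrable[OF assms(2)]]
    by (meson add_mono order_trans)
qed

lemma bnd_cmult:
  assumes "bnd r s H P f" shows "bnd r s H (norm a * P) (\<lambda>x. a * f x)"
  using assms unfolding bnd_def by (simp add: norm_mult fourier_cmult mult.assoc mult_left_mono)

lemma bnd_zero: "bnd r s H 0 (\<lambda>x. 0)"
  by (simp add: bnd_def fourier_def)

locale gs_indices =
  fixes r s :: real
  assumes r: "r > 0" and s: "s > 0" and rs: "r + s > 1"
begin

lemma gs_iff: "f \<in> gs r s \<longleftrightarrow> f \<in> SS \<and> (\<forall>H>0. \<exists>P. bnd r s H P f)"
  using bnd_imp_gs[OF r s rs] gs_bnd_ex[OF r s] gs_imp_SS by blast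

lemma gs_add: assumes "f \<in> gs r s" "g \<in> gs r s" shows "(\<lambda>x. f x + g x) \<in> gs r s"
  unfolding gs_iff
proof (intro conjI allI impI)
  show "(\<lambda>x. f x + g x) \<in> SS" using assms by (intro SS_add) (auto simp: gs_iff)
  fix H :: real assume "H > 0"
  then obtain P Q where "bnd r s H P f" "bnd r s H Q g" using assms unfolding gs_iff by blast
  thus "\<exists>P. bnd r s H P (\<lambda>x. f x + g x)"
    using assms bnd_add[of f g r s H P Q] unfolding gs_iff by blast
qed

lemma gs_cmult: assumes "f \<in> gs r s" shows "(\<lambda>x. a * f x) \<in> gs r s"
  using assms unfolding gs_iff by (blast intro: bnd_cmult SS_cmult)

lemma gs_diff: assumes "f \<in> gs r s" "g \<in> gs r s" shows "(\<lambda>x. f x - g x) \<in> gs r s"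
  using gs_add[OF assms(1) gs_cmult[OF assms(2), of "-1"]] by simp

lemma gs_zero: "(\<lambda>x. 0) \<in> gs r s"
  unfolding gs_iff using SS_zero bnd_zero by blast

lemma gs_norm_leI:
  assumes "\<And>z. gs_quotient r s h f z <= B" shows "gs_norm r s h f <= B"
  unfolding gs_norm_def by (rule cSUP_least) (auto intro: assms)

lemma gs_norm_add:
  fixes f :: "'d::finite fn"
  assumes f: "f \<in> gs r s" and g: "g \<in> gs r s" and h: "h > 0"
  shows "gs_norm r s h (\<lambda>x. f x + g x) <= gs_norm r s h f + gs_norm r s h g"
proof (rule gs_norm_leI)
  fix z :: "(real^'d) \<times> ('d => nat) \<times> ('d => nat)"
  obtain x \<alpha> \<beta> where z: "z = (x, \<alpha>, \<beta>)" by (cases z) auto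
  let ?w = "map Inl (mi_list \<alpha>) @ map Inr (mi_list \<beta>)"
  let ?D = "h ^ mi_length (\<lambda>i. \<alpha> i + \<beta> i) * mi_fact \<alpha> powr r * mi_fact \<beta> powr s"
  have D: "?D > 0" using h mi_fact_pos[of \<alpha>] mi_fact_pos[of \<beta>] by simp
  have e: "wop ?w (\<lambda>x. f x + g x) x = wop ?w f x + wop ?w g x"
    using wop_linear[OF gs_imp_SS[OF f] gs_imp_SS[OF g], of ?w 1 1] by (simp del: foldr_append)
  have "gs_quotient r s h (\<lambda>x. f x + g x) z <= gs_quotient r s h f z + gs_quotient r s h g z"
    unfolding z gs_quotient_def case_prod_conv monomial_derivative_wop e add_divide_distrib[symmetric]
    using D by (intro divide_right_mono norm_triangle_ineq) auto
  also have "... <= gs_norm r s h f + gs_norm r s h g"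
    by (intro add_mono gs_quotient_le_norm f g h)
  finally show "gs_quotient r s h (\<lambda>x. f x + g x) z <= gs_norm r s h f + gs_norm r s h g" .
qed

lemma gs_norm_cmult:
  fixes f :: "'d::finite fn"
  assumes f: "f \<in> gs r s" and h: "h > 0"
  shows "gs_norm r s h (\<lambda>x. a * f x) <= norm a * gs_norm r s h f"
proof (rule gs_norm_leI)
  fix z :: "(real^'d) \<times> ('d => nat) \<times> ('d => nat)"
  obtain x \<alpha> \<beta> where z: "z = (x, \<alpha>, \<beta>)" by (cases z) auto
  let ?w = "map Inl (mi_list \<alpha>) @ map Inr (mi_list \<beta>)"
  have e: "wop ?w (\<lambda>x. a * f x) x = a * wop ?w f x"
    using wop_linear[OF gs_imp_SS[OF f] gs_imp_SS[OF f], of ?w a 0] by (simp del: foldr_append)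
  have "gs_quotient r s h (\<lambda>x. a * f x) z = norm a * gs_quotient r s h f z"
    unfolding z gs_quotient_def case_prod_conv monomial_derivative_wop e norm_mult by simp
  also have "... <= norm a * gs_norm r s h f" by (intro mult_left_mono gs_quotient_le_norm f h) auto
  finally show "gs_quotient r s h (\<lambda>x. a * f x) z <= norm a * gs_norm r s h f" .
qed

lemma gs_norm_zero: "h > 0 ==> gs_norm r s h (\<lambda>x::real^'d::finite. 0) = 0"
  using gs_norm_cmult[OF gs_zero[where ?'a='d], of h 0] gs_norm_nonneg[OF gs_zero[where ?'a='d], of h] by simp

lemma gs_norm_antimono:
  fixes f :: "'d::finite fn"
  assumes f: "f \<in> gs r s" and h: "0 < h" "h <= h'"
  shows "gs_norm r s h' f <= gs_norm r s h f"
proof (rule gs_norm_leI)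
  fix z :: "(real^'d) \<times> ('d => nat) \<times> ('d => nat)"
  obtain x \<alpha> \<beta> where z: "z = (x, \<alpha>, \<beta>)" by (cases z) auto
  have "gs_quotient r s h' f z <= gs_quotient r s h f z"
    unfolding z gs_quotient_def case_prod_conv using h mi_fact_pos[of \<alpha>] mi_fact_pos[of \<beta>]
    by (intro divide_left_mono mult_right_mono power_mono mult_pos_pos zero_less_power) auto
  also have "... <= gs_norm r s h f" by (rule gs_quotient_le_norm[OF f h(1)])
  finally show "gs_quotient r s h' f z <= gs_norm r s h f" .
qed

definition gball :: "'d::finite fn => real => real => 'd fn set"
  where "gball f h \<epsilon> = {g \<in> gs r s. gs_norm r s h (\<lambda>x. g x - f x) < \<epsilon>}"

lemma gball_center: "f \<in> gs r s ==> h > 0 ==> \<epsilon> > 0 ==> f \<in> gball f h \<epsilon>"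
  by (simp add: gball_def gs_norm_zero)

lemma gs_topology_eq: "gs_topology r s = topology_generated_by {gball f h \<epsilon> | f h \<epsilon>. f \<in> gs r s \<and> h > 0 \<and> \<epsilon> > 0}"
  by (simp add: gs_topology_def gball_def)

lemma gball_inside:
  assumes g: "g \<in> gball f h \<epsilon>" and f: "f \<in> gs r s" and h: "h > 0"
  obtains \<delta> where "\<delta> > 0" "gball g h \<delta> \<subseteq> gball f h \<epsilon>"
proof (rule that[of "\<epsilon> - gs_norm r s h (\<lambda>x. g x - f x)"])
  show "0 < \<epsilon> - gs_norm r s h (\<lambda>x. g x - f x)" using g by (simp add: gball_def)
  have gg: "g \<in> gs r s" using g by (simp add: gball_def)
  show "gball g h (\<epsilon> - gs_norm r s h (\<lambda>x. g x - f x)) \<subseteq> gball f h \<epsilon>"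
  proof
    fix k assume k: "k \<in> gball g h (\<epsilon> - gs_norm r s h (\<lambda>x. g x - f x))"
    hence kk: "k \<in> gs r s" by (simp add: gball_def)
    have "gs_norm r s h (\<lambda>x. (k x - g x) + (g x - f x)) <= gs_norm r s h (\<lambda>x. k x - g x) + gs_norm r s h (\<lambda>x. g x - f x)"
      by (intro gs_norm_add gs_diff kk gg f h)
    thus "k \<in> gball f h \<epsilon>" using k kk by (simp add: gball_def)
  qed
qed

text \<open>
  The norms increase as \<open>h\<close> decreases, so every intersection of two balls around \<open>f\<close> contains a ball around \<open>f\<close>.
\<close>

lemma openin_gs_iff:
  "openin (gs_topology r s) U \<longleftrightarrow> U \<subseteq> gs r s \<and> (\<forall>f\<in>U. \<exists>h>0. \<exists>\<delta>>0. gball f h \<delta> \<subseteq> U)" (is "?L \<longleftrightarrow> ?R")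
proof
  assume ?L
  hence "generate_topology_on {gball f h \<epsilon> | f h \<epsilon>. f \<in> gs r s \<and> h > 0 \<and> \<epsilon> > 0} U"
    unfolding gs_topology_eq by (rule openin_topology_generated_by)
  thus ?R
  proof induction
    case Empty thus ?case by simp
  next
    case (Int a b)
    show ?case
    proof (intro conjI ballI)
      show "a \<inter> b \<subseteq> gs r s" using Int by blast
      fix f assume f: "f \<in> a \<inter> b"
      have fg: "f \<in> gs r s" using Int f by blast
      obtain h1 \<delta>1 where 1: "h1 > 0" "\<delta>1 > 0" "gball f h1 \<delta>1 \<subseteq> a" using Int f by blast
      obtain h2 \<delta>2 where 2: "h2 > 0" "\<delta>2 > 0" "gball f h2 \<delta>2 \<subseteq> b" using Int f by blast
      have sub: "gball f (min h1 h2) (min \<delta>1 \<delta>2) \<subseteq> gball f h \<delta>" if "min h1 h2 <= h" "min \<delta>1 \<delta>2 <= \<delta>" for h \<delta>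
      proof
        fix g assume g: "g \<in> gball f (min h1 h2) (min \<delta>1 \<delta>2)"
        hence gg: "g \<in> gs r s" by (simp add: gball_def)
        have "gs_norm r s h (\<lambda>x. g x - f x) <= gs_norm r s (min h1 h2) (\<lambda>x. g x - f x)"
          using that 1 2 by (intro gs_norm_antimono gs_diff gg fg) auto
        also have "... < min \<delta>1 \<delta>2" using g by (simp add: gball_def del: min_less_iff_conj)
        also have "... <= \<delta>" by (rule that(2))
        finally show "g \<in> gball f h \<delta>" using gg by (simp add: gball_def)
      qed
      show "\<exists>h>0. \<exists>\<delta>>0. gball f h \<delta> \<subseteq> a \<inter> b"
        using sub[of h1 \<delta>1] sub[of h2 \<delta>2] 1 2
        by (intro exI[of _ "min h1 h2"] conjI exI[of _ "min \<delta>1 \<delta>2"]) auto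
    qed
  next
    case (UN K)
    show ?case
    proof (intro conjI ballI)
      show "\<Union>K \<subseteq> gs r s" using UN by blast
      fix f assume "f \<in> \<Union>K"
      then obtain k where k: "k \<in> K" "f \<in> k" by blast
      then obtain h \<delta> where "h > 0" "\<delta> > 0" "gball f h \<delta> \<subseteq> k" using UN by blast
      thus "\<exists>h>0. \<exists>\<delta>>0. gball f h \<delta> \<subseteq> \<Union>K" using k by blast
    qed
  next
    case (Basis S)
    then obtain f h \<epsilon> where S: "S = gball f h \<epsilon>" "f \<in> gs r s" "h > 0" "\<epsilon> > 0" by blast
    show ?case
    proof (intro conjI ballI)
      show "S \<subseteq> gs r s" by (auto simp: S gball_def)
      fix g assume "g \<in> S"
      then obtain \<delta> where "\<delta> > 0" "gball g h \<delta> \<subseteq> gball f h \<epsilon>" using gball_inside S by metis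
      thus "\<exists>h>0. \<exists>\<delta>>0. gball g h \<delta> \<subseteq> S" using S by blast
    qed
  qed
next
  assume R: ?R
  let ?S = "{gball f h \<epsilon> | f h \<epsilon>. f \<in> gs r s \<and> h > 0 \<and> \<epsilon> > 0}"
  have "U = \<Union>{B \<in> ?S. B \<subseteq> U}"
  proof (intro equalityI subsetI)
    fix f assume f: "f \<in> U"
    then obtain h \<delta> where h: "h > 0" "\<delta> > 0" "gball f h \<delta> \<subseteq> U" using R by blast
    moreover have "f \<in> gball f h \<delta>" using R f h by (intro gball_center) auto
    ultimately show "f \<in> \<Union>{B \<in> ?S. B \<subseteq> U}" using R f by blast
  qed blast
  moreover have "generate_topology_on ?S (\<Union>{B \<in> ?S. B \<subseteq> U})"
    by (rule generate_topology_on.UN) (auto intro: generate_topology_on.Basis)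
  ultimately show ?L unfolding gs_topology_eq openin_topology_generated_by_iff by simp
qed

lemma topspace_gs [simp]: "topspace (gs_topology r s) = (gs r s :: 'd::finite fn set)"
proof (rule antisym)
  show "topspace (gs_topology r s) \<subseteq> (gs r s :: 'd fn set)"
    using openin_gs_iff[of "topspace (gs_topology r s) :: 'd fn set"] by simp
  have "openin (gs_topology r s) (gs r s :: 'd fn set)"
    unfolding openin_gs_iff by (auto simp: gball_def intro!: exI[of _ 1])
  thus "(gs r s :: 'd fn set) \<subseteq> topspace (gs_topology r s)" by (rule openin_subset)
qed

lemma continuous_map_gs_gsI:
  fixes T :: "'d::finite fn => 'd fn"
  assumes m: "\<And>f. f \<in> gs r s ==> T f \<in> gs r s"
    and l: "\<And>f g. f \<in> gs r s ==> g \<in> gs r s ==> T (\<lambda>x. f x - g x) = (\<lambda>x. T f x - T g x)"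
    and b: "\<And>h. h > 0 ==> \<exists>h'>0. \<exists>C>0. \<forall>f\<in>gs r s. gs_norm r s h (T f) <= C * gs_norm r s h' f"
  shows "continuous_map (gs_topology r s) (gs_topology r s) T"
  unfolding continuous_map_def
proof (intro conjI allI impI)
  show "T \<in> topspace (gs_topology r s) \<rightarrow> topspace (gs_topology r s)" using m by simp
  fix U :: "'d fn set" assume U: "openin (gs_topology r s) U"
  show "openin (gs_topology r s) {f \<in> topspace (gs_topology r s). T f \<in> U}"
    unfolding openin_gs_iff
  proof (intro conjI ballI)
    fix f assume "f \<in> {f \<in> topspace (gs_topology r s). T f \<in> U}"
    hence f: "f \<in> gs r s" "T f \<in> U" by auto
    then obtain h \<delta> where h: "h > 0" "\<delta> > 0" "gball (T f) h \<delta> \<subseteq> U" using U unfolding openin_gs_iff by blast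
    obtain h' C where C: "h' > 0" "C > 0" "\<And>f. f \<in> gs r s ==> gs_norm r s h (T f) <= C * gs_norm r s h' f" using b[OF h(1)] by blast
    have "gball f h' (\<delta> / C) \<subseteq> {f \<in> topspace (gs_topology r s). T f \<in> U}"
    proof
      fix g assume g: "g \<in> gball f h' (\<delta> / C)"
      hence gg: "g \<in> gs r s" by (simp add: gball_def)
      have "gs_norm r s h (\<lambda>x. T g x - T f x) <= C * gs_norm r s h' (\<lambda>x. g x - f x)"
        using C(3)[OF gs_diff[OF gg f(1)]] l[OF gg f(1)] by simp
      also have "... < \<delta>" using g C by (simp add: gball_def pos_less_divide_eq mult.commute)
      finally have "T g \<in> gball (T f) h \<delta>" using m[OF gg] by (simp add: gball_def)
      thus "g \<in> {f \<in> topspace (gs_topology r s). T f \<in> U}" using h gg by auto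
    qed
    thus "\<exists>h>0. \<exists>\<delta>>0. gball f h \<delta> \<subseteq> {f \<in> topspace (gs_topology r s). T f \<in> U}"
      using C h by (meson divide_pos_pos)
  qed auto
qed

lemma gs_dual_add: "u \<in> gs_dual r s ==> f \<in> gs r s ==> g \<in> gs r s ==> u (\<lambda>x. f x + g x) = u f + u g"
  by (simp add: gs_dual_def)

lemma gs_dual_cmult: "u \<in> gs_dual r s ==> f \<in> gs r s ==> u (\<lambda>x. a * f x) = cnj a * u f"
  by (simp add: gs_dual_def)

lemma gs_dual_diff: "u \<in> gs_dual r s ==> f \<in> gs r s ==> g \<in> gs r s ==> u (\<lambda>x. f x - g x) = u f - u g"
  using gs_dual_add[of u f "\<lambda>x. (-1) * g x"] gs_dual_cmult[of u g "-1"] gs_cmult[of g "-1"] by simp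

lemma gs_dual_zero: "u \<in> gs_dual r s ==> u (\<lambda>x. 0) = 0"
  using gs_dual_cmult[of u "\<lambda>x. 0" 0] gs_zero by simp

lemma gs_dual_bound:
  fixes u :: "('d::finite) functional"
  assumes u: "u \<in> gs_dual r s"
  obtains h C where "h > 0" "C > 0" "\<And>f. f \<in> gs r s ==> norm (u f) <= C * gs_norm r s h f"
proof -
  have c: "continuous_map (gs_topology r s) euclidean u" using u by (simp add: gs_dual_def)
  have "openin (gs_topology r s) {f \<in> topspace (gs_topology r s). u f \<in> ball 0 1}"
    by (rule openin_continuous_map_preimage[OF c]) simp
  moreover have "(\<lambda>x. 0) \<in> {f \<in> topspace (gs_topology r s). u f \<in> ball 0 1}"
    using gs_dual_zero[OF u] gs_zero by simp
  ultimately obtain h \<delta> where h: "h > 0" "\<delta> > 0" "gball (\<lambda>x. 0) h \<delta> \<subseteq> {f \<in> topspace (gs_topology r s). u f \<in> ball 0 1}"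
    unfolding openin_gs_iff by blast
  have "norm (u f) <= (1 / \<delta>) * gs_norm r s h f" if f: "f \<in> gs r s" for f
  proof -
    have "\<delta> * norm (u f) <= gs_norm r s h f"
    proof (rule dense_ge)
      fix c assume c: "gs_norm r s h f < c"
      have c0: "c > 0" using c gs_norm_nonneg[OF f h(1)] by linarith
      let ?a = "complex_of_real (\<delta> / c)"
      have "gs_norm r s h (\<lambda>x. ?a * f x) <= norm ?a * gs_norm r s h f" by (rule gs_norm_cmult[OF f h(1)])
      also have "norm ?a * gs_norm r s h f = \<delta> * (gs_norm r s h f / c)" using h c0 by (simp add: norm_divide)
      also have "... < \<delta> * 1" using c c0 h by (intro mult_strict_left_mono) auto
      finally have "(\<lambda>x. ?a * f x) \<in> gball (\<lambda>x. 0) h \<delta>" using gs_cmult[OF f, of ?a] unfolding gball_def by simp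
      hence "norm (u (\<lambda>x. ?a * f x)) < 1" using h(3) unfolding subset_iff mem_Collect_eq by (simp only: mem_ball_0)
      hence "norm (cnj ?a * u f) < 1" unfolding gs_dual_cmult[OF u f] .
      hence "(\<delta> / c) * norm (u f) < 1" using h c0 by (simp add: norm_mult norm_divide)
      thus "\<delta> * norm (u f) <= c" using c0 by (simp add: field_simps)
    qed
    thus ?thesis using h by (simp add: field_simps)
  qed
  thus ?thesis using that[of h "1 / \<delta>"] h by simp
qed

lemma gs_dualI:
  fixes u :: "('d::finite) functional"
  assumes e: "u \<in> extensional (gs r s)"
    and a: "\<And>f g. f \<in> gs r s ==> g \<in> gs r s ==> u (\<lambda>x. f x + g x) = u f + u g"
    and c: "\<And>a f. f \<in> gs r s ==> u (\<lambda>x. a * f x) = cnj a * u f"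
    and h: "h > 0" and b: "\<And>f. f \<in> gs r s ==> norm (u f) <= C * gs_norm r s h f"
  shows "u \<in> gs_dual r s"
proof -
  have d: "u (\<lambda>x. f x - g x) = u f - u g" if "f \<in> gs r s" "g \<in> gs r s" for f g
    using a[OF that(1) gs_cmult[OF that(2), of "-1"]] c[OF that(2), of "-1"] by simp
  have "continuous_map (gs_topology r s) euclidean u"
    unfolding continuous_map_def
  proof (intro conjI allI impI)
    fix U :: "complex set" assume "openin euclidean U"
    hence U: "open U" by simp
    show "openin (gs_topology r s) {f \<in> topspace (gs_topology r s). u f \<in> U}"
      unfolding openin_gs_iff
    proof (intro conjI ballI)
      fix f assume "f \<in> {f \<in> topspace (gs_topology r s). u f \<in> U}"
      hence f: "f \<in> gs r s" "u f \<in> U" by auto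
      then obtain \<epsilon> where \<epsilon>: "\<epsilon> > 0" "ball (u f) \<epsilon> \<subseteq> U" using U open_contains_ball by blast
      let ?D = "\<bar>C\<bar> + 1"
      have "gball f h (\<epsilon> / ?D) \<subseteq> {f \<in> topspace (gs_topology r s). u f \<in> U}"
      proof
        fix g assume g: "g \<in> gball f h (\<epsilon> / ?D)"
        hence gg: "g \<in> gs r s" by (simp add: gball_def)
        let ?n = "gs_norm r s h (\<lambda>x. g x - f x)"
        have n0: "?n >= 0" by (rule gs_norm_nonneg[OF gs_diff[OF gg f(1)] h])
        have "norm (u g - u f) <= C * ?n" using b[OF gs_diff[OF gg f(1)]] d[OF gg f(1)] by simp
        also have "... <= ?D * ?n" using n0 by (intro mult_right_mono) auto
        also have "... < \<epsilon>"
        proof -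
          have "?n < \<epsilon> / ?D" using g by (simp add: gball_def)
          moreover have "?D > 0" by simp
          ultimately show ?thesis by (simp only: pos_less_divide_eq mult.commute)
        qed
        finally show "g \<in> {f \<in> topspace (gs_topology r s). u f \<in> U}"
          using \<epsilon> gg by (auto simp: dist_norm norm_minus_commute)
      qed
      moreover have "\<epsilon> / ?D > 0" using \<epsilon> by simp
      ultimately show "\<exists>h>0. \<exists>\<delta>>0. gball f h \<delta> \<subseteq> {f \<in> topspace (gs_topology r s). u f \<in> U}"
        using h by blast
    qed auto
  qed simp
  thus ?thesis using e a c unfolding gs_dual_def by (auto simp: gs_dual_def)
qed

lemma gs_dual_bnd:
  assumes u: "u \<in> (gs_dual r s :: ('d::finite) functional set)"
  obtains H C where "H > 0" "C > 0" "\<And>f P. f \<in> gs r s ==> bnd r s H P f ==> norm (u f) <= C * P"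
proof -
  obtain h C1 where 1: "h > 0" "C1 > 0" "\<And>f. f \<in> gs r s ==> norm (u f) <= C1 * gs_norm r s h f"
    using gs_dual_bound[OF u] by metis
  obtain H C2 where 2: "H > 0" "C2 > 0" "\<And>f P. f \<in> (SS :: 'd fn set) ==> bnd r s H P f ==> gs_norm r s h f <= C2 * P"
    using gs_norm_le_bnd[OF r s rs 1(1)] by metis
  show ?thesis
  proof (rule that[OF 2(1), of "C1 * C2"])
    show "C1 * C2 > 0" using 1 2 by simp
    fix f :: "'d fn" and P :: real assume f: "f \<in> gs r s" and bd: "bnd r s H P f"
    have "norm (u f) <= C1 * gs_norm r s h f" by (rule 1(3)[OF f])
    also have "... <= C1 * (C2 * P)" using 1 2(3)[OF gs_imp_SS[OF f] bd] by (intro mult_left_mono) auto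
    finally show "norm (u f) <= C1 * C2 * P" by (simp only: mult.assoc)
  qed
qed

lemma regular_distr_dual:
  fixes f :: "'d::finite fn"
  assumes f: "f \<in> SS" shows "restrict (regular_distr f) (gs r s) \<in> gs_dual r s"
proof (rule gs_dualI[where h=1])
  show "restrict (regular_distr f) (gs r s) \<in> extensional (gs r s)" by simp
  fix g k :: "'d fn" assume g: "g \<in> gs r s" and k: "k \<in> gs r s"
  have "(LBINT x. f x * cnj (g x + k x)) = (LBINT x. f x * cnj (g x) + f x * cnj (k x))"
    by (simp add: distrib_left)
  also have "... = (LBINT x. f x * cnj (g x)) + (LBINT x. f x * cnj (k x))"
    by (intro Bochner_Integration.integral_add SS_ip_integrable f gs_imp_SS[OF g] gs_imp_SS[OF k])
  finally show "restrict (regular_distr f) (gs r s) (\<lambda>x. g x + k x) =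
      restrict (regular_distr f) (gs r s) g + restrict (regular_distr f) (gs r s) k"
    using gs_add[OF g k] g k by (simp add: regular_distr_def)
next
  fix a :: complex and g :: "'d fn" assume g: "g \<in> gs r s"
  have "(LBINT x. f x * cnj (a * g x)) = (LBINT x. cnj a * (f x * cnj (g x)))"
    by (simp add: mult_ac)
  also have "... = cnj a * (LBINT x. f x * cnj (g x))" by (rule integral_mult_right_zero)
  finally show "restrict (regular_distr f) (gs r s) (\<lambda>x. a * g x) = cnj a * restrict (regular_distr f) (gs r s) g"
    using gs_cmult[OF g, of a] g by (simp add: regular_distr_def)
next
  fix g :: "'d fn" assume g: "g \<in> gs r s"
  have b: "norm (g x) <= gs_norm r s 1 g" for x
    using gs_moment_le[OF g zero_less_one, of x "mi_single undefined 0" "mi_single undefined 0"]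
    unfolding mi_single_simps by simp
  have "norm (LBINT x. f x * cnj (g x)) <= (LBINT x. norm (f x * cnj (g x)))" by (rule integral_norm_bound)
  also have "... <= (LBINT x. norm (f x) * gs_norm r s 1 g)"
  proof (rule integral_mono)
    show "integrable lborel (\<lambda>x. norm (f x * cnj (g x)))" by (intro integrable_norm SS_ip_integrable f gs_imp_SS[OF g])
    show "integrable lborel (\<lambda>x. norm (f x) * gs_norm r s 1 g)" by (intro integrable_mult_left integrable_norm SS_integrable f)
    show "norm (f x * cnj (g x)) <= norm (f x) * gs_norm r s 1 g" for x
      unfolding norm_mult complex_mod_cnj by (intro mult_left_mono b) auto
  qed
  also have "... = (LBINT x. norm (f x)) * gs_norm r s 1 g" by simp
  finally show "norm (restrict (regular_distr f) (gs r s) g) <= (LBINT x. norm (f x)) * gs_norm r s 1 g"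
    using g by (simp add: regular_distr_def)
qed simp

end

section \<open>Superpositions of test functions\<close>

context gs_indices
begin

text \<open>
  Linear functionals that are bounded by \<open>bnd\<close>: the values of \<open>f\<close> and of its transform at points, and the
  conjugate of an element of the dual. An estimate for all of them at once is an estimate in the
  topology of \<open>gs r s\<close> as well as for a given element of the dual.
\<close>

definition evl :: "real => ('d::finite fn => complex) => real => bool"
  where "evl H e \<omega> \<longleftrightarrow> (\<forall>f\<in>gs r s. \<forall>g\<in>gs r s. e (\<lambda>x. f x + g x) = e f + e g) \<and>
    (\<forall>f\<in>gs r s. \<forall>a. e (\<lambda>x. a * f x) = a * e f) \<and>
    (\<forall>f\<in>gs r s. \<forall>P. bnd r s H P f \<longrightarrow> norm (e f) <= P * \<omega>)"

lemma evl_add: "evl H e \<omega> ==> f \<in> gs r s ==> g \<in> gs r s ==> e (\<lambda>x. f x + g x) = e f + e g"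
  and evl_cmult: "evl H e \<omega> ==> f \<in> gs r s ==> e (\<lambda>x. a * f x) = a * e f"
  and evl_le: "evl H e \<omega> ==> f \<in> gs r s ==> bnd r s H P f ==> norm (e f) <= P * \<omega>"
  by (simp_all add: evl_def)

lemma evl_diff: 
  assumes "evl H e \<omega>" "f \<in> gs r s" "g \<in> gs r s" shows "e (\<lambda>x. f x - g x) = e f - e g"
  using evl_add[OF assms(1,2) gs_cmult[OF assms(3), of "-1"]] evl_cmult[OF assms(1,3), of "-1"] by simp

lemma evl_zero: assumes "evl H e \<omega>" shows "e (\<lambda>x. 0) = 0"
  using evl_cmult[OF assms gs_zero, of 0] by simp

lemma evl_nonneg: assumes "evl H e \<omega>" shows "\<omega> >= 0"
proof -
  have "bnd r s H 1 (\<lambda>x. 0)" by (simp add: bnd_def fourier_def)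
  from evl_le[OF assms gs_zero this] show ?thesis by (simp add: evl_zero[OF assms])
qed

lemma evl_apply: "evl H (\<lambda>f. f x) (ew r H x)"
  by (simp add: evl_def bnd_def)

lemma evl_fourier:
  fixes \<xi> :: "real^'d::finite"
  shows "evl H (\<lambda>f. fourier f \<xi>) (ew s H \<xi>)"
  unfolding evl_def
proof (intro conjI ballI allI impI)
  fix f g :: "'d fn" assume "f \<in> gs r s" "g \<in> gs r s"
  thus "fourier (\<lambda>x. f x + g x) \<xi> = fourier f \<xi> + fourier g \<xi>"
    by (subst fourier_add) (auto simp: gs_iff SS_integrable)
qed (simp_all add: fourier_cmult bnd_def)

lemma evl_continuous:
  fixes \<Phi> :: "'w::euclidean_space => 'd::finite fn"
  assumes e: "evl H e \<omega>" and \<Phi>: "\<And>w. \<Phi> w \<in> gs r s"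
    and cont: "\<And>w0 \<epsilon>. \<epsilon> > 0 ==> \<exists>U. open U \<and> w0 \<in> U \<and> (\<forall>w\<in>U. bnd r s H \<epsilon> (\<lambda>x. \<Phi> w x - \<Phi> w0 x))"
  shows "continuous_on UNIV (\<lambda>w. e (\<Phi> w))"
  unfolding continuous_on_eq_continuous_at[OF open_UNIV]
proof (intro ballI)
  fix w0
  have \<omega>: "\<omega> >= 0" by (rule evl_nonneg[OF e])
  show "isCont (\<lambda>w. e (\<Phi> w)) w0"
    unfolding continuous_at_open
  proof (intro allI impI)
    fix t assume t: "open t \<and> e (\<Phi> w0) \<in> t"
    then obtain \<epsilon> where \<epsilon>: "\<epsilon> > 0" "ball (e (\<Phi> w0)) \<epsilon> \<subseteq> t" using open_contains_ball by blast
    have "\<epsilon> / (\<omega> + 1) > 0" using \<epsilon> \<omega> by simp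
    from cont[OF this, of w0] obtain U where U: "open U" "w0 \<in> U"
      "\<And>w. w \<in> U ==> bnd r s H (\<epsilon> / (\<omega> + 1)) (\<lambda>x. \<Phi> w x - \<Phi> w0 x)" by blast
    have "e (\<Phi> w) \<in> t" if "w \<in> U" for w
    proof -
      have "norm (e (\<Phi> w) - e (\<Phi> w0)) <= \<epsilon> / (\<omega> + 1) * \<omega>"
        using evl_le[OF e gs_diff[OF \<Phi> \<Phi>] U(3)[OF that]] by (simp only: evl_diff[OF e \<Phi> \<Phi>])
      also have "... < \<epsilon>" using \<epsilon> \<omega> by (simp add: field_simps)
      finally show ?thesis using \<epsilon> by (auto simp: dist_norm norm_minus_commute)
    qed
    thus "\<exists>s. open s \<and> w0 \<in> s \<and> (\<forall>x'\<in>s. e (\<Phi> x') \<in> t)" using U by blast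
  qed
qed

lemma evl_integrable:
  fixes \<Phi> :: "'w::euclidean_space => 'd::finite fn"
  assumes e: "evl H e \<omega>" and \<Phi>: "\<And>w. \<Phi> w \<in> gs r s"
    and cont: "\<And>w0 \<epsilon>. \<epsilon> > 0 ==> \<exists>U. open U \<and> w0 \<in> U \<and> (\<forall>w\<in>U. bnd r s H \<epsilon> (\<lambda>x. \<Phi> w x - \<Phi> w0 x))"
    and B: "\<And>w. bnd r s H (B w) (\<Phi> w)" and aB: "integrable lborel (\<lambda>w. norm (a w) * B w)"
    and a: "integrable lborel a"
  shows "integrable lborel (\<lambda>w. a w * e (\<Phi> w))"
proof (rule Bochner_Integration.integrable_bound)
  show "integrable lborel (\<lambda>w. (norm (a w) * B w) * \<omega>)" using aB by (rule integrable_mult_left)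
  have "(\<lambda>w. e (\<Phi> w)) \<in> borel_measurable borel"
    by (rule borel_measurable_continuous_onI[OF evl_continuous[OF e \<Phi> cont]])
  thus "(\<lambda>w. a w * e (\<Phi> w)) \<in> borel_measurable lborel"
    using borel_measurable_integrable[OF a] by simp
  show "AE w in lborel. norm (a w * e (\<Phi> w)) <= norm (norm (a w) * B w * \<omega>)"
  proof (rule AE_I2)
    fix w
    have "norm (e (\<Phi> w)) <= B w * \<omega>" by (rule evl_le[OF e \<Phi> B])
    hence "norm (a w * e (\<Phi> w)) <= norm (a w) * (B w * \<omega>)" unfolding norm_mult by (rule mult_left_mono) simp
    also have "... = norm (a w) * B w * \<omega>" by (simp only: mult.assoc)
    finally show "norm (a w * e (\<Phi> w)) <= norm (norm (a w) * B w * \<omega>)" by simp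
  qed
qed

lemma set_integrable_borel:
  fixes f :: "'w::euclidean_space => 'z::{banach, second_countable_topology}"
  assumes "integrable lborel f" "S \<in> sets borel" shows "set_integrable lborel S f"
  unfolding set_integrable_def using assms by (intro integrable_mult_indicator) auto

lemma LBINT_split:
  fixes f :: "'w::euclidean_space => 'z::{banach, second_countable_topology}"
  assumes "integrable lborel f" "S \<in> sets borel" "T \<in> sets borel" "S \<inter> T = {}"
  shows "(LBINT w:S \<union> T. f w) = (LBINT w:S. f w) + (LBINT w:T. f w)"
  by (rule set_integral_Un) (auto intro!: set_integrable_borel assms)

text \<open>
  On each set of a finite cover \<open>\<Phi>\<close> is replaced by its value at a fixed point, from which it differs
  by at most \<open>\<epsilon>\<close> there.
\<close>

lemma finite_superposition:
  fixes \<Phi> :: "'w::euclidean_space => 'd::finite fn"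
  assumes \<Phi>: "\<And>w. \<Phi> w \<in> gs r s"
    and cont: "\<And>w0 \<epsilon>. \<epsilon> > 0 ==> \<exists>U. open U \<and> w0 \<in> U \<and> (\<forall>w\<in>U. bnd r s H \<epsilon> (\<lambda>x. \<Phi> w x - \<Phi> w0 x))"
    and B: "\<And>w. bnd r s H (B w) (\<Phi> w)" and aB: "integrable lborel (\<lambda>w. norm (a w) * B w)"
    and a: "integrable lborel a"
    and L: "\<And>U v. (U, v) \<in> set L ==> open U \<and> (\<forall>w\<in>U. bnd r s H \<epsilon> (\<lambda>x. \<Phi> w x - \<Phi> v x))"
    and A: "A \<in> sets borel" "A \<subseteq> \<Union>(fst ` set L)"
  shows "\<exists>F\<in>gs r s. \<forall>e \<omega>. evl H e \<omega> \<longrightarrow>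
    norm (e F - (LBINT w:A. a w * e (\<Phi> w))) <= \<epsilon> * \<omega> * (LBINT w:A. norm (a w))"
  using L A
proof (induction L arbitrary: A)
  case Nil
  thus ?case by (intro bexI[OF _ gs_zero]) (auto simp: evl_zero set_lebesgue_integral_def)
next
  case (Cons p L)
  obtain U v where p: "p = (U, v)" by (cases p)
  have U: "open U" "\<And>w. w \<in> U ==> bnd r s H \<epsilon> (\<lambda>x. \<Phi> w x - \<Phi> v x)" using Cons.prems(1)[of U v] by (auto simp: p)
  let ?A1 = "A \<inter> U" and ?A2 = "A - U"
  have mA: "?A1 \<in> sets borel" "?A2 \<in> sets borel" using Cons.prems(2) U(1) by auto
  have "\<exists>F\<in>gs r s. \<forall>e \<omega>. evl H e \<omega> \<longrightarrow>
      norm (e F - (LBINT w:?A2. a w * e (\<Phi> w))) <= \<epsilon> * \<omega> * (LBINT w:?A2. norm (a w))"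
  proof (rule Cons.IH[OF _ mA(2)])
    show "open U' \<and> (\<forall>w\<in>U'. bnd r s H \<epsilon> (\<lambda>x. \<Phi> w x - \<Phi> v' x))" if "(U', v') \<in> set L" for U' v'
      by (rule Cons.prems(1)) (simp add: that)
    show "?A2 \<subseteq> \<Union>(fst ` set L)" using Cons.prems(3) by (auto simp: p)
  qed
  then obtain F where F: "F \<in> gs r s" "\<And>e \<omega>. evl H e \<omega> ==>
      norm (e F - (LBINT w:?A2. a w * e (\<Phi> w))) <= \<epsilon> * \<omega> * (LBINT w:?A2. norm (a w))" by blast
  define c where "c = (LBINT w:?A1. a w)"
  have split: "(LBINT w:A. f w) = (LBINT w:?A1. f w) + (LBINT w:?A2. f w)"
    if "integrable lborel f" for f :: "'w => 'z::{banach, second_countable_topology}"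
  proof -
    have "?A1 \<inter> ?A2 = {}" by blast
    thus ?thesis using LBINT_split[OF that mA] by (simp add: Int_Diff_Un)
  qed
  show ?case
  proof (intro bexI[of _ "\<lambda>x. c * \<Phi> v x + F x"] allI impI)
    show "(\<lambda>x. c * \<Phi> v x + F x) \<in> gs r s" by (intro gs_add gs_cmult \<Phi> F)
    fix e :: "'d fn => complex" and \<omega> :: real assume e: "evl H e \<omega>"
    have ei: "integrable lborel (\<lambda>w. a w * e (\<Phi> w))" by (rule evl_integrable[OF e \<Phi> cont B aB a])
    have eF: "e (\<lambda>x. c * \<Phi> v x + F x) = c * e (\<Phi> v) + e F"
      by (simp only: evl_add[OF e gs_cmult[OF \<Phi>] F(1)] evl_cmult[OF e \<Phi>])
    have "c * e (\<Phi> v) - (LBINT w:?A1. a w * e (\<Phi> w)) = (LBINT w:?A1. a w * e (\<Phi> v) - a w * e (\<Phi> w))"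
    proof -
      have "c * e (\<Phi> v) = (LBINT w:?A1. a w * e (\<Phi> v))" unfolding c_def by simp
      thus ?thesis
        by (simp only:) (rule set_integral_diff(2)[symmetric], auto intro!: set_integrable_borel integrable_mult_left a ei mA)
    qed
    also have "norm ... <= (LBINT w:?A1. norm (a w) * (\<epsilon> * \<omega>))"
      unfolding set_lebesgue_integral_def
    proof (rule Bochner_Integration.integral_norm_bound_integral)
      show "integrable lborel (\<lambda>w. indicat_real ?A1 w *\<^sub>R (a w * e (\<Phi> v) - a w * e (\<Phi> w)))"
        using set_integrable_borel[OF Bochner_Integration.integrable_diff[OF integrable_mult_left[OF a] ei] mA(1)]
        by (simp add: set_integrable_def)
      show "integrable lborel (\<lambda>w. indicat_real ?A1 w *\<^sub>R (norm (a w) * (\<epsilon> * \<omega>)))"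
        using set_integrable_borel[OF integrable_mult_left[OF integrable_norm[OF a]] mA(1)] by (simp add: set_integrable_def)
      fix w
      have "norm (a w * e (\<Phi> v) - a w * e (\<Phi> w)) <= norm (a w) * (\<epsilon> * \<omega>)" if "w \<in> U"
      proof -
        have "norm (e (\<Phi> w) - e (\<Phi> v)) <= \<epsilon> * \<omega>"
          using evl_le[OF e gs_diff[OF \<Phi> \<Phi>] U(2)[OF that]] by (simp only: evl_diff[OF e \<Phi> \<Phi>])
        hence "norm (e (\<Phi> v) - e (\<Phi> w)) <= \<epsilon> * \<omega>" by (simp only: norm_minus_commute)
        thus ?thesis unfolding right_diff_distrib[symmetric] norm_mult by (rule mult_left_mono) simp
      qed
      thus "norm (indicat_real ?A1 w *\<^sub>R (a w * e (\<Phi> v) - a w * e (\<Phi> w))) <= indicat_real ?A1 w *\<^sub>R (norm (a w) * (\<epsilon> * \<omega>))"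
        by (simp add: indicator_def)
    qed
    also have "... = \<epsilon> * \<omega> * (LBINT w:?A1. norm (a w))" by (simp add: mult.commute)
    finally have 1: "norm (c * e (\<Phi> v) - (LBINT w:?A1. a w * e (\<Phi> w))) <= \<epsilon> * \<omega> * (LBINT w:?A1. norm (a w))" .
    have eq: "e (\<lambda>x. c * \<Phi> v x + F x) - (LBINT w:A. a w * e (\<Phi> w)) =
       (c * e (\<Phi> v) - (LBINT w:?A1. a w * e (\<Phi> w))) + (e F - (LBINT w:?A2. a w * e (\<Phi> w)))"
      unfolding eF split[OF ei] by simp
    show "norm (e (\<lambda>x. c * \<Phi> v x + F x) - (LBINT w:A. a w * e (\<Phi> w))) <= \<epsilon> * \<omega> * (LBINT w:A. norm (a w))"
      unfolding eq split[OF integrable_norm[OF a]] distrib_left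
      by (rule order_trans[OF norm_triangle_ineq add_mono[OF 1 F(2)[OF e]]])
  qed
qed

lemma tail_integral_small:
  fixes f :: "'w::euclidean_space => real"
  assumes f: "integrable lborel f" and \<epsilon>: "\<epsilon> > 0"
  obtains n :: nat where "(LINT w:- cball 0 (real n)|lborel. f w) < \<epsilon>"
proof -
  have "(\<lambda>n. LBINT w. indicator (- cball 0 (real n)) w *\<^sub>R f w) \<longlonglongrightarrow> (LINT w|(lborel::'w measure). 0)"
  proof (rule integral_dominated_convergence[where w = "\<lambda>w. norm (f w)"])
    show "AE w in lborel. (\<lambda>n. indicator (- cball 0 (real n)) w *\<^sub>R f w) \<longlonglongrightarrow> 0"
    proof (rule AE_I2, rule tendsto_eventually)
      fix w :: 'w
      obtain N where "norm w <= real N" using real_arch_simple by blast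
      thus "\<forall>\<^sub>F n in sequentially. indicator (- cball 0 (real n)) w *\<^sub>R f w = 0"
        by (intro eventually_sequentiallyI[of N]) (auto simp: indicator_def)
    qed
    show "AE w in lborel. norm (indicator (- cball 0 (real n)) w *\<^sub>R f w) <= norm (f w)" for n
      by (rule AE_I2) (simp add: indicator_def)
  qed (use f in \<open>auto intro!: borel_measurable_scaleR borel_measurable_indicator\<close>)
  from order_tendstoD(2)[OF this, of \<epsilon>] \<epsilon> obtain n where "(LBINT w. indicator (- cball 0 (real n)) w *\<^sub>R f w) < \<epsilon>"
    by (auto simp: eventually_sequentially)
  thus ?thesis using that[of n] by (simp add: set_lebesgue_integral_def)
qed

text \<open>
  An element of the dual passes under the integral. Up to a small tail, the integral is close to a
  finite superposition \<open>F\<close> in the sense of all \<open>evl\<close>. Tested on points this says that \<open>g - F\<close> is small in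
  \<open>gs r s\<close>, so \<open>u F\<close> is close to \<open>u g\<close>; tested on \<open>u\<close> it says that \<open>u F\<close> is close to the right-hand side.
\<close>

lemma dual_integral:
  fixes \<Phi> :: "'w::euclidean_space => 'd::finite fn"
  assumes u: "u \<in> gs_dual r s" and \<Phi>: "\<And>w. \<Phi> w \<in> gs r s"
    and cont: "\<And>w0 H \<epsilon>. H > 0 ==> \<epsilon> > 0 ==> \<exists>U. open U \<and> w0 \<in> U \<and> (\<forall>w\<in>U. bnd r s H \<epsilon> (\<lambda>x. \<Phi> w x - \<Phi> w0 x))"
    and bound: "\<And>H. H > 0 ==> \<exists>B. (\<forall>w. bnd r s H (B w) (\<Phi> w)) \<and> integrable lborel (\<lambda>w. norm (a w) * B w)"
    and a: "integrable lborel a"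
    and g: "g \<in> gs r s" "\<And>x. g x = (LBINT w. a w * \<Phi> w x)"
      "\<And>\<xi>. fourier g \<xi> = (LBINT w. a w * fourier (\<Phi> w) \<xi>)"
  shows "cnj (u g) = (LBINT w. a w * cnj (u (\<Phi> w)))"
    and "integrable lborel (\<lambda>w. a w * cnj (u (\<Phi> w)))"
proof -
  obtain H C where H: "H > 0" and C: "C > 0" and uC: "\<And>f P. f \<in> gs r s ==> bnd r s H P f ==> norm (u f) <= C * P"
    using gs_dual_bnd[OF u] by metis
  obtain B where B: "\<And>w. bnd r s H (B w) (\<Phi> w)" and aB: "integrable lborel (\<lambda>w. norm (a w) * B w)"
    using bound[OF H] by blast
  have eu: "evl H (\<lambda>f. cnj (u f)) C"
    unfolding evl_def using gs_dual_add[OF u] gs_dual_cmult[OF u] uC by (simp add: mult.commute)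
  note ct = cont[OF H]
  show "integrable lborel (\<lambda>w. a w * cnj (u (\<Phi> w)))" by (rule evl_integrable[OF eu \<Phi> ct B aB a])
  define N where "N = (LBINT w. norm (a w))"
  have N0: "N >= 0" unfolding N_def by (rule Bochner_Integration.integral_nonneg) simp
  let ?D = "norm (cnj (u g) - (LBINT w. a w * cnj (u (\<Phi> w))))"
  have D: "?D <= 2 * C * (N + 1) * \<epsilon>" if \<epsilon>: "\<epsilon> > 0" for \<epsilon> :: real
  proof -
    obtain n :: nat where n: "(LINT w:- cball 0 (real n)|lborel. norm (a w) * B w) < \<epsilon>"
      by (rule tail_integral_small[OF aB \<epsilon>])
    let ?K = "cball (0::'w) (real n)"
    obtain U where U: "\<And>w0. open (U w0) \<and> w0 \<in> U w0 \<and> (\<forall>w\<in>U w0. bnd r s H \<epsilon> (\<lambda>x. \<Phi> w x - \<Phi> w0 x))"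
      using ct[OF \<epsilon>] by metis
    obtain C' where C': "C' \<subseteq> ?K" "finite C'" "?K \<subseteq> (\<Union>c\<in>C'. U c)"
      by (rule compactE_image[of ?K ?K U]) (use U in auto)
    obtain l where l: "set l = C'" using finite_list[OF C'(2)] by blast
    have "\<exists>F\<in>gs r s. \<forall>e \<omega>. evl H e \<omega> \<longrightarrow>
      norm (e F - (LBINT w:?K. a w * e (\<Phi> w))) <= \<epsilon> * \<omega> * (LBINT w:?K. norm (a w))"
      by (rule finite_superposition[OF \<Phi> ct B aB a, where L = "map (\<lambda>w. (U w, w)) l"])
        (use U C' l in \<open>auto simp: image_image\<close>)
    then obtain F where F: "F \<in> gs r s" "\<And>e \<omega>. evl H e \<omega> ==>
      norm (e F - (LBINT w:?K. a w * e (\<Phi> w))) <= \<epsilon> * \<omega> * (LBINT w:?K. norm (a w))" by blast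
    have split: "(LBINT w. f w) = (LBINT w:?K. f w) + (LBINT w:- ?K. f w)"
      if "integrable lborel f" for f :: "'w => 'z::{banach, second_countable_topology}"
      using LBINT_split[OF that, of ?K "- ?K"] by (simp add: set_lebesgue_integral_def)
    have KN: "(LBINT w:?K. norm (a w)) <= N"
    proof -
      have "(LINT w:- ?K|lborel. norm (a w)) >= 0" unfolding set_lebesgue_integral_def
        by (rule Bochner_Integration.integral_nonneg) simp
      thus ?thesis using split[OF integrable_norm[OF a]] by (simp add: N_def)
    qed
    have key: "norm ((LBINT w. a w * e (\<Phi> w)) - e F) <= (\<epsilon> * (N + 1)) * \<omega>" if e: "evl H e \<omega>"
      for e :: "'d fn => complex" and \<omega> :: real
    proof -
      have \<omega>: "\<omega> >= 0" by (rule evl_nonneg[OF e])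
      have ei: "integrable lborel (\<lambda>w. a w * e (\<Phi> w))" by (rule evl_integrable[OF e \<Phi> ct B aB a])
      have "norm (LINT w:- ?K|lborel. a w * e (\<Phi> w)) <= (LINT w:- ?K|lborel. (norm (a w) * B w) * \<omega>)"
        unfolding set_lebesgue_integral_def
      proof (rule Bochner_Integration.integral_norm_bound_integral)
        show "integrable lborel (\<lambda>w. indicat_real (- ?K) w *\<^sub>R (a w * e (\<Phi> w)))"
          using set_integrable_borel[OF ei, of "- ?K"] by (simp add: set_integrable_def)
        show "integrable lborel (\<lambda>w. indicat_real (- ?K) w *\<^sub>R (norm (a w) * B w * \<omega>))"
          using set_integrable_borel[OF integrable_mult_left[OF aB, of \<omega>], of "- ?K"] by (simp add: set_integrable_def)
        fix w
        have "norm (e (\<Phi> w)) <= B w * \<omega>" by (rule evl_le[OF e \<Phi> B])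
        hence "norm (a w * e (\<Phi> w)) <= norm (a w) * (B w * \<omega>)" unfolding norm_mult by (rule mult_left_mono) simp
        also have "... = norm (a w) * B w * \<omega>" by (simp only: mult.assoc)
        finally show "norm (indicat_real (- ?K) w *\<^sub>R (a w * e (\<Phi> w))) <= indicat_real (- ?K) w *\<^sub>R (norm (a w) * B w * \<omega>)"
          by (simp add: indicator_def)
      qed
      also have "... = (LINT w:- ?K|lborel. norm (a w) * B w) * \<omega>" by simp
      also have "... <= \<epsilon> * \<omega>" using n \<omega> by (intro mult_right_mono) auto
      finally have 1: "norm (LINT w:- ?K|lborel. a w * e (\<Phi> w)) <= \<epsilon> * \<omega>" .
      have 2: "norm ((LBINT w:?K. a w * e (\<Phi> w)) - e F) <= \<epsilon> * \<omega> * N"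
      proof -
        have "norm ((LBINT w:?K. a w * e (\<Phi> w)) - e F) <= \<epsilon> * \<omega> * (LBINT w:?K. norm (a w))"
          using F(2)[OF e] by (simp only: norm_minus_commute)
        also have "... <= \<epsilon> * \<omega> * N" using KN \<epsilon> \<omega> by (intro mult_left_mono) auto
        finally show ?thesis .
      qed
      have eq: "(LBINT w. a w * e (\<Phi> w)) - e F =
          ((LBINT w:?K. a w * e (\<Phi> w)) - e F) + (LINT w:- ?K|lborel. a w * e (\<Phi> w))"
        unfolding split[OF ei] by simp
      have "norm ((LBINT w. a w * e (\<Phi> w)) - e F) <= \<epsilon> * \<omega> * N + \<epsilon> * \<omega>"
        unfolding eq by (rule order_trans[OF norm_triangle_ineq add_mono[OF 2 1]])
      also have "... = (\<epsilon> * (N + 1)) * \<omega>" by (simp add: algebra_simps)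
      finally show ?thesis .
    qed
    have "bnd r s H (\<epsilon> * (N + 1)) (\<lambda>x. g x - F x)"
      unfolding bnd_def
    proof (intro conjI allI)
      show "norm (g x - F x) <= \<epsilon> * (N + 1) * ew r H x" for x :: "real^'d"
        using key[OF evl_apply[of H x]] by (simp only: g(2)[symmetric])
      show "norm (fourier (\<lambda>x. g x - F x) \<xi>) <= \<epsilon> * (N + 1) * ew s H \<xi>" for \<xi> :: "real^'d"
        using key[OF evl_fourier[of H \<xi>]] evl_diff[OF evl_fourier[of H \<xi>] g(1) F(1)] by (simp only: g(3)[symmetric])
    qed
    from evl_le[OF eu gs_diff[OF g(1) F(1)] this]
    have 3: "norm (cnj (u g) - cnj (u F)) <= \<epsilon> * (N + 1) * C" by (simp only: evl_diff[OF eu g(1) F(1)])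
    have 4: "norm ((LBINT w. a w * cnj (u (\<Phi> w))) - cnj (u F)) <= \<epsilon> * (N + 1) * C" by (rule key[OF eu])
    have "?D = norm ((cnj (u g) - cnj (u F)) - ((LBINT w. a w * cnj (u (\<Phi> w))) - cnj (u F)))" by simp
    also have "... <= \<epsilon> * (N + 1) * C + \<epsilon> * (N + 1) * C"
      by (rule order_trans[OF norm_triangle_ineq4 add_mono[OF 3 4]])
    also have "... = 2 * C * (N + 1) * \<epsilon>" by simp
    finally show ?thesis .
  qed
  show "cnj (u g) = (LBINT w. a w * cnj (u (\<Phi> w)))"
  proof (rule ccontr)
    assume "cnj (u g) \<noteq> (LBINT w. a w * cnj (u (\<Phi> w)))"
    hence D0: "?D > 0" by simp
    define X where "X = C * (N + 1)"
    have p: "X > 0" using C N0 by (simp add: X_def)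
    have "?D <= 2 * C * (N + 1) * (?D / (4 * X))" by (rule D) (use D0 p in \<open>simp\<close>)
    also have "... = 2 * X * (?D / (4 * X))" by (simp only: X_def mult.assoc)
    also have "... = ?D / 2" using p by simp
    finally show False using D0 by simp
  qed
qed

end

section \<open>The short-time Fourier transform of test functions\<close>

lemma ew_convolution:
  assumes q: "q > 0" and H: "H > 0"
  obtains H' C where "H' >= H" "C > 0"
    "\<And>y::real^'d::finite. integrable lborel (\<lambda>z. ew q H' z * ew q H' (y - z))"
    "\<And>y::real^'d. (LBINT z. ew q H' z * ew q H' (y - z)) <= C * ew q H y"
proof -
  let ?K = "2 powr (1 / q) * H"
  let ?C = "LBINT x. ew q 1 (x::real^'d)"
  have K: "?K >= H"
  proof -
    have "1 <= 2 powr (1 / q)" using q by (intro ge_one_powr_ge_zero) auto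
    thus ?thesis using mult_right_mono[of 1 "2 powr (1 / q)" H] H by simp
  qed
  have le: "ew q (?K + 1) z * ew q (?K + 1) (y - z) <= ew q H y * ew q 1 z" for y z :: "real^'d"
  proof -
    have "ew q ?K z * ew q ?K (y - z) <= ew q H y"
    proof -
      have "H * norm (z + (y - z)) powr (1 / q) <= H * (2 powr (1 / q) * (norm z powr (1 / q) + norm (y - z) powr (1 / q)))"
        using ew_quasi_triangle[OF q, of z "y - z"] H by (intro mult_left_mono) auto
      thus ?thesis unfolding ew_def exp_add[symmetric] by (simp add: algebra_simps)
    qed
    moreover have "ew q 1 (y - z) <= 1" by (rule ew_le_1) simp
    ultimately have "(ew q ?K z * ew q ?K (y - z)) * (ew q 1 z * ew q 1 (y - z)) <= ew q H y * (ew q 1 z * 1)"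
      by (intro mult_mono) auto
    thus ?thesis unfolding ew_add by (simp only: mult_ac mult_1)
  qed
  have i1: "integrable lborel (\<lambda>z::real^'d. ew q H y * ew q 1 z)" for y :: "real^'d"
    using integrable_ew[OF q, of 1] by (intro integrable_mult_right) simp
  have i2: "integrable lborel (\<lambda>z::real^'d. ew q (?K + 1) z * ew q (?K + 1) (y - z))" for y :: "real^'d"
  proof (rule Bochner_Integration.integrable_bound[OF i1[of y]])
    have "continuous_on UNIV (\<lambda>z::real^'d. ew q (?K + 1) z * ew q (?K + 1) (y - z))"
      by (intro continuous_intros continuous_on_ew q continuous_on_compose2[OF continuous_on_ew[OF q, of "?K + 1"]]) auto
    thus "(\<lambda>z. ew q (?K + 1) z * ew q (?K + 1) (y - z)) \<in> borel_measurable lborel"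
      using borel_measurable_continuous_onI by simp
    show "AE z in lborel. norm (ew q (?K + 1) z * ew q (?K + 1) (y - z)) <= norm (ew q H y * ew q 1 z)"
      using le by (intro AE_I2) (simp add: abs_mult)
  qed
  show ?thesis
  proof (rule that[of "?K + 1" ?C, OF _ integral_ew_pos[OF q] i2])
    show "?K + 1 >= H" using K by simp
    fix y :: "real^'d"
    have "(LBINT z. ew q (?K + 1) z * ew q (?K + 1) (y - z)) <= (LBINT z. ew q H y * ew q 1 (z::real^'d))"
      by (intro Bochner_Integration.integral_mono i2 i1 le)
    also have "... = ?C * ew q H y" by simp
    finally show "(LBINT z. ew q (?K + 1) z * ew q (?K + 1) (y - z)) <= ?C * ew q H y" .
  qed
qed

text \<open>
  The short-time Fourier transform of a function; that of a functional is \<open>stft\<close>.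
\<close>

definition vf :: "'d::finite fn => 'd fn => (real^'d) \<times> (real^'d) => complex"
  where "vf \<psi> g w = fourier (\<lambda>x. g x * cnj (\<psi> (x - fst w))) (snd w)"

definition tf :: "(real^'d::finite) \<times> (real^'d) => 'd fn => ('d fn)"
  where "tf w f = tfs (fst w) (snd w) f"

lemma vf_tfs: "norm (vf \<psi> (tfs x \<xi> g) w) = norm (vf \<psi> g (fst w - x, snd w - \<xi>))"
proof -
  have "(\<lambda>z. tfs x \<xi> g z * cnj (\<psi> (z - fst w))) = tfs x \<xi> (\<lambda>z. g z * cnj (\<psi> (z - (fst w - x))))"
    by (intro ext) (simp add: tfs_apply)
  thus ?thesis by (simp add: vf_def)
qed

lemma vf_factor:
  assumes g: "g \<in> SS" and \<psi>: "\<psi> \<in> (SS :: 'd::finite fn set)"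
  shows "continuous_on UNIV (\<lambda>x. g x * cnj (\<psi> (x - y)))" (is ?a)
    and "integrable lborel (\<lambda>x. g x * cnj (\<psi> (x - y)))" (is ?b)
    and "\<exists>B. \<forall>x. norm (g x * cnj (\<psi> (x - y))) <= B" (is ?c)
proof -
  have t: "(\<lambda>x. \<psi> (x - y)) \<in> SS" using tfs_SS[OF \<psi>, of y 0] by (simp add: tfs_apply[abs_def])
  show ?a by (intro continuous_intros SS_cont[OF g] SS_cont[OF t])
  show ?b by (rule SS_ip_integrable[OF g t])
  obtain B1 where B1: "\<And>x. norm (g x) <= B1" using rapid_bounded[OF SS_rapid[OF g]] by metis
  obtain B2 where B2: "\<And>x. norm (\<psi> (x - y)) <= B2" using rapid_bounded[OF SS_rapid[OF t]] by metis
  have "norm (g x * cnj (\<psi> (x - y))) <= B1 * B2" for x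
  proof -
    have "0 <= B1" using B1[of x] norm_ge_zero order_trans by blast
    thus ?thesis unfolding norm_mult complex_mod_cnj by (intro mult_mono B1 B2) auto
  qed
  thus ?c by blast
qed

lemma continuous_on_vf:
  fixes g :: "'d::finite fn"
  assumes g: "g \<in> SS" and \<psi>: "\<psi> \<in> SS"
  shows "continuous_on UNIV (vf \<psi> g)"
proof -
  obtain B where B: "\<And>x. norm (\<psi> x) <= B" using rapid_bounded[OF SS_rapid[OF \<psi>]] by metis
  have "continuous_on UNIV (\<lambda>w::(real^'d) \<times> (real^'d). LBINT x. g x * cnj (\<psi> (x - fst w)) * osc x (snd w))"
  proof (rule continuous_on_integral_dominated)
    show "integrable lborel (\<lambda>x. norm (g x) * B)" by (intro integrable_mult_left integrable_norm SS_integrable g)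
    show "norm (g x * cnj (\<psi> (x - fst w)) * osc x (snd w)) <= norm (g x) * B"
      for w :: "(real^'d) \<times> (real^'d)" and x
      by (simp add: norm_mult mult_left_mono B)
    show "(\<lambda>x. g x * cnj (\<psi> (x - fst w)) * osc x (snd w)) \<in> borel_measurable borel"
      for w :: "(real^'d) \<times> (real^'d)"
      by (intro borel_measurable_continuous_onI continuous_intros SS_cont[OF g] continuous_on_compose2[OF SS_cont[OF \<psi>]]) auto
    show "continuous_on UNIV (\<lambda>w::(real^'d) \<times> (real^'d). g x * cnj (\<psi> (x - fst w)) * osc x (snd w))" for x
      by (intro continuous_intros continuous_on_compose2[OF SS_cont[OF \<psi>]]) auto
  qed
  thus ?thesis unfolding vf_def[abs_def] fourier_eq by (intro continuous_intros)
qed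

text \<open>
  Decay in \<open>y\<close> comes from the product \<open>g \<psi>(\<cdot> - y)\<close>, decay in \<open>\<eta>\<close> from the convolution of the
  transforms; the geometric mean has both.
\<close>

lemma vf_bound:
  assumes r: "r > 0" and s: "s > 0" and H: "H > 0"
  obtains H' C where "H' > 0" "C > 0"
    "\<And>g \<psi> P Q w. g \<in> SS ==> \<psi> \<in> (SS :: 'd::finite fn set) ==> bnd r s H' P g ==> bnd r s H' Q \<psi> ==>
      norm (vf \<psi> g w) <= C * P * Q * ew r H (fst w) * ew s H (snd w)"
proof -
  have H2: "2 * H > 0" using H by simp
  obtain H1 C1 where 1: "H1 >= 2 * H" "C1 > 0"
    "\<And>y::real^'d::finite. integrable lborel (\<lambda>z. ew r H1 z * ew r H1 (y - z))"
    "\<And>y::real^'d. (LBINT z. ew r H1 z * ew r H1 (y - z)) <= C1 * ew r (2 * H) y"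
    by (rule ew_convolution[OF r H2]) blast
  obtain H2 C2 where 2: "H2 >= 2 * H" "C2 > 0"
    "\<And>y::real^'d::finite. integrable lborel (\<lambda>z. ew s H2 z * ew s H2 (y - z))"
    "\<And>y::real^'d. (LBINT z. ew s H2 z * ew s H2 (y - z)) <= C2 * ew s (2 * H) y"
    by (rule ew_convolution[OF s H2]) blast
  define c where "c = fconst TYPE('d)"
  have c: "c > 0" unfolding c_def by (rule fconst_pos)
  show ?thesis
  proof (rule that[of "max H1 H2" "c * (C1 + C2)"])
    show "max H1 H2 > 0" using 1 H by linarith
    show "c * (C1 + C2) > 0" using c 1 2 by simp
    fix g \<psi> :: "'d fn" and P Q :: real and w :: "(real^'d) \<times> (real^'d)"
    assume g: "g \<in> SS" and \<psi>: "\<psi> \<in> SS" and bg: "bnd r s (max H1 H2) P g" and b\<psi>: "bnd r s (max H1 H2) Q \<psi>"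
    have P: "P >= 0" "Q >= 0" using bnd_nonneg[OF bg] bnd_nonneg[OF b\<psi>] .
    have bg1: "bnd r s H1 P g" "bnd r s H2 P g" and b\<psi>1: "bnd r s H1 Q \<psi>" "bnd r s H2 Q \<psi>"
      by (rule bnd_weaken[OF bg] bnd_weaken[OF b\<psi>]; simp)+
    obtain y \<eta> where w: "w = (y, \<eta>)" by (cases w)
    let ?n = "norm (vf \<psi> g w)"
    have n1: "?n <= c * P * Q * C1 * ew r (2 * H) y"
    proof -
      have "?n <= c * (LBINT z. norm (g z * cnj (\<psi> (z - y))))"
        unfolding vf_def w fst_conv snd_conv c_def by (rule norm_fourier_le)
      also have "(LBINT z. norm (g z * cnj (\<psi> (z - y)))) <= (LBINT z. (P * Q) * (ew r H1 z * ew r H1 (y - z)))"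
      proof (rule integral_mono)
        show "integrable lborel (\<lambda>z. norm (g z * cnj (\<psi> (z - y))))" by (intro integrable_norm vf_factor(2) g \<psi>)
        show "integrable lborel (\<lambda>z. (P * Q) * (ew r H1 z * ew r H1 (y - z)))" by (intro integrable_mult_right 1(3))
        fix z
        have "norm (g z) <= P * ew r H1 z" using bg1(1) by (simp add: bnd_def)
        moreover have "norm (\<psi> (z - y)) <= Q * ew r H1 (y - z)"
          using b\<psi>1(1) ew_uminus[of r H1 "y - z"] unfolding bnd_def minus_diff_eq by metis
        ultimately have "norm (g z) * norm (\<psi> (z - y)) <= (P * ew r H1 z) * (Q * ew r H1 (y - z))"
          using P by (intro mult_mono) auto
        thus "norm (g z * cnj (\<psi> (z - y))) <= (P * Q) * (ew r H1 z * ew r H1 (y - z))"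
          unfolding norm_mult complex_mod_cnj by (simp only: mult_ac)
      qed
      also have "... = (P * Q) * (LBINT z. ew r H1 z * ew r H1 (y - z))" by (rule integral_mult_right_zero)
      also have "... <= (P * Q) * (C1 * ew r (2 * H) y)" using P by (intro mult_left_mono 1(4)) auto
      finally show ?thesis using c by (simp add: mult_ac)
    qed
    have n2: "?n <= c * P * Q * C2 * ew s (2 * H) \<eta>"
    proof -
      have t: "(\<lambda>x. \<psi> (x - y)) = tfs y 0 \<psi>" by (simp add: tfs_apply[abs_def])
      have v: "(\<lambda>x. cnj (\<psi> (x - y))) \<in> SS" unfolding t[THEN fun_cong] by (intro SS_cnj tfs_SS \<psi>)
      have fv: "norm (fourier (\<lambda>x. cnj (\<psi> (x - y))) \<zeta>) = norm (fourier \<psi> (- \<zeta>))" for \<zeta>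
        unfolding fourier_cnj t by simp
      have I: "integrable lborel (\<lambda>\<zeta>. (P * Q) * (ew s H2 \<zeta> * ew s H2 (\<eta> - \<zeta>)))" by (intro integrable_mult_right 2(3))
      have le: "norm (fourier (\<lambda>x. cnj (\<psi> (x - y))) \<zeta> * fourier g (\<eta> - \<zeta>)) <= (P * Q) * (ew s H2 \<zeta> * ew s H2 (\<eta> - \<zeta>))" for \<zeta>
      proof -
        have "norm (fourier g (\<eta> - \<zeta>)) <= P * ew s H2 (\<eta> - \<zeta>)" using bg1(2) by (simp add: bnd_def)
        moreover have "norm (fourier \<psi> (- \<zeta>)) <= Q * ew s H2 \<zeta>"
          using b\<psi>1(2) ew_uminus[of s H2 \<zeta>] unfolding bnd_def by metis
        ultimately have "norm (fourier \<psi> (- \<zeta>)) * norm (fourier g (\<eta> - \<zeta>)) <= (Q * ew s H2 \<zeta>) * (P * ew s H2 (\<eta> - \<zeta>))"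
          using P by (intro mult_mono) auto
        thus ?thesis unfolding norm_mult fv by (simp only: mult_ac)
      qed
      have "vf \<psi> g w = of_real c * (LBINT \<zeta>. fourier (\<lambda>x. cnj (\<psi> (x - y))) \<zeta> * fourier g (\<eta> - \<zeta>))"
        unfolding vf_def w fst_conv snd_conv c_def by (rule fourier_mult[OF SS_integrable[OF g] v])
      hence "?n = c * norm (LBINT \<zeta>. fourier (\<lambda>x. cnj (\<psi> (x - y))) \<zeta> * fourier g (\<eta> - \<zeta>))"
        using c by (simp add: norm_mult)
      also have "norm (LBINT \<zeta>. fourier (\<lambda>x. cnj (\<psi> (x - y))) \<zeta> * fourier g (\<eta> - \<zeta>)) <=
          (LBINT \<zeta>. (P * Q) * (ew s H2 \<zeta> * ew s H2 (\<eta> - \<zeta>)))"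
      proof (rule Bochner_Integration.integral_norm_bound_integral[OF _ I le])
        have c: "continuous_on UNIV (\<lambda>\<zeta>. fourier (\<lambda>x. cnj (\<psi> (x - y))) \<zeta> * fourier g (\<eta> - \<zeta>))"
          by (intro continuous_intros SS_fourier_cont[OF v] continuous_on_compose2[OF SS_fourier_cont[OF g]]) auto
        have "(\<lambda>\<zeta>. fourier (\<lambda>x. cnj (\<psi> (x - y))) \<zeta> * fourier g (\<eta> - \<zeta>)) \<in> borel_measurable lborel"
          using borel_measurable_continuous_onI[OF c] by simp
        thus "integrable lborel (\<lambda>\<zeta>. fourier (\<lambda>x. cnj (\<psi> (x - y))) \<zeta> * fourier g (\<eta> - \<zeta>))"
          by (rule Bochner_Integration.integrable_bound[OF I]) (intro AE_I2 order_trans[OF le], simp)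
      qed
      also have "... = (P * Q) * (LBINT z. ew s H2 z * ew s H2 (\<eta> - z))" by (rule integral_mult_right_zero)
      also have "... <= (P * Q) * (C2 * ew s (2 * H) \<eta>)" using P by (intro mult_left_mono 2(4)) auto
      finally show ?thesis using c by (simp add: mult_ac)
    qed
    define D where "D = c * P * Q"
    define e1 where "e1 = ew r H y"
    define e2 where "e2 = ew s H \<eta>"
    have D: "D >= 0" using c P by (simp add: D_def)
    have e: "e1 >= 0" "e2 >= 0" by (simp_all add: e1_def e2_def)
    have n1': "?n <= D * C1 * (e1 * e1)" using n1 unfolding D_def e1_def ew_add[symmetric] by simp
    have n2': "?n <= D * C2 * (e2 * e2)" using n2 unfolding D_def e2_def ew_add[symmetric] by simp
    have "?n\<^sup>2 <= (D * C1 * (e1 * e1)) * (D * C2 * (e2 * e2))"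
      unfolding power2_eq_square by (intro mult_mono n1' n2') (use D e 1(2) in auto)
    also have "... = (D * e1 * e2)\<^sup>2 * (C1 * C2)" by (simp add: power2_eq_square mult_ac)
    also have "... <= (D * e1 * e2)\<^sup>2 * (C1 + C2)\<^sup>2"
    proof (rule mult_left_mono)
      have "0 <= C1 * C2" using 1(2) 2(2) by simp
      thus "C1 * C2 <= (C1 + C2)\<^sup>2" unfolding power2_sum using zero_le_power2[of C1] zero_le_power2[of C2] by linarith
    qed simp
    also have "... = (D * e1 * e2 * (C1 + C2))\<^sup>2" by (simp only: power_mult_distrib)
    finally have "?n <= D * e1 * e2 * (C1 + C2)" by (rule power2_le_imp_le) (use D e 1(2) 2(2) in auto)
    thus "?n <= c * (C1 + C2) * P * Q * ew r H (fst w) * ew s H (snd w)"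
      unfolding D_def e1_def e2_def w fst_conv snd_conv by (simp only: mult_ac)
  qed
qed

lemma bnd_tf:
  fixes \<psi> :: "'d::finite fn"
  assumes r: "r > 0" and s: "s > 0" and H: "H > 0"
  obtains M where "M > 0"
    "\<And>\<psi> P w. bnd r s M P (\<psi> :: 'd fn) ==> bnd r s H (P * inverse (ew r M (fst w)) * inverse (ew s M (snd w))) (tf w \<psi>)"
proof -
  let ?K1 = "2 powr (1 / r) * H" and ?K2 = "2 powr (1 / s) * H"
  let ?M = "max ?K1 ?K2"
  have K: "?K1 > 0" "?K2 > 0" using H by simp_all
  have tr: "ew q ?M (x - a) <= inverse (ew q ?M a) * ew q H x"
    if q: "q > 0" and le: "2 powr (1 / q) * H <= ?M" for q and x a :: "real^'d"
  proof -
    have "ew q ?M (x - a) <= ew q (2 powr (1 / q) * H) (x - a)" by (rule ew_mono[OF le])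
    also have "... <= exp (2 powr (1 / q) * H * norm a powr (1 / q)) * ew q H x" using q H by (intro ew_translate_le) auto
    also have "... <= exp (?M * norm a powr (1 / q)) * ew q H x" using le by (intro mult_right_mono) (auto intro: mult_right_mono)
    also have "exp (?M * norm a powr (1 / q)) = inverse (ew q ?M a)" by (simp add: ew_def exp_minus)
    finally show ?thesis .
  qed
  have inv1: "inverse (ew q ?M a) >= 1" for q and a :: "real^'d"
    using ew_le_1[of ?M q a] K by (intro one_le_inverse) auto
  show ?thesis
  proof (rule that[of ?M])
    show "?M > 0" using K by linarith
    fix \<psi> :: "'d fn" and P :: real and w :: "(real^'d) \<times> (real^'d)"
    assume b: "bnd r s ?M P \<psi>"
    have P: "P >= 0" by (rule bnd_nonneg[OF b])
    let ?A = "inverse (ew r ?M (fst w))" and ?B = "inverse (ew s ?M (snd w))"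
    show "bnd r s H (P * ?A * ?B) (tf w \<psi>)"
      unfolding bnd_def tf_def norm_tfs norm_fourier_tfs
    proof (intro conjI allI)
      fix x :: "real^'d"
      have "norm (\<psi> (x - fst w)) <= P * ew r ?M (x - fst w)" using b by (simp add: bnd_def)
      also have "... <= P * (?A * ew r H x)" using P by (intro mult_left_mono tr r) auto
      also have "... = (P * ?A * ew r H x) * 1" by simp
      also have "... <= (P * ?A * ew r H x) * ?B" using P inv1[of s "snd w"] by (intro mult_left_mono) auto
      also have "... = P * ?A * ?B * ew r H x" by (simp only: mult_ac)
      finally show "norm (\<psi> (x - fst w)) <= P * ?A * ?B * ew r H x" .
    next
      fix x :: "real^'d"
      have "norm (fourier \<psi> (x - snd w)) <= P * ew s ?M (x - snd w)" using b by (simp add: bnd_def)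
      also have "... <= P * (?B * ew s H x)" using P by (intro mult_left_mono tr s) auto
      also have "... = (P * ?B * ew s H x) * 1" by simp
      also have "... <= (P * ?B * ew s H x) * ?A" using P inv1[of r "fst w"] by (intro mult_left_mono) auto
      also have "... = P * ?A * ?B * ew s H x" by (simp only: mult_ac)
      finally show "norm (fourier \<psi> (x - snd w)) <= P * ?A * ?B * ew s H x" .
    qed
  qed
qed

text \<open>
  For large \<open>x\<close> the surplus rate makes both terms small, for bounded \<open>x\<close> uniform continuity does.
\<close>

lemma weighted_continuity:
  fixes \<phi> :: "'w::euclidean_space => 'd::finite fn"
  assumes q: "q > 0" and H: "H > 0" and \<epsilon>: "\<epsilon> > 0"
    and c: "continuous_on UNIV (\<lambda>(w, x). \<phi> w x)"
    and Q: "\<And>w x. w \<in> cball w0 1 ==> norm (\<phi> w x) <= Q * ew q (H + 1) x"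
  obtains \<delta> where "\<delta> > 0" "\<And>w x. dist w w0 < \<delta> ==> norm (\<phi> w x - \<phi> w0 x) <= \<epsilon> * ew q H x"
proof -
  have Q0: "Q >= 0" using order_trans[OF norm_ge_zero Q[of w0 0]] by (simp add: ew_def)
  define T where "T = max 1 (ln ((2 * Q + 1) / \<epsilon>))"
  define R where "R = T powr q"
  have T: "T >= 1" "exp (- T) * (2 * Q) <= \<epsilon>"
  proof -
    show "T >= 1" by (simp add: T_def)
    have "(2 * Q + 1) / \<epsilon> = exp (ln ((2 * Q + 1) / \<epsilon>))" using Q0 \<epsilon> by (intro exp_ln[symmetric]) simp
    also have "... <= exp T" by (simp add: T_def)
    finally have "2 * Q + 1 <= \<epsilon> * exp T" using \<epsilon> by (simp add: pos_divide_le_eq mult.commute)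
    thus "exp (- T) * (2 * Q) <= \<epsilon>" by (simp add: exp_minus field_simps)
  qed
  let ?S = "cball w0 1 \<times> cball (0::real^'d) R"
  let ?m = "exp (- (H * R powr (1 / q)))"
  have "uniformly_continuous_on ?S (\<lambda>(w, x). \<phi> w x)"
    by (intro compact_uniformly_continuous compact_Times compact_cball continuous_on_subset[OF c]) auto
  moreover have "\<epsilon> * ?m > 0" using \<epsilon> by simp
  ultimately obtain d where d: "d > 0" "\<And>p p'. p \<in> ?S ==> p' \<in> ?S ==> dist p' p < d ==>
      dist ((\<lambda>(w, x). \<phi> w x) p') ((\<lambda>(w, x). \<phi> w x) p) < \<epsilon> * ?m"
    unfolding uniformly_continuous_on_def by meson
  show ?thesis
  proof (rule that[of "min d 1"])
    show "min d 1 > 0" using d by simp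
    fix w x assume w: "dist w w0 < min d 1"
    hence wc: "w \<in> cball w0 1" by (simp add: dist_commute)
    show "norm (\<phi> w x - \<phi> w0 x) <= \<epsilon> * ew q H x"
    proof (cases "norm x <= R")
      case True
      have "dist (w, x) (w0, x) < d" using w by (simp add: dist_Pair_Pair)
      hence "norm (\<phi> w x - \<phi> w0 x) < \<epsilon> * ?m"
        using d(2)[of "(w0, x)" "(w, x)"] wc True by (simp add: dist_norm)
      also have "\<epsilon> * ?m <= \<epsilon> * ew q H x"
        unfolding ew_def using True \<epsilon> H q by (intro mult_left_mono) (auto intro!: mult_left_mono powr_mono2)
      finally show ?thesis by simp
    next
      case False
      have "T = R powr (1 / q)" using T(1) q by (simp add: R_def powr_powr)
      also have "... <= norm x powr (1 / q)" using False q by (intro powr_mono2) (auto simp: R_def)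
      finally have x: "ew q 1 x <= exp (- T)" by (simp add: ew_def)
      have "norm (\<phi> w x - \<phi> w0 x) <= Q * ew q (H + 1) x + Q * ew q (H + 1) x"
        by (rule order_trans[OF norm_triangle_ineq4 add_mono[OF Q[OF wc] Q]]) simp
      also have "... = ew q 1 x * (2 * Q) * ew q H x" unfolding ew_add by simp
      also have "... <= exp (- T) * (2 * Q) * ew q H x" using x Q0 by (intro mult_right_mono) auto
      also have "... <= \<epsilon> * ew q H x" using T(2) by (intro mult_right_mono) auto
      finally show ?thesis .
    qed
  qed
qed

context gs_indices
begin

lemma tf_gs: assumes "\<psi> \<in> gs r s" shows "tf w \<psi> \<in> gs r s"
  unfolding gs_iff
proof (intro conjI allI impI)
  show "tf w \<psi> \<in> SS" using assms by (simp add: tf_def tfs_SS gs_iff)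
  fix H :: real assume "H > 0"
  from bnd_tf[OF r s this] obtain M where "M > 0" 
    "\<And>\<psi> P w. bnd r s M P (\<psi> :: 'a fn) ==> bnd r s H (P * inverse (ew r M (fst w)) * inverse (ew s M (snd w))) (tf w \<psi>)"
    by metis
  moreover obtain P where "bnd r s M P \<psi>" using assms \<open>M > 0\<close> unfolding gs_iff by blast
  ultimately show "\<exists>P. bnd r s H P (tf w \<psi>)" by blast
qed

lemma tf_continuity:
  fixes \<psi> :: "'d::finite fn"
  assumes \<psi>: "\<psi> \<in> gs r s" and H: "H > 0" and \<epsilon>: "\<epsilon> > 0"
  shows "\<exists>U. open U \<and> w0 \<in> U \<and> (\<forall>w\<in>U. bnd r s H \<epsilon> (\<lambda>x. tf w \<psi> x - tf w0 \<psi> x))"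
proof -
  have \<psi>S: "\<psi> \<in> SS" using \<psi> by (simp add: gs_iff)
  have "H + 1 > 0" using H by simp
  then obtain M where M: "M > 0"
    "\<And>\<psi> P w. bnd r s M P (\<psi> :: 'd fn) ==> bnd r s (H + 1) (P * inverse (ew r M (fst w)) * inverse (ew s M (snd w))) (tf w \<psi>)"
    using bnd_tf[OF r s] by metis
  obtain P where P: "bnd r s M P \<psi>" using \<psi> M(1) unfolding gs_iff by blast
  let ?B = "\<lambda>w::(real^'d) \<times> (real^'d). P * inverse (ew r M (fst w)) * inverse (ew s M (snd w))"
  have "continuous_on (cball w0 1) ?B"
    by (intro continuous_intros continuous_on_compose2[OF continuous_on_ew[OF r]] continuous_on_compose2[OF continuous_on_ew[OF s]]) auto
  hence "bounded (?B ` cball w0 1)" by (intro compact_imp_bounded compact_continuous_image compact_cball)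
  then obtain Q where "\<forall>z\<in>?B ` cball w0 1. norm z <= Q" unfolding bounded_iff by blast
  hence Q: "?B w <= Q" if "w \<in> cball w0 1" for w
  proof -
    have "norm (?B w) <= Q" using \<open>\<forall>z\<in>?B ` cball w0 1. norm z <= Q\<close> imageI[OF that, of ?B] by (rule bspec)
    thus ?thesis unfolding real_norm_def by (rule order_trans[OF abs_ge_self])
  qed
  have b: "bnd r s (H + 1) Q (tf w \<psi>)" if "w \<in> cball w0 1" for w
    by (rule bnd_weaken[OF M(2)[OF P, of w] order_refl Q[OF that]])
  have c1: "continuous_on UNIV (\<lambda>(w, x). tf w \<psi> x)"
    unfolding tf_def tfs_apply case_prod_beta
    by (intro continuous_intros continuous_on_compose2[OF SS_cont[OF \<psi>S]]) auto
  have c2: "continuous_on UNIV (\<lambda>(w, x). fourier (tf w \<psi>) x)"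
    unfolding tf_def fourier_tfs case_prod_beta
    by (intro continuous_intros continuous_on_compose2[OF SS_fourier_cont[OF \<psi>S]]) auto
  have b1: "norm (tf w \<psi> x) <= Q * ew r (H + 1) x" and b2: "norm (fourier (tf w \<psi>) x) <= Q * ew s (H + 1) x"
    if "w \<in> cball w0 1" for w x using b[OF that] by (simp_all add: bnd_def)
  obtain \<delta>1 where 1: "\<delta>1 > 0" "\<And>w x. dist w w0 < \<delta>1 ==> norm (tf w \<psi> x - tf w0 \<psi> x) <= \<epsilon> * ew r H x"
    by (rule weighted_continuity[OF r H \<epsilon> c1 b1]) blast+
  obtain \<delta>2 where 2: "\<delta>2 > 0" "\<And>w \<xi>. dist w w0 < \<delta>2 ==> norm (fourier (tf w \<psi>) \<xi> - fourier (tf w0 \<psi>) \<xi>) <= \<epsilon> * ew s H \<xi>"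
    by (rule weighted_continuity[OF s H \<epsilon> c2 b2]) blast+
  have "bnd r s H \<epsilon> (\<lambda>x. tf w \<psi> x - tf w0 \<psi> x)" if "w \<in> ball w0 (min \<delta>1 \<delta>2)" for w
    unfolding bnd_def
  proof (intro conjI allI)
    show "norm (tf w \<psi> x - tf w0 \<psi> x) <= \<epsilon> * ew r H x" for x
      by (rule 1(2)) (use that in \<open>simp add: dist_commute\<close>)
    fix \<xi> :: "real^'d"
    have "fourier (\<lambda>x. tf w \<psi> x - tf w0 \<psi> x) \<xi> = fourier (tf w \<psi>) \<xi> - fourier (tf w0 \<psi>) \<xi>"
      by (rule evl_diff[OF evl_fourier[of H \<xi>] tf_gs[OF \<psi>] tf_gs[OF \<psi>]])
    thus "norm (fourier (\<lambda>x. tf w \<psi> x - tf w0 \<psi> x) \<xi>) <= \<epsilon> * ew s H \<xi>"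
      using 2(2)[of w \<xi>] that by (simp add: dist_commute)
  qed
  thus ?thesis using 1(1) 2(1) by (intro exI[of _ "ball w0 (min \<delta>1 \<delta>2)"]) auto
qed

end

lemma integrable_phase_space:
  fixes f :: "(real^'d::finite) \<times> (real^'d) => 'b::{banach, second_countable_topology}"
  assumes q: "q > 0" and p: "p > 0" and f: "f \<in> borel_measurable borel"
    and b: "\<And>w. norm (f w) <= C * ew q 1 (fst w) * ew p 1 (snd w)"
  shows "integrable lborel f"
proof -
  have "integrable (lborel \<Otimes>\<^sub>M lborel) (\<lambda>(y, \<eta>). of_real (ew q 1 (y::real^'d)) * of_real (ew p 1 (\<eta>::real^'d)) * (\<lambda>z. complex_of_real C) (y, \<eta>))"
    by (rule integrable_tensor[where C="\<bar>C\<bar>"]) (auto intro!: integrable_of_real integrable_ew q p)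
  hence I: "integrable lborel (\<lambda>(y, \<eta>). complex_of_real (ew q 1 (y::real^'d)) * of_real (ew p 1 (\<eta>::real^'d)) * of_real C)"
    by (simp add: lborel_prod)
  show ?thesis
  proof (rule Bochner_Integration.integrable_bound[OF I])
    show "f \<in> borel_measurable lborel" using f by simp
    show "AE w in lborel. norm (f w) <= norm (case w of (y, \<eta>) => complex_of_real (ew q 1 (y::real^'d)) * of_real (ew p 1 (\<eta>::real^'d)) * of_real C)"
    proof (intro AE_I2)
      fix w :: "(real^'d) \<times> (real^'d)"
      have "norm (f w) <= C * ew q 1 (fst w) * ew p 1 (snd w)" by (rule b)
      also have "... <= \<bar>C\<bar> * ew q 1 (fst w) * ew p 1 (snd w)" by (intro mult_right_mono) auto
      also have "... = norm (case w of (y, \<eta>) => complex_of_real (ew q 1 (y::real^'d)) * of_real (ew p 1 (\<eta>::real^'d)) * of_real C)"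
        by (simp add: case_prod_beta norm_mult)
      finally show "norm (f w) <= norm (case w of (y, \<eta>) => complex_of_real (ew q 1 (y::real^'d)) * of_real (ew p 1 (\<eta>::real^'d)) * of_real C)" .
    qed
  qed
qed

context gs_indices
begin

lemma vf_gs_bound:
  fixes g \<psi> :: "'d::finite fn"
  assumes g: "g \<in> gs r s" and \<psi>: "\<psi> \<in> gs r s" and H: "H > 0"
  obtains C where "C > 0" "\<And>w. norm (vf \<psi> g w) <= C * ew r H (fst w) * ew s H (snd w)"
proof -
  obtain H' C where H': "H' > 0" and C: "C > 0" and b:
    "\<And>g \<psi> P Q w. g \<in> SS ==> \<psi> \<in> (SS :: 'd fn set) ==> bnd r s H' P g ==> bnd r s H' Q \<psi> ==>
      norm (vf \<psi> g w) <= C * P * Q * ew r H (fst w) * ew s H (snd w)"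
    by (rule vf_bound[OF r s H]) blast
  obtain P Q where PQ: "bnd r s H' P g" "bnd r s H' Q \<psi>" using g \<psi> H' unfolding gs_iff by blast
  have SS: "g \<in> SS" "\<psi> \<in> SS" using g \<psi> by (simp_all add: gs_iff)
  have PQ0: "P >= 0" "Q >= 0" using bnd_nonneg[OF PQ(1)] bnd_nonneg[OF PQ(2)] .
  show ?thesis
  proof (rule that[of "C * P * Q + 1"])
    show "C * P * Q + 1 > 0" using C PQ0 by (intro add_nonneg_pos mult_nonneg_nonneg) auto
    show "norm (vf \<psi> g w) <= (C * P * Q + 1) * ew r H (fst w) * ew s H (snd w)" for w
      by (rule order_trans[OF b[OF SS PQ]], intro mult_right_mono) auto
  qed
qed

lemma vf_measurable:
  assumes "g \<in> gs r s" "\<psi> \<in> gs r s" shows "vf \<psi> g \<in> borel_measurable borel"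
  using assms by (intro borel_measurable_continuous_onI continuous_on_vf) (auto simp: gs_iff)

lemma vf_integrable:
  assumes g: "g \<in> gs r s" and \<psi>: "\<psi> \<in> gs r s"
  shows "integrable lborel (vf \<psi> g)"
proof -
  obtain C where C: "C > 0" "\<And>w. norm (vf \<psi> g w) <= C * ew r 1 (fst w) * ew s 1 (snd w)" by (rule vf_gs_bound[OF g \<psi> zero_less_one]) blast
  show ?thesis by (rule integrable_phase_space[OF r s vf_measurable[OF g \<psi>] C(2)])
qed

lemma vf_tf_bound:
  fixes g \<psi> :: "'d::finite fn"
  assumes g: "g \<in> gs r s" and \<psi>: "\<psi> \<in> gs r s" and H: "H > 0"
  shows "\<exists>B. (\<forall>w. bnd r s H (B w) (tf w \<psi>)) \<and> integrable lborel (\<lambda>w. norm (vf \<psi> g w) * B w)"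
proof -
  obtain M where M: "M > 0"
    "\<And>\<psi> P w. bnd r s M P (\<psi> :: 'd fn) ==> bnd r s H (P * inverse (ew r M (fst w)) * inverse (ew s M (snd w))) (tf w \<psi>)"
    by (rule bnd_tf[OF r s H]) blast
  obtain P where P: "bnd r s M P \<psi>" using \<psi> M(1) unfolding gs_iff by blast
  have P0: "P >= 0" by (rule bnd_nonneg[OF P])
  let ?B = "\<lambda>w::(real^'d) \<times> (real^'d). P * inverse (ew r M (fst w)) * inverse (ew s M (snd w))"
  have "M + 1 > 0" using M by simp
  then obtain C where C: "C > 0" "\<And>w. norm (vf \<psi> g w) <= C * ew r (M + 1) (fst w) * ew s (M + 1) (snd w)" using vf_gs_bound[OF g \<psi>] by blast
  have B0: "?B w >= 0" for w using P0 by simp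
  have "integrable lborel (\<lambda>w. norm (vf \<psi> g w) * ?B w)"
  proof (rule integrable_phase_space[OF r s])
    have "continuous_on UNIV ?B"
      by (intro continuous_intros continuous_on_compose2[OF continuous_on_ew[OF r]] continuous_on_compose2[OF continuous_on_ew[OF s]]) auto
    hence 1: "?B \<in> borel_measurable borel" by (rule borel_measurable_continuous_onI)
    have 2: "(\<lambda>w. norm (vf \<psi> g w)) \<in> borel_measurable borel" using vf_measurable[OF g \<psi>] by simp
    show "(\<lambda>w. norm (vf \<psi> g w) * ?B w) \<in> borel_measurable borel" by (rule borel_measurable_times[OF 2 1])
    fix w :: "(real^'d) \<times> (real^'d)"
    have "norm (norm (vf \<psi> g w) * ?B w) = norm (vf \<psi> g w) * ?B w" using B0[of w] by simp
    also have "... <= (C * ew r (M + 1) (fst w) * ew s (M + 1) (snd w)) * ?B w" by (intro mult_right_mono C B0)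
    also have "... = C * P * ew r 1 (fst w) * ew s 1 (snd w)" unfolding ew_add by (simp add: field_simps)
    finally show "norm (norm (vf \<psi> g w) * ?B w) <= C * P * ew r 1 (fst w) * ew s 1 (snd w)" .
  qed
  thus ?thesis using M(2)[OF P] by (intro exI[of _ ?B] conjI allI)
qed

text \<open>
  Fourier inversion in \<open>\<eta>\<close> leaves \<open>g x * \<bar>\<psi>(x - y)\<bar>\<^sup>2\<close>, which is then integrated over \<open>y\<close>.
\<close>

lemma gabor_reconstruction:
  fixes g \<psi> :: "'d::finite fn"
  assumes g: "g \<in> gs r s" and \<psi>: "\<psi> \<in> gs r s"
  shows "ip \<psi> \<psi> / of_real (fconst TYPE('d)) * g x = (LBINT w. vf \<psi> g w * tf w \<psi> x)"
proof -
  let ?c = "of_real (fconst TYPE('d)) :: complex"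
  have c0: "?c \<noteq> 0" using fconst_pos[where 'd='d] by simp
  have gS: "g \<in> SS" and \<psi>S: "\<psi> \<in> SS" using g \<psi> by (simp_all add: gs_iff)
  obtain B where B: "\<And>x. norm (\<psi> x) <= B" using rapid_bounded[OF SS_rapid[OF \<psi>S]] by metis
  have ct: "continuous_on UNIV (\<lambda>w::(real^'d) \<times> (real^'d). tf w \<psi> x)"
    unfolding tf_def tfs_apply
    by (intro continuous_intros continuous_on_compose2[OF SS_cont[OF \<psi>S]]) auto
  have I: "integrable lborel (\<lambda>w. vf \<psi> g w * tf w \<psi> x)"
  proof (rule Bochner_Integration.integrable_bound[OF integrable_mult_left[OF vf_integrable[OF g \<psi>], of "of_real B"]])
    show "(\<lambda>w. vf \<psi> g w * tf w \<psi> x) \<in> borel_measurable lborel"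
      using vf_measurable[OF g \<psi>] borel_measurable_continuous_onI[OF ct] by simp
    show "AE w in lborel. norm (vf \<psi> g w * tf w \<psi> x) <= norm (vf \<psi> g w * of_real B)"
      unfolding norm_mult tf_def norm_tfs using B by (intro AE_I2 mult_left_mono) (auto intro: order_trans[OF _ abs_ge_self])
  qed
  have "(LBINT w. vf \<psi> g w * tf w \<psi> x) = (LBINT y. LBINT \<eta>. vf \<psi> g (y, \<eta>) * tf (y, \<eta>) \<psi> x)"
    using lborel_pair.integral_fst'[of "\<lambda>w. vf \<psi> g w * tf w \<psi> x"] I by (simp add: lborel_prod)
  also have "... = (LBINT y. g x / ?c * (\<psi> (x - y) * cnj (\<psi> (x - y))))"
  proof (rule Bochner_Integration.integral_cong[OF refl])
    fix y :: "real^'d"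
    let ?h = "\<lambda>z. g z * cnj (\<psi> (z - y))"
    obtain B' where B': "\<And>z. norm (?h z) <= B'" using vf_factor(3)[OF gS \<psi>S, of y] by blast
    obtain C where C: "C > 0" "\<And>w. norm (vf \<psi> g w) <= C * ew r 1 (fst w) * ew s 1 (snd w)" by (rule vf_gs_bound[OF g \<psi> zero_less_one]) blast
    have fh: "fourier ?h \<eta> = vf \<psi> g (y, \<eta>)" for \<eta> by (simp add: vf_def)
    have fi: "integrable lborel (fourier ?h)"
    proof (rule Bochner_Integration.integrable_bound[OF integrable_mult_right[OF integrable_ew[OF s zero_less_one], of "C"]])
      show "fourier ?h \<in> borel_measurable lborel"
        using borel_measurable_continuous_onI[OF continuous_on_fourier[OF vf_factor(2)[OF gS \<psi>S, of y]]] by simp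
      have "norm (fourier ?h \<eta>) <= norm (C * ew s 1 \<eta>)" for \<eta>
      proof -
        have "norm (fourier ?h \<eta>) <= C * ew r 1 y * ew s 1 \<eta>" using C(2)[of "(y, \<eta>)"] unfolding fh by simp
        also have "... <= C * 1 * ew s 1 \<eta>" using C(1) ew_le_1[of 1 r y] by (intro mult_right_mono mult_left_mono) auto
        finally show ?thesis using C(1) by simp
      qed
      thus "AE \<eta> in lborel. norm (fourier ?h \<eta>) <= norm (C * ew s 1 \<eta>)" by (rule AE_I2)
    qed
    have "fourier (fourier ?h) (- x) = ?h x"
      by (rule fourier_inversion[OF vf_factor(1)[OF gS \<psi>S] B' vf_factor(2)[OF gS \<psi>S] fi])
    hence inv: "(LBINT \<eta>. vf \<psi> g (y, \<eta>) * exp (\<i> * of_real (\<eta> \<bullet> x))) = ?h x / ?c"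
      using c0 unfolding fourier_eq[of "fourier ?h"] fh by (simp add: field_simps)
    have "(LBINT \<eta>. vf \<psi> g (y, \<eta>) * tf (y, \<eta>) \<psi> x) = (LBINT \<eta>. (vf \<psi> g (y, \<eta>) * exp (\<i> * of_real (\<eta> \<bullet> x))) * \<psi> (x - y))"
      by (simp only: tf_def tfs_apply fst_conv snd_conv inner_commute mult.assoc)
    also have "... = ?h x / ?c * \<psi> (x - y)" unfolding inv[symmetric] by (rule integral_mult_left_zero)
    finally show "(LBINT \<eta>. vf \<psi> g (y, \<eta>) * tf (y, \<eta>) \<psi> x) = g x / ?c * (\<psi> (x - y) * cnj (\<psi> (x - y)))"
      by (simp add: mult_ac)
  qed
  also have "... = g x / ?c * (LBINT y. \<psi> (x - y) * cnj (\<psi> (x - y)))" by (rule integral_mult_right_zero)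
  also have "(LBINT y. \<psi> (x - y) * cnj (\<psi> (x - y))) = ip \<psi> \<psi>"
    unfolding ip_def by (rule lborel_integral_translate(3))
  finally show ?thesis by simp
qed

lemma gabor_reconstruction_fourier:
  fixes g \<psi> :: "'d::finite fn"
  assumes g: "g \<in> gs r s" and \<psi>: "\<psi> \<in> gs r s"
  shows "fourier (\<lambda>x. ip \<psi> \<psi> / of_real (fconst TYPE('d)) * g x) \<xi> = (LBINT w. vf \<psi> g w * fourier (tf w \<psi>) \<xi>)"
proof -
  let ?c = "of_real (fconst TYPE('d)) :: complex"
  have gS: "g \<in> SS" and \<psi>S: "\<psi> \<in> SS" using g \<psi> by (simp_all add: gs_iff)
  obtain B where B: "\<And>w. bnd r s 1 (B w) (tf w \<psi>)" and aB: "integrable lborel (\<lambda>w. norm (vf \<psi> g w) * B w)"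
    using vf_tf_bound[OF g \<psi> zero_less_one] by blast
  let ?G = "\<lambda>(w::(real^'d) \<times> (real^'d)) x. vf \<psi> g w * tf w \<psi> x * osc x \<xi>"
  have I: "integrable (lborel \<Otimes>\<^sub>M lborel) (\<lambda>(w, x). ?G w x)"
  proof (rule Bochner_Integration.integrable_bound)
    show "integrable (lborel \<Otimes>\<^sub>M lborel) (\<lambda>(w, x). of_real (norm (vf \<psi> g w) * B w) * of_real (ew r 1 (x::real^'d)) * (\<lambda>z. 1::complex) (w, x))"
      by (rule integrable_tensor[where C=1]) (auto intro!: integrable_of_real aB integrable_ew r simp del: of_real_mult)
    have "continuous_on UNIV (\<lambda>(w, x). ?G w x)"
      unfolding case_prod_beta tf_def tfs_apply
      by (intro continuous_intros continuous_on_compose2[OF SS_cont[OF \<psi>S]] continuous_on_compose2[OF continuous_on_vf[OF gS \<psi>S]]) auto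
    hence "(\<lambda>(w, x). ?G w x) \<in> borel_measurable (borel \<Otimes>\<^sub>M borel)" by (rule borel_measurable_pair_continuous)
    thus "(\<lambda>(w, x). ?G w x) \<in> borel_measurable (lborel \<Otimes>\<^sub>M lborel)" by (simp cong: measurable_cong_sets sets_pair_measure_cong)
    have "norm (?G w x) <= norm (complex_of_real (norm (vf \<psi> g w) * B w) * of_real (ew r 1 x) * 1)" for w x
    proof -
      have "norm (tf w \<psi> x) <= B w * ew r 1 x" using B[of w] by (simp add: bnd_def)
      hence "norm (?G w x) <= norm (vf \<psi> g w) * (B w * ew r 1 x)" by (simp add: norm_mult mult_left_mono)
      also have "... = norm (vf \<psi> g w) * B w * ew r 1 x" by (simp only: mult.assoc)
      also have "... <= norm (complex_of_real (norm (vf \<psi> g w) * B w) * of_real (ew r 1 x) * 1)"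
        unfolding norm_mult norm_of_real by (simp add: mult_right_mono)
      finally show ?thesis .
    qed
    thus "AE z in lborel \<Otimes>\<^sub>M lborel. norm (case z of (w, x) => ?G w x) <=
        norm (case z of (w, x) => complex_of_real (norm (vf \<psi> g w) * B w) * of_real (ew r 1 x) * (\<lambda>z. 1) (w, x))"
      by (intro AE_I2) (simp only: case_prod_beta)
  qed
  have "fourier (\<lambda>x. ip \<psi> \<psi> / ?c * g x) \<xi> = ?c * (LBINT x. LBINT w. ?G w x)"
    unfolding fourier_eq gabor_reconstruction[OF g \<psi>]
    by (rule arg_cong[of _ _ "\<lambda>z. ?c * z"], rule Bochner_Integration.integral_cong[OF refl], rule integral_mult_left_zero[symmetric])
  also have "(LBINT x. LBINT w. ?G w x) = (LBINT w. LBINT x. ?G w x)"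
    by (rule lborel_pair.Fubini_integral[OF I])
  also have "?c * (LBINT w. LBINT x. ?G w x) = (LBINT w. ?c * (LBINT x. ?G w x))"
    by (rule integral_mult_right_zero[symmetric])
  also have "... = (LBINT w. vf \<psi> g w * fourier (tf w \<psi>) \<xi>)"
  proof (rule Bochner_Integration.integral_cong[OF refl])
    fix w :: "(real^'d) \<times> (real^'d)"
    have "(LBINT x. ?G w x) = vf \<psi> g w * (LBINT x. tf w \<psi> x * osc x \<xi>)"
      unfolding mult.assoc by (rule integral_mult_right_zero)
    thus "?c * (LBINT x. ?G w x) = vf \<psi> g w * fourier (tf w \<psi>) \<xi>"
      unfolding fourier_eq[of "tf w \<psi>"] by (simp only: mult_ac)
  qed
  finally show ?thesis .
qed

text \<open>
  The reconstruction formula with \<open>u\<close> applied under the integral.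
\<close>

theorem dual_stft_bound:
  fixes g \<psi> :: "'d::finite fn"
  assumes u: "u \<in> gs_dual r s" and g: "g \<in> gs r s" and \<psi>: "\<psi> \<in> gs r s"
  shows "norm (ip \<psi> \<psi>) / fconst TYPE('d) * norm (u g) <= (LBINT w. norm (vf \<psi> g w) * norm (u (tf w \<psi>)))"
    and "integrable lborel (\<lambda>w. norm (vf \<psi> g w) * norm (u (tf w \<psi>)))"
proof -
  let ?c = "of_real (fconst TYPE('d)) :: complex"
  let ?Z = "ip \<psi> \<psi> / ?c"
  have c: "fconst TYPE('d) > 0" by (rule fconst_pos)
  let ?g = "\<lambda>x. ?Z * g x"
  have gZ: "?g \<in> gs r s" by (rule gs_cmult[OF g])
  note D = dual_integral[where \<Phi> = "\<lambda>w. tf w \<psi>" and a = "vf \<psi> g" and g = ?g, OF u tf_gs[OF \<psi>]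
      tf_continuity[OF \<psi>] vf_tf_bound[OF g \<psi>] vf_integrable[OF g \<psi>] gZ
      gabor_reconstruction[OF g \<psi>] gabor_reconstruction_fourier[OF g \<psi>]]
  have "integrable lborel (\<lambda>w. norm (vf \<psi> g w * cnj (u (tf w \<psi>))))" using D(2) by (rule integrable_norm)
  thus "integrable lborel (\<lambda>w. norm (vf \<psi> g w) * norm (u (tf w \<psi>)))" by (simp add: norm_mult)
  have "norm ?Z * norm (u g) = norm (cnj (u (\<lambda>x. ?Z * g x)))"
    unfolding gs_dual_cmult[OF u g, of ?Z] complex_mod_cnj norm_mult ..
  also have "... = norm (LBINT w. vf \<psi> g w * cnj (u (tf w \<psi>)))" by (simp only: D(1))
  also have "... <= (LBINT w. norm (vf \<psi> g w * cnj (u (tf w \<psi>))))" by (rule integral_norm_bound)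
  also have "... = (LBINT w. norm (vf \<psi> g w) * norm (u (tf w \<psi>)))" by (simp add: norm_mult)
  finally show "norm (ip \<psi> \<psi>) / fconst TYPE('d) * norm (u g) <= (LBINT w. norm (vf \<psi> g w) * norm (u (tf w \<psi>)))"
    using c by (simp add: norm_divide)
qed

end

section \<open>Density of functions in the dual and the extension of the propagator\<close>

lemma fourier_inj:
  assumes "f \<in> SS" "g \<in> SS" "\<And>\<xi>. fourier f \<xi> = fourier g \<xi>" shows "f = g"
proof -
  have "fourier f = fourier g" using assms(3) by (rule ext)
  hence "ifourier (fourier f) = ifourier (fourier g)" by (rule arg_cong)
  thus ?thesis by (simp only: ifourier_fourier assms(1,2))
qed

lemma evo_add:
  assumes "f \<in> SS" "g \<in> SS" shows "evo c m t (\<lambda>x. f x + g x) = (\<lambda>x. evo c m t f x + evo c m t g x)"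
proof (rule fourier_inj)
  show "evo c m t (\<lambda>x. f x + g x) \<in> SS" by (intro evo_SS SS_add assms)
  show "(\<lambda>x. evo c m t f x + evo c m t g x) \<in> SS" by (intro evo_SS SS_add assms)
  show "fourier (evo c m t (\<lambda>x. f x + g x)) \<xi> = fourier (\<lambda>x. evo c m t f x + evo c m t g x) \<xi>" for \<xi>
    by (simp add: fourier_evo fourier_add SS_integrable evo_SS(1) SS_add assms distrib_left)
qed

lemma evo_cmult:
  assumes "f \<in> SS" shows "evo c m t (\<lambda>x. a * f x) = (\<lambda>x. a * evo c m t f x)"
proof (rule fourier_inj)
  show "evo c m t (\<lambda>x. a * f x) \<in> SS" by (intro evo_SS SS_cmult assms)
  show "(\<lambda>x. a * evo c m t f x) \<in> SS" by (intro evo_SS SS_cmult assms)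
  show "fourier (evo c m t (\<lambda>x. a * f x)) \<xi> = fourier (\<lambda>x. a * evo c m t f x) \<xi>" for \<xi>
    by (simp add: fourier_evo fourier_cmult SS_cmult assms)
qed

context gs_indices
begin

lemma gs_dual_linear:
  fixes u v :: "('d::finite) functional"
  assumes u: "u \<in> gs_dual r s" and v: "v \<in> gs_dual r s"
  shows "(\<lambda>f\<in>gs r s. a * u f + b * v f) \<in> gs_dual r s"
proof -
  obtain h1 C1 where 1: "h1 > 0" "C1 > 0" "\<And>f. f \<in> gs r s ==> norm (u f) <= C1 * gs_norm r s h1 f"
    using gs_dual_bound[OF u] by metis
  obtain h2 C2 where 2: "h2 > 0" "C2 > 0" "\<And>f. f \<in> gs r s ==> norm (v f) <= C2 * gs_norm r s h2 f"
    using gs_dual_bound[OF v] by metis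
  show ?thesis
  proof (rule gs_dualI[where h = "min h1 h2" and C = "norm a * C1 + norm b * C2"])
    show "(\<lambda>f\<in>gs r s. a * u f + b * v f) \<in> extensional (gs r s)" by simp
    show "min h1 h2 > 0" using 1 2 by simp
  next
    fix f g :: "'d fn" assume f: "f \<in> gs r s" and g: "g \<in> gs r s"
    show "(\<lambda>f\<in>gs r s. a * u f + b * v f) (\<lambda>x. f x + g x) = (\<lambda>f\<in>gs r s. a * u f + b * v f) f + (\<lambda>f\<in>gs r s. a * u f + b * v f) g"
      using f g gs_add[OF f g] by (simp add: gs_dual_add[OF u f g] gs_dual_add[OF v f g] algebra_simps)
  next
    fix \<alpha> :: complex and f :: "'d fn" assume f: "f \<in> gs r s"
    show "(\<lambda>f\<in>gs r s. a * u f + b * v f) (\<lambda>x. \<alpha> * f x) = cnj \<alpha> * (\<lambda>f\<in>gs r s. a * u f + b * v f) f"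
      using f gs_cmult[OF f, of \<alpha>] by (simp add: gs_dual_cmult[OF u f] gs_dual_cmult[OF v f] algebra_simps)
  next
    fix f :: "'d fn" assume f: "f \<in> gs r s"
    let ?n = "gs_norm r s (min h1 h2) f"
    have "norm (u f) <= C1 * ?n"
      using 1 2 by (intro order_trans[OF 1(3)[OF f]] mult_left_mono gs_norm_antimono f) auto
    moreover have "norm (v f) <= C2 * ?n"
      using 1 2 by (intro order_trans[OF 2(3)[OF f]] mult_left_mono gs_norm_antimono f) auto
    ultimately have "norm (a * u f) + norm (b * v f) <= norm a * (C1 * ?n) + norm b * (C2 * ?n)"
      unfolding norm_mult by (intro add_mono mult_left_mono) auto
    hence "norm (a * u f + b * v f) <= norm a * (C1 * ?n) + norm b * (C2 * ?n)"
      using norm_triangle_ineq order_trans by blast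
    thus "norm ((\<lambda>f\<in>gs r s. a * u f + b * v f) f) <= (norm a * C1 + norm b * C2) * ?n"
      using f by (simp add: algebra_simps)
  qed
qed

abbreviation reg :: "'d::finite fn => 'd functional"
  where "reg f \<equiv> restrict (regular_distr f) (gs r s)"

lemma reg_dual: "f \<in> gs r s ==> reg f \<in> gs_dual r s"
  by (rule regular_distr_dual) (simp add: gs_iff)

lemma regular_distr_ip: "regular_distr f g = ip f g"
  by (simp add: regular_distr_def ip_def)

lemma reg_apply: "g \<in> gs r s ==> reg f g = ip f g"
  by (simp add: regular_distr_def ip_def)

text \<open>
  The second property expresses that \<open>g\<close> is a linear combination of the list. To add \<open>f\<close>, subtract
  from it the interpolant \<open>h\<close> of its own functional; then \<open>e = f - h\<close> is orthogonal to the old list. If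
  \<open>\<langle>e, f\<rangle> \<noteq> 0\<close>, a multiple of \<open>e\<close> corrects the value at \<open>f\<close>. Otherwise \<open>e\<close> is orthogonal to itself, so
  \<open>f = h\<close> is a combination of the old list and the value at \<open>f\<close> is already right.
\<close>

lemma dual_interpolation:
  fixes fs :: "('d::finite fn) list"
  assumes "set fs \<subseteq> gs r s" "u \<in> gs_dual r s"
  shows "\<exists>g\<in>gs r s. (\<forall>f\<in>set fs. ip g f = u f) \<and>
    (\<forall>v\<in>gs_dual r s. (\<forall>f\<in>set fs. v f = 0) \<longrightarrow> v g = 0)"
  using assms
proof (induction fs arbitrary: u)
  case Nil
  thus ?case by (intro bexI[of _ "\<lambda>x. 0"]) (auto simp: gs_zero gs_dual_zero)
next
  case (Cons f fs)
  have f: "f \<in> gs r s" and fs: "set fs \<subseteq> gs r s" and u: "u \<in> gs_dual r s" using Cons.prems by auto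
  obtain g0 where g0: "g0 \<in> gs r s" "\<And>k. k \<in> set fs ==> ip g0 k = u k"
    "\<And>v. v \<in> gs_dual r s ==> (\<And>k. k \<in> set fs ==> v k = 0) ==> v g0 = 0"
    using Cons.IH[OF fs u] by blast
  obtain h where h: "h \<in> gs r s" "\<And>k. k \<in> set fs ==> ip h k = reg f k"
    "\<And>v. v \<in> gs_dual r s ==> (\<And>k. k \<in> set fs ==> v k = 0) ==> v h = 0"
    using Cons.IH[OF fs reg_dual[OF f]] by blast
  define e where "e = (\<lambda>x. f x - h x)"
  have e: "e \<in> gs r s" unfolding e_def by (rule gs_diff[OF f h(1)])
  have SS: "f \<in> SS" "h \<in> SS" "g0 \<in> SS" "e \<in> SS" using f h(1) g0(1) e by (simp_all add: gs_iff)
  have kS: "k \<in> SS" if "k \<in> set fs" for k using that fs by (auto simp: gs_iff)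
  have ek: "ip e k = 0" if k: "k \<in> set fs" for k
  proof -
    have "ip e k = ip (\<lambda>x. 1 * f x + (-1) * h x) k" by (simp add: e_def)
    also have "... = 1 * ip f k + (-1) * ip h k" by (rule ip_linear[OF SS(1,2) kS[OF k]])
    also have "... = 0" using h(2)[OF k] k fs by (simp add: regular_distr_ip subset_iff)
    finally show ?thesis .
  qed
  show ?case
  proof (cases "ip e f = 0")
    case False
    define a where "a = (u f - ip g0 f) / ip e f"
    show ?thesis
    proof (intro bexI[of _ "\<lambda>x. 1 * g0 x + a * e x"] conjI ballI impI)
      show "(\<lambda>x. 1 * g0 x + a * e x) \<in> gs r s" by (intro gs_add gs_cmult g0(1) e)
      fix k assume "k \<in> set (f # fs)"
      then consider "k = f" | "k \<in> set fs" by auto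
      thus "ip (\<lambda>x. 1 * g0 x + a * e x) k = u k"
      proof cases
        case 1
        thus ?thesis using False unfolding 1 ip_linear[OF SS(3,4,1)] a_def by simp
      next
        case 2
        thus ?thesis unfolding ip_linear[OF SS(3,4) kS[OF 2]] by (simp add: ek g0(2))
      qed
    next
      fix v assume v: "v \<in> gs_dual r s" and v0: "\<forall>k\<in>set (f # fs). v k = 0"
      have "v g0 = 0" "v h = 0" by (rule g0(3)[OF v] h(3)[OF v]; use v0 in simp)+
      moreover have "v e = v f - v h" unfolding e_def by (rule gs_dual_diff[OF v f h(1)])
      ultimately have "v e = 0" using v0 by simp
      thus "v (\<lambda>x. 1 * g0 x + a * e x) = 0"
        using gs_dual_add[OF v gs_cmult[OF g0(1)] gs_cmult[OF e], of 1 a] gs_dual_cmult[OF v g0(1), of 1]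
          gs_dual_cmult[OF v e, of a] \<open>v g0 = 0\<close> by simp
    qed
  next
    case True
    have "reg e h = 0"
      by (rule h(3)[OF reg_dual[OF e]]) (use ek fs in \<open>auto simp: regular_distr_ip\<close>)
    hence eh: "ip e h = 0" using h(1) by (simp add: regular_distr_ip)
    have "reg e e = reg e f - reg e h"
      using gs_dual_diff[OF reg_dual[OF e] f h(1)] unfolding e_def .
    hence "ip e e = ip e f - ip e h" by (simp only: reg_apply[OF e] reg_apply[OF f] reg_apply[OF h(1)])
    hence "ip e e = 0" using True eh by simp
    hence "e x = 0" for x by (rule SS_eq_0[OF SS(4)])
    hence fh: "f = h" by (intro ext) (simp add: e_def)
    let ?v = "\<lambda>k\<in>gs r s. 1 * u k + (-1) * reg g0 k"
    have "?v h = 0"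
      by (rule h(3)[OF gs_dual_linear[OF u reg_dual[OF g0(1)]]]) (use g0(2) fs in \<open>auto simp: regular_distr_ip subset_iff\<close>)
    hence "ip g0 f = u f" using f by (simp add: fh regular_distr_ip)
    thus ?thesis using g0 by (intro bexI[OF _ g0(1)]) auto
  qed
qed

lemma topspace_weak_star: "topspace (gs_weak_star r s) = (gs_dual r s :: ('d::finite) functional set)"
  unfolding gs_weak_star_def by (auto simp: gs_dual_def PiE_def)

lemma Hausdorff_weak_star: "Hausdorff_space (gs_weak_star r s :: ('d::finite) functional topology)"
  unfolding gs_weak_star_def
  by (intro Hausdorff_space_subtopology) (simp add: Hausdorff_space_product_topology)

text \<open>
  A basic neighbourhood restricts only finitely many values.
\<close>

lemma reg_dense:
  assumes u: "u \<in> (gs_dual r s :: ('d::finite) functional set)"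
  shows "u \<in> gs_weak_star r s closure_of (reg ` gs r s)"
  unfolding in_closure_of topspace_weak_star
proof (intro conjI allI impI u)
  fix T assume "u \<in> T \<and> openin (gs_weak_star r s) T"
  then obtain S where uS: "u \<in> S" and S: "openin (product_topology (\<lambda>_. euclidean) (gs r s)) S" and T: "T = S \<inter> gs_dual r s"
    unfolding gs_weak_star_def openin_subtopology by blast
  then obtain U where U: "finite {f \<in> gs r s. U f \<noteq> topspace euclidean}" "u \<in> Pi\<^sub>E (gs r s) U" "Pi\<^sub>E (gs r s) U \<subseteq> S"
    unfolding openin_product_topology_alt by blast
  obtain fs where fs: "set fs = {f \<in> gs r s. U f \<noteq> topspace euclidean}" using finite_list[OF U(1)] by blast
  obtain g where g: "g \<in> gs r s" "\<And>f. f \<in> set fs ==> ip g f = u f"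
    using dual_interpolation[of fs u] u fs by blast
  have "reg g f \<in> U f" if f: "f \<in> gs r s" for f
  proof (cases "f \<in> set fs")
    case True
    have "u f \<in> U f" using U(2) f by (rule PiE_mem)
    thus ?thesis using f g(2)[OF True] by (simp add: regular_distr_ip)
  next
    case False
    thus ?thesis using fs f by auto
  qed
  hence "reg g \<in> Pi\<^sub>E (gs r s) U" by (auto simp: PiE_def)
  hence "reg g \<in> T" using U(3) reg_dual[OF g(1)] T by blast
  thus "\<exists>y. y \<in> reg ` gs r s \<and> y \<in> T" using g(1) by blast
qed

end

locale propagation = gs_indices r s for r s :: real +
  fixes c :: "('d::finite => nat) => real" and m :: nat
  assumes m: "m >= 2" and rk: "r >= s * (real m - 1)" and sk: "s * (real m - 1) > 1"
begin

lemma evo_in_gs: "f \<in> gs r s ==> evo c m t f \<in> gs r s"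
  by (rule evo_gs[OF m r s rk sk])

lemma propagator_gs: "f \<in> gs r s ==> propagator c m t f = evo c m t f"
  by (rule propagator_eq_evo) (simp add: gs_iff)

lemma propagator_continuous: "continuous_map (gs_topology r s) (gs_topology r s) (propagator c m t)"
proof (rule continuous_map_gs_gsI)
  show "propagator c m t f \<in> gs r s" if "f \<in> gs r s" for f using evo_in_gs[OF that] propagator_gs[OF that] by simp
  fix f g :: "'d fn" assume f: "f \<in> gs r s" and g: "g \<in> gs r s"
  have "evo c m t (\<lambda>x. f x + (-1) * g x) = (\<lambda>x. evo c m t f x + (-1) * evo c m t g x)"
    using f g by (simp only: gs_iff evo_add SS_cmult evo_cmult)
  thus "propagator c m t (\<lambda>x. f x - g x) = (\<lambda>x. propagator c m t f x - propagator c m t g x)"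
    using propagator_gs[OF f] propagator_gs[OF g] propagator_gs[OF gs_diff[OF f g]] by simp
next
  fix h :: real assume h: "h > 0"
  obtain h' C where C: "h' > 0" "C > 0" "\<And>f. f \<in> gs r s ==> gs_norm r s h (evo c m t f) <= C * gs_norm r s h' f"
    by (rule gs_norm_evo_le[OF m r s rk sk h]) blast
  show "\<exists>h'>0. \<exists>C>0. \<forall>f\<in>gs r s. gs_norm r s h (propagator c m t f) <= C * gs_norm r s h' f"
    using C by (intro exI[of _ h'] exI[of _ C] conjI ballI) (simp_all add: propagator_gs)
qed

text \<open>
  The transpose: the adjoint of the propagator at time \<open>t\<close> is the propagator at time \<open>- t\<close>.
\<close>

definition ext :: "real => 'd functional => 'd functional"
  where "ext t = (\<lambda>u\<in>gs_dual r s. \<lambda>f\<in>gs r s. u (evo c m (- t) f))"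

lemma ext_apply: "u \<in> gs_dual r s ==> f \<in> gs r s ==> ext t u f = u (evo c m (- t) f)"
  by (simp add: ext_def)

lemma ext_dual:
  assumes u: "u \<in> gs_dual r s" shows "ext t u \<in> gs_dual r s"
proof -
  obtain h C where 1: "h > 0" "C > 0" "\<And>f. f \<in> gs r s ==> norm (u f) <= C * gs_norm r s h f"
    using gs_dual_bound[OF u] by metis
  obtain h' C' where 2: "h' > 0" "C' > 0" "\<And>f. f \<in> gs r s ==> gs_norm r s h (evo c m (- t) f) <= C' * gs_norm r s h' f"
    by (rule gs_norm_evo_le[OF m r s rk sk 1(1)]) blast
  show ?thesis
  proof (rule gs_dualI[where h = h' and C = "C * C'"])
    show "ext t u \<in> extensional (gs r s)" using u by (simp add: ext_def)
    show "h' > 0" by fact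
  next
    fix f g :: "'d fn" assume f: "f \<in> gs r s" and g: "g \<in> gs r s"
    have "evo c m (- t) (\<lambda>x. f x + g x) = (\<lambda>x. evo c m (- t) f x + evo c m (- t) g x)" using f g by (simp add: gs_iff evo_add)
    thus "ext t u (\<lambda>x. f x + g x) = ext t u f + ext t u g"
      using gs_dual_add[OF u evo_in_gs[OF f] evo_in_gs[OF g]] by (simp add: ext_apply u f g gs_add)
  next
    fix a :: complex and f :: "'d fn" assume f: "f \<in> gs r s"
    have "evo c m (- t) (\<lambda>x. a * f x) = (\<lambda>x. a * evo c m (- t) f x)" using f by (simp add: gs_iff evo_cmult)
    thus "ext t u (\<lambda>x. a * f x) = cnj a * ext t u f"
      using gs_dual_cmult[OF u evo_in_gs[OF f]] by (simp add: ext_apply u f gs_cmult)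
  next
    fix f :: "'d fn" assume f: "f \<in> gs r s"
    have "norm (ext t u f) <= C * gs_norm r s h (evo c m (- t) f)" unfolding ext_apply[OF u f] by (rule 1(3)[OF evo_in_gs[OF f]])
    also have "... <= C * (C' * gs_norm r s h' f)" using 1(2) by (intro mult_left_mono 2(3) f) auto
    finally show "norm (ext t u f) <= C * C' * gs_norm r s h' f" by (simp only: mult.assoc)
  qed
qed

lemma ext_reg:
  assumes f: "f \<in> gs r s" shows "ext t (reg f) = reg (propagator c m t f)"
proof -
  have "ext t (reg f) = (\<lambda>g\<in>gs r s. reg f (evo c m (- t) g))" using reg_dual[OF f] by (simp add: ext_def)
  also have "... = reg (propagator c m t f)"
  proof (rule restrict_ext)
    fix g :: "'d fn" assume g: "g \<in> gs r s"
    have "reg f (evo c m (- t) g) = ip f (evo c m (- t) g)" by (rule reg_apply[OF evo_in_gs[OF g]])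
    also have "... = ip (evo c m t f) g" using f g by (intro ip_evo[symmetric]) (simp_all add: gs_iff)
    finally show "reg f (evo c m (- t) g) = regular_distr (propagator c m t f) g"
      by (simp add: propagator_gs[OF f] regular_distr_def ip_def)
  qed
  finally show ?thesis .
qed

lemma ext_dual_extension: "dual_extension r s (propagator c m t) (ext t)"
  unfolding dual_extension_def
proof (intro conjI ballI allI)
  show "ext t \<in> extensional (gs_dual r s)" by (simp add: ext_def)
  show "ext t (reg f) = reg (propagator c m t f)" if "f \<in> gs r s" for f by (rule ext_reg[OF that])
  fix u v :: "'d functional" and a b assume u: "u \<in> gs_dual r s" and v: "v \<in> gs_dual r s"
  show "ext t (\<lambda>f\<in>gs r s. a * u f + b * v f) = (\<lambda>f\<in>gs r s. a * ext t u f + b * ext t v f)"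
    using gs_dual_linear[OF u v, of a b] u v by (simp add: ext_def evo_in_gs cong: restrict_cong)
next
  show "continuous_map (gs_weak_star r s) (gs_weak_star r s) (ext t)"
    unfolding gs_weak_star_def[of r s] continuous_map_in_subtopology
    unfolding gs_weak_star_def[symmetric]
  proof (intro conjI)
    show "ext t \<in> topspace (gs_weak_star r s) \<rightarrow> gs_dual r s" unfolding topspace_weak_star using ext_dual by blast
    show "continuous_map (gs_weak_star r s) (product_topology (\<lambda>_. euclidean) (gs r s)) (ext t)"
      unfolding continuous_map_componentwise topspace_weak_star
    proof (intro conjI ballI)
      show "ext t ` gs_dual r s \<subseteq> extensional (gs r s)" by (auto simp: ext_def)
      fix f :: "'d fn" assume f: "f \<in> gs r s"
      have "continuous_map (gs_weak_star r s) euclidean (\<lambda>u. u (evo c m (- t) f))"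
        unfolding gs_weak_star_def
        by (intro continuous_map_from_subtopology continuous_map_product_projection evo_in_gs f)
      thus "continuous_map (gs_weak_star r s) euclidean (\<lambda>u. ext t u f)"
        by (rule continuous_map_eq) (simp add: topspace_weak_star ext_apply f)
    qed
  qed
qed

lemma dual_extension_unique:
  fixes L :: "'d functional => 'd functional"
  assumes L: "dual_extension r s (propagator c m t) L" shows "L = ext t"
proof (rule extensionalityI[of _ "gs_dual r s"])
  show "L \<in> extensional (gs_dual r s)" using L by (simp add: dual_extension_def)
  show "ext t \<in> extensional (gs_dual r s)" by (simp add: ext_def)
  fix u :: "'d functional" assume u: "u \<in> gs_dual r s"
  show "L u = ext t u"
  proof (rule forall_in_closure_of_eq[OF reg_dense[OF u] Hausdorff_weak_star])
    show "continuous_map (gs_weak_star r s) (gs_weak_star r s) L" using L by (simp add: dual_extension_def)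
    show "continuous_map (gs_weak_star r s) (gs_weak_star r s) (ext t)"
      using ext_dual_extension by (simp add: dual_extension_def)
    fix v :: "'d functional" assume "v \<in> reg ` gs r s"
    thus "L v = ext t v" using L ext_reg by (auto simp: dual_extension_def)
  qed
qed

lemma dual_propagator_eq: "dual_propagator r s c m t = ext t"
  unfolding dual_propagator_def using ext_dual_extension dual_extension_unique by (rule the_equality)

lemma ext_inverse:
  assumes u: "u \<in> gs_dual r s" shows "ext (- t) (ext t u) = u"
proof (rule extensionalityI[of _ "gs r s"])
  show "ext (- t) (ext t u) \<in> extensional (gs r s)" using ext_dual[OF ext_dual[OF u]] by (simp add: gs_dual_def)
  show "u \<in> extensional (gs r s)" using u by (simp add: gs_dual_def)
  fix f :: "'d fn" assume f: "f \<in> gs r s"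
  have "evo c m (- t) (evo c m t f) = f" using f by (intro evo_inverse) (simp add: gs_iff)
  thus "ext (- t) (ext t u) f = u f"
    by (simp add: ext_apply ext_dual u f evo_in_gs)
qed

end

section \<open>Propagation of the wave front set\<close>

lemma mon_scaleR: "mon l (a *\<^sub>R \<xi>) = a ^ length l * mon l \<xi>"
  by (induction l) (simp_all add: mult_ac)

lemma powr_scaling_limit:
  assumes "s * real n <= r"
  shows "((\<lambda>l::real. l powr (- r) * (l powr s) ^ n) \<longlongrightarrow> (if s * real n = r then 1 else 0)) at_top"
proof -
  have ev: "\<forall>\<^sub>F l in at_top. l powr (s * real n - r) = l powr (- r) * (l powr s) ^ n"
  proof (rule eventually_mono[OF eventually_gt_at_top[of 0]])
    fix l :: real assume "l > 0"
    hence "(l powr s) ^ n = l powr (s * real n)" by (simp add: powr_powr[symmetric] powr_realpow)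
    thus "l powr (s * real n - r) = l powr (- r) * (l powr s) ^ n" by (simp add: powr_add[symmetric])
  qed
  have "((\<lambda>l::real. l powr (s * real n - r)) \<longlongrightarrow> (if s * real n = r then 1 else 0)) at_top"
  proof (cases "s * real n = r")
    case True
    have "((\<lambda>l::real. l powr (s * real n - r)) \<longlongrightarrow> 1) at_top"
      by (rule tendsto_eventually, rule eventually_mono[OF eventually_gt_at_top[of 0]]) (simp add: True)
    thus ?thesis using True by simp
  next
    case False
    thus ?thesis using assms tendsto_neg_powr[of "s * real n - r" "\<lambda>l. l" at_top] by (simp add: filterlim_ident)
  qed
  thus ?thesis by (rule Lim_transform_eventually[OF _ ev])
qed

abbreviation drift :: "(('d::finite => nat) => real) => nat => real => real => real => real => real^'d => real^'d"
  where "drift c m r s t l \<xi> \<equiv> l powr (- r) *\<^sub>R (t *\<^sub>R grad (poly_fun c m) (l powr s *\<^sub>R \<xi>))"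

text \<open>
  A monomial of degree \<open>k\<close> in the gradient scales with the exponent \<open>s k - r \<le> s (m - 1) - r \<le> 0\<close>. It
  survives only if \<open>k = m - 1\<close> and \<open>r = s (m - 1)\<close>.
\<close>

lemma scaled_gradient_limit:
  fixes c :: "('d::finite => nat) => real"
  assumes rk: "r >= s * (real m - 1)" and s: "s > 0" and \<delta>: "\<delta> > 0"
  defines "G \<equiv> \<lambda>\<xi>. if r = s * (real m - 1) then grad (principal_part c m) \<xi> else 0"
  shows "\<exists>l0>0. \<exists>d>0. \<forall>l\<ge>l0. \<forall>\<xi>. norm (\<xi> - \<xi>0) < d \<longrightarrow>
    norm (drift c m r s t l \<xi> - t *\<^sub>R G \<xi>0) < \<delta>"
proof -
  let ?F = "at_top \<times>\<^sub>F nhds \<xi>0"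
  let ?A = "{\<alpha> :: 'd => nat. mi_length \<alpha> <= m}"
  let ?l = "\<lambda>j \<alpha>. remove1 j (mi_list \<alpha>)"
  have len: "real (length (?l j \<alpha>)) = real (mi_length \<alpha>) - 1" if "\<alpha> j \<noteq> 0" for j and \<alpha> :: "'d => nat"
  proof -
    have j: "j \<in> set (mi_list \<alpha>)" using that count_mi_list[of \<alpha> j] by (metis count_notin)
    hence "length (mi_list \<alpha>) \<noteq> 0" by auto
    thus ?thesis using j by (simp add: length_remove1 length_mi_list of_nat_diff)
  qed
  have comp: "((\<lambda>(l, \<xi>). l powr (- r) * dpsum c ?A j (l powr s *\<^sub>R \<xi>)) \<longlongrightarrow> G \<xi>0 $ j) ?F" for j
  proof -
    have trm: "((\<lambda>p. (c \<alpha> * real (\<alpha> j)) * ((fst p powr (- r) * (fst p powr s) ^ length (?l j \<alpha>)) * mon (?l j \<alpha>) (snd p)))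
        \<longlongrightarrow> (c \<alpha> * real (\<alpha> j)) * ((if s * (real (mi_length \<alpha>) - 1) = r then 1 else 0) * mon (?l j \<alpha>) \<xi>0)) ?F"
      if \<alpha>: "\<alpha> \<in> ?A" for \<alpha>
    proof (cases "\<alpha> j = 0")
      case False
      have ln: "real (length (?l j \<alpha>)) = real (mi_length \<alpha>) - 1" by (rule len) (rule False)
      have le: "s * real (length (?l j \<alpha>)) <= r"
      proof -
        have "s * real (length (?l j \<alpha>)) <= s * (real m - 1)" using \<alpha> s by (simp add: ln)
        thus ?thesis using rk by linarith
      qed
      have 1: "((\<lambda>p. fst p powr (- r) * (fst p powr s) ^ length (?l j \<alpha>)) \<longlongrightarrow> (if s * real (length (?l j \<alpha>)) = r then 1 else 0)) ?F"
        by (rule filterlim_compose[OF powr_scaling_limit[OF le] filterlim_fst])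
      have "isCont (mon (?l j \<alpha>)) \<xi>0" by (rule has_derivative_continuous[OF mon_has_derivative])
      hence "(mon (?l j \<alpha>) \<longlongrightarrow> mon (?l j \<alpha>) \<xi>0) (nhds \<xi>0)" by (simp add: isCont_def tendsto_at_iff_tendsto_nhds)
      hence 2: "((\<lambda>p. mon (?l j \<alpha>) (snd p)) \<longlongrightarrow> mon (?l j \<alpha>) \<xi>0) ?F"
        by (rule filterlim_compose[OF _ filterlim_snd])
      show ?thesis using tendsto_mult[OF tendsto_const[of "c \<alpha> * real (\<alpha> j)"] tendsto_mult[OF 1 2]] unfolding ln .
    qed simp
    have S: "((\<lambda>p. \<Sum>\<alpha>\<in>?A. (c \<alpha> * real (\<alpha> j)) * ((fst p powr (- r) * (fst p powr s) ^ length (?l j \<alpha>)) * mon (?l j \<alpha>) (snd p)))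
        \<longlongrightarrow> (\<Sum>\<alpha>\<in>?A. (c \<alpha> * real (\<alpha> j)) * ((if s * (real (mi_length \<alpha>) - 1) = r then 1 else 0) * mon (?l j \<alpha>) \<xi>0))) ?F"
      by (rule tendsto_sum[OF trm])
    have e1: "(\<lambda>p. \<Sum>\<alpha>\<in>?A. (c \<alpha> * real (\<alpha> j)) * ((fst p powr (- r) * (fst p powr s) ^ length (?l j \<alpha>)) * mon (?l j \<alpha>) (snd p)))
        = (\<lambda>(l, \<xi>). l powr (- r) * dpsum c ?A j (l powr s *\<^sub>R \<xi>))"
      by (simp add: fun_eq_iff dpsum_def mon_scaleR sum_distrib_left mult_ac)
    have e2: "(\<Sum>\<alpha>\<in>?A. (c \<alpha> * real (\<alpha> j)) * ((if s * (real (mi_length \<alpha>) - 1) = r then 1 else 0) * mon (?l j \<alpha>) \<xi>0)) = G \<xi>0 $ j"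
    proof (cases "r = s * (real m - 1)")
      case True
      have "(\<Sum>\<alpha>\<in>?A. (c \<alpha> * real (\<alpha> j)) * ((if s * (real (mi_length \<alpha>) - 1) = r then 1 else 0) * mon (?l j \<alpha>) \<xi>0)) =
          (\<Sum>\<alpha>\<in>{\<alpha>. mi_length \<alpha> = m}. (c \<alpha> * real (\<alpha> j)) * mon (?l j \<alpha>) \<xi>0)"
        by (rule sum.mono_neutral_cong_right) (use s True finite_mi_le[of m] in auto)
      thus ?thesis using True by (simp add: G_def principal_part_psum grad_psum dpsum_def)
    next
      case False
      have "s * (real (mi_length \<alpha>) - 1) \<noteq> r" if "\<alpha> \<in> ?A" for \<alpha>
      proof -
        have "s * (real (mi_length \<alpha>) - 1) <= s * (real m - 1)" using that s by simp
        thus ?thesis using False rk by linarith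
      qed
      thus ?thesis using False by (simp add: G_def)
    qed
    show ?thesis using S unfolding e1 e2 .
  qed
  have "((\<lambda>(l, \<xi>). drift c m r s t l \<xi>) \<longlongrightarrow> t *\<^sub>R G \<xi>0) ?F"
  proof (rule vec_tendstoI)
    fix j
    have e: "(\<lambda>p. (case p of (l, \<xi>) => drift c m r s t l \<xi>) $ j) =
        (\<lambda>p. t * (case p of (l, \<xi>) => l powr (- r) * dpsum c ?A j (l powr s *\<^sub>R \<xi>)))"
      by (simp add: fun_eq_iff poly_fun_psum grad_psum mult_ac)
    show "((\<lambda>p. (case p of (l, \<xi>) => drift c m r s t l \<xi>) $ j) \<longlongrightarrow> (t *\<^sub>R G \<xi>0) $ j) ?F"
      unfolding e vector_scaleR_component real_scaleR_def by (rule tendsto_mult[OF tendsto_const comp])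
  qed
  from tendstoD[OF this \<delta>]
  obtain P Q where P: "eventually P at_top" and Q: "eventually Q (nhds \<xi>0)"
    and PQ: "\<And>l \<xi>. P l ==> Q \<xi> ==> norm (drift c m r s t l \<xi> - t *\<^sub>R G \<xi>0) < \<delta>"
    unfolding eventually_prod_filter by (auto simp: dist_norm)
  obtain L where L: "\<And>l. l >= L ==> P l" using P unfolding eventually_at_top_linorder by blast
  obtain d where d: "d > 0" "\<And>\<xi>. dist \<xi> \<xi>0 < d ==> Q \<xi>" using Q unfolding eventually_nhds_metric by blast
  have "0 < max L 1" by simp
  thus ?thesis using PQ L d by (intro exI[of _ "max L 1"] conjI exI[of _ d] allI impI) (auto simp: dist_norm)
qed

context propagation
begin

lemma vf_cmult: "norm (vf \<psi> (\<lambda>x. a * h x) w) = norm a * norm (vf \<psi> h w)"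
proof -
  have "(\<lambda>x. a * h x * cnj (\<psi> (x - fst w))) = (\<lambda>x. a * (h x * cnj (\<psi> (x - fst w))))" by (simp only: mult.assoc)
  thus ?thesis unfolding vf_def by (simp only: fourier_cmult norm_mult)
qed

text \<open>
  Values of the propagated functional on shifted windows, from those of \<open>u\<close>: \<open>evo_tfs\<close> shifts the
  window, \<open>pmul_decay\<close> controls its deformation, and \<open>dual_stft_bound\<close> expresses the value by \<open>u\<close>. The
  hypothesis is a pointwise domination by an integrable weight, so that the integral can be estimated
  separately in different regions.
\<close>

lemma kernel_estimate:
  fixes u :: "'d functional" and t :: real
  assumes u: "u \<in> gs_dual r s" and \<psi>: "\<psi> \<in> gs r s" and \<psi>0: "ip \<psi> \<psi> \<noteq> 0" and H: "H > 0"
  obtains C where "C > 0" "\<And>x \<xi> D. D >= 0 ==>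
     (\<And>w. ew r H (fst w - (x - t *\<^sub>R grad (poly_fun c m) \<xi>)) * ew s H (snd w - \<xi>) * norm (u (tf w \<psi>)) <=
        D * (ew r 1 (fst w - (x - t *\<^sub>R grad (poly_fun c m) \<xi>)) * ew s 1 (snd w - \<xi>))) ==>
     norm (ext t u (tf (x, \<xi>) \<psi>)) <= C * exp ((1 + norm \<xi>) powr (1 / s)) * D"
proof -
  obtain H1 C1 where H1: "H1 > 0" and C1: "C1 > 0" and vb:
    "\<And>g \<psi> P Q w. g \<in> SS ==> \<psi> \<in> (SS :: 'd fn set) ==> bnd r s H1 P g ==> bnd r s H1 Q \<psi> ==>
      norm (vf \<psi> g w) <= C1 * P * Q * ew r H (fst w) * ew s H (snd w)"
    by (rule vf_bound[OF r s H]) blast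
  obtain B where B: "B >= 0" "\<And>\<xi>. \<exists>qs. good_phase (m - 1) B (1 + norm \<xi>) (remainder c m \<xi>) qs"
    by (rule remainder_good_phase) blast
  have m1: "m - 1 >= 1" "r >= s * real (m - 1)" "s * real (m - 1) > 1" using m rk sk by (simp_all add: of_nat_diff)
  obtain H2 C2 where H2: "H2 > 0" and C2: "C2 > 0" and pd:
    "\<And>f P q qs \<rho>0 x. f \<in> (SS :: 'd fn set) ==> bnd r s H2 P f ==> \<rho>0 >= 1 ==>
       good_phase (m - 1) B \<rho>0 q qs ==> norm (pmul (- t) q f x) <= C2 * P * ew r H1 x * exp (1 * \<rho>0 powr (1 / s))"
    by (rule pmul_decay[OF r s m1 H1 zero_less_one B(1), of "- t"]) blast
  have \<psi>S: "\<psi> \<in> SS" using \<psi> by (simp add: gs_iff)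
  obtain P where P: "bnd r s (max H1 H2) P \<psi>" using \<psi> H1 unfolding gs_iff by (meson less_max_iff_disj)
  have P0: "P >= 0" by (rule bnd_nonneg[OF P])
  have P1: "bnd r s H1 P \<psi>" and P2: "bnd r s H2 P \<psi>" by (rule bnd_weaken[OF P]; simp)+
  define N where "N = (LINT w|(lborel :: ((real^'d) \<times> (real^'d)) measure). ew r 1 (fst w) * ew s 1 (snd w))"
  have Ni: "integrable lborel (\<lambda>w::(real^'d) \<times> (real^'d). ew r 1 (fst w) * ew s 1 (snd w))"
  proof (rule integrable_phase_space[OF r s, where C=1])
    have "continuous_on UNIV (\<lambda>w::(real^'d) \<times> (real^'d). ew r 1 (fst w) * ew s 1 (snd w))"
      by (intro continuous_intros continuous_on_compose2[OF continuous_on_ew[OF r]] continuous_on_compose2[OF continuous_on_ew[OF s]]) auto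
    thus "(\<lambda>w::(real^'d) \<times> (real^'d). ew r 1 (fst w) * ew s 1 (snd w)) \<in> borel_measurable borel" by (rule borel_measurable_continuous_onI)
  qed simp
  have N0: "N >= 0" unfolding N_def by (rule Bochner_Integration.integral_nonneg) simp
  define Z where "Z = norm (ip \<psi> \<psi>) / fconst TYPE('d)"
  have Z: "Z > 0" using \<psi>0 fconst_pos[where 'd='d] by (simp add: Z_def)
  define C where "C = C1 * ((C2 + 1) * P) * P * N / Z"
  have C0: "C >= 0" using C1 C2 P0 N0 Z by (simp add: C_def)
  show ?thesis
  proof (rule that[of "C + 1"])
    show "C + 1 > 0" using C0 by simp
    fix x \<xi> :: "real^'d" and D :: real
    let ?x = "x - t *\<^sub>R grad (poly_fun c m) \<xi>"
    let ?E = "exp ((1 + norm \<xi>) powr (1 / s))"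
    assume D0: "D >= 0" and D: "\<And>w. ew r H (fst w - ?x) * ew s H (snd w - \<xi>) * norm (u (tf w \<psi>)) <=
        D * (ew r 1 (fst w - ?x) * ew s 1 (snd w - \<xi>))"
    let ?h = "pmul (- t) (remainder c m \<xi>) \<psi>"
    obtain qs where qs: "good_phase (m - 1) B (1 + norm \<xi>) (remainder c m \<xi>) qs" using B(2) by blast
    have hS: "?h \<in> SS" by (rule pmul_SS(1)[OF qs \<psi>S])
    have E1: "?E >= 1" by simp
    have hb: "bnd r s H1 ((C2 + 1) * P * ?E) ?h"
      unfolding bnd_def
    proof (intro conjI allI)
      fix z :: "real^'d"
      have "norm (?h z) <= C2 * P * ew r H1 z * exp (1 * (1 + norm \<xi>) powr (1 / s))"
        by (rule pd[OF \<psi>S P2 _ qs]) simp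
      also have "... = C2 * P * ?E * ew r H1 z" by simp
      also have "... <= (C2 + 1) * P * ?E * ew r H1 z" using P0 by (intro mult_right_mono) auto
      finally show "norm (?h z) <= (C2 + 1) * P * ?E * ew r H1 z" .
      have "norm (fourier ?h z) = norm (fourier \<psi> z)" by (simp add: pmul_SS(2)[OF qs \<psi>S] norm_mult)
      also have "... <= P * ew s H1 z" using P1 by (simp add: bnd_def)
      also have "... <= (C2 + 1) * P * ?E * ew s H1 z"
      proof (rule mult_right_mono)
        have "P * 1 <= ((C2 + 1) * P) * ?E"
          using P0 C2 E1 by (intro mult_mono) (auto simp: algebra_simps)
        thus "P <= (C2 + 1) * P * ?E" by simp
      qed simp
      finally show "norm (fourier ?h z) <= (C2 + 1) * P * ?E * ew s H1 z" .
    qed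
    let ?g = "evo c m (- t) (tf (x, \<xi>) \<psi>)"
    have g: "?g \<in> gs r s" by (rule evo_in_gs[OF tf_gs[OF \<psi>]])
    have vg: "norm (vf \<psi> ?g w) <= C1 * ((C2 + 1) * P * ?E) * P * (ew r H (fst w - ?x) * ew s H (snd w - \<xi>))" for w
    proof -
      have "norm (vf \<psi> ?g w) = norm (exp (- \<i> * of_real (- t * poly_fun c m \<xi>))) * norm (vf \<psi> (tfs (x + (- t) *\<^sub>R grad (poly_fun c m) \<xi>) \<xi> ?h) w)"
        unfolding tf_def fst_conv snd_conv evo_tfs vf_cmult ..
      also have "norm (exp (- \<i> * of_real (- t * poly_fun c m \<xi>))) = 1" by simp
      also have "x + (- t) *\<^sub>R grad (poly_fun c m) \<xi> = ?x" by simp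
      also have "1 * norm (vf \<psi> (tfs ?x \<xi> ?h) w) = norm (vf \<psi> ?h (fst w - ?x, snd w - \<xi>))" by (simp only: mult_1 vf_tfs)
      also have "... <= C1 * ((C2 + 1) * P * ?E) * P * ew r H (fst w - ?x) * ew s H (snd w - \<xi>)"
        using vb[OF hS \<psi>S hb P1, of "(fst w - ?x, snd w - \<xi>)"] by (simp only: fst_conv snd_conv)
      finally show ?thesis by (simp only: mult.assoc)
    qed
    let ?A = "C1 * ((C2 + 1) * P * ?E) * P"
    have A0: "?A >= 0" using C1 C2 P0 by simp
    have "ext t u (tf (x, \<xi>) \<psi>) = u ?g" by (rule ext_apply[OF u tf_gs[OF \<psi>]])
    hence "Z * norm (ext t u (tf (x, \<xi>) \<psi>)) = Z * norm (u ?g)" by simp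
    also have "... <= (LBINT w. norm (vf \<psi> ?g w) * norm (u (tf w \<psi>)))"
      unfolding Z_def by (rule dual_stft_bound(1)[OF u g \<psi>])
    also have "... <= (LBINT w. (?A * D) * (ew r 1 (fst (w - (?x, \<xi>))) * ew s 1 (snd (w - (?x, \<xi>)))))"
    proof (rule Bochner_Integration.integral_mono)
      show "integrable lborel (\<lambda>w. norm (vf \<psi> ?g w) * norm (u (tf w \<psi>)))" by (rule dual_stft_bound(2)[OF u g \<psi>])
      show "integrable lborel (\<lambda>w. (?A * D) * (ew r 1 (fst (w - (?x, \<xi>))) * ew s 1 (snd (w - (?x, \<xi>)))))"
        by (rule integrable_mult_right) (use Ni lborel_integrable_translate(2)[of "\<lambda>w. ew r 1 (fst w) * ew s 1 (snd w)" "(?x, \<xi>)"] in blast)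
      fix w :: "(real^'d) \<times> (real^'d)"
      have "norm (vf \<psi> ?g w) * norm (u (tf w \<psi>)) <= ?A * (ew r H (fst w - ?x) * ew s H (snd w - \<xi>)) * norm (u (tf w \<psi>))"
        by (rule mult_right_mono[OF vg]) simp
      also have "... = ?A * (ew r H (fst w - ?x) * ew s H (snd w - \<xi>) * norm (u (tf w \<psi>)))" by (simp only: mult.assoc)
      also have "... <= ?A * (D * (ew r 1 (fst w - ?x) * ew s 1 (snd w - \<xi>)))" by (rule mult_left_mono[OF D A0])
      finally show "norm (vf \<psi> ?g w) * norm (u (tf w \<psi>)) <= (?A * D) * (ew r 1 (fst (w - (?x, \<xi>))) * ew s 1 (snd (w - (?x, \<xi>))))"
        by (simp only: fst_diff snd_diff fst_conv snd_conv mult.assoc)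
    qed
    also have "... = (?A * D) * (LBINT w. ew r 1 (fst (w - (?x, \<xi>))) * ew s 1 (snd (w - (?x, \<xi>))))"
      by (rule integral_mult_right_zero)
    also have "(LBINT w. ew r 1 (fst (w - (?x, \<xi>))) * ew s 1 (snd (w - (?x, \<xi>)))) = N"
      unfolding N_def by (rule lborel_integral_translate(2))
    also have "?A * D * N = Z * (C * ?E * D)" using Z by (simp add: C_def field_simps)
    finally have "norm (ext t u (tf (x, \<xi>) \<psi>)) <= C * ?E * D" using Z by simp
    also have "... <= (C + 1) * ?E * D" using D0 by (intro mult_right_mono) auto
    finally show "norm (ext t u (tf (x, \<xi>) \<psi>)) <= (C + 1) * ?E * D" .
  qed
qed

end

context gs_indices
begin

lemma dual_growth:
  fixes u :: "('d::finite) functional"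
  assumes u: "u \<in> gs_dual r s" and \<psi>: "\<psi> \<in> gs r s"
  obtains M C where "M > 0" "C >= 0"
    "\<And>w. norm (u (tf w \<psi>)) <= C * exp (M * (norm (fst w) powr (1 / r) + norm (snd w) powr (1 / s)))"
proof -
  obtain H C where H: "H > 0" "C > 0" "\<And>f P. f \<in> gs r s ==> bnd r s H P f ==> norm (u f) <= C * P"
    using gs_dual_bnd[OF u] by metis
  obtain M where M: "M > 0"
    "\<And>\<psi> P w. bnd r s M P (\<psi> :: 'd fn) ==> bnd r s H (P * inverse (ew r M (fst w)) * inverse (ew s M (snd w))) (tf w \<psi>)"
    by (rule bnd_tf[OF r s H(1)]) blast
  obtain P where P: "bnd r s M P \<psi>" using \<psi> M(1) unfolding gs_iff by blast
  have e: "inverse (ew r M y) * inverse (ew s M \<eta>) = exp (M * (norm y powr (1 / r) + norm \<eta> powr (1 / s)))" for y \<eta> :: "real^'d"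
    by (simp add: ew_def exp_minus distrib_left exp_add)
  show ?thesis
  proof (rule that[OF M(1), of "C * P"])
    show "C * P >= 0" using H(2) bnd_nonneg[OF P] by simp
    show "norm (u (tf w \<psi>)) <= C * P * exp (M * (norm (fst w) powr (1 / r) + norm (snd w) powr (1 / s)))" for w
      using H(3)[OF tf_gs[OF \<psi>] M(2)[OF P], of w] unfolding mult.assoc e .
  qed
qed

abbreviation dil :: "real => real^'d::finite => real^'d => (real^'d) \<times> (real^'d)"
  where "dil l x \<xi> \<equiv> (l powr r *\<^sub>R x, l powr s *\<^sub>R \<xi>)"

text \<open>
  The condition in the definition of the wave front set, in terms of values on shifted windows.
\<close>

definition decays :: "'d::finite fn => 'd functional => ((real^'d) \<times> (real^'d)) set => bool"
  where "decays \<psi> u U \<longleftrightarrow> (\<forall>R>0. \<exists>D\<ge>0. \<forall>l>0. \<forall>(x, \<xi>)\<in>U.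
    norm (u (tf (dil l x \<xi>) \<psi>)) <= D * exp (- (R * l)))"

lemma WF_iff:
  "z \<in> WF r s \<psi> u \<longleftrightarrow> z \<noteq> 0 \<and> \<not> (\<exists>U. open U \<and> U \<subseteq> - {0} \<and> z \<in> U \<and> decays \<psi> u U)"
  for u :: "('d::finite) functional"
proof -
  have "(\<forall>R>0. bdd_above {exp (R * l) * cmod (stft \<psi> u (l powr r *\<^sub>R x) (l powr s *\<^sub>R \<xi>)) | l x \<xi>. l > 0 \<and> (x, \<xi>) \<in> U}) \<longleftrightarrow> decays \<psi> u U" for U
    unfolding decays_def
  proof (rule all_cong, rule iffI)
    fix R :: real assume R: "R > 0"
    let ?c = "fconst TYPE('d)"
    have c: "?c > 0" by (rule fconst_pos)
    have st: "exp (R * l) * cmod (stft \<psi> u x \<xi>) = exp (R * l) * (?c * norm (u (tf (x, \<xi>) \<psi>)))" for l x \<xi>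
      using c by (simp add: stft_def tf_def tfs_def fconst_def norm_mult)
    let ?S = "{exp (R * l) * cmod (stft \<psi> u (l powr r *\<^sub>R x) (l powr s *\<^sub>R \<xi>)) | l x \<xi>. l > 0 \<and> (x, \<xi>) \<in> U}"
    {
      assume "bdd_above ?S"
      then obtain M where M: "\<And>a. a \<in> ?S ==> a <= M" unfolding bdd_above_def by blast
      have "norm (u (tf (dil l x \<xi>) \<psi>)) <= (\<bar>M\<bar> / ?c) * exp (- (R * l))" if "l > 0" "(x, \<xi>) \<in> U" for l x \<xi>
      proof -
        have "exp (R * l) * (?c * norm (u (tf (dil l x \<xi>) \<psi>))) <= M"
          unfolding st[symmetric] by (rule M) (use that in blast)
        hence "exp (R * l) * (?c * norm (u (tf (dil l x \<xi>) \<psi>))) <= \<bar>M\<bar>" by linarith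
        thus ?thesis using c by (simp add: exp_minus field_simps)
      qed
      thus "\<exists>D\<ge>0. \<forall>l>0. \<forall>(x, \<xi>)\<in>U. norm (u (tf (dil l x \<xi>) \<psi>)) <= D * exp (- (R * l))"
        using c by (intro exI[of _ "\<bar>M\<bar> / ?c"]) auto
    next
      assume "\<exists>D\<ge>0. \<forall>l>0. \<forall>(x, \<xi>)\<in>U. norm (u (tf (dil l x \<xi>) \<psi>)) <= D * exp (- (R * l))"
      then obtain D where D: "\<And>l x \<xi>. l > 0 ==> (x, \<xi>) \<in> U ==> norm (u (tf (dil l x \<xi>) \<psi>)) <= D * exp (- (R * l))" by blast
      show "bdd_above ?S"
      proof (rule bdd_aboveI[of _ "?c * D"])
        fix a assume "a \<in> ?S"
        then obtain l x \<xi> where a: "a = exp (R * l) * cmod (stft \<psi> u (l powr r *\<^sub>R x) (l powr s *\<^sub>R \<xi>))" "l > 0" "(x, \<xi>) \<in> U" by blast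
        have "a <= exp (R * l) * (?c * (D * exp (- (R * l))))"
          unfolding a(1) st using c by (intro mult_left_mono D a(2,3)) auto
        also have "... = ?c * D" by (simp add: exp_minus)
        finally show "a <= ?c * D" .
      qed
    }
  qed
  thus ?thesis by (simp add: WF_def)
qed

end

context propagation
begin

text \<open>
  Values of \<open>u\<close> at points near the displaced point lie in the dilated neighbourhood where \<open>u\<close>
  decays. All other points are at distance at least \<open>\<delta> l\<^sup>r\<close> or \<open>\<delta> l\<^sup>s\<close>, where the kernel with a large rate
  beats the growth of \<open>u\<close>, which is at most exponential in \<open>l\<close>.
\<close>

lemma WF_inclusion:
  fixes u :: "'d functional" and t :: real and G :: "real^'d => real^'d"
  assumes u: "u \<in> gs_dual r s" and \<psi>: "\<psi> \<in> gs r s" and \<psi>0: "ip \<psi> \<psi> \<noteq> 0"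
    and lim: "\<And>\<xi>0 \<delta>. \<delta> > 0 ==> \<exists>l0>0. \<exists>d>0. \<forall>l\<ge>l0. \<forall>\<xi>. norm (\<xi> - \<xi>0) < d \<longrightarrow>
      norm (drift c m r s t l \<xi> - G \<xi>0) < \<delta>"
    and z: "(x0, \<xi>0) \<in> WF r s \<psi> (ext t u)" and nz: "(x0 - G \<xi>0, \<xi>0) \<noteq> 0"
  shows "(x0 - G \<xi>0, \<xi>0) \<in> WF r s \<psi> u"
proof (rule ccontr)
  define a0 where "a0 = x0 - G \<xi>0"
  assume "(x0 - G \<xi>0, \<xi>0) \<notin> WF r s \<psi> u"
  then obtain U where U: "open U" "(a0, \<xi>0) \<in> U" and dec: "decays \<psi> u U"
    using nz unfolding WF_iff a0_def by blast
  obtain \<delta>1 where \<delta>1: "\<delta>1 > 0" "ball (a0, \<xi>0) \<delta>1 \<subseteq> U" using U open_contains_ball by blast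
  define \<delta> where "\<delta> = \<delta>1 / 4"
  have \<delta>: "\<delta> > 0" using \<delta>1 by (simp add: \<delta>_def)
  have inU: "(Y, N) \<in> U" if "norm (Y - a0) < 2 * \<delta>" "norm (N - \<xi>0) < 2 * \<delta>" for Y N
  proof -
    have "norm ((Y, N) - (a0, \<xi>0)) <= norm (Y - a0) + norm (N - \<xi>0)" by (simp add: norm_Pair_le)
    also have "... < \<delta>1" using that by (simp add: \<delta>_def)
    finally have "dist (a0, \<xi>0) (Y, N) < \<delta>1" by (simp only: dist_norm norm_minus_commute)
    thus ?thesis using \<delta>1(2) by auto
  qed
  have "\<delta> / 2 > 0" using \<delta> by simp
  from lim[OF this, of \<xi>0] obtain l0 d where l0: "l0 > 0" and d: "d > 0"
    and lim': "\<And>l \<xi>. l >= l0 ==> norm (\<xi> - \<xi>0) < d ==>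
      norm (drift c m r s t l \<xi> - G \<xi>0) < \<delta> / 2" by blast
  define V where "V = (ball x0 (\<delta> / 2) \<times> ball \<xi>0 (min d \<delta>)) - {0}"
  have V: "open V" "V \<subseteq> - {0}" "(x0, \<xi>0) \<in> V"
    using \<delta> d z by (auto simp: V_def WF_iff intro!: open_Diff open_Times)
  have Vx: "norm (x - x0) < \<delta> / 2" "norm (\<xi> - \<xi>0) < d" "norm (\<xi> - \<xi>0) < \<delta>" if "(x, \<xi>) \<in> V" for x \<xi>
    using that by (auto simp: V_def dist_norm norm_minus_commute)
  define \<rho> where "\<rho> = norm a0 + norm x0 + norm \<xi>0 + \<delta>"
  have \<rho>: "\<rho> > 0" using \<delta> by (simp add: \<rho>_def add_nonneg_pos)
  obtain M C2 where M: "M > 0" and C2: "C2 >= 0" and growth: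
    "\<And>w. norm (u (tf w \<psi>)) <= C2 * exp (M * (norm (fst w) powr (1 / r) + norm (snd w) powr (1 / s)))"
    by (rule dual_growth[OF u \<psi>]) blast
  obtain M3 C3 where M3: "M3 > 0" and C3: "C3 >= 0" and growth3:
    "\<And>w. norm (ext t u (tf w \<psi>)) <= C3 * exp (M3 * (norm (fst w) powr (1 / r) + norm (snd w) powr (1 / s)))"
    by (rule dual_growth[OF ext_dual[OF u] \<psi>]) blast
  define K1 where "K1 = 2 powr (1 / r)"
  define K2 where "K2 = 2 powr (1 / s)"
  have K: "K1 > 0" "K2 > 0" by (simp_all add: K1_def K2_def)
  define M1 where "M1 = M * (K1 + K2)"
  have M1: "M1 > 0" using M K by (simp add: M1_def)
  define \<beta> where "\<beta> = \<rho> powr (1 / r) + \<rho> powr (1 / s)"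
  have \<beta>: "\<beta> > 0" using \<rho> by (simp add: \<beta>_def add_pos_pos)
  define \<delta>' where "\<delta>' = min (\<delta> powr (1 / r)) (\<delta> powr (1 / s))"
  have \<delta>': "\<delta>' > 0" using \<delta> by (simp add: \<delta>'_def)
  have scale: "norm (l powr q *\<^sub>R v) powr (1 / q) = l * norm v powr (1 / q)" if "l > 0" "q > 0" for l q :: real and v :: "real^'d"
    using that by (simp add: powr_mult powr_powr)
  have "decays \<psi> (ext t u) V"
    unfolding decays_def
  proof (intro allI impI)
    fix R :: real assume R: "R > 0"
    \<comment> \<open>The surplus pays for the factor \<open>exp ((1 + \<bar>\<xi>\<bar>)\<^bsup>1/s\<^esup>)\<close> of the kernel estimate.\<close>
    define R1 where "R1 = R + K2 * \<rho> powr (1 / s)"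
    have R1: "R1 > 0" using R K \<rho> by (simp add: R1_def add_pos_nonneg)
    \<comment> \<open>Chosen so that far points contribute with rate \<open>R1\<close> in spite of the growth of \<open>u\<close>.\<close>
    define H' where "H' = (M1 * \<beta> + R1) / \<delta>'"
    have H': "H' > 0" using M1 \<beta> R1 \<delta>' by (simp add: H'_def add_pos_pos)
    define H where "H = M1 + 1 + H'"
    have H: "H > 0" "H >= 1" using M1 H' by (simp_all add: H_def)
    obtain DA where DA0: "DA >= 0" and DA1: "\<forall>l>0. \<forall>(x, \<xi>)\<in>U.
        norm (u (tf (dil l x \<xi>) \<psi>)) <= DA * exp (- (R1 * l))"
      using dec[unfolded decays_def, THEN spec, THEN mp, OF R1] by (elim exE conjE)
    have DA2: "norm (u (tf (dil l x \<xi>) \<psi>)) <= DA * exp (- (R1 * l))"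
      if "l > 0" "(x, \<xi>) \<in> U" for l x \<xi>
      using bspec[OF mp[OF spec[OF DA1] that(1)] that(2)] by (simp only: case_prod_conv)
    note DA = DA0 DA2
    obtain C where C: "C > 0" and ker: "\<And>x \<xi> D. D >= 0 ==>
     (\<And>w. ew r H (fst w - (x - t *\<^sub>R grad (poly_fun c m) \<xi>)) * ew s H (snd w - \<xi>) * norm (u (tf w \<psi>)) <=
        D * (ew r 1 (fst w - (x - t *\<^sub>R grad (poly_fun c m) \<xi>)) * ew s 1 (snd w - \<xi>))) ==>
     norm (ext t u (tf (x, \<xi>) \<psi>)) <= C * exp ((1 + norm \<xi>) powr (1 / s)) * D"
      by (rule kernel_estimate[OF u \<psi> \<psi>0 H(1), of t]) blast
    define D where "D = C2 + DA"
    have large: "norm (ext t u (tf (dil l x \<xi>) \<psi>)) <= (C * exp K2 * D) * exp (- (R * l))"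
      if l: "l >= l0" and xV: "(x, \<xi>) \<in> V" for l x \<xi>
    proof -
      have lp: "l > 0" using l l0 by linarith
      define X where "X = x - drift c m r s t l \<xi>"
      define x' where "x' = l powr r *\<^sub>R x - t *\<^sub>R grad (poly_fun c m) (l powr s *\<^sub>R \<xi>)"
      define \<xi>' where "\<xi>' = l powr s *\<^sub>R \<xi>"
      have lr: "l powr r * l powr (- r) = 1" "l powr s * l powr (- s) = 1" using lp by (simp_all add: powr_add[symmetric])
      have x'X: "x' = l powr r *\<^sub>R X" by (simp add: x'_def X_def scaleR_diff_right lr(1))
      have Xa: "norm (X - a0) < \<delta>"
      proof -
        have "X - a0 = (x - x0) - (drift c m r s t l \<xi> - G \<xi>0)" by (simp add: X_def a0_def)
        hence "norm (X - a0) <= norm (x - x0) + norm (drift c m r s t l \<xi> - G \<xi>0)"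
          using norm_triangle_ineq4 by metis
        also have "... < \<delta> / 2 + \<delta> / 2" by (intro add_strict_mono Vx(1)[OF xV] lim'[OF l Vx(2)[OF xV]])
        finally show ?thesis by simp
      qed
      have X\<rho>: "norm X <= \<rho>"
        using norm_triangle_ineq[of "X - a0" a0] Xa norm_ge_zero[of x0] norm_ge_zero[of \<xi>0]
        unfolding diff_add_cancel \<rho>_def by linarith
      have \<xi>\<rho>: "norm \<xi> <= \<rho>"
        using norm_triangle_ineq[of "\<xi> - \<xi>0" \<xi>0] Vx(3)[OF xV] norm_ge_zero[of x0] norm_ge_zero[of a0]
        unfolding diff_add_cancel \<rho>_def by linarith
      have x'\<rho>: "norm x' powr (1 / r) <= l * \<rho> powr (1 / r)"
        unfolding x'X scale[OF lp r] using lp X\<rho> r by (intro mult_left_mono powr_mono2) auto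
      have \<xi>'\<rho>: "norm \<xi>' powr (1 / s) <= l * \<rho> powr (1 / s)"
        unfolding \<xi>'_def scale[OF lp s] using lp \<xi>\<rho> s by (intro mult_left_mono powr_mono2) auto
      have point: "ew r H (fst w - x') * ew s H (snd w - \<xi>') * norm (u (tf w \<psi>)) <=
          (D * exp (- (R1 * l))) * (ew r 1 (fst w - x') * ew s 1 (snd w - \<xi>'))" for w
      proof -
        define y where "y = fst w"
        define \<eta> where "\<eta> = snd w"
        define A where "A = norm (y - x') powr (1 / r) + norm (\<eta> - \<xi>') powr (1 / s)"
        have A0: "A >= 0" by (simp add: A_def)
        have e: "ew r h (y - x') * ew s h (\<eta> - \<xi>') = exp (- (h * A))" for h
          by (simp add: ew_def A_def exp_add[symmetric] algebra_simps)
        have main: "exp (- (H * A)) * norm (u (tf w \<psi>)) <= (D * exp (- (R1 * l))) * exp (- (1 * A))"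
        proof (cases "norm (y - x') <= l powr r * \<delta> \<and> norm (\<eta> - \<xi>') <= l powr s * \<delta>")
          case True
          define Y where "Y = l powr (- r) *\<^sub>R y"
          define N where "N = l powr (- s) *\<^sub>R \<eta>"
          have w: "w = dil l Y N" by (simp add: Y_def N_def lr y_def \<eta>_def)
          have "norm (Y - X) <= \<delta>"
          proof -
            have "l powr r * norm (Y - X) = norm (y - x')"
              unfolding x'X by (simp add: w y_def scaleR_diff_right[symmetric])
            hence "l powr r * norm (Y - X) <= l powr r * \<delta>" using True by simp
            thus ?thesis using lp by simp
          qed
          hence 1: "norm (Y - a0) < 2 * \<delta>"
            using norm_triangle_ineq[of "Y - X" "X - a0"] Xa by simp
          have "norm (N - \<xi>) <= \<delta>"
          proof -
            have "l powr s * norm (N - \<xi>) = norm (\<eta> - \<xi>')"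
              unfolding \<xi>'_def by (simp add: w \<eta>_def scaleR_diff_right[symmetric])
            hence "l powr s * norm (N - \<xi>) <= l powr s * \<delta>" using True by simp
            thus ?thesis using lp by simp
          qed
          hence 2: "norm (N - \<xi>0) < 2 * \<delta>"
            using norm_triangle_ineq[of "N - \<xi>" "\<xi> - \<xi>0"] Vx(3)[OF xV] by simp
          have "norm (u (tf w \<psi>)) <= DA * exp (- (R1 * l))" unfolding w by (rule DA(2)[OF lp inU[OF 1 2]])
          also have "... <= D * exp (- (R1 * l))" using C2 by (intro mult_right_mono) (auto simp: D_def)
          finally have u1: "norm (u (tf w \<psi>)) <= D * exp (- (R1 * l))" .
          have "exp (- (H * A)) <= exp (- (1 * A))" using mult_right_mono[OF H(2) A0] by simp
          hence "exp (- (H * A)) * norm (u (tf w \<psi>)) <= exp (- (1 * A)) * (D * exp (- (R1 * l)))"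
            using u1 by (intro mult_mono) auto
          thus ?thesis by (simp only: mult.commute)
        next
          case False
          have Al: "A >= l * \<delta>'"
          proof -
            have *: "l * \<delta>' <= norm v powr (1 / q)" if "q > 0" "norm v > l powr q * \<delta>" "\<delta>' <= \<delta> powr (1 / q)" for q :: real and v :: "real^'d"
            proof -
              have "l * \<delta>' <= l * \<delta> powr (1 / q)" using that lp by (intro mult_left_mono) auto
              also have "... = (l powr q * \<delta>) powr (1 / q)" using lp \<delta> that(1) by (simp add: powr_mult powr_powr)
              also have "... <= norm v powr (1 / q)" using that lp \<delta> by (intro powr_mono2) auto
              finally show ?thesis .
            qed
            from False consider "norm (y - x') > l powr r * \<delta>" | "norm (\<eta> - \<xi>') > l powr s * \<delta>" by linarith
            thus ?thesis
            proof cases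
              case 1
              have "l * \<delta>' <= norm (y - x') powr (1 / r)" by (rule *[OF r 1]) (simp add: \<delta>'_def)
              thus ?thesis unfolding A_def by (simp add: add_increasing2)
            next
              case 2
              have "l * \<delta>' <= norm (\<eta> - \<xi>') powr (1 / s)" by (rule *[OF s 2]) (simp add: \<delta>'_def)
              thus ?thesis unfolding A_def by (simp add: add_increasing)
            qed
          qed
          have g: "norm v powr (1 / q) <= (K1 + K2) * (norm (v - v') powr (1 / q) + l * \<rho> powr (1 / q))"
            if q: "q > 0" and K': "2 powr (1 / q) <= K1 + K2" and v': "norm v' powr (1 / q) <= l * \<rho> powr (1 / q)"
            for q and v v' :: "real^'d"
          proof -
            have "norm v powr (1 / q) <= 2 powr (1 / q) * (norm (v - v') powr (1 / q) + norm v' powr (1 / q))"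
              using ew_quasi_triangle[OF q, of "v - v'" v'] by simp
            also have "... <= (K1 + K2) * (norm (v - v') powr (1 / q) + l * \<rho> powr (1 / q))"
              using K K' v' by (intro mult_mono add_left_mono) auto
            finally show ?thesis .
          qed
          have g1: "norm y powr (1 / r) <= (K1 + K2) * (norm (y - x') powr (1 / r) + l * \<rho> powr (1 / r))"
            by (rule g[OF r _ x'\<rho>]) (simp add: K1_def K2_def)
          have g2: "norm \<eta> powr (1 / s) <= (K1 + K2) * (norm (\<eta> - \<xi>') powr (1 / s) + l * \<rho> powr (1 / s))"
            by (rule g[OF s _ \<xi>'\<rho>]) (simp add: K1_def K2_def)
          have "M * (norm y powr (1 / r) + norm \<eta> powr (1 / s)) <= M * ((K1 + K2) * (A + l * \<beta>))"
          proof (rule mult_left_mono)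
            have "norm y powr (1 / r) + norm \<eta> powr (1 / s) <= (K1 + K2) * (norm (y - x') powr (1 / r) + l * \<rho> powr (1 / r)) +
              (K1 + K2) * (norm (\<eta> - \<xi>') powr (1 / s) + l * \<rho> powr (1 / s))" by (rule add_mono[OF g1 g2])
            also have "... = (K1 + K2) * (A + l * \<beta>)" by (simp add: A_def \<beta>_def algebra_simps)
            finally show "norm y powr (1 / r) + norm \<eta> powr (1 / s) <= (K1 + K2) * (A + l * \<beta>)" .
          qed (use M in simp)
          also have "... = M1 * A + M1 * \<beta> * l" by (simp add: M1_def algebra_simps)
          finally have gr: "M * (norm y powr (1 / r) + norm \<eta> powr (1 / s)) <= M1 * A + M1 * \<beta> * l" .
          have "norm (u (tf w \<psi>)) <= C2 * exp (M * (norm y powr (1 / r) + norm \<eta> powr (1 / s)))"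
            using growth[of w] by (simp only: y_def \<eta>_def)
          also have "... <= C2 * exp (M1 * A + M1 * \<beta> * l)" using gr C2 by (intro mult_left_mono) auto
          finally have "exp (- (H * A)) * norm (u (tf w \<psi>)) <= exp (- (H * A)) * (C2 * exp (M1 * A + M1 * \<beta> * l))"
            by (intro mult_left_mono) auto
          also have "... = C2 * exp (- (H * A) + (M1 * A + M1 * \<beta> * l))"
            unfolding exp_add[of "- (H * A)"] by (rule mult.left_commute)
          also have "... <= C2 * exp (- (R1 * l) + - (1 * A))"
          proof (rule mult_left_mono[OF _ C2])
            have "H' * (l * \<delta>') <= H' * A" using Al H' by (intro mult_left_mono) auto
            moreover have "H' * (l * \<delta>') = M1 * \<beta> * l + R1 * l" using \<delta>' by (simp add: H'_def field_simps)
            moreover have "H * A = M1 * A + A + H' * A" by (simp add: H_def algebra_simps)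
            ultimately show "exp (- (H * A) + (M1 * A + M1 * \<beta> * l)) <= exp (- (R1 * l) + - (1 * A))"
              unfolding exp_le_cancel_iff by linarith
          qed
          also have "... = C2 * exp (- (R1 * l)) * exp (- (1 * A))" by (simp only: exp_add mult.assoc)
          also have "... <= (D * exp (- (R1 * l))) * exp (- (1 * A))"
            using DA(1) by (intro mult_right_mono) (auto simp: D_def)
          finally show ?thesis .
        qed
        thus ?thesis unfolding y_def[symmetric] \<eta>_def[symmetric] e .
      qed
      have D0: "D * exp (- (R1 * l)) >= 0" using C2 DA(1) by (simp add: D_def)
      have "norm (ext t u (tf (l powr r *\<^sub>R x, \<xi>') \<psi>)) <= C * exp ((1 + norm \<xi>') powr (1 / s)) * (D * exp (- (R1 * l)))"
        by (rule ker[OF D0]) (use point in \<open>simp only: x'_def \<xi>'_def\<close>)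
      also have "... <= C * exp (K2 * (1 + l * \<rho> powr (1 / s))) * (D * exp (- (R1 * l)))"
      proof (intro mult_right_mono mult_left_mono D0)
        have "(1 + norm \<xi>') powr (1 / s) <= K2 * (1 + norm \<xi>' powr (1 / s))"
          using ew_quasi_triangle[OF s, of "1::real" "norm \<xi>'"] by (simp add: K2_def)
        also have "... <= K2 * (1 + l * \<rho> powr (1 / s))" using K \<xi>'\<rho> by (intro mult_left_mono add_left_mono) auto
        finally show "exp ((1 + norm \<xi>') powr (1 / s)) <= exp (K2 * (1 + l * \<rho> powr (1 / s)))" by simp
      qed (use C in simp)
      also have "... = (C * exp K2 * D) * (exp (K2 * (l * \<rho> powr (1 / s))) * exp (- (R1 * l)))"
        unfolding distrib_left exp_add mult_1_right by (simp only: mult_ac)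
      also have "exp (K2 * (l * \<rho> powr (1 / s))) * exp (- (R1 * l)) = exp (- (R * l))"
        unfolding exp_add[symmetric] by (simp add: R1_def algebra_simps)
      finally show ?thesis unfolding \<xi>'_def .
    qed
    \<comment> \<open>For \<open>l < l0\<close> all points stay in a bounded set, where the values are bounded.\<close>
    define \<sigma> where "\<sigma> = l0 * \<beta>"
    have small: "norm (ext t u (tf (dil l x \<xi>) \<psi>)) <= (C3 * exp (M3 * \<sigma>) * exp (R * l0)) * exp (- (R * l))"
      if l: "0 < l" "l < l0" and xV: "(x, \<xi>) \<in> V" for l x \<xi>
    proof -
      have x\<rho>: "norm x <= \<rho>"
        using norm_triangle_ineq[of "x - x0" x0] Vx(1)[OF xV] norm_ge_zero[of a0] norm_ge_zero[of \<xi>0] \<delta>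
        unfolding diff_add_cancel \<rho>_def by argo
      have \<xi>\<rho>: "norm \<xi> <= \<rho>"
        using norm_triangle_ineq[of "\<xi> - \<xi>0" \<xi>0] Vx(3)[OF xV] norm_ge_zero[of x0] norm_ge_zero[of a0]
        unfolding diff_add_cancel \<rho>_def by linarith
      have "norm (l powr r *\<^sub>R x) powr (1 / r) + norm (l powr s *\<^sub>R \<xi>) powr (1 / s) <= \<sigma>"
      proof -
        have "norm (l powr r *\<^sub>R x) powr (1 / r) + norm (l powr s *\<^sub>R \<xi>) powr (1 / s) = l * (norm x powr (1 / r) + norm \<xi> powr (1 / s))"
          unfolding scale[OF l(1) r] scale[OF l(1) s] by (simp only: distrib_left)
        also have "... <= l0 * \<beta>"
          unfolding \<beta>_def using l x\<rho> \<xi>\<rho> r s by (intro mult_mono add_mono powr_mono2) auto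
        finally show ?thesis unfolding \<sigma>_def .
      qed
      hence "M3 * (norm (l powr r *\<^sub>R x) powr (1 / r) + norm (l powr s *\<^sub>R \<xi>) powr (1 / s)) <= M3 * \<sigma>"
        using M3 by (intro mult_left_mono) auto
      hence "C3 * exp (M3 * (norm (l powr r *\<^sub>R x) powr (1 / r) + norm (l powr s *\<^sub>R \<xi>) powr (1 / s))) <= C3 * exp (M3 * \<sigma>)"
        using C3 by (intro mult_left_mono) auto
      hence "norm (ext t u (tf (dil l x \<xi>) \<psi>)) <= C3 * exp (M3 * \<sigma>) * 1"
        using growth3[of "dil l x \<xi>"] unfolding fst_conv snd_conv by linarith
      also have "... <= C3 * exp (M3 * \<sigma>) * (exp (R * l0) * exp (- (R * l)))"
        unfolding exp_add[symmetric] using l R C3 by (intro mult_left_mono) auto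
      finally show ?thesis by (simp only: mult.assoc)
    qed
    show "\<exists>D\<ge>0. \<forall>l>0. \<forall>(x, \<xi>)\<in>V. norm (ext t u (tf (dil l x \<xi>) \<psi>)) <= D * exp (- (R * l))"
    proof (intro exI[of _ "C * exp K2 * D + C3 * exp (M3 * \<sigma>) * exp (R * l0)"] conjI allI impI ballI, goal_cases)
      case 1
      show ?case using C C2 DA(1) C3 by (simp add: D_def)
    next
      case (2 l p)
      obtain x \<xi> where p: "p = (x, \<xi>)" by (cases p)
      have pos: "C * exp K2 * D >= 0" "C3 * exp (M3 * \<sigma>) * exp (R * l0) >= 0" using C C2 DA(1) C3 by (simp_all add: D_def)
      show ?case
      proof (cases "l >= l0")
        case True
        show ?thesis unfolding p case_prod_conv
          by (rule order_trans[OF large[OF True 2(2)[unfolded p]]], intro mult_right_mono) (use pos in auto)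
      next
        case False
        hence "l < l0" by simp
        show ?thesis unfolding p case_prod_conv
          by (rule order_trans[OF small[OF 2(1) \<open>l < l0\<close> 2(2)[unfolded p]]], intro mult_right_mono) (use pos in auto)
      qed
    qed
  qed
  thus False using z V unfolding WF_iff by blast
qed

lemma window_norm_nonzero:
  assumes "\<psi> \<in> gs r s - {\<lambda>_. 0}" shows "ip \<psi> \<psi> \<noteq> 0"
  using SS_eq_0[of \<psi>] assms by (auto simp: gs_iff fun_eq_iff)

text \<open>
  The second inclusion is the first one for the inverse propagator, whose displacement is opposite.
\<close>

lemma WF_propagation:
  fixes u :: "'d functional" and t :: real
  defines "G \<equiv> \<lambda>\<xi>. if r = s * (real m - 1) then grad (principal_part c m) \<xi> else 0"
  assumes u: "u \<in> gs_dual r s" and \<psi>: "\<psi> \<in> gs r s - {\<lambda>_. 0}"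
  shows "WF r s \<psi> (dual_propagator r s c m t u) = (\<lambda>(x, \<xi>). (x + t *\<^sub>R G \<xi>, \<xi>)) ` WF r s \<psi> u"
proof -
  have \<psi>': "\<psi> \<in> gs r s" "ip \<psi> \<psi> \<noteq> 0" using \<psi> window_norm_nonzero[OF \<psi>] by auto
  have sub: "(x - t *\<^sub>R G \<xi>, \<xi>) \<in> WF r s \<psi> v" if v: "v \<in> gs_dual r s" and z: "(x, \<xi>) \<in> WF r s \<psi> (ext t v)" for v x \<xi> t
  proof (rule WF_inclusion[where G = "\<lambda>\<xi>. t *\<^sub>R G \<xi>", OF v \<psi>' _ z])
    show "\<exists>l0>0. \<exists>d>0. \<forall>l\<ge>l0. \<forall>\<xi>. norm (\<xi> - \<xi>0) < d \<longrightarrow>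
        norm (drift c m r s t l \<xi> - t *\<^sub>R G \<xi>0) < \<delta>" if "\<delta> > 0" for \<xi>0 \<delta>
      unfolding G_def by (rule scaled_gradient_limit[OF rk s that])
    have "G 0 = 0"
    proof -
      have "dpsum c {\<alpha>. mi_length \<alpha> = m} j 0 = 0" for j
        unfolding dpsum_def
      proof (rule sum.neutral, rule ballI)
        fix \<alpha> :: "'d => nat" assume "\<alpha> \<in> {\<alpha>. mi_length \<alpha> = m}"
        hence "length (mi_list \<alpha>) >= 2" using m by (simp add: length_mi_list)
        hence "length (remove1 j (mi_list \<alpha>)) \<noteq> 0" by (cases "mi_list \<alpha>") (auto simp: length_remove1)
        then obtain i k where "remove1 j (mi_list \<alpha>) = i # k" by (cases "remove1 j (mi_list \<alpha>)") auto
        thus "c \<alpha> * real (\<alpha> j) * mon (remove1 j (mi_list \<alpha>)) 0 = 0" by simp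
      qed
      hence "grad (principal_part c m) 0 $ j = 0 $ j" for j
        unfolding principal_part_psum grad_psum zero_index .
      hence "grad (principal_part c m) 0 = 0" by (rule iffD2[OF vec_eq_iff, OF allI])
      thus ?thesis unfolding G_def by (cases "r = s * (real m - 1)") simp_all
    qed
    hence "(x - t *\<^sub>R G \<xi>, \<xi>) = 0 ==> (x, \<xi>) = 0" by (simp add: zero_prod_def)
    thus "(x - t *\<^sub>R G \<xi>, \<xi>) \<noteq> 0" using z unfolding WF_iff by blast
  qed
  show ?thesis unfolding dual_propagator_eq
  proof (intro equalityI subsetI)
    fix z assume z: "z \<in> WF r s \<psi> (ext t u)"
    obtain x \<xi> where zx: "z = (x, \<xi>)" by (cases z)
    have "(x - t *\<^sub>R G \<xi>, \<xi>) \<in> WF r s \<psi> u" using sub[OF u] z by (simp add: zx)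
    thus "z \<in> (\<lambda>(x, \<xi>). (x + t *\<^sub>R G \<xi>, \<xi>)) ` WF r s \<psi> u" by (force simp: zx)
  next
    fix z assume "z \<in> (\<lambda>(x, \<xi>). (x + t *\<^sub>R G \<xi>, \<xi>)) ` WF r s \<psi> u"
    then obtain x \<xi> where z: "z = (x + t *\<^sub>R G \<xi>, \<xi>)" and w: "(x, \<xi>) \<in> WF r s \<psi> u" by auto
    have "(x, \<xi>) \<in> WF r s \<psi> (ext (- t) (ext t u))" using w by (simp add: ext_inverse[OF u])
    hence "(x - (- t) *\<^sub>R G \<xi>, \<xi>) \<in> WF r s \<psi> (ext t u)" by (rule sub[OF ext_dual[OF u]])
    thus "z \<in> WF r s \<psi> (ext t u)" by (simp add: z)
  qed
qed

end

theorem theorem7p1: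
  fixes c :: "('d::finite \<Rightarrow> nat) \<Rightarrow> real" and m :: nat and r s t :: real
  assumes "m \<ge> 2"
    and "\<exists>\<alpha>. mi_length \<alpha> = m \<and> c \<alpha> \<noteq> 0"
    and "r > 0" and "s > 0"
    and "r \<ge> s * (real m - 1)" and "s * (real m - 1) > 1"
  shows
    "(\<forall>f\<in>gs r s. propagator c m t f \<in> gs r s \<and>
        kernel_op c m t f = restrict (regular_distr (propagator c m t f)) schwartz) \<and>
     continuous_map (gs_topology r s) (gs_topology r s) (propagator c m t) \<and>
     (\<exists>!L. dual_extension r s (propagator c m t) L) \<and>
     (\<forall>f\<in>gs r s. propagator c m (- t) (propagator c m t f) = f \<and>
        propagator c m t (propagator c m (- t) f) = f) \<and>
     (\<forall>u\<in>gs_dual r s. dual_propagator r s c m (- t) (dual_propagator r s c m t u) = u \<and>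
        dual_propagator r s c m t (dual_propagator r s c m (- t) u) = u) \<and>
     (\<forall>u\<in>gs_dual (s * (real m - 1)) s. \<forall>\<psi>\<in>gs (s * (real m - 1)) s - {\<lambda>_. 0}.
        WF (s * (real m - 1)) s \<psi> (dual_propagator (s * (real m - 1)) s c m t u) =
          ham_flow c m t ` WF (s * (real m - 1)) s \<psi> u) \<and>
     (r > s * (real m - 1) \<longrightarrow>
       (\<forall>u\<in>gs_dual r s. \<forall>\<psi>\<in>gs r s - {\<lambda>_. 0}.
          WF r s \<psi> (dual_propagator r s c m t u) = WF r s \<psi> u))"
proof -
  interpret propagation r s c m
    by unfold_locales (use assms in linarith)+
  interpret critical: propagation "s * (real m - 1)" s c m
    by unfold_locales (use assms in linarith)+
  have 1: "propagator c m t f \<in> gs r s \<and>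
      kernel_op c m t f = restrict (regular_distr (propagator c m t f)) schwartz" if "f \<in> gs r s" for f t
    using that evo_in_gs[OF that] kernel_op_eq[of f c m t] by (simp add: propagator_gs gs_iff)
  have 2: "propagator c m (- t) (propagator c m t f) = f" if "f \<in> gs r s" for f t
    using that evo_in_gs[OF that, of t] evo_inverse[of f c m t] by (simp add: propagator_gs gs_iff)
  have 3: "\<exists>!L. dual_extension r s (propagator c m t) L"
    using ext_dual_extension dual_extension_unique by blast
  have 4: "dual_propagator r s c m (- t) (dual_propagator r s c m t u) = u" if "u \<in> gs_dual r s" for u t
    using that by (simp add: dual_propagator_eq ext_inverse)
  have 5: "WF (s * (real m - 1)) s \<psi> (dual_propagator (s * (real m - 1)) s c m t u) =
          ham_flow c m t ` WF (s * (real m - 1)) s \<psi> u"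
    if "u \<in> gs_dual (s * (real m - 1)) s" "\<psi> \<in> gs (s * (real m - 1)) s - {\<lambda>_. 0}" for u \<psi>
    using critical.WF_propagation[OF that, of t] by (simp add: ham_flow_def)
  have 6: "WF r s \<psi> (dual_propagator r s c m t u) = WF r s \<psi> u"
    if "r > s * (real m - 1)" "u \<in> gs_dual r s" "\<psi> \<in> gs r s - {\<lambda>_. 0}" for u \<psi>
    using WF_propagation[OF that(2,3), of t] that(1) by simp
  show ?thesis
    using 2[of _ "- t"] 4[of _ "- t"]
    by (intro conjI ballI impI 1 2 3 4 5 6 propagator_continuous) (simp_all only: minus_minus)
qed

end
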